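(* Every finite group of order less than $64$ is categorically rigid.
   Context: For a finite group $G$, $\mathrm{Rep}\,G$ is the category of finite-dimensional complex representations of $G$ with its usual tensor product. Finite groups $G$ and $H$ are called isocategorical if $\mathrm{Rep}\,G$ and $\mathrm{Rep}\,H$ are equivalent as $\mathbb{C}$-linear monoidal categories (the equivalence is not required to respect the symmetric structures). A finite group $G$ is called categorically rigid if any group isocategorical to $G$ is isomorphic to $G$. *)

theory Defs
  imports "Jordan_Normal_Form.Matrix" "HOL-Algebra.Coset"
begin

section \<open>Complex-linear monoidal categories\<close>

text \<open>
  Hom-sets of different pairs of objects need not be disjoint, so every operation that depends on
  the source or target of a morphism takes these objects as explicit arguments.
  Composition is in applicative order: \<open>g \<cdot> f\<close> is \<open>g\<close> after \<open>f\<close>.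
\<close>

record ('o, 'm) lin_mon_cat =
  Ob :: "'o set"
  Hom :: "'o \<Rightarrow> 'o \<Rightarrow> 'm set"
  Ide :: "'o \<Rightarrow> 'm"
  Comp :: "'m \<Rightarrow> 'm \<Rightarrow> 'm" (infixr \<open>\<cdot>\<index>\<close> 70)
  Zero :: "'o \<Rightarrow> 'o \<Rightarrow> 'm"
  Add :: "'m \<Rightarrow> 'm \<Rightarrow> 'm"
  Scale :: "complex \<Rightarrow> 'm \<Rightarrow> 'm"
  TenO :: "'o \<Rightarrow> 'o \<Rightarrow> 'o" (infixl \<open>\<otimes>\<^sub>o\<index>\<close> 75)
  TenM :: "'m \<Rightarrow> 'm \<Rightarrow> 'm" (infixl \<open>\<otimes>\<^sub>m\<index>\<close> 75)
  UnitO :: "'o"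
  Assoc :: "'o \<Rightarrow> 'o \<Rightarrow> 'o \<Rightarrow> 'm"
  LUnit :: "'o \<Rightarrow> 'm"
  RUnit :: "'o \<Rightarrow> 'm"

definition cat_iso :: "('o, 'm) lin_mon_cat \<Rightarrow> 'o \<Rightarrow> 'o \<Rightarrow> 'm \<Rightarrow> bool" where
  "cat_iso C X Y f \<longleftrightarrow> f \<in> Hom C X Y \<and>
     (\<exists>g \<in> Hom C Y X. g \<cdot>\<^bsub>C\<^esub> f = Ide C X \<and> f \<cdot>\<^bsub>C\<^esub> g = Ide C Y)"

locale linear_monoidal_category =
  fixes C :: "('o, 'm) lin_mon_cat" (structure)
  assumes ide_hom: "X \<in> Ob C \<Longrightarrow> Ide C X \<in> Hom C X X"
    and comp_hom: "\<lbrakk>X \<in> Ob C; Y \<in> Ob C; Z \<in> Ob C; f \<in> Hom C X Y; g \<in> Hom C Y Z\<rbrakk>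
      \<Longrightarrow> g \<cdot> f \<in> Hom C X Z"
    and comp_ide: "\<lbrakk>X \<in> Ob C; Y \<in> Ob C; f \<in> Hom C X Y\<rbrakk> \<Longrightarrow> f \<cdot> Ide C X = f"
    and ide_comp: "\<lbrakk>X \<in> Ob C; Y \<in> Ob C; f \<in> Hom C X Y\<rbrakk> \<Longrightarrow> Ide C Y \<cdot> f = f"
    and comp_assoc: "\<lbrakk>W \<in> Ob C; X \<in> Ob C; Y \<in> Ob C; Z \<in> Ob C;
        f \<in> Hom C W X; g \<in> Hom C X Y; h \<in> Hom C Y Z\<rbrakk> \<Longrightarrow> (h \<cdot> g) \<cdot> f = h \<cdot> (g \<cdot> f)"
    \<comment> \<open>each hom-set is a complex vector space\<close>
    and zero_hom: "\<lbrakk>X \<in> Ob C; Y \<in> Ob C\<rbrakk> \<Longrightarrow> Zero C X Y \<in> Hom C X Y"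
    and add_hom: "\<lbrakk>X \<in> Ob C; Y \<in> Ob C; f \<in> Hom C X Y; g \<in> Hom C X Y\<rbrakk> \<Longrightarrow> Add C f g \<in> Hom C X Y"
    and scale_hom: "\<lbrakk>X \<in> Ob C; Y \<in> Ob C; f \<in> Hom C X Y\<rbrakk> \<Longrightarrow> Scale C a f \<in> Hom C X Y"
    and add_assoc: "\<lbrakk>X \<in> Ob C; Y \<in> Ob C; f \<in> Hom C X Y; g \<in> Hom C X Y; h \<in> Hom C X Y\<rbrakk>
      \<Longrightarrow> Add C (Add C f g) h = Add C f (Add C g h)"
    and add_comm: "\<lbrakk>X \<in> Ob C; Y \<in> Ob C; f \<in> Hom C X Y; g \<in> Hom C X Y\<rbrakk>
      \<Longrightarrow> Add C f g = Add C g f"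
    and add_zero: "\<lbrakk>X \<in> Ob C; Y \<in> Ob C; f \<in> Hom C X Y\<rbrakk> \<Longrightarrow> Add C f (Zero C X Y) = f"
    and add_minus: "\<lbrakk>X \<in> Ob C; Y \<in> Ob C; f \<in> Hom C X Y\<rbrakk> \<Longrightarrow> Add C f (Scale C (-1) f) = Zero C X Y"
    and scale_one: "\<lbrakk>X \<in> Ob C; Y \<in> Ob C; f \<in> Hom C X Y\<rbrakk> \<Longrightarrow> Scale C 1 f = f"
    and scale_scale: "\<lbrakk>X \<in> Ob C; Y \<in> Ob C; f \<in> Hom C X Y\<rbrakk>
      \<Longrightarrow> Scale C a (Scale C b f) = Scale C (a * b) f"
    and scale_add: "\<lbrakk>X \<in> Ob C; Y \<in> Ob C; f \<in> Hom C X Y; g \<in> Hom C X Y\<rbrakk>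
      \<Longrightarrow> Scale C a (Add C f g) = Add C (Scale C a f) (Scale C a g)"
    and add_scale: "\<lbrakk>X \<in> Ob C; Y \<in> Ob C; f \<in> Hom C X Y\<rbrakk>
      \<Longrightarrow> Scale C (a + b) f = Add C (Scale C a f) (Scale C b f)"
    \<comment> \<open>composition is bilinear\<close>
    and comp_add_left: "\<lbrakk>X \<in> Ob C; Y \<in> Ob C; Z \<in> Ob C; f \<in> Hom C X Y; g \<in> Hom C Y Z; g' \<in> Hom C Y Z\<rbrakk>
      \<Longrightarrow> Add C g g' \<cdot> f = Add C (g \<cdot> f) (g' \<cdot> f)"
    and comp_add_right: "\<lbrakk>X \<in> Ob C; Y \<in> Ob C; Z \<in> Ob C; f \<in> Hom C X Y; f' \<in> Hom C X Y; g \<in> Hom C Y Z\<rbrakk>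
      \<Longrightarrow> g \<cdot> Add C f f' = Add C (g \<cdot> f) (g \<cdot> f')"
    and comp_scale_left: "\<lbrakk>X \<in> Ob C; Y \<in> Ob C; Z \<in> Ob C; f \<in> Hom C X Y; g \<in> Hom C Y Z\<rbrakk>
      \<Longrightarrow> Scale C a g \<cdot> f = Scale C a (g \<cdot> f)"
    and comp_scale_right: "\<lbrakk>X \<in> Ob C; Y \<in> Ob C; Z \<in> Ob C; f \<in> Hom C X Y; g \<in> Hom C Y Z\<rbrakk>
      \<Longrightarrow> g \<cdot> Scale C a f = Scale C a (g \<cdot> f)"
    \<comment> \<open>the tensor product is a bilinear bifunctor\<close>
    and unit_ob: "UnitO C \<in> Ob C"
    and ten_ob: "\<lbrakk>X \<in> Ob C; Y \<in> Ob C\<rbrakk> \<Longrightarrow> X \<otimes>\<^sub>o Y \<in> Ob C"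
    and ten_hom: "\<lbrakk>X \<in> Ob C; X' \<in> Ob C; Y \<in> Ob C; Y' \<in> Ob C; f \<in> Hom C X X'; g \<in> Hom C Y Y'\<rbrakk>
      \<Longrightarrow> f \<otimes>\<^sub>m g \<in> Hom C (X \<otimes>\<^sub>o Y) (X' \<otimes>\<^sub>o Y')"
    and ten_ide: "\<lbrakk>X \<in> Ob C; Y \<in> Ob C\<rbrakk> \<Longrightarrow> Ide C X \<otimes>\<^sub>m Ide C Y = Ide C (X \<otimes>\<^sub>o Y)"
    and ten_comp: "\<lbrakk>X \<in> Ob C; X' \<in> Ob C; X'' \<in> Ob C; Y \<in> Ob C; Y' \<in> Ob C; Y'' \<in> Ob C;
        f \<in> Hom C X X'; f' \<in> Hom C X' X''; g \<in> Hom C Y Y'; g' \<in> Hom C Y' Y''\<rbrakk>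
      \<Longrightarrow> (f' \<cdot> f) \<otimes>\<^sub>m (g' \<cdot> g) = (f' \<otimes>\<^sub>m g') \<cdot> (f \<otimes>\<^sub>m g)"
    and ten_add_left: "\<lbrakk>X \<in> Ob C; X' \<in> Ob C; Y \<in> Ob C; Y' \<in> Ob C;
        f \<in> Hom C X X'; f' \<in> Hom C X X'; g \<in> Hom C Y Y'\<rbrakk>
      \<Longrightarrow> Add C f f' \<otimes>\<^sub>m g = Add C (f \<otimes>\<^sub>m g) (f' \<otimes>\<^sub>m g)"
    and ten_add_right: "\<lbrakk>X \<in> Ob C; X' \<in> Ob C; Y \<in> Ob C; Y' \<in> Ob C;
        f \<in> Hom C X X'; g \<in> Hom C Y Y'; g' \<in> Hom C Y Y'\<rbrakk>
      \<Longrightarrow> f \<otimes>\<^sub>m Add C g g' = Add C (f \<otimes>\<^sub>m g) (f \<otimes>\<^sub>m g')"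
    and ten_scale_left: "\<lbrakk>X \<in> Ob C; X' \<in> Ob C; Y \<in> Ob C; Y' \<in> Ob C; f \<in> Hom C X X'; g \<in> Hom C Y Y'\<rbrakk>
      \<Longrightarrow> Scale C a f \<otimes>\<^sub>m g = Scale C a (f \<otimes>\<^sub>m g)"
    and ten_scale_right: "\<lbrakk>X \<in> Ob C; X' \<in> Ob C; Y \<in> Ob C; Y' \<in> Ob C; f \<in> Hom C X X'; g \<in> Hom C Y Y'\<rbrakk>
      \<Longrightarrow> f \<otimes>\<^sub>m Scale C a g = Scale C a (f \<otimes>\<^sub>m g)"
    \<comment> \<open>associator and unitors are natural isomorphisms\<close>
    and assoc_iso: "\<lbrakk>X \<in> Ob C; Y \<in> Ob C; Z \<in> Ob C\<rbrakk>
      \<Longrightarrow> cat_iso C (X \<otimes>\<^sub>o Y \<otimes>\<^sub>o Z) (X \<otimes>\<^sub>o (Y \<otimes>\<^sub>o Z)) (Assoc C X Y Z)"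
    and assoc_natural: "\<lbrakk>X \<in> Ob C; X' \<in> Ob C; Y \<in> Ob C; Y' \<in> Ob C; Z \<in> Ob C; Z' \<in> Ob C;
        f \<in> Hom C X X'; g \<in> Hom C Y Y'; h \<in> Hom C Z Z'\<rbrakk>
      \<Longrightarrow> Assoc C X' Y' Z' \<cdot> (f \<otimes>\<^sub>m g \<otimes>\<^sub>m h) = (f \<otimes>\<^sub>m (g \<otimes>\<^sub>m h)) \<cdot> Assoc C X Y Z"
    and lunit_iso: "X \<in> Ob C \<Longrightarrow> cat_iso C (UnitO C \<otimes>\<^sub>o X) X (LUnit C X)"
    and lunit_natural: "\<lbrakk>X \<in> Ob C; Y \<in> Ob C; f \<in> Hom C X Y\<rbrakk>
      \<Longrightarrow> LUnit C Y \<cdot> (Ide C (UnitO C) \<otimes>\<^sub>m f) = f \<cdot> LUnit C X"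
    and runit_iso: "X \<in> Ob C \<Longrightarrow> cat_iso C (X \<otimes>\<^sub>o UnitO C) X (RUnit C X)"
    and runit_natural: "\<lbrakk>X \<in> Ob C; Y \<in> Ob C; f \<in> Hom C X Y\<rbrakk>
      \<Longrightarrow> RUnit C Y \<cdot> (f \<otimes>\<^sub>m Ide C (UnitO C)) = f \<cdot> RUnit C X"
    and pentagon: "\<lbrakk>W \<in> Ob C; X \<in> Ob C; Y \<in> Ob C; Z \<in> Ob C\<rbrakk>
      \<Longrightarrow> Assoc C W X (Y \<otimes>\<^sub>o Z) \<cdot> Assoc C (W \<otimes>\<^sub>o X) Y Z =
          (Ide C W \<otimes>\<^sub>m Assoc C X Y Z) \<cdot> Assoc C W (X \<otimes>\<^sub>o Y) Z \<cdot> (Assoc C W X Y \<otimes>\<^sub>m Ide C Z)"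
    and triangle: "\<lbrakk>X \<in> Ob C; Y \<in> Ob C\<rbrakk>
      \<Longrightarrow> (Ide C X \<otimes>\<^sub>m LUnit C Y) \<cdot> Assoc C X (UnitO C) Y = RUnit C X \<otimes>\<^sub>m Ide C Y"


section \<open>Functors and equivalences\<close>

text \<open>
  A functor is given by its object map \<open>F\<close> and its morphism map \<open>Fm\<close>, where \<open>Fm X Y\<close> is the
  action on the morphisms from \<open>X\<close> to \<open>Y\<close>.
\<close>

definition cat_functor ::
  "('o, 'm) lin_mon_cat \<Rightarrow> ('p, 'n) lin_mon_cat \<Rightarrow> ('o \<Rightarrow> 'p) \<Rightarrow> ('o \<Rightarrow> 'o \<Rightarrow> 'm \<Rightarrow> 'n) \<Rightarrow> bool" where
  "cat_functor C D F Fm \<longleftrightarrow>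
     (\<forall>X \<in> Ob C. F X \<in> Ob D) \<and>
     (\<forall>X \<in> Ob C. \<forall>Y \<in> Ob C. \<forall>f \<in> Hom C X Y. Fm X Y f \<in> Hom D (F X) (F Y)) \<and>
     (\<forall>X \<in> Ob C. Fm X X (Ide C X) = Ide D (F X)) \<and>
     (\<forall>X \<in> Ob C. \<forall>Y \<in> Ob C. \<forall>Z \<in> Ob C. \<forall>f \<in> Hom C X Y. \<forall>g \<in> Hom C Y Z.
        Fm X Z (g \<cdot>\<^bsub>C\<^esub> f) = Fm Y Z g \<cdot>\<^bsub>D\<^esub> Fm X Y f)"

definition linear_functor ::
  "('o, 'm) lin_mon_cat \<Rightarrow> ('p, 'n) lin_mon_cat \<Rightarrow> ('o \<Rightarrow> 'p) \<Rightarrow> ('o \<Rightarrow> 'o \<Rightarrow> 'm \<Rightarrow> 'n) \<Rightarrow> bool" where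
  "linear_functor C D F Fm \<longleftrightarrow> cat_functor C D F Fm \<and>
     (\<forall>X \<in> Ob C. \<forall>Y \<in> Ob C. \<forall>f \<in> Hom C X Y. \<forall>g \<in> Hom C X Y.
        Fm X Y (Add C f g) = Add D (Fm X Y f) (Fm X Y g)) \<and>
     (\<forall>X \<in> Ob C. \<forall>Y \<in> Ob C. \<forall>f \<in> Hom C X Y. \<forall>a.
        Fm X Y (Scale C a f) = Scale D a (Fm X Y f))"

definition natural_iso ::
  "('o, 'm) lin_mon_cat \<Rightarrow> ('p, 'n) lin_mon_cat \<Rightarrow>
   ('o \<Rightarrow> 'p) \<Rightarrow> ('o \<Rightarrow> 'o \<Rightarrow> 'm \<Rightarrow> 'n) \<Rightarrow> ('o \<Rightarrow> 'p) \<Rightarrow> ('o \<Rightarrow> 'o \<Rightarrow> 'm \<Rightarrow> 'n) \<Rightarrow> ('o \<Rightarrow> 'n) \<Rightarrow> bool" where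
  "natural_iso C D F Fm G Gm \<eta> \<longleftrightarrow>
     (\<forall>X \<in> Ob C. cat_iso D (F X) (G X) (\<eta> X)) \<and>
     (\<forall>X \<in> Ob C. \<forall>Y \<in> Ob C. \<forall>f \<in> Hom C X Y.
        \<eta> Y \<cdot>\<^bsub>D\<^esub> Fm X Y f = Gm X Y f \<cdot>\<^bsub>D\<^esub> \<eta> X)"

definition equivalence_functor ::
  "('o, 'm) lin_mon_cat \<Rightarrow> ('p, 'n) lin_mon_cat \<Rightarrow> ('o \<Rightarrow> 'p) \<Rightarrow> ('o \<Rightarrow> 'o \<Rightarrow> 'm \<Rightarrow> 'n) \<Rightarrow> bool" where
  "equivalence_functor C D F Fm \<longleftrightarrow> cat_functor C D F Fm \<and>
     (\<exists>G Gm \<eta> \<epsilon>. cat_functor D C G Gm \<and>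
        natural_iso C C (\<lambda>X. X) (\<lambda>X Y f. f) (\<lambda>X. G (F X)) (\<lambda>X Y f. Gm (F X) (F Y) (Fm X Y f)) \<eta> \<and>
        natural_iso D D (\<lambda>X. F (G X)) (\<lambda>X Y f. Fm (G X) (G Y) (Gm X Y f)) (\<lambda>X. X) (\<lambda>X Y f. f) \<epsilon>)"

text \<open>
  Strong monoidal structure on a functor: a natural isomorphism \<open>J X Y : F X \<otimes> F Y \<rightarrow> F (X \<otimes> Y)\<close>
  and an isomorphism \<open>u : 1 \<rightarrow> F 1\<close>, compatible with associators and unitors.
\<close>

definition monoidal_structure ::
  "('o, 'm) lin_mon_cat \<Rightarrow> ('p, 'n) lin_mon_cat \<Rightarrow> ('o \<Rightarrow> 'p) \<Rightarrow> ('o \<Rightarrow> 'o \<Rightarrow> 'm \<Rightarrow> 'n) \<Rightarrow>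
   ('o \<Rightarrow> 'o \<Rightarrow> 'n) \<Rightarrow> 'n \<Rightarrow> bool" where
  "monoidal_structure C D F Fm J u \<longleftrightarrow>
     (\<forall>X \<in> Ob C. \<forall>Y \<in> Ob C. cat_iso D (F X \<otimes>\<^sub>o\<^bsub>D\<^esub> F Y) (F (X \<otimes>\<^sub>o\<^bsub>C\<^esub> Y)) (J X Y)) \<and>
     (\<forall>X \<in> Ob C. \<forall>X' \<in> Ob C. \<forall>Y \<in> Ob C. \<forall>Y' \<in> Ob C. \<forall>f \<in> Hom C X X'. \<forall>g \<in> Hom C Y Y'.
        J X' Y' \<cdot>\<^bsub>D\<^esub> (Fm X X' f \<otimes>\<^sub>m\<^bsub>D\<^esub> Fm Y Y' g) =
        Fm (X \<otimes>\<^sub>o\<^bsub>C\<^esub> Y) (X' \<otimes>\<^sub>o\<^bsub>C\<^esub> Y') (f \<otimes>\<^sub>m\<^bsub>C\<^esub> g) \<cdot>\<^bsub>D\<^esub> J X Y) \<and>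
     cat_iso D (UnitO D) (F (UnitO C)) u \<and>
     (\<forall>X \<in> Ob C. \<forall>Y \<in> Ob C. \<forall>Z \<in> Ob C.
        Fm (X \<otimes>\<^sub>o\<^bsub>C\<^esub> Y \<otimes>\<^sub>o\<^bsub>C\<^esub> Z) (X \<otimes>\<^sub>o\<^bsub>C\<^esub> (Y \<otimes>\<^sub>o\<^bsub>C\<^esub> Z)) (Assoc C X Y Z) \<cdot>\<^bsub>D\<^esub>
          J (X \<otimes>\<^sub>o\<^bsub>C\<^esub> Y) Z \<cdot>\<^bsub>D\<^esub> (J X Y \<otimes>\<^sub>m\<^bsub>D\<^esub> Ide D (F Z)) =
        J X (Y \<otimes>\<^sub>o\<^bsub>C\<^esub> Z) \<cdot>\<^bsub>D\<^esub> (Ide D (F X) \<otimes>\<^sub>m\<^bsub>D\<^esub> J Y Z) \<cdot>\<^bsub>D\<^esub> Assoc D (F X) (F Y) (F Z)) \<and>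
     (\<forall>X \<in> Ob C.
        Fm (UnitO C \<otimes>\<^sub>o\<^bsub>C\<^esub> X) X (LUnit C X) \<cdot>\<^bsub>D\<^esub> J (UnitO C) X \<cdot>\<^bsub>D\<^esub> (u \<otimes>\<^sub>m\<^bsub>D\<^esub> Ide D (F X)) =
        LUnit D (F X)) \<and>
     (\<forall>X \<in> Ob C.
        Fm (X \<otimes>\<^sub>o\<^bsub>C\<^esub> UnitO C) X (RUnit C X) \<cdot>\<^bsub>D\<^esub> J X (UnitO C) \<cdot>\<^bsub>D\<^esub> (Ide D (F X) \<otimes>\<^sub>m\<^bsub>D\<^esub> u) =
        RUnit D (F X))"

definition linear_monoidal_equivalent ::
  "('o, 'm) lin_mon_cat \<Rightarrow> ('p, 'n) lin_mon_cat \<Rightarrow> bool" where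
  "linear_monoidal_equivalent C D \<longleftrightarrow>
     (\<exists>F Fm J u. linear_functor C D F Fm \<and> equivalence_functor C D F Fm \<and>
        monoidal_structure C D F Fm J u)"


section \<open>The category of finite-dimensional complex representations\<close>

text \<open>
  A finite-dimensional complex representation is presented in coordinates, as a pair \<open>(n, \<rho>)\<close> of
  a dimension \<open>n\<close> (possibly \<open>0\<close>) and a homomorphism \<open>\<rho>\<close> from the group to the invertible complex
  \<open>n \<times> n\<close> matrices.  Since every finite-dimensional space has a basis, these objects
  form a category monoidally equivalent to that of all finite-dimensional representations; working
  in coordinates is what allows all objects to live in a single type.
  The tensor basis of \<open>\<complex>\<^sup>m \<otimes> \<complex>\<^sup>n\<close> is ordered lexicographically, so that the tensor product of
  matrices is the Kronecker product and the usual associators and unitors have identity matrices.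
\<close>

definition GL :: "nat \<Rightarrow> complex mat monoid" where
  "GL n = units_of (ring_mat TYPE(complex) n ())"

definition kronecker :: "complex mat \<Rightarrow> complex mat \<Rightarrow> complex mat" where
  "kronecker A B = mat (dim_row A * dim_row B) (dim_col A * dim_col B)
     (\<lambda>(i, j). A $$ (i div dim_row B, j div dim_col B) * B $$ (i mod dim_row B, j mod dim_col B))"

type_synonym 'a matrix_rep = "nat \<times> ('a \<Rightarrow> complex mat)"

definition representations :: "('a, 'b) monoid_scheme \<Rightarrow> 'a matrix_rep set" where
  "representations G = {(n, \<rho>). \<rho> \<in> hom G (GL n) \<and> \<rho> \<in> extensional (carrier G)}"

definition intertwiners ::
  "('a, 'b) monoid_scheme \<Rightarrow> 'a matrix_rep \<Rightarrow> 'a matrix_rep \<Rightarrow> complex mat set" where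
  "intertwiners G V W = {T \<in> carrier_mat (fst W) (fst V). \<forall>g \<in> carrier G. T * snd V g = snd W g * T}"

definition Rep :: "('a, 'b) monoid_scheme \<Rightarrow> ('a matrix_rep, complex mat) lin_mon_cat" where
  "Rep G = \<lparr>
     Ob = representations G,
     Hom = intertwiners G,
     Ide = (\<lambda>V. 1\<^sub>m (fst V)),
     Comp = (*),
     Zero = (\<lambda>V W. 0\<^sub>m (fst W) (fst V)),
     Add = (+),
     Scale = (\<cdot>\<^sub>m),
     TenO = (\<lambda>V W. (fst V * fst W, \<lambda>g \<in> carrier G. kronecker (snd V g) (snd W g))),
     TenM = kronecker,
     UnitO = (1, \<lambda>g \<in> carrier G. 1\<^sub>m 1),
     Assoc = (\<lambda>U V W. 1\<^sub>m (fst U * fst V * fst W)),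
     LUnit = (\<lambda>V. 1\<^sub>m (fst V)),
     RUnit = (\<lambda>V. 1\<^sub>m (fst V)) \<rparr>"

text \<open>The data above satisfy the axioms of a complex-linear monoidal category.\<close>

lemma dim_kronecker [simp]:
  "dim_row (kronecker A B) = dim_row A * dim_row B"
  "dim_col (kronecker A B) = dim_col A * dim_col B"
  by (simp_all add: kronecker_def)

lemma kronecker_carrier:
  "\<lbrakk>A \<in> carrier_mat m n; B \<in> carrier_mat p q\<rbrakk> \<Longrightarrow> kronecker A B \<in> carrier_mat (m * p) (n * q)"
  by (rule carrier_matI) auto

lemma div_mod_less: "i < m * p \<Longrightarrow> i div p < m \<and> i mod p < (p::nat)"
  by (cases "p = 0") (simp_all add: less_mult_imp_div_less)

lemma kronecker_index:
  "\<lbrakk>A \<in> carrier_mat m n; B \<in> carrier_mat p q; i < m * p; j < n * q\<rbrakk> \<Longrightarrow>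
    kronecker A B $$ (i, j) = A $$ (i div p, j div q) * B $$ (i mod p, j mod q)"
  by (auto simp: kronecker_def)

lemma mult_add_less: "a < m \<Longrightarrow> b < p \<Longrightarrow> a * p + b < m * (p::nat)"
  using mult_le_mono1[of "Suc a" m p] by simp

lemma sum_div_mod:
  fixes f :: "nat \<Rightarrow> nat \<Rightarrow> complex"
  shows "(\<Sum>k = 0..<n * q. f (k div q) (k mod q)) = (\<Sum>a = 0..<n. \<Sum>b = 0..<q. f a b)"
proof -
  have eq: "(\<Sum>k = 0..<n * q. f (k div q) (k mod q)) = (\<Sum>(a, b) \<in> {0..<n} \<times> {0..<q}. f a b)"
    by (rule sum.reindex_bij_witness[where j = "\<lambda>k. (k div q, k mod q)" and i = "\<lambda>(a, b). a * q + b"])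
      (auto simp: div_mod_less mult_add_less)
  show ?thesis unfolding eq by (simp add: sum.cartesian_product)
qed

lemma kronecker_mult:
  assumes A: "A \<in> carrier_mat m n" and A': "A' \<in> carrier_mat n r"
    and B: "B \<in> carrier_mat p q" and B': "B' \<in> carrier_mat q s"
  shows "kronecker (A * A') (B * B') = kronecker A B * kronecker A' B'"
proof (rule eq_matI)
  fix i j
  assume "i < dim_row (kronecker A B * kronecker A' B')" "j < dim_col (kronecker A B * kronecker A' B')"
  then have ij: "i < m * p" "j < r * s" using A B A' B' by auto
  note d = div_mod_less[OF ij(1)] div_mod_less[OF ij(2)]
  have "kronecker (A * A') (B * B') $$ (i, j) = (A * A') $$ (i div p, j div s) * (B * B') $$ (i mod p, j mod s)"
    by (rule kronecker_index) (use assms ij in auto)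
  also have "\<dots> = (\<Sum>a = 0..<n. A $$ (i div p, a) * A' $$ (a, j div s)) *
      (\<Sum>b = 0..<q. B $$ (i mod p, b) * B' $$ (b, j mod s))"
    using assms d by (auto simp: scalar_prod_def)
  also have "\<dots> = (\<Sum>a = 0..<n. \<Sum>b = 0..<q. (A $$ (i div p, a) * B $$ (i mod p, b)) *
      (A' $$ (a, j div s) * B' $$ (b, j mod s)))"
    by (simp add: sum_product ac_simps)
  also have "\<dots> = (\<Sum>k = 0..<n * q. (A $$ (i div p, k div q) * B $$ (i mod p, k mod q)) *
      (A' $$ (k div q, j div s) * B' $$ (k mod q, j mod s)))"
    by (rule sum_div_mod[symmetric])
  also have "\<dots> = (\<Sum>k = 0..<n * q. kronecker A B $$ (i, k) * kronecker A' B' $$ (k, j))"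
    using ij by (intro sum.cong) (auto simp: kronecker_index[OF A B] kronecker_index[OF A' B'])
  also have "\<dots> = (kronecker A B * kronecker A' B') $$ (i, j)"
    using assms ij by (auto simp: scalar_prod_def)
  finally show "kronecker (A * A') (B * B') $$ (i, j) = (kronecker A B * kronecker A' B') $$ (i, j)" .
qed (use assms in auto)

lemma kronecker_assoc: "kronecker (kronecker A B) C = kronecker A (kronecker B C)"
proof (rule eq_matI)
  fix i j
  assume "i < dim_row (kronecker A (kronecker B C))" "j < dim_col (kronecker A (kronecker B C))"
  then have ij: "i < dim_row A * (dim_row B * dim_row C)" "j < dim_col A * (dim_col B * dim_col C)"
    by auto
  note d = div_mod_less[OF ij(1)] div_mod_less[OF ij(2)]
    div_mod_less[of i "dim_row A * dim_row B" "dim_row C"] div_mod_less[of j "dim_col A * dim_col B" "dim_col C"]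
  have m: "x mod (b * c) div c = x div c mod b" "x mod (b * c) mod c = x mod c"
      "x div c div b = x div (b * c)" for x b c :: nat
    using mod_mult2_eq[of x c b] div_mult2_eq[of x c b] by (cases "c = 0"; simp add: mult.commute)+
  show "kronecker (kronecker A B) C $$ (i, j) = kronecker A (kronecker B C) $$ (i, j)"
    using ij d by (simp add: kronecker_def m mult.assoc)
qed (simp_all add: mult.assoc)

lemma kronecker_one: "kronecker (1\<^sub>m m) (1\<^sub>m n) = 1\<^sub>m (m * n)"
proof (rule eq_matI)
  fix i j assume "i < dim_row (1\<^sub>m (m * n) :: complex mat)" "j < dim_col (1\<^sub>m (m * n) :: complex mat)"
  then have ij: "i < m * n" "j < m * n" by auto
  have "i = j \<longleftrightarrow> i div n = j div n \<and> i mod n = j mod n" by (metis div_mult_mod_eq)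
  then show "kronecker (1\<^sub>m m) (1\<^sub>m n) $$ (i, j) = 1\<^sub>m (m * n) $$ (i, j)"
    using ij div_mod_less[OF ij(1)] div_mod_less[OF ij(2)] by (auto simp: kronecker_def)
qed auto

lemma kronecker_one_left: "kronecker (1\<^sub>m 1) A = A"
  by (rule eq_matI) (auto simp: kronecker_def)

lemma kronecker_one_right: "kronecker A (1\<^sub>m 1) = A"
  by (rule eq_matI) (auto simp: kronecker_def)

lemma kronecker_add_left:
  "\<lbrakk>A \<in> carrier_mat m n; A' \<in> carrier_mat m n\<rbrakk> \<Longrightarrow>
    kronecker (A + A') B = kronecker A B + kronecker A' B"
  by (rule eq_matI) (auto simp: kronecker_def div_mod_less algebra_simps)

lemma kronecker_add_right:
  "\<lbrakk>B \<in> carrier_mat m n; B' \<in> carrier_mat m n\<rbrakk> \<Longrightarrow>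
    kronecker A (B + B') = kronecker A B + kronecker A B'"
  by (rule eq_matI) (auto simp: kronecker_def div_mod_less algebra_simps)

lemma kronecker_smult_left: "kronecker (a \<cdot>\<^sub>m A) B = a \<cdot>\<^sub>m kronecker A B"
  by (rule eq_matI) (auto simp: kronecker_def div_mod_less)

lemma kronecker_smult_right: "kronecker A (a \<cdot>\<^sub>m B) = a \<cdot>\<^sub>m kronecker A B"
  by (rule eq_matI) (auto simp: kronecker_def div_mod_less)

lemma GL_simps: "mult (GL n) = (*)" "one (GL n) = 1\<^sub>m n"
  by (simp_all add: GL_def units_of_def ring_mat_simps)

lemma GL_iff:
  "A \<in> carrier (GL n) \<longleftrightarrow> A \<in> carrier_mat n n \<and> (\<exists>B \<in> carrier_mat n n. B * A = 1\<^sub>m n \<and> A * B = 1\<^sub>m n)"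
  by (auto simp: GL_def units_of_def Units_def ring_mat_simps)

lemma one_GL: "1\<^sub>m n \<in> carrier (GL n)"
  unfolding GL_iff by (auto intro!: bexI[of _ "1\<^sub>m n"])

lemma kronecker_GL:
  assumes "A \<in> carrier (GL m)" "B \<in> carrier (GL n)"
  shows "kronecker A B \<in> carrier (GL (m * n))"
proof -
  obtain A' B' where *: "A \<in> carrier_mat m m" "A' \<in> carrier_mat m m" "B \<in> carrier_mat n n" "B' \<in> carrier_mat n n"
    "A' * A = 1\<^sub>m m" "A * A' = 1\<^sub>m m" "B' * B = 1\<^sub>m n" "B * B' = 1\<^sub>m n"
    using assms unfolding GL_iff by blast
  have "kronecker A' B' * kronecker A B = 1\<^sub>m (m * n)" "kronecker A B * kronecker A' B' = 1\<^sub>m (m * n)"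
    using kronecker_mult[OF *(2,1,4,3)] kronecker_mult[OF *(1,2,3,4)] *(5-8) by (simp_all add: kronecker_one)
  then show ?thesis
    unfolding GL_iff using kronecker_carrier[OF *(1,3)] kronecker_carrier[OF *(2,4)] by blast
qed

lemma representationsD:
  assumes "V \<in> representations G" "g \<in> carrier G"
  shows "snd V g \<in> carrier (GL (fst V))" "snd V g \<in> carrier_mat (fst V) (fst V)"
proof -
  show "snd V g \<in> carrier (GL (fst V))"
    using assms by (auto simp: representations_def hom_def)
  then show "snd V g \<in> carrier_mat (fst V) (fst V)" by (simp add: GL_iff)
qed

lemma representations_mult:
  "\<lbrakk>V \<in> representations G; g \<in> carrier G; h \<in> carrier G\<rbrakk>
    \<Longrightarrow> snd V (g \<otimes>\<^bsub>G\<^esub> h) = snd V g * snd V h"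
  by (auto simp: representations_def hom_def GL_simps)

lemma intertwiners_carrier: "T \<in> intertwiners G V W \<Longrightarrow> T \<in> carrier_mat (fst W) (fst V)"
  by (simp add: intertwiners_def)

lemma intertwiners_eq: "\<lbrakk>T \<in> intertwiners G V W; g \<in> carrier G\<rbrakk> \<Longrightarrow> T * snd V g = snd W g * T"
  by (simp add: intertwiners_def)

lemma one_intertwiner: "V \<in> representations G \<Longrightarrow> 1\<^sub>m (fst V) \<in> intertwiners G V V"
  by (auto simp: intertwiners_def dest!: representationsD(2))

lemma Rep_simps [simp]:
  "Ob (Rep G) = representations G"
  "Hom (Rep G) = intertwiners G"
  "Ide (Rep G) V = 1\<^sub>m (fst V)"
  "S \<cdot>\<^bsub>Rep G\<^esub> T = S * T"
  "Zero (Rep G) V W = 0\<^sub>m (fst W) (fst V)"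
  "Add (Rep G) S T = S + T"
  "Scale (Rep G) a T = a \<cdot>\<^sub>m T"
  "V \<otimes>\<^sub>o\<^bsub>Rep G\<^esub> W = (fst V * fst W, \<lambda>g \<in> carrier G. kronecker (snd V g) (snd W g))"
  "S \<otimes>\<^sub>m\<^bsub>Rep G\<^esub> T = kronecker S T"
  "UnitO (Rep G) = (1, \<lambda>g \<in> carrier G. 1\<^sub>m 1)"
  "Assoc (Rep G) U V W = 1\<^sub>m (fst U * fst V * fst W)"
  "LUnit (Rep G) V = 1\<^sub>m (fst V)"
  "RUnit (Rep G) V = 1\<^sub>m (fst V)"
  by (simp_all add: Rep_def)

lemma one_cat_iso:
  assumes "V \<in> representations G" "W \<in> representations G" "fst V = fst W"
    "\<And>g. g \<in> carrier G \<Longrightarrow> snd V g = snd W g"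
  shows "cat_iso (Rep G) V W (1\<^sub>m (fst V))"
proof -
  have "1\<^sub>m (fst V) \<in> intertwiners G V W" "1\<^sub>m (fst V) \<in> intertwiners G W V"
    using one_intertwiner[OF assms(1)] assms(3,4) by (auto simp: intertwiners_def)
  then show ?thesis
    unfolding cat_iso_def using assms(3) by (auto intro!: bexI[of _ "1\<^sub>m (fst V)"])
qed

lemma tensor_representation:
  assumes "group G" and V: "V \<in> representations G" and W: "W \<in> representations G"
  shows "V \<otimes>\<^sub>o\<^bsub>Rep G\<^esub> W \<in> representations G"
proof -
  interpret group G by fact
  have "kronecker (snd V (g \<otimes>\<^bsub>G\<^esub> h)) (snd W (g \<otimes>\<^bsub>G\<^esub> h)) =
      kronecker (snd V g) (snd W g) * kronecker (snd V h) (snd W h)"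
    if "g \<in> carrier G" "h \<in> carrier G" for g h
    using that V W
    by (auto simp: representations_mult representationsD(2)
        intro!: kronecker_mult[of _ "fst V" "fst V" _ "fst V" _ "fst W" "fst W" _ "fst W"])
  moreover have "kronecker (snd V g) (snd W g) \<in> carrier (GL (fst V * fst W))" if "g \<in> carrier G" for g
    using that V W by (intro kronecker_GL representationsD)
  ultimately show ?thesis
    by (auto simp: representations_def[of G] GL_simps intro!: homI)
qed

lemma tensor_intertwiner:
  assumes S: "S \<in> intertwiners G V V'" and T: "T \<in> intertwiners G W W'"
    and V: "V \<in> representations G" "V' \<in> representations G"
    and W: "W \<in> representations G" "W' \<in> representations G"
  shows "kronecker S T \<in> intertwiners G (V \<otimes>\<^sub>o\<^bsub>Rep G\<^esub> W) (V' \<otimes>\<^sub>o\<^bsub>Rep G\<^esub> W')"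
proof -
  note c = S[THEN intertwiners_carrier] T[THEN intertwiners_carrier]
  have "kronecker S T * kronecker (snd V g) (snd W g) = kronecker (snd V' g) (snd W' g) * kronecker S T"
    if g: "g \<in> carrier G" for g
    using kronecker_mult[OF c(1) representationsD(2)[OF V(1) g] c(2) representationsD(2)[OF W(1) g]]
      kronecker_mult[OF representationsD(2)[OF V(2) g] c(1) representationsD(2)[OF W(2) g] c(2)]
      intertwiners_eq[OF S g] intertwiners_eq[OF T g] by simp
  then show ?thesis
    using kronecker_carrier[OF c] by (auto simp: intertwiners_def)
qed

lemma unit_representation: "group G \<Longrightarrow> UnitO (Rep G) \<in> representations G"
  by (auto simp: representations_def GL_simps one_GL group.is_monoid monoid.m_closed intro!: homI)

lemma linear_monoidal_category_Rep:
  assumes G: "group G"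
  shows "linear_monoidal_category (Rep G)"
proof -
  note ten = tensor_representation[OF G, simplified] and unit = unit_representation[OF G, simplified]
  note car = intertwiners_carrier
  show ?thesis
  proof (unfold_locales, unfold Rep_simps, goal_cases)
    case (2 X Y Z f g)
    have "g * f * snd X x = snd Z x * (g * f)" if x: "x \<in> carrier G" for x
    proof -
      note c = car[OF 2(4)] car[OF 2(5)] 2(1-3)[THEN representationsD(2), OF x]
      have "g * f * snd X x = g * (f * snd X x)" using c by (auto intro: assoc_mult_mat)
      also have "\<dots> = g * (snd Y x * f)" using intertwiners_eq[OF 2(4) x] by simp
      also have "\<dots> = (g * snd Y x) * f" using c by (auto intro: assoc_mult_mat[symmetric])
      also have "\<dots> = (snd Z x * g) * f" using intertwiners_eq[OF 2(5) x] by simp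
      also have "\<dots> = snd Z x * (g * f)" using c by (auto intro: assoc_mult_mat)
      finally show ?thesis .
    qed
    then show ?case using car[OF 2(4)] car[OF 2(5)] by (auto simp: intertwiners_def)
  next
    case (6 X Y)
    then show ?case by (auto simp: intertwiners_def left_mult_zero_mat[OF representationsD(2)]
          right_mult_zero_mat[OF representationsD(2)])
  next
    case (7 X Y f g)
    then show ?case
      by (auto simp: intertwiners_def add_mult_distrib_mat[OF _ _ representationsD(2)]
          mult_add_distrib_mat[OF representationsD(2)])
  next
    case (8 X Y f a)
    then show ?case
      by (auto simp: intertwiners_def mult_smult_assoc_mat[OF _ representationsD(2)]
          mult_smult_distrib[OF representationsD(2)])
  next
    case (9 X Y f g h)
    then show ?case by (auto dest!: car)
  next
    case (5 W X Y Z f g h)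
    then show ?case using car by (blast intro: assoc_mult_mat)
  next
    case (10 X Y f g)
    then show ?case using car by (blast intro: comm_add_mat)
  next
    case (17 X Y Z f g g')
    then show ?case using car by (blast intro: add_mult_distrib_mat)
  next
    case (18 X Y Z f f' g)
    then show ?case using car by (blast intro: mult_add_distrib_mat)
  next
    case (19 X Y Z f g a)
    then show ?case using car by (blast intro: mult_smult_assoc_mat)
  next
    case (20 X Y Z f g a)
    then show ?case using car by (blast intro: mult_smult_distrib)
  next
    case (23 X X' Y Y' f g)
    then show ?case using tensor_intertwiner[of f G X X' g Y Y'] by simp
  next
    case (25 X X' X'' Y Y' Y'' f f' g g')
    then show ?case using car by (blast intro: kronecker_mult)
  next
    case (26 X X' Y Y' f f' g)
    then show ?case using car by (blast intro: kronecker_add_left)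
  next
    case (27 X X' Y Y' f g g')
    then show ?case using car by (blast intro: kronecker_add_right)
  next
    case (30 X Y Z)
    have "cat_iso (Rep G) (X \<otimes>\<^sub>o\<^bsub>Rep G\<^esub> Y \<otimes>\<^sub>o\<^bsub>Rep G\<^esub> Z) (X \<otimes>\<^sub>o\<^bsub>Rep G\<^esub> (Y \<otimes>\<^sub>o\<^bsub>Rep G\<^esub> Z))
        (1\<^sub>m (fst (X \<otimes>\<^sub>o\<^bsub>Rep G\<^esub> Y \<otimes>\<^sub>o\<^bsub>Rep G\<^esub> Z)))"
      using 30 by (intro one_cat_iso tensor_representation G) (auto simp: kronecker_assoc)
    then show ?case by simp
  next
    case (31 X X' Y Y' Z Z' f g h)
    then have "kronecker (kronecker f g) h \<in>
        carrier_mat (fst X' * fst Y' * fst Z') (fst X * fst Y * fst Z)"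
      by (intro kronecker_carrier car)
    then show ?case by (simp add: kronecker_assoc left_mult_one_mat[where nr = "fst X' * fst Y' * fst Z'"]
          right_mult_one_mat[where nc = "fst X * fst Y * fst Z"])
  next
    case (32 X)
    have "cat_iso (Rep G) (UnitO (Rep G) \<otimes>\<^sub>o\<^bsub>Rep G\<^esub> X) X (1\<^sub>m (fst (UnitO (Rep G) \<otimes>\<^sub>o\<^bsub>Rep G\<^esub> X)))"
      using 32 by (intro one_cat_iso tensor_representation unit_representation G)
        (auto simp: kronecker_one_left[simplified])
    then show ?case by simp
  next
    case (34 X)
    have "cat_iso (Rep G) (X \<otimes>\<^sub>o\<^bsub>Rep G\<^esub> UnitO (Rep G)) X (1\<^sub>m (fst (X \<otimes>\<^sub>o\<^bsub>Rep G\<^esub> UnitO (Rep G))))"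
      using 34 by (intro one_cat_iso tensor_representation unit_representation G)
        (auto simp: kronecker_one_right[simplified])
    then show ?case by simp
  next
    case (33 X Y f)
    then show ?case by (auto simp: kronecker_one_left[simplified] dest!: car)
  next
    case (35 X Y f)
    then show ?case by (auto simp: kronecker_one_right[simplified] dest!: car)
  next
    case (36 W X Y Z)
    show ?case by (simp add: kronecker_one mult.assoc)
  next
    case (22 X Y)
    then show ?case using tensor_representation[OF G] by simp
  next
    case (12 X Y f)
    then show ?case by (auto dest!: car intro!: eq_matI)
  next
    case (15 X Y f g a)
    then show ?case using car by (blast intro: add_smult_distrib_left_mat)
  next
    case (16 X Y f a b)
    then show ?case using car by (blast intro: add_smult_distrib_right_mat)
  next
    case (14 X Y f a b)
    then show ?case by (auto intro!: eq_matI)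
  next
    case (13 X Y f)
    then show ?case by (auto intro!: eq_matI)
  next
    case (11 X Y f)
    then show ?case by (auto dest!: car)
  next
    case (3 X Y f)
    then show ?case by (auto dest!: car)
  next
    case (4 X Y f)
    then show ?case by (auto dest!: car)
  qed (simp_all add: one_intertwiner unit kronecker_one kronecker_smult_left kronecker_smult_right)
qed


section \<open>Categorical rigidity\<close>

definition isocategorical :: "('a, 'c) monoid_scheme \<Rightarrow> ('b, 'd) monoid_scheme \<Rightarrow> bool" where
  "isocategorical G H \<longleftrightarrow> linear_monoidal_equivalent (Rep G) (Rep H)"

text \<open>
  A definition cannot quantify over all types, so the type over which the groups compared with \<open>G\<close>
  range is a parameter.  Rigidity in the mathematical sense is rigidity for every type, that is,
  a statement in which this type is left as a variable.
\<close>

definition categorically_rigid ::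
  "('b, 'd) monoid_scheme itself \<Rightarrow> ('a, 'c) monoid_scheme \<Rightarrow> bool" where
  "categorically_rigid T G \<longleftrightarrow>
     (\<forall>H :: ('b, 'd) monoid_scheme.
        group H \<and> finite (carrier H) \<and> isocategorical G H \<longrightarrow> H \<cong> G)"

end

theory Submission
  imports "HOL-Algebra.Sylow" "HOL-Algebra.Multiplicative_Group"
    "HOL-Computational_Algebra.Fundamental_Theorem_Algebra" "HOL-Library.Function_Algebras" Defs
begin

hide_const (open) Polynomial.order
hide_fact (open) Polynomial.order_def

text \<open>The functions on \<open>G\<close> form an algebra in \<open>Rep G\<close> on which \<open>G\<close> also acts from the other side, with \<open>G\<close>-Galois
multiplication. An equivalence carries it to an algebra \<open>M\<close> with commuting actions of \<open>G\<close> and \<open>H\<close>, both of which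
fix only the scalars. Let \<open>M\<^sub>s\<close> consist of the \<open>x\<close> with \<open>x y = s(y) x\<close> for all \<open>y\<close>. The group of those \<open>s\<close> with
\<open>M\<^sub>s \<noteq> 0\<close> is normal in \<open>G\<close>; call it \<open>S\<close>. The characters of the centre \<open>M\<^sub>1\<close> are permuted transitively by \<open>G\<close> and
by \<open>H\<close>, so the stabiliser \<open>\<Gamma>\<close> of one of them in \<open>G \<times> H\<close> projects onto both factors. It acts monomially on the
fibre of \<open>\<Oplus>\<^sub>s M\<^sub>s\<close> at this character, which is a twisted group algebra of \<open>S\<close>. The kernel \<open>T\<close> of \<open>\<Gamma> \<rightarrow> G\<close> acts on the
fibre by characters of \<open>S\<close>, and this makes \<open>S\<close> an abelian group in duality with \<open>T\<close>, carrying a nondegenerate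
alternating bicharacter \<open>\<beta>\<close> that is invariant under \<open>G\<close>. In particular \<open>card S\<close> is a square.

If \<open>\<Gamma>\<close> has a subgroup that is a complement of \<open>T\<close> and meets \<open>S\<close> trivially, it is the graph of an isomorphism
\<open>G \<cong> H\<close>. Such a subgroup exists if \<open>G\<close> acts on \<open>S\<close> through a cyclic group, if \<open>card S\<close> is odd and some element of
\<open>G\<close> inverts \<open>S\<close>, and if \<open>card S = 4\<close>. For \<open>card G < 64\<close> nothing else is left by counting except \<open>card S = 9\<close> with
\<open>card G\<close> equal to \<open>36\<close> or \<open>54\<close> and \<open>S\<close> its own centraliser; then every element outside \<open>S\<close> with square in \<open>S\<close> inverts \<open>S\<close>.\<close>

section \<open>Characters and monomial data\<close>

text \<open>The equivalence need not respect the flip of tensor factors, so the image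
  \<open>M\<close> of the commutative algebra of functions on \<open>G\<close> can fail to commute;
  \<open>S\<close> measures this failure. The Galois property is transported for \<open>G\<close>
  alone. On the side of \<open>H\<close>, fixed vectors being scalar, faithfulness and a trace
  computation for \<open>card (carrier G) \<le> card (carrier H)\<close> take its place. The
  obstacle is an extension problem. On the fibre, \<open>\<gamma>\<close> is visible through the
  automorphism it induces on \<open>S\<close> and the factors \<open>\<epsilon> \<gamma>\<close>;
  these pairs form an extension of a group of automorphisms by the characters of \<open>S\<close>.
  Both \<open>S\<close>, through \<open>\<beta>\<close>, and \<open>T\<close>, through
  \<open>\<chi>\<close>, map isomorphically onto the characters. Hence the preimage of a complement
  of the characters meets \<open>S\<close> and \<open>T\<close> in the unit only, and each criterion
  splits this one extension. For a cyclic group the obstruction is killed by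
  \<open>eps_norm\<close>. The bound 64 is where counting first admits \<open>card S = 16\<close>
  with a noncyclic group of order 4 acting on \<open>S\<close>, which none of the criteria
  covers.\<close>

definition char_on :: "('a, 'c) monoid_scheme \<Rightarrow> 'a set \<Rightarrow> ('a \<Rightarrow> complex) \<Rightarrow> bool" where
  "char_on G K c \<longleftrightarrow> (\<forall>s\<in>K. c s \<noteq> 0) \<and> (\<forall>s\<in>K. \<forall>t\<in>K. c (s \<otimes>\<^bsub>G\<^esub> t) = c s * c t)"

lemma char_onI:
  "\<lbrakk>\<And>s. s \<in> K \<Longrightarrow> c s \<noteq> 0; \<And>s t. \<lbrakk>s \<in> K; t \<in> K\<rbrakk> \<Longrightarrow> c (s \<otimes>\<^bsub>G\<^esub> t) = c s * c t\<rbrakk> \<Longrightarrow> char_on G K c"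
  by (auto simp: char_on_def)

lemma char_onD:
  assumes "char_on G K c" "s \<in> K"
  shows "c s \<noteq> 0" "t \<in> K \<Longrightarrow> c (s \<otimes>\<^bsub>G\<^esub> t) = c s * c t"
  using assms by (auto simp: char_on_def)

lemma char_on_divide:
  "\<lbrakk>char_on G K c; char_on G K d\<rbrakk> \<Longrightarrow> char_on G K (\<lambda>s. c s / d s)"
  by (auto simp: char_on_def)

lemma char_on_power:
  "char_on G K c \<Longrightarrow> char_on G K (\<lambda>s. c s ^ n)"
  by (auto simp: char_on_def power_mult_distrib)

lemma (in group) bij_betw_mult_subgroup:
  assumes "subgroup K G" "a \<in> K"
  shows "bij_betw (\<lambda>s. a \<otimes> s) K K"
proof -
  interpret K: subgroup K G by fact
  show ?thesis
    by (rule bij_betw_byWitness[where f' = "\<lambda>s. inv a \<otimes> s"])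
      (use assms(2) in \<open>auto simp: m_assoc[symmetric] K.mem_carrier\<close>)
qed

text \<open>Left multiplication by \<open>a\<close> maps the finite set \<open>K\<close> injectively
  into itself, hence onto; preimages of \<open>a\<close> and of \<open>\<one>\<close> supply the
  unit and the inverse.\<close>

lemma (in group) finite_subgroupI:
  assumes "K \<subseteq> carrier G" "K \<noteq> {}" "finite K" and closed: "\<And>x y. \<lbrakk>x \<in> K; y \<in> K\<rbrakk> \<Longrightarrow> x \<otimes> y \<in> K"
  shows "subgroup K G"
proof (rule subgroupI)
  fix a assume a: "a \<in> K"
  have "inj_on ((\<otimes>) a) K" using a assms(1) by (intro inj_onI) (auto simp: subset_iff)
  then have surj: "(\<otimes>) a ` K = K" using a closed by (intro endo_inj_surj[OF assms(3)]) auto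
  then obtain x where x: "x \<in> K" "a \<otimes> x = a" using a by (metis imageE)
  moreover have car: "a \<in> carrier G" "x \<in> carrier G" using a x(1) assms(1) by auto
  ultimately have "inv a \<otimes> (a \<otimes> x) = inv a \<otimes> a" by simp
  then have "x = \<one>" using car by (simp flip: m_assoc)
  then obtain y where y: "y \<in> K" "a \<otimes> y = \<one>" using surj x(1) by (metis imageE)
  have "inv a = y" using inv_equality[of y a] inv_comm[OF y(2)] a y assms(1) by auto
  then show "inv a \<in> K" using y(1) by simp
qed (use assms in auto)

lemma (in group) char_one:
  assumes "subgroup K G" "char_on G K c"
  shows "c \<one> = 1"
proof -
  have one: "\<one> \<in> K" using assms(1) by (rule subgroup.one_closed)
  have "c (\<one> \<otimes> \<one>) = c \<one> * c \<one>" by (rule char_onD(2)[OF assms(2) one one])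
  then show ?thesis using char_onD(1)[OF assms(2) one] by simp
qed

lemma (in group) char_inv:
  assumes "subgroup K G" "char_on G K c" "s \<in> K"
  shows "c (inv s) = 1 / c s"
proof -
  have "inv s \<in> K" using assms(1,3) by (rule subgroup.m_inv_closed)
  then have "c (s \<otimes> inv s) = c s * c (inv s)" "c s \<noteq> 0" using char_onD[OF assms(2)] assms(3) by auto
  then show ?thesis using char_one[OF assms(1,2)] assms by (simp add: subgroup.mem_carrier field_simps)
qed

text \<open>Translation by some \<open>a\<close> with \<open>c a \<noteq> 1\<close> multiplies the
  sum by \<open>c a\<close>, so the sum vanishes unless \<open>c\<close> is trivial on
  \<open>K\<close>.\<close>

lemma (in group) sum_char:
  assumes "subgroup K G" "char_on G K c"
  shows "(\<Sum>s\<in>K. c s) = (if \<forall>s\<in>K. c s = 1 then of_nat (card K) else 0)"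
proof (cases "\<forall>s\<in>K. c s = 1")
  case False
  then obtain a where a: "a \<in> K" "c a \<noteq> 1" by blast
  have "(\<Sum>s\<in>K. c s) = (\<Sum>s\<in>K. c (a \<otimes> s))"
    by (rule sum.reindex_bij_betw[OF bij_betw_mult_subgroup[OF assms(1) a(1)], symmetric])
  also have "\<dots> = c a * (\<Sum>s\<in>K. c s)"
    using char_onD(2)[OF assms(2) a(1)] by (simp add: sum_distrib_left)
  finally show ?thesis using a False by auto
qed auto

text \<open>Translation by \<open>s\<close> permutes the factors of the nonzero product of all
  values of \<open>c\<close>, as in the proof of Fermat's little theorem.\<close>

lemma (in group) char_pow_card:
  assumes "finite (carrier G)" "subgroup K G" "char_on G K c" "s \<in> K"
  shows "c s ^ card K = 1"
proof -
  interpret K: subgroup K G by fact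
  have "finite K" using assms(1) K.subset finite_subset by blast
  have nz: "(\<Prod>s\<in>K. c s) \<noteq> 0" using char_onD(1)[OF assms(3)] \<open>finite K\<close> by simp
  have "(\<Prod>x\<in>K. c x) = (\<Prod>x\<in>K. c (s \<otimes> x))"
    by (rule prod.reindex_bij_betw[OF bij_betw_mult_subgroup[OF assms(2,4)], symmetric])
  also have "\<dots> = c s ^ card K * (\<Prod>x\<in>K. c x)"
    using char_onD(2)[OF assms(3,4)] by (simp add: prod.distrib)
  finally show ?thesis using nz by simp
qed

section \<open>Conjugation and norm products\<close>

definition conjg :: "('a, 'c) monoid_scheme \<Rightarrow> 'a \<Rightarrow> 'a \<Rightarrow> 'a" where
  "conjg G g s = g \<otimes>\<^bsub>G\<^esub> s \<otimes>\<^bsub>G\<^esub> inv\<^bsub>G\<^esub> g"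

text \<open>With \<open>\<gamma>\<close> acting by conjugation, this is the product \<open>\<gamma>\<^sup>k\<^sup>-\<^sup>1 s \<cdots> \<gamma> s \<cdot> s\<close>, in this order.\<close>

primrec norm_prod :: "('a, 'c) monoid_scheme \<Rightarrow> 'a \<Rightarrow> nat \<Rightarrow> 'a \<Rightarrow> 'a" where
  "norm_prod G g 0 s = \<one>\<^bsub>G\<^esub>"
| "norm_prod G g (Suc k) s = norm_prod G g k (conjg G g s) \<otimes>\<^bsub>G\<^esub> s"

lemma (in group) conj_closed [simp, intro]:
  "\<lbrakk>g \<in> carrier G; s \<in> carrier G\<rbrakk> \<Longrightarrow> conjg G g s \<in> carrier G"
  by (simp add: conjg_def)

lemma (in group) conj_mult_left:
  "\<lbrakk>g \<in> carrier G; h \<in> carrier G; s \<in> carrier G\<rbrakk> \<Longrightarrow> conjg G (g \<otimes> h) s = conjg G g (conjg G h s)"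
  by (simp add: conjg_def inv_mult_group m_assoc)

lemma (in group) conj_mult:
  "\<lbrakk>g \<in> carrier G; s \<in> carrier G; t \<in> carrier G\<rbrakk> \<Longrightarrow> conjg G g (s \<otimes> t) = conjg G g s \<otimes> conjg G g t"
  by (simp add: conjg_def m_assoc inv_solve_left)

lemma (in group) conj_one_left [simp]: "s \<in> carrier G \<Longrightarrow> conjg G \<one> s = s"
  by (simp add: conjg_def)

lemma (in group) conj_one [simp]: "g \<in> carrier G \<Longrightarrow> conjg G g \<one> = \<one>"
  by (simp add: conjg_def)

lemma (in group) conj_inv_left:
  "\<lbrakk>g \<in> carrier G; s \<in> carrier G\<rbrakk> \<Longrightarrow> conjg G (inv g) (conjg G g s) = s"
  by (simp flip: conj_mult_left)

lemma (in group) conj_inv: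
  "\<lbrakk>g \<in> carrier G; s \<in> carrier G\<rbrakk> \<Longrightarrow> conjg G g (inv s) = inv (conjg G g s)"
  by (simp add: conjg_def inv_mult_group m_assoc)

text \<open>A choice \<open>s\<close> of partners for the elements of \<open>G\<close> identifies
  \<open>\<Gamma>\<close> with the product of \<open>carrier G\<close> and the fibre over
  \<open>\<one>\<close>.\<close>

lemma card_subdirect:
  assumes G: "group G" and H: "group H" and fin: "finite (carrier G)" "finite (carrier H)"
    and \<Gamma>: "subgroup \<Gamma> (G \<times>\<times> H)" and surj: "\<And>g. g \<in> carrier G \<Longrightarrow> \<exists>h. (g, h) \<in> \<Gamma>"
  shows "card \<Gamma> = card (carrier G) * card {h. (\<one>\<^bsub>G\<^esub>, h) \<in> \<Gamma>}"
proof -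
  interpret G: group G by fact
  interpret H: group H by fact
  have car: "g \<in> carrier G" "h \<in> carrier H" if "(g, h) \<in> \<Gamma>" for g h
    using subgroup.subset[OF \<Gamma>] that by auto
  have "\<exists>s. \<forall>g\<in>carrier G. (g, s g) \<in> \<Gamma>" using surj by metis
  then obtain s where s: "\<And>g. g \<in> carrier G \<Longrightarrow> (g, s g) \<in> \<Gamma>" by blast
  have mult: "(g \<otimes>\<^bsub>G\<^esub> g', h \<otimes>\<^bsub>H\<^esub> h') \<in> \<Gamma>" if "(g, h) \<in> \<Gamma>" "(g', h') \<in> \<Gamma>" for g h g' h'
    using subgroup.m_closed[OF \<Gamma> that] by simp
  have inv: "(inv\<^bsub>G\<^esub> g, inv\<^bsub>H\<^esub> h) \<in> \<Gamma>" if "(g, h) \<in> \<Gamma>" for g h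
    using subgroup.m_inv_closed[OF \<Gamma> that] car[OF that] G H by simp
  have "bij_betw (\<lambda>(g, t). (g, s g \<otimes>\<^bsub>H\<^esub> t)) (carrier G \<times> {h. (\<one>\<^bsub>G\<^esub>, h) \<in> \<Gamma>}) \<Gamma>"
  proof (rule bij_betw_byWitness[where f' = "\<lambda>(g, h). (g, inv\<^bsub>H\<^esub> s g \<otimes>\<^bsub>H\<^esub> h)"])
    show "\<forall>a\<in>carrier G \<times> {h. (\<one>\<^bsub>G\<^esub>, h) \<in> \<Gamma>}.
        (case case a of (g, t) \<Rightarrow> (g, s g \<otimes>\<^bsub>H\<^esub> t) of (g, h) \<Rightarrow> (g, inv\<^bsub>H\<^esub> s g \<otimes>\<^bsub>H\<^esub> h)) = a"
      using car s by (fastforce simp: H.m_assoc[symmetric])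
    show "\<forall>a\<in>\<Gamma>. (case case a of (g, h) \<Rightarrow> (g, inv\<^bsub>H\<^esub> s g \<otimes>\<^bsub>H\<^esub> h) of (g, t) \<Rightarrow> (g, s g \<otimes>\<^bsub>H\<^esub> t)) = a"
      using car s by (fastforce simp: H.m_assoc[symmetric])
    show "(\<lambda>(g, t). (g, s g \<otimes>\<^bsub>H\<^esub> t)) ` (carrier G \<times> {h. (\<one>\<^bsub>G\<^esub>, h) \<in> \<Gamma>}) \<subseteq> \<Gamma>"
      using mult[OF s] by fastforce
    show "(\<lambda>(g, h). (g, inv\<^bsub>H\<^esub> s g \<otimes>\<^bsub>H\<^esub> h)) ` \<Gamma> \<subseteq> carrier G \<times> {h. (\<one>\<^bsub>G\<^esub>, h) \<in> \<Gamma>}"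
    proof clarsimp
      fix g h assume gh: "(g, h) \<in> \<Gamma>"
      show "g \<in> carrier G \<and> (\<one>\<^bsub>G\<^esub>, inv\<^bsub>H\<^esub> s g \<otimes>\<^bsub>H\<^esub> h) \<in> \<Gamma>"
        using mult[OF inv[OF s] gh, OF car(1)[OF gh]] car[OF gh] by simp
    qed
  qed
  then have "card (carrier G \<times> {h. (\<one>\<^bsub>G\<^esub>, h) \<in> \<Gamma>}) = card \<Gamma>" by (rule bij_betw_same_card)
  then show ?thesis by (simp add: card_cartesian_product)
qed

text \<open>Think of a twisted group algebra of \<open>S\<close> with basis \<open>v s\<close> and product \<open>v s \<cdot> v t = f s t \<cdot> v (s \<otimes> t)\<close>, on which
  \<open>\<Gamma>\<close> acts by algebra automorphisms \<open>\<gamma> (v s) = \<epsilon> \<gamma> s \<cdot> v (conjg G (fst \<gamma>) s)\<close>; the element \<open>(s, \<one>)\<close> of \<open>\<Gamma>\<close>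
  acts as conjugation by \<open>v s\<close>. Associativity of this algebra enters only through its consequence \<open>eps_norm\<close>.\<close>

locale monomial_data =
  G: group G + H: group H
  for G :: "('a, 'c) monoid_scheme" (structure) and H :: "('b, 'd) monoid_scheme" +
  fixes \<Gamma> :: "('a \<times> 'b) set" and S :: "'a set" and \<epsilon> :: "'a \<times> 'b \<Rightarrow> 'a \<Rightarrow> complex"
    and f :: "'a \<Rightarrow> 'a \<Rightarrow> complex"
  assumes finG: "finite (carrier G)" and finH: "finite (carrier H)"
    and card_GH: "card (carrier G) \<le> card (carrier H)"
    and subgroup_Gamma: "subgroup \<Gamma> (G \<times>\<times> H)"
    and Gamma_fst: "g \<in> carrier G \<Longrightarrow> \<exists>h. (g, h) \<in> \<Gamma>"
    and Gamma_snd: "h \<in> carrier H \<Longrightarrow> \<exists>g. (g, h) \<in> \<Gamma>"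
    and subgroup_S: "subgroup S G"
    and conj_S: "\<lbrakk>g \<in> carrier G; s \<in> S\<rbrakk> \<Longrightarrow> conjg G g s \<in> S"
    and S_Gamma: "s \<in> S \<Longrightarrow> (s, \<one>\<^bsub>H\<^esub>) \<in> \<Gamma>"
    and eps_nz: "\<lbrakk>\<gamma> \<in> \<Gamma>; s \<in> S\<rbrakk> \<Longrightarrow> \<epsilon> \<gamma> s \<noteq> 0"
    and f_nz: "\<lbrakk>s \<in> S; t \<in> S\<rbrakk> \<Longrightarrow> f s t \<noteq> 0"
    and eps_mult: "\<lbrakk>\<gamma> \<in> \<Gamma>; \<delta> \<in> \<Gamma>; s \<in> S\<rbrakk> \<Longrightarrow>
      \<epsilon> (\<gamma> \<otimes>\<^bsub>G \<times>\<times> H\<^esub> \<delta>) s = \<epsilon> \<gamma> (conjg G (fst \<delta>) s) * \<epsilon> \<delta> s"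
    and eps_f: "\<lbrakk>\<gamma> \<in> \<Gamma>; s \<in> S; t \<in> S\<rbrakk> \<Longrightarrow> f s t * \<epsilon> \<gamma> (s \<otimes> t) =
      \<epsilon> \<gamma> s * \<epsilon> \<gamma> t * f (conjg G (fst \<gamma>) s) (conjg G (fst \<gamma>) t)"
    and f_comm: "\<lbrakk>s \<in> S; t \<in> S\<rbrakk> \<Longrightarrow> f s t = \<epsilon> (s, \<one>\<^bsub>H\<^esub>) t * f (conjg G s t) s"
    and faithful_fst: "\<lbrakk>s \<in> S; \<And>t. t \<in> S \<Longrightarrow> s \<otimes> t = t \<otimes> s; \<And>t. t \<in> S \<Longrightarrow> \<epsilon> (s, \<one>\<^bsub>H\<^esub>) t = 1\<rbrakk> \<Longrightarrow> s = \<one>"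
    and faithful_snd: "\<lbrakk>(\<one>, h) \<in> \<Gamma>; \<And>t. t \<in> S \<Longrightarrow> \<epsilon> (\<one>, h) t = 1\<rbrakk> \<Longrightarrow> h = \<one>\<^bsub>H\<^esub>"
    and eps_norm: "\<lbrakk>\<gamma> \<in> \<Gamma>; s \<in> S; k > 0; conjg G (fst \<gamma> [^] k) s = s; norm_prod G (fst \<gamma>) k s = \<one>\<rbrakk>
      \<Longrightarrow> \<epsilon> (\<gamma> [^]\<^bsub>G \<times>\<times> H\<^esub> k) s = 1"
begin

sublocale P: group "G \<times>\<times> H"
  by (rule DirProd_group) unfold_locales

lemma Gamma_carrier: "\<gamma> \<in> \<Gamma> \<Longrightarrow> fst \<gamma> \<in> carrier G \<and> snd \<gamma> \<in> carrier H"
  using subgroup.subset[OF subgroup_Gamma] by auto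

lemma S_carrier: "s \<in> S \<Longrightarrow> s \<in> carrier G"
  using subgroup.subset[OF subgroup_S] by auto

lemma finite_S: "finite S"
  using finG subgroup.subset[OF subgroup_S] finite_subset by blast

lemma one_S [simp, intro]: "\<one> \<in> S"
  using subgroup_S by (rule subgroup.one_closed)

lemma mult_S [intro]: "\<lbrakk>s \<in> S; t \<in> S\<rbrakk> \<Longrightarrow> s \<otimes> t \<in> S"
  using subgroup_S by (rule subgroup.m_closed)

lemma inv_S [intro]: "s \<in> S \<Longrightarrow> inv s \<in> S"
  using subgroup_S by (rule subgroup.m_inv_closed)

lemma Gamma_mult: "\<lbrakk>\<gamma> \<in> \<Gamma>; \<delta> \<in> \<Gamma>\<rbrakk> \<Longrightarrow> \<gamma> \<otimes>\<^bsub>G \<times>\<times> H\<^esub> \<delta> \<in> \<Gamma>"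
  using subgroup_Gamma by (rule subgroup.m_closed)

lemma Gamma_inv: "\<gamma> \<in> \<Gamma> \<Longrightarrow> inv\<^bsub>G \<times>\<times> H\<^esub> \<gamma> \<in> \<Gamma>"
  using subgroup_Gamma by (rule subgroup.m_inv_closed)

lemma conj_Gamma_S: "\<lbrakk>\<gamma> \<in> \<Gamma>; s \<in> S\<rbrakk> \<Longrightarrow> conjg G (fst \<gamma>) s \<in> S"
  using conj_S Gamma_carrier by blast

text \<open>For \<open>\<gamma>\<close> centralising \<open>S\<close> the cocycle \<open>f\<close>
  occurs equally on both sides of \<open>eps_f\<close> and cancels.\<close>

lemma eps_char:
  assumes "\<gamma> \<in> \<Gamma>" "\<And>s. s \<in> S \<Longrightarrow> conjg G (fst \<gamma>) s = s"
  shows "char_on G S (\<epsilon> \<gamma>)"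
proof (rule char_onI)
  fix s t assume st: "s \<in> S" "t \<in> S"
  show "\<epsilon> \<gamma> (s \<otimes> t) = \<epsilon> \<gamma> s * \<epsilon> \<gamma> t"
    using eps_f[OF assms(1) st] f_nz[OF st] assms(2) st by simp
qed (use eps_nz assms in auto)

section \<open>Duality between \<open>S\<close> and \<open>T\<close>\<close>

definition T :: "'b set" where
  "T = {h. (\<one>, h) \<in> \<Gamma>}"

definition \<chi> :: "'b \<Rightarrow> 'a \<Rightarrow> complex" where
  "\<chi> t = \<epsilon> (\<one>, t)"

lemma T_Gamma: "t \<in> T \<Longrightarrow> (\<one>, t) \<in> \<Gamma>"
  by (simp add: T_def)

lemma subgroup_T: "subgroup T H"
proof
  show "T \<subseteq> carrier H" using Gamma_carrier by (auto simp: T_def)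
  show "\<one>\<^bsub>H\<^esub> \<in> T" using subgroup.one_closed[OF subgroup_Gamma] by (simp add: T_def)
  show "x \<otimes>\<^bsub>H\<^esub> y \<in> T" if "x \<in> T" "y \<in> T" for x y
    using Gamma_mult[OF T_Gamma T_Gamma, OF that] by (simp add: T_def)
  show "inv\<^bsub>H\<^esub> x \<in> T" if "x \<in> T" for x
    using Gamma_inv[OF T_Gamma[OF that]] Gamma_carrier[OF T_Gamma[OF that]]
    by (simp add: T_def inv_DirProd[OF G.is_group H.is_group])
qed

lemma finite_T: "finite T"
  using finH subgroup.subset[OF subgroup_T] finite_subset by blast

lemma char_chi: "t \<in> T \<Longrightarrow> char_on G S (\<chi> t)"
  unfolding \<chi>_def by (rule eps_char) (auto simp: T_Gamma S_carrier)

lemma char_chi': "s \<in> S \<Longrightarrow> char_on H T (\<lambda>t. \<chi> t s)"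
  unfolding \<chi>_def
proof (rule char_onI)
  fix t u assume s: "s \<in> S" and tu: "t \<in> T" "u \<in> T"
  show "\<epsilon> (\<one>, t) s \<noteq> 0" using eps_nz T_Gamma tu s by blast
  show "\<epsilon> (\<one>, t \<otimes>\<^bsub>H\<^esub> u) s = \<epsilon> (\<one>, t) s * \<epsilon> (\<one>, u) s"
    using eps_mult[OF tu[THEN T_Gamma] s] s by (simp add: S_carrier)
qed

lemma chi_faithful: "\<lbrakk>t \<in> T; \<And>s. s \<in> S \<Longrightarrow> \<chi> t s = 1\<rbrakk> \<Longrightarrow> t = \<one>\<^bsub>H\<^esub>"
  unfolding \<chi>_def by (rule faithful_snd) (auto simp: T_Gamma)

lemma chi_one: "s \<in> S \<Longrightarrow> \<chi> \<one>\<^bsub>H\<^esub> s = 1"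
  using H.char_one[OF subgroup_T char_chi'] by simp

lemma card_Gamma:
  "card \<Gamma> = card (carrier G) * card T" "card \<Gamma> = card (carrier H) * card {g. (g, \<one>\<^bsub>H\<^esub>) \<in> \<Gamma>}"
proof -
  show "card \<Gamma> = card (carrier G) * card T"
    unfolding T_def using G.is_group H.is_group finG finH subgroup_Gamma Gamma_fst
    by (rule card_subdirect)
  have swap: "(h, g) \<in> prod.swap ` \<Gamma> \<longleftrightarrow> (g, h) \<in> \<Gamma>" for g h by force
  have "subgroup (prod.swap ` \<Gamma>) (H \<times>\<times> G)"
  proof (rule group.subgroupI)
    show "prod.swap ` \<Gamma> \<subseteq> carrier (H \<times>\<times> G)" using Gamma_carrier by auto
    show "prod.swap ` \<Gamma> \<noteq> {}" using S_Gamma one_S by auto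
    fix a b assume a: "a \<in> prod.swap ` \<Gamma>" and b: "b \<in> prod.swap ` \<Gamma>"
    obtain g h g' h' where ab: "a = (h, g)" "(g, h) \<in> \<Gamma>" "b = (h', g')" "(g', h') \<in> \<Gamma>"
      using a b by auto
    show "a \<otimes>\<^bsub>H \<times>\<times> G\<^esub> b \<in> prod.swap ` \<Gamma>"
      using Gamma_mult[OF ab(2,4)] by (simp add: ab(1,3) swap)
    show "inv\<^bsub>H \<times>\<times> G\<^esub> a \<in> prod.swap ` \<Gamma>"
      using Gamma_inv[OF ab(2)] Gamma_carrier[OF ab(2)] G.is_group H.is_group by (simp add: ab(1) swap)
  qed (rule DirProd_group[OF H.is_group G.is_group])
  from card_subdirect[OF H.is_group G.is_group finH finG this]
  have "card (prod.swap ` \<Gamma>) = card (carrier H) * card {g. (g, \<one>\<^bsub>H\<^esub>) \<in> \<Gamma>}"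
    using Gamma_snd by (simp add: swap)
  moreover have "card (prod.swap ` \<Gamma>) = card \<Gamma>" by (intro card_image) simp
  ultimately show "card \<Gamma> = card (carrier H) * card {g. (g, \<one>\<^bsub>H\<^esub>) \<in> \<Gamma>}" by simp
qed

lemma S_subset_kernel: "S \<subseteq> {g. (g, \<one>\<^bsub>H\<^esub>) \<in> \<Gamma>}"
  using S_Gamma by auto

lemma finite_kernel: "finite {g. (g, \<one>\<^bsub>H\<^esub>) \<in> \<Gamma>}"
  by (rule finite_subset[OF _ finG]) (use Gamma_carrier in auto)

text \<open>\<open>\<Gamma>\<close> is counted over \<open>G\<close> with fibre \<open>T\<close> and
  over \<open>H\<close> with fibre the kernel of the second projection; by \<open>card_GH\<close>
  the fibre over \<open>H\<close> cannot be the larger one.\<close>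

lemma card_kernel_le: "card {g. (g, \<one>\<^bsub>H\<^esub>) \<in> \<Gamma>} \<le> card T"
proof -
  let ?k = "card {g. (g, \<one>\<^bsub>H\<^esub>) \<in> \<Gamma>}"
  have "card (carrier G) * ?k \<le> card (carrier H) * ?k" using card_GH by simp
  also have "\<dots> = card (carrier G) * card T" using card_Gamma by simp
  finally have "0 < card (carrier G) \<longrightarrow> ?k \<le> card T" by simp
  moreover have "0 < card (carrier G)" using finG G.one_closed card_gt_0_iff by blast
  ultimately show ?thesis by blast
qed

text \<open>Both inequalities between \<open>card S\<close> and \<open>card T\<close> come from evaluating
  \<open>\<Sum>t\<in>T. \<Sum>s\<in>S. \<chi> t s\<close> in both orders.\<close>

lemma
  shows card_T: "card T = card S"
    and chi_separates: "\<lbrakk>s \<in> S; \<And>t. t \<in> T \<Longrightarrow> \<chi> t s = 1\<rbrakk> \<Longrightarrow> s = \<one>"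
proof -
  define S0 where "S0 = {s \<in> S. \<forall>t\<in>T. \<chi> t s = 1}"
  have one: "\<one> \<in> S0" unfolding S0_def using G.char_one[OF subgroup_S char_chi] by auto
  have S0: "S0 \<subseteq> S" "finite S0" using finite_S by (auto simp: S0_def)
  have "(\<Sum>t\<in>T. \<Sum>s\<in>S. \<chi> t s) = (\<Sum>t\<in>T. if t = \<one>\<^bsub>H\<^esub> then of_nat (card S) else 0)"
  proof (rule sum.cong)
    fix t assume t: "t \<in> T"
    have "(\<forall>s\<in>S. \<chi> t s = 1) \<longleftrightarrow> t = \<one>\<^bsub>H\<^esub>" using chi_faithful[OF t] chi_one by blast
    then show "(\<Sum>s\<in>S. \<chi> t s) = (if t = \<one>\<^bsub>H\<^esub> then of_nat (card S) else 0)"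
      using G.sum_char[OF subgroup_S char_chi[OF t]] by simp
  qed simp
  also have "\<dots> = of_nat (card S)"
    using subgroup.one_closed[OF subgroup_T] finite_T by (simp add: sum.delta)
  finally have 1: "(\<Sum>t\<in>T. \<Sum>s\<in>S. \<chi> t s) = of_nat (card S)" .
  have "(\<Sum>t\<in>T. \<Sum>s\<in>S. \<chi> t s) = (\<Sum>s\<in>S. \<Sum>t\<in>T. \<chi> t s)" by (rule sum.swap)
  also have "\<dots> = (\<Sum>s\<in>S. if s \<in> S0 then of_nat (card T) else 0)"
    using H.sum_char[OF subgroup_T char_chi'] by (intro sum.cong) (auto simp: S0_def)
  also have "\<dots> = of_nat (card S0 * card T)"
    using finite_S S0 by (simp add: sum.If_cases Int_absorb1)
  finally have "of_nat (card S) = (of_nat (card S0 * card T) :: complex)" using 1 by simp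
  then have eq: "card S = card S0 * card T" using of_nat_eq_iff by blast
  \<comment> \<open>The reverse inequality: \<open>S\<close> lies in the kernel of the projection to
    \<open>H\<close>, which has at most \<open>card T\<close> elements. Together with
    \<open>card S = card S0 * card T\<close> this leaves a single element in
    \<open>S0\<close>.\<close>
  have "card S \<le> card T"
    using card_mono[OF finite_kernel S_subset_kernel] card_kernel_le by simp
  moreover have "card S0 \<ge> 1" using one S0(2) card_gt_0_iff[of S0] by auto
  moreover have "card S > 0" using finite_S one_S card_gt_0_iff[of S] by auto
  moreover obtain d where "card S0 = 1 + d" using \<open>card S0 \<ge> 1\<close> le_Suc_ex by blast
  moreover have "card T > 0" using \<open>card S > 0\<close> eq by (cases "card T = 0") auto
  ultimately have c: "card S0 = 1" using eq by simp
  then show "card T = card S" using eq by simp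
  from c one have "S0 = {\<one>}" by (metis card_1_singletonE singletonD)
  then show "s = \<one>" if "s \<in> S" "\<And>t. t \<in> T \<Longrightarrow> \<chi> t s = 1" using that by (auto simp: S0_def)
qed

text \<open>The kernel of the projection to \<open>H\<close> contains \<open>S\<close> and has at
  most \<open>card T = card S\<close> elements.\<close>

lemma kernel_fst: "(g, \<one>\<^bsub>H\<^esub>) \<in> \<Gamma> \<longleftrightarrow> g \<in> S"
proof -
  have "S = {g. (g, \<one>\<^bsub>H\<^esub>) \<in> \<Gamma>}"
    using card_kernel_le card_T card_mono[OF finite_kernel S_subset_kernel]
    by (intro card_subset_eq[OF finite_kernel S_subset_kernel]) simp
  then show ?thesis by blast
qed

text \<open>A commutator has value 1 under every \<open>\<chi> u\<close>, and these characters
  separate the elements of \<open>S\<close>.\<close>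

lemma S_comm: "\<lbrakk>s \<in> S; t \<in> S\<rbrakk> \<Longrightarrow> s \<otimes> t = t \<otimes> s"
proof -
  assume st: "s \<in> S" "t \<in> S"
  let ?r = "(s \<otimes> t) \<otimes> inv (t \<otimes> s)"
  have "\<chi> u ?r = 1" if u: "u \<in> T" for u
    using char_onD[OF char_chi[OF u]] G.char_inv[OF subgroup_S char_chi[OF u]] st
    by (simp add: mult_S inv_S del: G.inv_mult_group)
  then have "?r = \<one>" by (intro chi_separates) (use st in auto)
  then have "s \<otimes> t = inv (inv (t \<otimes> s))"
    using st by (intro G.inv_equality[symmetric]) (auto simp: S_carrier)
  then show ?thesis using st by (simp add: S_carrier)
qed

lemma conj_S_S [simp]: "\<lbrakk>s \<in> S; t \<in> S\<rbrakk> \<Longrightarrow> conjg G s t = t"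
  unfolding conjg_def using S_comm[of s t] by (simp add: S_carrier G.m_assoc)

text \<open>Summed over \<open>T\<close> first, the ratios \<open>\<chi> t s / \<psi> s\<close>
  survive only at \<open>s = \<one>\<close> and give \<open>card T\<close>. So for some
  \<open>t\<close> the sum over \<open>S\<close> is nonzero, which by orthogonality means that the
  ratio is trivial.\<close>

lemma char_surj:
  assumes "char_on G S \<psi>"
  obtains t where "t \<in> T" "\<And>s. s \<in> S \<Longrightarrow> \<chi> t s = \<psi> s"
proof -
  have "(\<Sum>t\<in>T. \<Sum>s\<in>S. \<chi> t s / \<psi> s) = (\<Sum>s\<in>S. \<Sum>t\<in>T. \<chi> t s / \<psi> s)" by (rule sum.swap)
  also have "\<dots> = (\<Sum>s\<in>S. (if s = \<one> then of_nat (card T) else 0))"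
  proof (rule sum.cong)
    fix s assume s: "s \<in> S"
    have "(\<forall>t\<in>T. \<chi> t s = 1) \<longleftrightarrow> s = \<one>"
      using chi_separates[OF s] G.char_one[OF subgroup_S char_chi] by auto
    then have "(\<Sum>t\<in>T. \<chi> t s) = (if s = \<one> then of_nat (card T) else 0)"
      using H.sum_char[OF subgroup_T char_chi'[OF s]] by simp
    moreover have "(\<Sum>t\<in>T. \<chi> t s / \<psi> s) = (\<Sum>t\<in>T. \<chi> t s) / \<psi> s" by (simp add: sum_divide_distrib)
    ultimately show "(\<Sum>t\<in>T. \<chi> t s / \<psi> s) = (if s = \<one> then of_nat (card T) else 0)"
      using G.char_one[OF subgroup_S assms] by simp
  qed simp
  also have "\<dots> = of_nat (card T)" using finite_S by (simp add: sum.delta)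
  also have "\<dots> \<noteq> 0" using finite_T subgroup.one_closed[OF subgroup_T] by auto
  finally obtain t where t: "t \<in> T" "(\<Sum>s\<in>S. \<chi> t s / \<psi> s) \<noteq> 0"
    by (meson sum.neutral)
  then have "\<forall>s\<in>S. \<chi> t s / \<psi> s = 1"
    using G.sum_char[OF subgroup_S char_on_divide[OF char_chi[OF t(1)] assms]] by metis
  then show ?thesis using that t(1) char_onD(1)[OF assms] by auto
qed

section \<open>The commutator pairing of the twisted group algebra\<close>

definition \<beta> :: "'a \<Rightarrow> 'a \<Rightarrow> complex" where
  "\<beta> s = \<epsilon> (s, \<one>\<^bsub>H\<^esub>)"

lemma char_beta: "s \<in> S \<Longrightarrow> char_on G S (\<beta> s)"
  unfolding \<beta>_def by (rule eps_char) (auto simp: S_Gamma)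

lemma char_beta': "t \<in> S \<Longrightarrow> char_on G S (\<lambda>s. \<beta> s t)"
  unfolding \<beta>_def
proof (rule char_onI)
  fix s u assume t: "t \<in> S" and su: "s \<in> S" "u \<in> S"
  show "\<epsilon> (s, \<one>\<^bsub>H\<^esub>) t \<noteq> 0" using eps_nz S_Gamma su t by blast
  show "\<epsilon> (s \<otimes> u, \<one>\<^bsub>H\<^esub>) t = \<epsilon> (s, \<one>\<^bsub>H\<^esub>) t * \<epsilon> (u, \<one>\<^bsub>H\<^esub>) t"
    using eps_mult[OF su[THEN S_Gamma] t] su t by simp
qed

lemma beta_f: "\<lbrakk>s \<in> S; t \<in> S\<rbrakk> \<Longrightarrow> f s t = \<beta> s t * f t s"
  using f_comm[of s t] by (simp add: \<beta>_def)

lemma beta_alt: "\<lbrakk>s \<in> S; t \<in> S\<rbrakk> \<Longrightarrow> \<beta> s t * \<beta> t s = 1"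
  using beta_f[of s t] beta_f[of t s] f_nz[of s t] by simp

lemma beta_same: "s \<in> S \<Longrightarrow> \<beta> s s = 1"
  using beta_f[of s s] f_nz[of s s] by simp

lemma beta_nondeg: "\<lbrakk>s \<in> S; \<And>t. t \<in> S \<Longrightarrow> \<beta> s t = 1\<rbrakk> \<Longrightarrow> s = \<one>"
  by (rule faithful_fst) (auto simp: \<beta>_def intro: S_comm)

lemma beta_nondeg': "\<lbrakk>t \<in> S; \<And>s. s \<in> S \<Longrightarrow> \<beta> s t = 1\<rbrakk> \<Longrightarrow> t = \<one>"
  by (rule beta_nondeg) (use beta_alt in force)+

text \<open>\<open>\<beta> s t\<close> is the ratio of \<open>f s t\<close> to \<open>f t s\<close>,
  and since \<open>S\<close> is commutative \<open>eps_f\<close> changes both by the same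
  factors.\<close>

lemma beta_conj:
  assumes "\<gamma> \<in> \<Gamma>" "s \<in> S" "t \<in> S"
  shows "\<beta> (conjg G (fst \<gamma>) s) (conjg G (fst \<gamma>) t) = \<beta> s t"
proof -
  let ?s = "conjg G (fst \<gamma>) s" and ?t = "conjg G (fst \<gamma>) t"
  have S: "?s \<in> S" "?t \<in> S" using assms conj_Gamma_S by auto
  have "f s t * \<epsilon> \<gamma> (s \<otimes> t) = \<epsilon> \<gamma> s * \<epsilon> \<gamma> t * f ?s ?t" by (rule eps_f[OF assms])
  moreover have "f t s * \<epsilon> \<gamma> (s \<otimes> t) = \<epsilon> \<gamma> s * \<epsilon> \<gamma> t * f ?t ?s"
    using eps_f[OF assms(1,3,2)] S_comm[OF assms(2,3)] by (simp add: mult_ac)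
  moreover have "f s t = \<beta> s t * f t s" "f ?s ?t = \<beta> ?s ?t * f ?t ?s"
    using beta_f[OF assms(2,3)] beta_f[OF S] by auto
  ultimately have "\<beta> ?s ?t * (f t s * \<epsilon> \<gamma> (s \<otimes> t)) = \<epsilon> \<gamma> s * \<epsilon> \<gamma> t * f ?s ?t" by (simp only: mult_ac)
  also have "\<dots> = f s t * \<epsilon> \<gamma> (s \<otimes> t)" by (rule eps_f[OF assms, symmetric])
  also have "\<dots> = \<beta> s t * (f t s * \<epsilon> \<gamma> (s \<otimes> t))" using beta_f[OF assms(2,3)] by (simp only: mult_ac)
  finally show ?thesis
    using f_nz[OF assms(3,2)] eps_nz[OF assms(1) mult_S[OF assms(2,3)]] by simp
qed

text \<open>A maximal isotropic subgroup \<open>L\<close> is its own orthogonal complement, whose order is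
  \<open>card S / card L\<close> by orthogonality of characters.\<close>

lemma card_S_square: "\<exists>m. card S = m\<^sup>2"
proof -
  define iso where "iso L \<longleftrightarrow> subgroup L G \<and> L \<subseteq> S \<and> (\<forall>a\<in>L. \<forall>b\<in>L. \<beta> a b = 1)" for L
  have fin: "finite {L. iso L}" by (rule finite_subset[OF _ finite_Pow_iff[THEN iffD2, OF finite_S]]) (auto simp: iso_def)
  have ne: "{\<one>} \<in> {L. iso L}"
    using G.triv_subgroup beta_same[OF one_S] by (simp add: iso_def)
  obtain L where L: "iso L" and max: "\<And>L'. iso L' \<Longrightarrow> L \<subseteq> L' \<Longrightarrow> L' = L"
    using finite_has_maximal[OF fin] ne by (metis (mono_tags) empty_iff mem_Collect_eq)
  have Lsub: "subgroup L G" "L \<subseteq> S" and Liso: "\<And>a b. \<lbrakk>a \<in> L; b \<in> L\<rbrakk> \<Longrightarrow> \<beta> a b = 1"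
    using L by (auto simp: iso_def)
  have bm: "\<beta> (a \<otimes> b) c = \<beta> a c * \<beta> b c" "\<beta> a (b \<otimes> c) = \<beta> a b * \<beta> a c"
    if "a \<in> S" "b \<in> S" "c \<in> S" for a b c
    using char_onD(2)[OF char_beta'] char_onD(2)[OF char_beta] that by auto
  \<comment> \<open>An element orthogonal to \<open>L\<close> generates together with
    \<open>L\<close> an isotropic subgroup, because \<open>\<beta>\<close> is alternating;
    maximality puts it in \<open>L\<close>.\<close>
  have perp: "a \<in> L" if a: "a \<in> S" "\<And>l. l \<in> L \<Longrightarrow> \<beta> a l = 1" for a
  proof -
    define L' where "L' = {x \<in> S. \<exists>l\<in>L. \<exists>i::nat. x = l \<otimes> a [^] i}"
    have aS: "a [^] i \<in> S" for i :: nat by (induction i) (use a in auto)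
    have aL: "\<beta> (a [^] i) l = 1" if "l \<in> L" for i :: nat and l
      using that a aS Lsub(2) by (induction i) (auto simp: bm subset_iff intro: G.char_one[OF subgroup_S char_beta'])
    have aa: "\<beta> (a [^] i) (a [^] j) = 1" for i j :: nat
    proof -
      have "\<beta> a (a [^] j) = 1" by (induction j) (use a(1) aS beta_same in \<open>auto simp: bm intro: G.char_one[OF subgroup_S char_beta]\<close>)
      then show ?thesis using a(1) aS by (induction i) (auto simp: bm intro: G.char_one[OF subgroup_S char_beta'])
    qed
    have la: "\<beta> l (a [^] i) = 1" if "l \<in> L" for i :: nat and l
      using beta_alt[OF aS[of i], of l] aL[OF that, of i] that Lsub(2) by auto
    have mem: "l \<otimes> a [^] i \<in> L'" if "l \<in> L" for l and i :: nat
      using that aS Lsub(2) by (auto simp: L'_def)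
    have "subgroup L' G"
    proof (rule G.finite_subgroupI)
      show "L' \<subseteq> carrier G" by (auto simp: L'_def S_carrier)
      show "L' \<noteq> {}" using mem[OF subgroup.one_closed[OF Lsub(1)], of 0] by blast
      show "finite L'" using finite_S by (simp add: L'_def)
      fix x y assume "x \<in> L'" "y \<in> L'"
      then obtain l l' i j where *: "l \<in> L" "l' \<in> L" "x = l \<otimes> a [^] (i::nat)" "y = l' \<otimes> a [^] (j::nat)"
        by (auto simp: L'_def)
      have S: "l \<in> S" "l' \<in> S" using * Lsub by auto
      have "x \<otimes> y = l \<otimes> (a [^] i \<otimes> l') \<otimes> a [^] j" using * S aS S_carrier a by (simp add: G.m_assoc)
      also have "a [^] i \<otimes> l' = l' \<otimes> a [^] i" by (rule S_comm) (use S aS in auto)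
      also have "l \<otimes> (l' \<otimes> a [^] i) \<otimes> a [^] j = (l \<otimes> l') \<otimes> a [^] (i + j)"
        using S aS S_carrier a by (simp add: G.m_assoc G.nat_pow_mult)
      finally show "x \<otimes> y \<in> L'" using mem[OF subgroup.m_closed[OF Lsub(1) *(1,2)]] by simp
    qed
    moreover have "\<beta> x y = 1" if xy: "x \<in> L'" "y \<in> L'" for x y
    proof -
      obtain l l' i j where *: "l \<in> L" "l' \<in> L" "x = l \<otimes> a [^] (i::nat)" "y = l' \<otimes> a [^] (j::nat)"
        using xy by (auto simp: L'_def)
      have S: "l \<in> S" "l' \<in> S" using * Lsub by auto
      show ?thesis using * S aS by (simp add: bm mult_S Liso aL la aa)
    qed
    ultimately have "iso L'" by (auto simp: iso_def L'_def)
    moreover have "L \<subseteq> L'"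
    proof
      fix x assume "x \<in> L"
      then show "x \<in> L'" using mem[of x 0] Lsub S_carrier by (simp add: subset_iff)
    qed
    ultimately have "L' = L" by (rule max)
    moreover have "a \<in> L'" using mem[OF subgroup.one_closed[OF Lsub(1)], of 1] a S_carrier by simp
    ultimately show "a \<in> L" by simp
  qed
  have "(\<Sum>l\<in>L. \<Sum>a\<in>S. \<beta> a l) = (\<Sum>l\<in>L. if l = \<one> then of_nat (card S) else 0)"
  proof (rule sum.cong)
    fix l assume l: "l \<in> L"
    have "(\<forall>a\<in>S. \<beta> a l = 1) \<longleftrightarrow> l = \<one>"
      using beta_nondeg'[of l] G.char_one[OF subgroup_S char_beta] l Lsub by auto
    then show "(\<Sum>a\<in>S. \<beta> a l) = (if l = \<one> then of_nat (card S) else 0)"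
      using G.sum_char[OF subgroup_S char_beta'[of l]] l Lsub by (simp add: subset_iff)
  qed simp
  also have "\<dots> = of_nat (card S)"
    using subgroup.one_closed[OF Lsub(1)] finite_subset[OF Lsub(2) finite_S] by (simp add: sum.delta)
  finally have 1: "(\<Sum>l\<in>L. \<Sum>a\<in>S. \<beta> a l) = of_nat (card S)" .
  have "(\<Sum>l\<in>L. \<Sum>a\<in>S. \<beta> a l) = (\<Sum>a\<in>S. \<Sum>l\<in>L. \<beta> a l)" by (rule sum.swap)
  also have "\<dots> = (\<Sum>a\<in>S. if a \<in> L then of_nat (card L) else 0)"
  proof (rule sum.cong)
    fix a assume a: "a \<in> S"
    have "char_on G L (\<beta> a)" using char_beta[OF a] Lsub(2) by (auto simp: char_on_def subset_iff)
    moreover have "(\<forall>l\<in>L. \<beta> a l = 1) \<longleftrightarrow> a \<in> L" using perp[OF a] Liso by blast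
    ultimately show "(\<Sum>l\<in>L. \<beta> a l) = (if a \<in> L then of_nat (card L) else 0)"
      using G.sum_char[OF Lsub(1)] by simp
  qed simp
  also have "\<dots> = of_nat (card L * card L)"
    using finite_S Lsub by (simp add: sum.If_cases Int_absorb1)
  finally have "of_nat (card S) = (of_nat (card L * card L) :: complex)" using 1 by simp
  then have "card S = card L * card L" using of_nat_eq_iff by blast
  then show ?thesis by (auto simp: power2_eq_square)
qed

section \<open>Complements of \<open>T\<close> in \<open>\<Gamma>\<close>\<close>

lemma card_eq: "card (carrier G) = card (carrier H)"
proof -
  have "card (carrier G) * card S = card \<Gamma>" using card_Gamma(1) card_T by simp
  also have "\<dots> = card (carrier H) * card S" using card_Gamma(2) by (simp add: kernel_fst)
  finally have "card (carrier G) * card S = card (carrier H) * card S" .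
  moreover have "card S > 0" using finite_S one_S card_gt_0_iff[of S] by auto
  ultimately show ?thesis by simp
qed

text \<open>\<open>\<Gamma>'\<close> is a graph: \<open>ex\<close> provides a partner for every
  element of \<open>G\<close>, \<open>snd_trivial\<close> makes it unique,
  \<open>fst_trivial\<close> makes the resulting homomorphism injective, and \<open>card_eq\<close>
  makes it onto.\<close>

lemma iso_of_complement:
  assumes sub: "\<Gamma>' \<subseteq> \<Gamma>"
    and closed: "\<And>\<gamma> \<delta>. \<lbrakk>\<gamma> \<in> \<Gamma>'; \<delta> \<in> \<Gamma>'\<rbrakk> \<Longrightarrow> \<gamma> \<otimes>\<^bsub>G \<times>\<times> H\<^esub> \<delta> \<in> \<Gamma>'"
    and fst_trivial: "\<And>g. (g, \<one>\<^bsub>H\<^esub>) \<in> \<Gamma>' \<Longrightarrow> g = \<one>"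
    and snd_trivial: "\<And>h. (\<one>, h) \<in> \<Gamma>' \<Longrightarrow> h = \<one>\<^bsub>H\<^esub>"
    and ex: "\<And>\<gamma>. \<gamma> \<in> \<Gamma> \<Longrightarrow> \<exists>t\<in>T. \<gamma> \<otimes>\<^bsub>G \<times>\<times> H\<^esub> (\<one>, t) \<in> \<Gamma>'"
  shows "H \<cong> G"
proof -
  have car: "g \<in> carrier G \<and> h \<in> carrier H" if "(g, h) \<in> \<Gamma>'" for g h
    using Gamma_carrier[of "(g, h)"] sub that by auto
  have subgroup: "subgroup \<Gamma>' (G \<times>\<times> H)"
  proof (rule P.finite_subgroupI)
    show "\<Gamma>' \<subseteq> carrier (G \<times>\<times> H)" using car by auto
    show "\<Gamma>' \<noteq> {}" using ex[OF S_Gamma[OF one_S]] by blast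
    show "finite \<Gamma>'"
      by (rule finite_subset[of _ "carrier G \<times> carrier H"]) (use car finG finH in auto)
  qed (rule closed)
  have "\<exists>h. (g, h) \<in> \<Gamma>'" if g: "g \<in> carrier G" for g
  proof -
    obtain h where h: "(g, h) \<in> \<Gamma>" using Gamma_fst[OF g] by blast
    then show ?thesis using ex[OF h] g by auto
  qed
  then obtain \<theta> where \<theta>: "\<And>g. g \<in> carrier G \<Longrightarrow> (g, \<theta> g) \<in> \<Gamma>'" by metis
  have uniq: "h = h'" if gh: "(g, h) \<in> \<Gamma>'" "(g, h') \<in> \<Gamma>'" for g h h'
  proof -
    have "inv\<^bsub>G \<times>\<times> H\<^esub> (g, h) \<in> \<Gamma>'" using subgroup.m_inv_closed[OF subgroup gh(1)] .
    then have "(inv g, inv\<^bsub>H\<^esub> h) \<in> \<Gamma>'" using car[OF gh(1)] G.is_group H.is_group by simp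
    from closed[OF this gh(2)] have "inv\<^bsub>H\<^esub> h \<otimes>\<^bsub>H\<^esub> h' = \<one>\<^bsub>H\<^esub>"
      using car[OF gh(1)] by (intro snd_trivial) simp
    then have "h \<otimes>\<^bsub>H\<^esub> (inv\<^bsub>H\<^esub> h \<otimes>\<^bsub>H\<^esub> h') = h" using car[OF gh(1)] by simp
    then show ?thesis using car[OF gh(1)] car[OF gh(2)] by (simp flip: H.m_assoc)
  qed
  have \<theta>car: "\<theta> g \<in> carrier H" if "g \<in> carrier G" for g using car[OF \<theta>[OF that]] by blast
  have hom: "\<theta> (g \<otimes> g') = \<theta> g \<otimes>\<^bsub>H\<^esub> \<theta> g'" if "g \<in> carrier G" "g' \<in> carrier G" for g g'
    using closed[OF \<theta> \<theta>, OF that] uniq[OF \<theta>] that by simp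
  have \<theta>hom: "\<theta> \<in> hom G H" using \<theta>car hom by (intro homI)
  interpret group_hom G H \<theta> by unfold_locales (rule \<theta>hom)
  have "kernel G H \<theta> \<subseteq> {\<one>}"
  proof
    fix g assume "g \<in> kernel G H \<theta>"
    then have "(g, \<one>\<^bsub>H\<^esub>) \<in> \<Gamma>'" using \<theta>[of g] by (simp add: kernel_def)
    then show "g \<in> {\<one>}" using fst_trivial by blast
  qed
  moreover have "\<one> \<in> kernel G H \<theta>" by (simp add: kernel_def)
  ultimately have "kernel G H \<theta> = {\<one>}" by blast
  then have inj: "inj_on \<theta> (carrier G)" by (rule trivial_ker_imp_inj)
  have "\<theta> ` carrier G = carrier H"
    using \<theta>car card_image[OF inj] card_eq by (intro card_subset_eq[OF finH]) auto
  then have "\<theta> \<in> iso G H" using inj \<theta>hom by (simp add: iso_def bij_betw_def)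
  then show ?thesis using G.iso_sym is_isoI by blast
qed

text \<open>An element of \<open>\<Gamma>\<close> with one trivial component lies in
  \<open>S\<close> or in \<open>T\<close>; there it fixes \<open>S\<close> pointwise and its
  \<open>\<epsilon>\<close> is \<open>\<beta> g\<close> or \<open>\<chi> h\<close>. Faithfulness of
  both pairings reduces two conditions of \<open>iso_of_complement\<close> to one.\<close>

lemma eps_trivial:
  assumes "\<Gamma>' \<subseteq> \<Gamma>"
    and triv: "\<And>\<gamma> s. \<lbrakk>\<gamma> \<in> \<Gamma>'; \<And>s. s \<in> S \<Longrightarrow> conjg G (fst \<gamma>) s = s; char_on G S (\<epsilon> \<gamma>); s \<in> S\<rbrakk> \<Longrightarrow> \<epsilon> \<gamma> s = 1"
  shows "(g, \<one>\<^bsub>H\<^esub>) \<in> \<Gamma>' \<Longrightarrow> g = \<one>" "(\<one>, h) \<in> \<Gamma>' \<Longrightarrow> h = \<one>\<^bsub>H\<^esub>"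
proof -
  assume g: "(g, \<one>\<^bsub>H\<^esub>) \<in> \<Gamma>'"
  then have gS: "g \<in> S" using assms(1) kernel_fst by blast
  show "g = \<one>"
    by (rule beta_nondeg[OF gS]) (use triv[OF g] char_beta[OF gS] gS in \<open>auto simp: \<beta>_def\<close>)
next
  assume h: "(\<one>, h) \<in> \<Gamma>'"
  then have hT: "h \<in> T" using assms(1) by (auto simp: T_def)
  show "h = \<one>\<^bsub>H\<^esub>"
    by (rule chi_faithful[OF hT]) (use triv[OF h] char_chi[OF hT] S_carrier in \<open>auto simp: \<chi>_def\<close>)
qed

text \<open>Elements of \<open>T\<close> do not move \<open>S\<close>, so multiplying by them
  changes \<open>\<epsilon> \<gamma>\<close> by a character alone, and by \<open>char_surj\<close>
  this can be any prescribed one.\<close>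

lemma eps_T:
  assumes "\<gamma> \<in> \<Gamma>" "t \<in> T"
  shows "\<gamma> \<otimes>\<^bsub>G \<times>\<times> H\<^esub> (\<one>, t) \<in> \<Gamma>" "fst (\<gamma> \<otimes>\<^bsub>G \<times>\<times> H\<^esub> (\<one>, t)) = fst \<gamma>"
    "s \<in> S \<Longrightarrow> \<epsilon> (\<gamma> \<otimes>\<^bsub>G \<times>\<times> H\<^esub> (\<one>, t)) s = \<epsilon> \<gamma> s * \<chi> t s"
proof -
  show "\<gamma> \<otimes>\<^bsub>G \<times>\<times> H\<^esub> (\<one>, t) \<in> \<Gamma>" by (rule Gamma_mult[OF assms(1) T_Gamma[OF assms(2)]])
  show "fst (\<gamma> \<otimes>\<^bsub>G \<times>\<times> H\<^esub> (\<one>, t)) = fst \<gamma>" using Gamma_carrier[OF assms(1)] by (simp add: mult_DirProd')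
  show "\<epsilon> (\<gamma> \<otimes>\<^bsub>G \<times>\<times> H\<^esub> (\<one>, t)) s = \<epsilon> \<gamma> s * \<chi> t s" if "s \<in> S"
    using eps_mult[OF assms(1) T_Gamma[OF assms(2)] that] S_carrier[OF that] by (simp add: \<chi>_def)
qed

text \<open>Equal actions give the same values of \<open>f\<close> in \<open>eps_f\<close> for
  \<open>\<gamma>\<close> and \<open>\<delta>\<close>, so they cancel in the ratio. By
  \<open>char_surj\<close> an element of \<open>T\<close> can then make the two factors
  agree.\<close>

lemma eps_ratio_char:
  assumes "\<gamma> \<in> \<Gamma>" "\<delta> \<in> \<Gamma>" "\<And>s. s \<in> S \<Longrightarrow> conjg G (fst \<gamma>) s = conjg G (fst \<delta>) s"
  shows "char_on G S (\<lambda>s. \<epsilon> \<gamma> s / \<epsilon> \<delta> s)"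
proof (rule char_onI)
  fix s t assume st: "s \<in> S" "t \<in> S"
  let ?f = "f (conjg G (fst \<delta>) s) (conjg G (fst \<delta>) t)"
  have nz: "?f \<noteq> 0" "f s t \<noteq> 0" "\<epsilon> \<delta> s \<noteq> 0" "\<epsilon> \<delta> t \<noteq> 0" "\<epsilon> \<gamma> s \<noteq> 0" "\<epsilon> \<gamma> t \<noteq> 0"
    using st assms f_nz conj_Gamma_S eps_nz by auto
  have "\<epsilon> \<gamma> (s \<otimes> t) = \<epsilon> \<gamma> s * \<epsilon> \<gamma> t * ?f / f s t" "\<epsilon> \<delta> (s \<otimes> t) = \<epsilon> \<delta> s * \<epsilon> \<delta> t * ?f / f s t"
    using eps_f[OF assms(1) st] eps_f[OF assms(2) st] assms(3) st nz by (simp_all add: field_simps)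
  then show "\<epsilon> \<gamma> (s \<otimes> t) / \<epsilon> \<delta> (s \<otimes> t) = \<epsilon> \<gamma> s / \<epsilon> \<delta> s * (\<epsilon> \<gamma> t / \<epsilon> \<delta> t)"
    using nz by simp
qed (use assms eps_nz in auto)

lemma P_pow_Gamma: "\<gamma> \<in> \<Gamma> \<Longrightarrow> \<gamma> [^]\<^bsub>G \<times>\<times> H\<^esub> (k::nat) \<in> \<Gamma>"
  by (induction k) (use subgroup.one_closed[OF subgroup_Gamma] Gamma_mult in auto)

lemma fst_P_pow: "\<gamma> \<in> \<Gamma> \<Longrightarrow> fst (\<gamma> [^]\<^bsub>G \<times>\<times> H\<^esub> (k::nat)) = fst \<gamma> [^] k"
  by (induction k) (auto simp: mult_DirProd')

lemma norm_prod_S: "\<lbrakk>g \<in> carrier G; s \<in> S\<rbrakk> \<Longrightarrow> norm_prod G g k s \<in> S"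
  by (induction k arbitrary: s) (auto intro: conj_S)

lemma norm_prod_mult:
  "\<lbrakk>g \<in> carrier G; s \<in> S; t \<in> S\<rbrakk> \<Longrightarrow> norm_prod G g k (s \<otimes> t) = norm_prod G g k s \<otimes> norm_prod G g k t"
proof (induction k arbitrary: s t)
  case (Suc k)
  let ?s = "norm_prod G g k (conjg G g s)" and ?t = "norm_prod G g k (conjg G g t)"
  have S: "?s \<in> S" "?t \<in> S" using Suc.prems norm_prod_S conj_S by auto
  have "norm_prod G g (Suc k) (s \<otimes> t) = (?s \<otimes> ?t) \<otimes> (s \<otimes> t)"
    using Suc conj_S by (simp add: G.conj_mult S_carrier)
  also have "\<dots> = ?s \<otimes> (?t \<otimes> s) \<otimes> t" using S Suc.prems by (simp add: S_carrier G.m_assoc)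
  also have "?t \<otimes> s = s \<otimes> ?t" using S Suc.prems by (intro S_comm)
  also have "?s \<otimes> (s \<otimes> ?t) \<otimes> t = (?s \<otimes> s) \<otimes> (?t \<otimes> t)" using S Suc.prems by (simp add: S_carrier G.m_assoc)
  finally show ?case by simp
qed simp

text \<open>The powers pick up \<open>\<chi> t\<close> at \<open>s\<close> and at its successive
  conjugates, whose product is \<open>norm_prod\<close>.\<close>

lemma eps_pow_T:
  assumes "\<gamma> \<in> \<Gamma>" "t \<in> T" "s \<in> S"
  shows "\<epsilon> ((\<gamma> \<otimes>\<^bsub>G \<times>\<times> H\<^esub> (\<one>, t)) [^]\<^bsub>G \<times>\<times> H\<^esub> (k::nat)) s =
    \<epsilon> (\<gamma> [^]\<^bsub>G \<times>\<times> H\<^esub> k) s * \<chi> t (norm_prod G (fst \<gamma>) k s)"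
  using assms(3)
proof (induction k arbitrary: s)
  case 0
  then show ?case using G.char_one[OF subgroup_S char_chi[OF assms(2)]] by simp
next
  case (Suc k)
  let ?\<gamma> = "\<gamma> \<otimes>\<^bsub>G \<times>\<times> H\<^esub> (\<one>, t)" and ?s = "conjg G (fst \<gamma>) s"
  note T = eps_T[OF assms(1,2)]
  have s: "?s \<in> S" using conj_Gamma_S[OF assms(1) Suc.prems] .
  then have N: "norm_prod G (fst \<gamma>) k ?s \<in> S" using norm_prod_S Gamma_carrier[OF assms(1)] by blast
  have "\<epsilon> (?\<gamma> [^]\<^bsub>G \<times>\<times> H\<^esub> Suc k) s = \<epsilon> (?\<gamma> [^]\<^bsub>G \<times>\<times> H\<^esub> k) ?s * \<epsilon> ?\<gamma> s"
    using eps_mult[OF P_pow_Gamma[OF T(1)] T(1) Suc.prems] T(2) by simp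
  also have "\<dots> = (\<epsilon> (\<gamma> [^]\<^bsub>G \<times>\<times> H\<^esub> k) ?s * \<epsilon> \<gamma> s) * (\<chi> t (norm_prod G (fst \<gamma>) k ?s) * \<chi> t s)"
    using Suc.IH[OF s] T(3)[OF Suc.prems] by simp
  also have "\<epsilon> (\<gamma> [^]\<^bsub>G \<times>\<times> H\<^esub> k) ?s * \<epsilon> \<gamma> s = \<epsilon> (\<gamma> [^]\<^bsub>G \<times>\<times> H\<^esub> Suc k) s"
    using eps_mult[OF P_pow_Gamma[OF assms(1)] assms(1) Suc.prems] by simp
  also have "\<chi> t (norm_prod G (fst \<gamma>) k ?s) * \<chi> t s = \<chi> t (norm_prod G (fst \<gamma>) (Suc k) s)"
    using char_onD(2)[OF char_chi[OF assms(2)] N Suc.prems] by simp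
  finally show ?case .
qed

text \<open>The character \<open>\<psi>\<close> below is trivial on the kernel of the norm map, hence is the pullback along
  the norm map of some \<open>\<beta> a\<close>; the number of such \<open>a\<close> is computed by orthogonality.\<close>

lemma norm_solve:
  assumes \<gamma>: "\<gamma> \<in> \<Gamma>" "k > 0" "\<And>s. s \<in> S \<Longrightarrow> conjg G (fst \<gamma> [^] k) s = s"
  obtains a where "a \<in> S" "\<And>s. s \<in> S \<Longrightarrow> \<beta> a (norm_prod G (fst \<gamma>) k s) = \<epsilon> (\<gamma> [^]\<^bsub>G \<times>\<times> H\<^esub> k) s"
proof -
  define N where "N = norm_prod G (fst \<gamma>) k"
  define \<psi> where "\<psi> = \<epsilon> (\<gamma> [^]\<^bsub>G \<times>\<times> H\<^esub> k)"
  have g: "fst \<gamma> \<in> carrier G" using Gamma_carrier \<gamma> by blast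
  have \<psi>: "char_on G S \<psi>"
    unfolding \<psi>_def by (rule eps_char) (use P_pow_Gamma fst_P_pow \<gamma> in auto)
  have NS: "N s \<in> S" if "s \<in> S" for s unfolding N_def using norm_prod_S g that .
  have \<psi>1: "\<psi> s = 1" if "s \<in> S" "N s = \<one>" for s
    unfolding \<psi>_def by (rule eps_norm) (use that \<gamma> in \<open>auto simp: N_def\<close>)
  have charN: "char_on G S (\<lambda>s. \<beta> a (N s))" if a: "a \<in> S" for a
    using char_onD[OF char_beta[OF a]] NS norm_prod_mult[OF g, of _ _ k]
    by (intro char_onI) (auto simp: N_def)
  have "(\<Sum>a\<in>S. \<Sum>s\<in>S. \<beta> a (N s) / \<psi> s) = (\<Sum>s\<in>S. \<Sum>a\<in>S. \<beta> a (N s) / \<psi> s)" by (rule sum.swap)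
  also have "\<dots> = (\<Sum>s\<in>S. if N s = \<one> then of_nat (card S) else 0)"
  proof (rule sum.cong)
    fix s assume s: "s \<in> S"
    have "(\<forall>a\<in>S. \<beta> a (N s) = 1) \<longleftrightarrow> N s = \<one>"
      using beta_nondeg'[OF NS[OF s]] G.char_one[OF subgroup_S char_beta] by metis
    then have "(\<Sum>a\<in>S. \<beta> a (N s)) = (if N s = \<one> then of_nat (card S) else 0)"
      using G.sum_char[OF subgroup_S char_beta'[OF NS[OF s]]] by simp
    then show "(\<Sum>a\<in>S. \<beta> a (N s) / \<psi> s) = (if N s = \<one> then of_nat (card S) else 0)"
      using \<psi>1[OF s] by (simp flip: sum_divide_distrib)
  qed simp
  also have "\<dots> = of_nat (card {s \<in> S. N s = \<one>} * card S)"
    using finite_S by (simp add: sum.If_cases Int_def)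
  also have "\<dots> \<noteq> 0"
  proof -
    have "N \<one> = \<one>" unfolding N_def using g by (induction k) auto
    then have "\<one> \<in> {s \<in> S. N s = \<one>}" by simp
    then have "{s \<in> S. N s = \<one>} \<noteq> {}" "S \<noteq> {}" by blast+
    then have "card {s \<in> S. N s = \<one>} \<noteq> 0" "card S \<noteq> 0" using finite_S by simp_all
    then show ?thesis by simp
  qed
  finally obtain a where a: "a \<in> S" "(\<Sum>s\<in>S. \<beta> a (N s) / \<psi> s) \<noteq> 0"
    by (meson sum.neutral)
  then have "\<forall>s\<in>S. \<beta> a (N s) / \<psi> s = 1"
    using G.sum_char[OF subgroup_S char_on_divide[OF charN[OF a(1)] \<psi>]] by metis
  then show ?thesis using that[OF a(1)] char_onD(1)[OF \<psi>] by (auto simp: N_def \<psi>_def)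
qed

text \<open>Let \<open>k\<close> be the order of the action of \<open>\<gamma>0\<close> on
  \<open>S\<close>. The extension splits once \<open>\<epsilon>\<close> of the \<open>k\<close>-th
  power is trivial. \<open>norm_solve\<close> writes it as a pullback along the norm map, and
  multiplying \<open>\<gamma>0\<close> by a suitable \<open>t\<close> in \<open>T\<close> cancels
  this by \<open>eps_pow_T\<close>.\<close>

lemma iso_of_cyclic:
  assumes \<gamma>0: "\<gamma>0 \<in> \<Gamma>"
    and cyc: "\<And>g. g \<in> carrier G \<Longrightarrow> \<exists>i::nat. \<forall>s\<in>S. conjg G g s = conjg G (fst \<gamma>0 [^] i) s"
  shows "H \<cong> G"
proof -
  define x where "x = fst \<gamma>0"
  have x: "x \<in> carrier G" using \<gamma>0 Gamma_carrier by (auto simp: x_def)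
  have add: "conjg G (x [^] (i + j)) s = conjg G (x [^] i) (conjg G (x [^] j) s)" if "s \<in> S" for i j :: nat and s
    using that x by (simp add: G.conj_mult_left[symmetric] S_carrier G.nat_pow_mult)
  have xS: "conjg G (x [^] i) s \<in> S" if "s \<in> S" for i :: nat and s
    using that x conj_S by simp
  define triv where "triv i \<longleftrightarrow> (\<forall>s\<in>S. conjg G (x [^] i) s = s)" for i :: nat
  \<comment> \<open>The order of the automorphism of \<open>S\<close> induced by \<open>x\<close>,
    which can be smaller than the order of \<open>x\<close>.\<close>
  define k where "k = (LEAST k. k > 0 \<and> triv k)"
  have "order G > 0 \<and> triv (order G)"
    using finG x G.order_gt_0_iff_finite by (auto simp: triv_def G.pow_order_eq_1 S_carrier)
  then have k: "k > 0" "triv k" unfolding k_def by (metis (mono_tags, lifting) LeastI)+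
  have kmin: "\<not> triv j" if "0 < j" "j < k" for j
    using not_less_Least[of j "\<lambda>k. k > 0 \<and> triv k"] that by (auto simp: k_def)
  have mult: "triv (k * q)" for q
    by (induction q) (use k(2) x in \<open>auto simp: triv_def add S_carrier xS\<close>)
  have dvd: "k dvd i" if "triv i" for i
  proof -
    have "conjg G (x [^] (i mod k)) s = s" if s: "s \<in> S" for s
    proof -
      have "conjg G (x [^] (k * q + r)) s = conjg G (x [^] r) s" for q r
        using mult[of q] s xS by (simp add: add triv_def)
      from this[of "i div k" "i mod k"] show ?thesis using \<open>triv i\<close> s by (simp add: triv_def)
    qed
    then have "triv (i mod k)" by (simp add: triv_def)
    then show ?thesis using kmin[of "i mod k"] k(1) by (auto simp: dvd_eq_mod_eq_0)
  qed
  obtain a where a: "a \<in> S"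
    "\<And>s. s \<in> S \<Longrightarrow> \<beta> a (norm_prod G x k s) = \<epsilon> (\<gamma>0 [^]\<^bsub>G \<times>\<times> H\<^esub> k) s"
    using norm_solve[OF \<gamma>0 k(1)] k(2) unfolding triv_def x_def by blast
  have "char_on G S (\<lambda>s. 1 / \<beta> a s)" using char_beta[OF a(1)] by (auto simp: char_on_def)
  then obtain t where t: "t \<in> T" "\<And>s. s \<in> S \<Longrightarrow> \<chi> t s = 1 / \<beta> a s" using char_surj by blast
  define \<gamma>1 where "\<gamma>1 = \<gamma>0 \<otimes>\<^bsub>G \<times>\<times> H\<^esub> (\<one>, t)"
  have \<gamma>1: "\<gamma>1 \<in> \<Gamma>" "fst \<gamma>1 = x" unfolding \<gamma>1_def x_def using eps_T[OF \<gamma>0 t(1)] by auto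
  have \<gamma>1k: "\<epsilon> (\<gamma>1 [^]\<^bsub>G \<times>\<times> H\<^esub> k) s = 1" if s: "s \<in> S" for s
  proof -
    have N: "norm_prod G x k s \<in> S" using norm_prod_S x s .
    then have "\<epsilon> (\<gamma>1 [^]\<^bsub>G \<times>\<times> H\<^esub> k) s = \<beta> a (norm_prod G x k s) * (1 / \<beta> a (norm_prod G x k s))"
      using eps_pow_T[OF \<gamma>0 t(1) s, of k] a(2)[OF s] t(2)[OF N] by (simp add: \<gamma>1_def x_def)
    then show ?thesis using char_onD(1)[OF char_beta[OF a(1)] N] by simp
  qed
  have \<gamma>1pow: "\<gamma>1 [^]\<^bsub>G \<times>\<times> H\<^esub> (i::nat) \<in> \<Gamma>" "fst (\<gamma>1 [^]\<^bsub>G \<times>\<times> H\<^esub> i) = x [^] i" for i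
    using P_pow_Gamma[OF \<gamma>1(1)] fst_P_pow[OF \<gamma>1(1)] \<gamma>1(2) by auto
  have \<gamma>1car: "\<gamma>1 \<in> carrier (G \<times>\<times> H)" using \<gamma>1(1) subgroup.subset[OF subgroup_Gamma] by blast
  have \<gamma>1add: "\<epsilon> (\<gamma>1 [^]\<^bsub>G \<times>\<times> H\<^esub> (i + j)) s =
      \<epsilon> (\<gamma>1 [^]\<^bsub>G \<times>\<times> H\<^esub> i) (conjg G (x [^] j) s) * \<epsilon> (\<gamma>1 [^]\<^bsub>G \<times>\<times> H\<^esub> j) s" if "s \<in> S" for i j :: nat and s
    using eps_mult[OF \<gamma>1pow(1)[of i] \<gamma>1pow(1)[of j] that] P.nat_pow_mult[OF \<gamma>1car, of i j] \<gamma>1pow(2)[of j] by simp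
  have e0: "\<epsilon> (\<gamma>1 [^]\<^bsub>G \<times>\<times> H\<^esub> (0::nat)) s = 1" if "s \<in> S" for s
    using \<gamma>1add[OF that, of k 0] \<gamma>1k[OF that] that by (simp add: S_carrier)
  have \<gamma>1kq: "\<epsilon> (\<gamma>1 [^]\<^bsub>G \<times>\<times> H\<^esub> (k * q)) s = 1" if s: "s \<in> S" for q s
  proof (induction q)
    case (Suc q)
    have "conjg G (x [^] (k * q)) s = s" using mult[of q] s by (simp add: triv_def)
    then show ?case using \<gamma>1add[OF s, of k "k * q"] Suc \<gamma>1k[OF s] by simp
  qed (use e0[OF s] in simp)
  \<comment> \<open>Membership compares only what is visible on \<open>S\<close>, so elements of
    \<open>\<Gamma>\<close> are matched with powers of \<open>\<gamma>1\<close> without having to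
    equal them.\<close>
  define \<Gamma>' where "\<Gamma>' = {\<gamma> \<in> \<Gamma>. \<exists>i::nat. \<forall>s\<in>S. conjg G (fst \<gamma>) s = conjg G (x [^] i) s \<and>
      \<epsilon> \<gamma> s = \<epsilon> (\<gamma>1 [^]\<^bsub>G \<times>\<times> H\<^esub> i) s}"
  have sub: "\<Gamma>' \<subseteq> \<Gamma>" by (auto simp: \<Gamma>'_def)
  have triv: "\<epsilon> \<gamma> s = 1" if \<gamma>: "\<gamma> \<in> \<Gamma>'" "\<And>s. s \<in> S \<Longrightarrow> conjg G (fst \<gamma>) s = s" and s: "s \<in> S" for \<gamma> s
  proof -
    obtain i :: nat where i: "\<And>s. s \<in> S \<Longrightarrow> conjg G (fst \<gamma>) s = conjg G (x [^] i) s \<and>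
        \<epsilon> \<gamma> s = \<epsilon> (\<gamma>1 [^]\<^bsub>G \<times>\<times> H\<^esub> i) s"
      using \<gamma>(1) by (auto simp: \<Gamma>'_def)
    then have "triv i" using \<gamma>(2) by (auto simp: triv_def)
    then obtain q where "i = k * q" using dvd by blast
    then show ?thesis using i[OF s] \<gamma>1kq[OF s] by simp
  qed
  show ?thesis
  proof (rule iso_of_complement[OF sub])
    show "g = \<one>" if "(g, \<one>\<^bsub>H\<^esub>) \<in> \<Gamma>'" for g using eps_trivial(1)[OF sub _ that] triv by blast
    show "h = \<one>\<^bsub>H\<^esub>" if "(\<one>, h) \<in> \<Gamma>'" for h using eps_trivial(2)[OF sub _ that] triv by blast
  next
    fix \<gamma> \<delta> assume \<gamma>\<delta>: "\<gamma> \<in> \<Gamma>'" "\<delta> \<in> \<Gamma>'"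
    obtain i j :: nat where
      i: "\<And>s. s \<in> S \<Longrightarrow> conjg G (fst \<gamma>) s = conjg G (x [^] i) s \<and> \<epsilon> \<gamma> s = \<epsilon> (\<gamma>1 [^]\<^bsub>G \<times>\<times> H\<^esub> i) s" and
      j: "\<And>s. s \<in> S \<Longrightarrow> conjg G (fst \<delta>) s = conjg G (x [^] j) s \<and> \<epsilon> \<delta> s = \<epsilon> (\<gamma>1 [^]\<^bsub>G \<times>\<times> H\<^esub> j) s"
      using \<gamma>\<delta> by (auto simp: \<Gamma>'_def)
    have G': "\<gamma> \<in> \<Gamma>" "\<delta> \<in> \<Gamma>" using \<gamma>\<delta> sub by auto
    have "conjg G (fst (\<gamma> \<otimes>\<^bsub>G \<times>\<times> H\<^esub> \<delta>)) s = conjg G (x [^] (i + j)) s \<and>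
        \<epsilon> (\<gamma> \<otimes>\<^bsub>G \<times>\<times> H\<^esub> \<delta>) s = \<epsilon> (\<gamma>1 [^]\<^bsub>G \<times>\<times> H\<^esub> (i + j)) s" if s: "s \<in> S" for s
    proof
      have s': "conjg G (x [^] j) s \<in> S" using xS[OF s] .
      show "conjg G (fst (\<gamma> \<otimes>\<^bsub>G \<times>\<times> H\<^esub> \<delta>)) s = conjg G (x [^] (i + j)) s"
        using Gamma_carrier[OF G'(1)] Gamma_carrier[OF G'(2)] i[OF s'] j[OF s] add[OF s]
        by (simp add: mult_DirProd' G.conj_mult_left S_carrier[OF s])
      show "\<epsilon> (\<gamma> \<otimes>\<^bsub>G \<times>\<times> H\<^esub> \<delta>) s = \<epsilon> (\<gamma>1 [^]\<^bsub>G \<times>\<times> H\<^esub> (i + j)) s"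
        using eps_mult[OF G' s] \<gamma>1add[OF s] i[OF s'] j[OF s] by simp
    qed
    then show "\<gamma> \<otimes>\<^bsub>G \<times>\<times> H\<^esub> \<delta> \<in> \<Gamma>'" using Gamma_mult[OF G'] by (auto simp: \<Gamma>'_def)
  next
    fix \<gamma> assume \<gamma>: "\<gamma> \<in> \<Gamma>"
    obtain i :: nat where i: "\<And>s. s \<in> S \<Longrightarrow> conjg G (fst \<gamma>) s = conjg G (x [^] i) s"
      using cyc[of "fst \<gamma>"] Gamma_carrier[OF \<gamma>] by (auto simp: x_def)
    have "char_on G S (\<lambda>s. \<epsilon> (\<gamma>1 [^]\<^bsub>G \<times>\<times> H\<^esub> i) s / \<epsilon> \<gamma> s)"
      by (rule eps_ratio_char[OF \<gamma>1pow(1) \<gamma>]) (simp add: i \<gamma>1pow(2))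
    then obtain u where u: "u \<in> T" "\<And>s. s \<in> S \<Longrightarrow> \<chi> u s = \<epsilon> (\<gamma>1 [^]\<^bsub>G \<times>\<times> H\<^esub> i) s / \<epsilon> \<gamma> s"
      using char_surj by blast
    have "\<gamma> \<otimes>\<^bsub>G \<times>\<times> H\<^esub> (\<one>, u) \<in> \<Gamma>'"
      unfolding \<Gamma>'_def using eps_T[OF \<gamma> u(1)] i u(2) eps_nz[OF \<gamma>]
      by (auto intro!: exI[of _ i])
    then show "\<exists>t\<in>T. \<gamma> \<otimes>\<^bsub>G \<times>\<times> H\<^esub> (\<one>, t) \<in> \<Gamma>'" using u(1) by blast
  qed
qed

text \<open>Inversion commutes with every automorphism of \<open>S\<close>, so each
  \<open>\<gamma>\<close> commutes with \<open>\<delta>\<close> up to a character. Halving this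
  character, possible in odd order, corrects \<open>\<gamma>\<close> so that it commutes with
  \<open>\<delta>\<close>. A character that commutes with \<open>\<delta>\<close> equals its own
  inverse, hence is trivial.\<close>

lemma iso_of_inversion:
  assumes \<delta>: "\<delta> \<in> \<Gamma>" "\<And>s. s \<in> S \<Longrightarrow> conjg G (fst \<delta>) s = inv s" and odd: "odd (card S)"
  shows "H \<cong> G"
proof -
  \<comment> \<open>By \<open>eps_mult\<close> the condition says that \<open>\<gamma>\<close> and
    \<open>\<delta>\<close> multiplied in either order have the same \<open>\<epsilon>\<close>: a
    centraliser of \<open>\<delta>\<close>, as far as \<open>S\<close> can tell.\<close>
  define \<Gamma>' where "\<Gamma>' = {\<gamma> \<in> \<Gamma>. \<forall>s\<in>S. \<epsilon> \<gamma> (inv s) * \<epsilon> \<delta> s = \<epsilon> \<delta> (conjg G (fst \<gamma>) s) * \<epsilon> \<gamma> s}"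
  have sub: "\<Gamma>' \<subseteq> \<Gamma>" by (auto simp: \<Gamma>'_def)
  have eq: "\<epsilon> \<gamma> (inv s) * \<epsilon> \<delta> s = \<epsilon> \<delta> (conjg G (fst \<gamma>) s) * \<epsilon> \<gamma> s" if "\<gamma> \<in> \<Gamma>'" "s \<in> S" for \<gamma> s
    using that by (auto simp: \<Gamma>'_def)
  have triv: "\<epsilon> \<gamma> s = 1"
    if \<gamma>: "\<gamma> \<in> \<Gamma>'" "\<And>s. s \<in> S \<Longrightarrow> conjg G (fst \<gamma>) s = s" "char_on G S (\<epsilon> \<gamma>)" and s: "s \<in> S" for \<gamma> s
  proof -
    have "\<epsilon> \<delta> s \<noteq> 0" "\<epsilon> \<gamma> s \<noteq> 0"
      using eps_nz[OF \<delta>(1) s] eps_nz[OF subsetD[OF sub \<gamma>(1)] s] .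
    then have "\<epsilon> \<gamma> s * \<epsilon> \<gamma> s = 1"
      using eq[OF \<gamma>(1) s] \<gamma>(2)[OF s] G.char_inv[OF subgroup_S \<gamma>(3) s] by (simp add: field_simps)
    moreover obtain n where "card S = 2 * n + 1" using odd by (auto elim: oddE)
    moreover have "\<epsilon> \<gamma> s ^ card S = 1" by (rule G.char_pow_card[OF finG subgroup_S \<gamma>(3) s])
    ultimately show ?thesis by (simp add: power_mult power2_eq_square)
  qed
  show ?thesis
  proof (rule iso_of_complement[OF sub])
    show "g = \<one>" if "(g, \<one>\<^bsub>H\<^esub>) \<in> \<Gamma>'" for g using eps_trivial(1)[OF sub _ that] triv by blast
    show "h = \<one>\<^bsub>H\<^esub>" if "(\<one>, h) \<in> \<Gamma>'" for h using eps_trivial(2)[OF sub _ that] triv by blast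
  next
    fix \<gamma> \<gamma>' assume \<gamma>: "\<gamma> \<in> \<Gamma>'" "\<gamma>' \<in> \<Gamma>'"
    have G': "\<gamma> \<in> \<Gamma>" "\<gamma>' \<in> \<Gamma>" using \<gamma> sub by auto
    note car = Gamma_carrier[OF G'(1)] Gamma_carrier[OF G'(2)]
    have "\<epsilon> (\<gamma> \<otimes>\<^bsub>G \<times>\<times> H\<^esub> \<gamma>') (inv s) * \<epsilon> \<delta> s =
        \<epsilon> \<delta> (conjg G (fst (\<gamma> \<otimes>\<^bsub>G \<times>\<times> H\<^esub> \<gamma>')) s) * \<epsilon> (\<gamma> \<otimes>\<^bsub>G \<times>\<times> H\<^esub> \<gamma>') s" if s: "s \<in> S" for s
    proof -
      define u where "u = conjg G (fst \<gamma>') s"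
      have u: "u \<in> S" unfolding u_def by (rule conj_Gamma_S[OF G'(2) s])
      have "\<epsilon> (\<gamma> \<otimes>\<^bsub>G \<times>\<times> H\<^esub> \<gamma>') (inv s) = \<epsilon> \<gamma> (inv u) * \<epsilon> \<gamma>' (inv s)"
        using eps_mult[OF G' inv_S[OF s]] car s by (simp add: u_def G.conj_inv S_carrier)
      moreover have "\<epsilon> (\<gamma> \<otimes>\<^bsub>G \<times>\<times> H\<^esub> \<gamma>') s = \<epsilon> \<gamma> u * \<epsilon> \<gamma>' s"
        using eps_mult[OF G' s] by (simp add: u_def)
      moreover have "conjg G (fst (\<gamma> \<otimes>\<^bsub>G \<times>\<times> H\<^esub> \<gamma>')) s = conjg G (fst \<gamma>) u"
        using car by (simp add: mult_DirProd' G.conj_mult_left S_carrier[OF s] u_def)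
      ultimately show ?thesis
        using eq[OF \<gamma>(1) u] eq[OF \<gamma>(2) s, folded u_def] by (metis (no_types, lifting) mult.assoc mult.commute)
    qed
    then show "\<gamma> \<otimes>\<^bsub>G \<times>\<times> H\<^esub> \<gamma>' \<in> \<Gamma>'" using Gamma_mult[OF G'] by (simp add: \<Gamma>'_def)
  next
    fix \<gamma> assume \<gamma>: "\<gamma> \<in> \<Gamma>"
    note car = Gamma_carrier[OF \<gamma>] Gamma_carrier[OF \<delta>(1)]
    define D where "D s = \<epsilon> (\<gamma> \<otimes>\<^bsub>G \<times>\<times> H\<^esub> \<delta>) s / \<epsilon> (\<delta> \<otimes>\<^bsub>G \<times>\<times> H\<^esub> \<gamma>) s" for s
    have D: "char_on G S D" unfolding D_def
    proof (rule eps_ratio_char)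
      fix s assume s: "s \<in> S"
      show "conjg G (fst (\<gamma> \<otimes>\<^bsub>G \<times>\<times> H\<^esub> \<delta>)) s = conjg G (fst (\<delta> \<otimes>\<^bsub>G \<times>\<times> H\<^esub> \<gamma>)) s"
        using car s \<delta>(2)[OF s] \<delta>(2)[OF conj_Gamma_S[OF \<gamma> s]]
        by (simp add: mult_DirProd' G.conj_mult_left G.conj_inv S_carrier[OF s])
    qed (use Gamma_mult \<gamma> \<delta>(1) in auto)
    have D_eq: "D s = \<epsilon> \<gamma> (inv s) * \<epsilon> \<delta> s / (\<epsilon> \<delta> (conjg G (fst \<gamma>) s) * \<epsilon> \<gamma> s)" if s: "s \<in> S" for s
      using eps_mult[OF \<gamma> \<delta>(1) s] eps_mult[OF \<delta>(1) \<gamma> s] \<delta>(2)[OF s] by (simp add: D_def)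
    obtain n where n: "card S = 2 * n + 1" using odd by (auto elim: oddE)
    \<comment> \<open>The exponent \<open>n + 1\<close> is the inverse of 2 modulo
      \<open>card S = 2 * n + 1\<close>, so \<open>\<chi> t\<close> is a square root of
      \<open>D\<close>.\<close>
    obtain t where t: "t \<in> T" "\<And>s. s \<in> S \<Longrightarrow> \<chi> t s = D s ^ (n + 1)"
      using char_surj[OF char_on_power[OF D]] by blast
    have t2: "\<chi> t s * \<chi> t s = D s" if s: "s \<in> S" for s
    proof -
      have "\<chi> t s * \<chi> t s = D s ^ (card S) * D s"
        using t(2)[OF s] by (simp add: n mult_2 flip: power_add power_Suc2)
      then show ?thesis using G.char_pow_card[OF finG subgroup_S D s] by simp
    qed
    have "\<gamma> \<otimes>\<^bsub>G \<times>\<times> H\<^esub> (\<one>, t) \<in> \<Gamma>'"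
    proof -
      have "\<epsilon> \<gamma> (inv s) * \<chi> t (inv s) * \<epsilon> \<delta> s = \<epsilon> \<delta> (conjg G (fst \<gamma>) s) * (\<epsilon> \<gamma> s * \<chi> t s)" if s: "s \<in> S" for s
      proof -
        have nz: "\<chi> t s \<noteq> 0" "\<epsilon> \<delta> (conjg G (fst \<gamma>) s) \<noteq> 0" "\<epsilon> \<gamma> s \<noteq> 0"
          using char_onD(1)[OF char_chi[OF t(1)] s] eps_nz conj_Gamma_S \<gamma> \<delta>(1) s by auto
        have inv: "\<chi> t s * \<chi> t (inv s) = 1"
          using G.char_inv[OF subgroup_S char_chi[OF t(1)] s] nz(1) by simp
        have "\<epsilon> \<gamma> (inv s) * \<epsilon> \<delta> s = \<chi> t s * \<chi> t s * (\<epsilon> \<delta> (conjg G (fst \<gamma>) s) * \<epsilon> \<gamma> s)"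
          using t2[OF s] nz unfolding D_eq[OF s] by (simp add: field_simps)
        moreover have "\<epsilon> \<gamma> (inv s) * \<chi> t (inv s) * \<epsilon> \<delta> s = (\<epsilon> \<gamma> (inv s) * \<epsilon> \<delta> s) * \<chi> t (inv s)"
          by simp
        ultimately have "\<epsilon> \<gamma> (inv s) * \<chi> t (inv s) * \<epsilon> \<delta> s =
            (\<chi> t s * \<chi> t (inv s)) * (\<epsilon> \<delta> (conjg G (fst \<gamma>) s) * (\<epsilon> \<gamma> s * \<chi> t s))"
          by (simp only: mult_ac)
        then show ?thesis using inv by simp
      qed
      then show ?thesis
        unfolding \<Gamma>'_def using eps_T[OF \<gamma> t(1)] inv_S by simp
    qed
    then show "\<exists>t\<in>T. \<gamma> \<otimes>\<^bsub>G \<times>\<times> H\<^esub> (\<one>, t) \<in> \<Gamma>'" using t(1) by blast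
  qed
qed

text \<open>A cyclic group carries no nontrivial alternating bicharacter, so nondegeneracy excludes
  elements with nontrivial square: \<open>\<beta> s\<close> would be trivial on the powers of
  \<open>s\<close>, hence on all four elements. The table is then forced.\<close>

lemma S_four:
  assumes "card S = 4"
  obtains x y z where "S = {\<one>, x, y, z}" "distinct [\<one>, x, y, z]"
    "x \<otimes> x = \<one>" "y \<otimes> y = \<one>" "z \<otimes> z = \<one>" "x \<otimes> y = z" "y \<otimes> x = z" "x \<otimes> z = y" "z \<otimes> x = y"
    "y \<otimes> z = x" "z \<otimes> y = x"
proof -
  have "card (S - {\<one>}) = 3" using assms finite_S by simp
  from this[unfolded card_3_iff] obtain x y z where
    xyz: "S - {\<one>} = {x, y, z}" "x \<noteq> y" "x \<noteq> z" "y \<noteq> z" by blast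
  then have S: "S = {\<one>, x, y, z}" by (metis insert_Diff one_S)
  have ne: "x \<noteq> \<one>" "y \<noteq> \<one>" "z \<noteq> \<one>" using xyz(1) by auto
  have sq: "s \<otimes> s = \<one>" if s: "s \<in> S" for s
  proof (rule ccontr)
    assume ss: "s \<otimes> s \<noteq> \<one>"
    then have s1: "s \<noteq> \<one>" by auto
    then have ss': "s \<otimes> s \<noteq> s" using s S_carrier by (simp add: G.r_cancel_one)
    define L where "L = {\<one>, s, s \<otimes> s}"
    have L: "L \<subseteq> S" "card L = 3" using s ss ss' s1 by (auto simp: L_def)
    then have "card (S - L) = 1" using assms finite_S by (simp add: card_Diff_subset finite_subset)
    then obtain r where r: "S - L = {r}" by (rule card_1_singletonE)
    have rS: "r \<in> S" "r \<notin> L" using r by auto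
    have bL: "\<beta> s a = 1" if "a \<in> L" for a
      using that char_onD(2)[OF char_beta[OF s] s s] beta_same[OF s] G.char_one[OF subgroup_S char_beta[OF s]]
      by (auto simp: L_def)
    have "\<beta> s r = 1"
    proof (rule ccontr)
      assume br: "\<beta> s r \<noteq> 1"
      have "\<beta> s (s \<otimes> r) \<noteq> 1" using char_onD(2)[OF char_beta[OF s] s rS(1)] beta_same[OF s] br by simp
      then have "s \<otimes> r \<notin> L" using bL by blast
      then have "s \<otimes> r = r" using r s rS(1) by blast
      then show False using s1 s rS S_carrier by (simp add: G.l_cancel_one)
    qed
    then have "\<beta> s a = 1" if "a \<in> S" for a using bL[of a] r that by (cases "a \<in> L") auto
    then show False using beta_nondeg[OF s] s1 by blast
  qed
  have prod: "a \<otimes> b = c" if abc: "{a, b, c} = {x, y, z}" "a \<noteq> b" "a \<noteq> c" "b \<noteq> c" for a b c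
  proof -
    have abS: "a \<in> S" "b \<in> S" using abc(1) S by blast+
    note car = abS[THEN S_carrier]
    have "a \<in> {x, y, z}" "b \<in> {x, y, z}" using abc(1) by blast+
    then have ab1: "a \<noteq> \<one>" "b \<noteq> \<one>" using ne by auto
    have "a \<otimes> b \<noteq> \<one>"
    proof
      assume "a \<otimes> b = \<one>"
      then have "a \<otimes> b = a \<otimes> a" using sq abS by simp
      then show False using car abc(2) by simp
    qed
    moreover have "a \<otimes> b \<noteq> a" "a \<otimes> b \<noteq> b" using ab1 car by (simp_all add: G.r_cancel_one G.l_cancel_one)
    moreover have "a \<otimes> b \<in> S" using abS by blast
    then have "a \<otimes> b \<in> {\<one>, a, b, c}" using S abc(1) by blast
    ultimately show ?thesis by blast
  qed
  show ?thesis
    by (rule that[of x y z]) (use S xyz ne sq prod in auto)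
qed

text \<open>Normalising \<open>\<epsilon>\<close> by square roots of \<open>f s s\<close> makes all its values signs, and an arbitrary triple
  of signs is a constant times a character.\<close>

lemma iso_of_card_4:
  assumes "card S = 4"
  shows "H \<cong> G"
proof -
  obtain x y z where S: "S = {\<one>, x, y, z}" "distinct [\<one>, x, y, z]"
    and tab: "x \<otimes> x = \<one>" "y \<otimes> y = \<one>" "z \<otimes> z = \<one>" "x \<otimes> y = z" "y \<otimes> x = z" "x \<otimes> z = y" "z \<otimes> x = y"
    "y \<otimes> z = x" "z \<otimes> y = x" using S_four[OF assms] .
  have sq: "s \<otimes> s = \<one>" if "s \<in> S" for s using that S(1) tab by auto
  have eps1: "\<epsilon> \<gamma> \<one> = 1" if \<gamma>: "\<gamma> \<in> \<Gamma>" for \<gamma>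
    using eps_f[OF \<gamma> one_S one_S] Gamma_carrier[OF \<gamma>] f_nz[OF one_S one_S] eps_nz[OF \<gamma> one_S] by simp
  define w where "w s = csqrt (f s s)" for s
  have w2: "w s * w s = f s s" for s
    using power2_csqrt[of "f s s"] by (simp add: w_def power2_eq_square)
  have wnz: "w s \<noteq> 0" if "s \<in> S" for s using f_nz[OF that that] by (simp add: w_def)
  define e where "e \<gamma> s = \<epsilon> \<gamma> s * w (conjg G (fst \<gamma>) s) / w s" for \<gamma> s
  have e2: "e \<gamma> s * e \<gamma> s = 1" if \<gamma>: "\<gamma> \<in> \<Gamma>" and s: "s \<in> S" for \<gamma> s
  proof -
    have "e \<gamma> s * e \<gamma> s = \<epsilon> \<gamma> s * \<epsilon> \<gamma> s * (w (conjg G (fst \<gamma>) s) * w (conjg G (fst \<gamma>) s)) / (w s * w s)"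
      by (simp add: e_def)
    also have "\<dots> = f s s / f s s"
      using eps_f[OF \<gamma> s s] eps1[OF \<gamma>] sq[OF s] by (simp add: w2)
    finally show ?thesis using f_nz[OF s s] by simp
  qed
  have enz: "e \<gamma> s \<noteq> 0" if "\<gamma> \<in> \<Gamma>" "s \<in> S" for \<gamma> s using e2[OF that] by auto
  have e_mult: "e (\<gamma> \<otimes>\<^bsub>G \<times>\<times> H\<^esub> \<delta>) s = e \<gamma> (conjg G (fst \<delta>) s) * e \<delta> s"
    if "\<gamma> \<in> \<Gamma>" "\<delta> \<in> \<Gamma>" "s \<in> S" for \<gamma> \<delta> s
    using eps_mult[OF that] that Gamma_carrier[of \<gamma>] Gamma_carrier[of \<delta>] wnz[OF conj_Gamma_S[OF that(2,3)]]
    by (simp add: e_def mult_DirProd' G.conj_mult_left S_carrier)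
  \<comment> \<open>Being constant off \<open>\<one>\<close> is unaffected by any permutation of the
    three involutions, so the condition is closed under products whatever the action on
    \<open>S\<close>.\<close>
  define \<Gamma>' where "\<Gamma>' = {\<gamma> \<in> \<Gamma>. \<exists>\<kappa>. \<forall>s\<in>S - {\<one>}. e \<gamma> s = \<kappa>}"
  have sub: "\<Gamma>' \<subseteq> \<Gamma>" by (auto simp: \<Gamma>'_def)
  have triv: "\<epsilon> \<gamma> s = 1"
    if \<gamma>: "\<gamma> \<in> \<Gamma>'" "\<And>s. s \<in> S \<Longrightarrow> conjg G (fst \<gamma>) s = s" "char_on G S (\<epsilon> \<gamma>)" and s: "s \<in> S" for \<gamma> s
  proof -
    have \<gamma>': "\<gamma> \<in> \<Gamma>" using \<gamma>(1) sub by blast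
    obtain \<kappa> where \<kappa>: "\<And>s. s \<in> S \<Longrightarrow> s \<noteq> \<one> \<Longrightarrow> e \<gamma> s = \<kappa>" using \<gamma>(1) by (auto simp: \<Gamma>'_def)
    have eps: "\<epsilon> \<gamma> s = \<kappa>" if "s \<in> S" "s \<noteq> \<one>" for s
      using \<kappa>[OF that] \<gamma>(2)[OF that(1)] wnz[OF that(1)] by (simp add: e_def)
    have xyz: "x \<in> S" "y \<in> S" "z \<in> S" "x \<noteq> \<one>" "y \<noteq> \<one>" "z \<noteq> \<one>" using S by auto
    have "\<kappa> = \<kappa> * \<kappa>" using char_onD(2)[OF \<gamma>(3) xyz(1,2)] eps xyz tab(4) by simp
    moreover have "\<kappa> \<noteq> 0" using eps[OF xyz(1,4)] eps_nz[OF \<gamma>' xyz(1)] by simp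
    ultimately have "\<kappa> = 1" by simp
    then show ?thesis using eps[OF s] eps1[OF \<gamma>'] by (cases "s = \<one>") auto
  qed
  show ?thesis
  proof (rule iso_of_complement[OF sub])
    show "g = \<one>" if "(g, \<one>\<^bsub>H\<^esub>) \<in> \<Gamma>'" for g using eps_trivial(1)[OF sub _ that] triv by blast
    show "h = \<one>\<^bsub>H\<^esub>" if "(\<one>, h) \<in> \<Gamma>'" for h using eps_trivial(2)[OF sub _ that] triv by blast
  next
    fix \<gamma> \<delta> assume \<gamma>\<delta>: "\<gamma> \<in> \<Gamma>'" "\<delta> \<in> \<Gamma>'"
    have G': "\<gamma> \<in> \<Gamma>" "\<delta> \<in> \<Gamma>" using \<gamma>\<delta> sub by auto
    obtain \<kappa> \<kappa>' where \<kappa>: "\<And>s. s \<in> S \<Longrightarrow> s \<noteq> \<one> \<Longrightarrow> e \<gamma> s = \<kappa>" "\<And>s. s \<in> S \<Longrightarrow> s \<noteq> \<one> \<Longrightarrow> e \<delta> s = \<kappa>'"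
      using \<gamma>\<delta> by (auto simp: \<Gamma>'_def)
    have "e (\<gamma> \<otimes>\<^bsub>G \<times>\<times> H\<^esub> \<delta>) s = \<kappa> * \<kappa>'" if s: "s \<in> S - {\<one>}" for s
    proof -
      have d: "fst \<delta> \<in> carrier G" using Gamma_carrier[OF G'(2)] by blast
      have "conjg G (fst \<delta>) s \<noteq> \<one>"
        using G.conj_inv_left[OF d, of s] s d S_carrier by (metis DiffD1 DiffD2 G.conj_one G.inv_closed singletonI)
      then show ?thesis using e_mult[OF G', of s] \<kappa> s conj_Gamma_S[OF G'(2)] by simp
    qed
    then show "\<gamma> \<otimes>\<^bsub>G \<times>\<times> H\<^esub> \<delta> \<in> \<Gamma>'" using Gamma_mult[OF G'] by (auto simp: \<Gamma>'_def)
  next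
    fix \<gamma> assume \<gamma>: "\<gamma> \<in> \<Gamma>"
    \<comment> \<open>Since the values of \<open>e\<close> are signs,
      \<open>\<kappa> * e \<gamma> s\<close> is the product of the signs at the other two
      involutions. This makes \<open>c\<close> a character, and multiplying by it leaves the
      constant \<open>\<kappa>\<close>.\<close>
    define \<kappa> where "\<kappa> = e \<gamma> x * e \<gamma> y * e \<gamma> z"
    define c where "c s = (if s = \<one> then 1 else \<kappa> * e \<gamma> s)" for s
    have e2': "e \<gamma> x * e \<gamma> x = 1" "e \<gamma> y * e \<gamma> y = 1" "e \<gamma> z * e \<gamma> z = 1" using e2[OF \<gamma>] S by auto
    have ex: "e \<gamma> x * (e \<gamma> x * a) = a" "e \<gamma> y * (e \<gamma> y * a) = a" "e \<gamma> z * (e \<gamma> z * a) = a" for a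
      using e2' by (simp_all flip: mult.assoc)
    have c: "char_on G S c"
    proof (rule char_onI)
      show "c s \<noteq> 0" if "s \<in> S" for s using that S enz[OF \<gamma>] by (auto simp: c_def \<kappa>_def)
      fix s t assume "s \<in> S" "t \<in> S"
      then have st: "s = \<one> \<or> s = x \<or> s = y \<or> s = z" "t = \<one> \<or> t = x \<or> t = y \<or> t = z" using S by auto
      have car: "x \<in> carrier G" "y \<in> carrier G" "z \<in> carrier G" using S S_carrier by auto
      have ne: "x \<noteq> \<one>" "y \<noteq> \<one>" "z \<noteq> \<one>" "x \<noteq> y" "x \<noteq> z" "y \<noteq> z" using S(2) by auto
      show "c (s \<otimes> t) = c s * c t"
        using st by (elim disjE) (simp_all add: c_def \<kappa>_def tab car ne mult_ac e2' ex)
    qed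
    obtain t where t: "t \<in> T" "\<And>s. s \<in> S \<Longrightarrow> \<chi> t s = c s" using char_surj[OF c] by blast
    have "e (\<gamma> \<otimes>\<^bsub>G \<times>\<times> H\<^esub> (\<one>, t)) s = \<kappa>" if s: "s \<in> S - {\<one>}" for s
    proof -
      have "e (\<gamma> \<otimes>\<^bsub>G \<times>\<times> H\<^esub> (\<one>, t)) s = e \<gamma> s * c s"
        using eps_T[OF \<gamma> t(1)] t(2) s by (simp add: e_def)
      also have "\<dots> = \<kappa> * (e \<gamma> s * e \<gamma> s)" using s by (simp add: c_def)
      finally show ?thesis using e2[OF \<gamma>] s by simp
    qed
    then have "\<gamma> \<otimes>\<^bsub>G \<times>\<times> H\<^esub> (\<one>, t) \<in> \<Gamma>'" using eps_T(1)[OF \<gamma> t(1)] by (auto simp: \<Gamma>'_def)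
    then show "\<exists>t\<in>T. \<gamma> \<otimes>\<^bsub>G \<times>\<times> H\<^esub> (\<one>, t) \<in> \<Gamma>'" using t(1) by blast
  qed
qed

section \<open>The centraliser of \<open>S\<close> and the orders below 64\<close>

definition C :: "'a set" where
  "C = {g \<in> carrier G. \<forall>s\<in>S. conjg G g s = s}"

lemma subgroup_C: "subgroup C G"
proof (rule G.finite_subgroupI)
  show "C \<noteq> {}" using S_carrier by (auto simp: C_def intro!: exI[of _ \<one>])
qed (use finG in \<open>auto simp: C_def G.conj_mult_left S_carrier\<close>)

lemma S_subset_C: "S \<subseteq> C"
  by (auto simp: C_def S_carrier)

text \<open>\<open>G\<close> induces on \<open>S\<close> a group of order \<open>i\<close>, which is
  therefore cyclic. Concretely, the elements acting like a power of some \<open>x\<close> outside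
  \<open>C\<close> form a subgroup \<open>D\<close> strictly above \<open>C\<close>, and a prime
  index leaves only the whole group.\<close>

lemma iso_of_index:
  assumes i: "card (carrier G) = i * card C" "i = 1 \<or> prime i"
  shows "H \<cong> G"
proof (cases "C = carrier G")
  case True
  show ?thesis
  proof (rule iso_of_cyclic[OF S_Gamma[OF one_S]])
    show "\<exists>i::nat. \<forall>s\<in>S. conjg G g s = conjg G (fst (\<one>, \<one>\<^bsub>H\<^esub>) [^] i) s" if "g \<in> carrier G" for g
      using that True by (intro exI[of _ 0]) (auto simp: C_def S_carrier)
  qed
next
  case False
  then obtain x where x: "x \<in> carrier G" "x \<notin> C" using subgroup.subset[OF subgroup_C] by blast
  define D where "D = {g \<in> carrier G. \<exists>i::nat. \<forall>s\<in>S. conjg G g s = conjg G (x [^] i) s}"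
  have add: "conjg G (x [^] (i + j)) s = conjg G (x [^] i) (conjg G (x [^] j) s)" if "s \<in> S" for i j :: nat and s
    using that x by (simp add: G.conj_mult_left[symmetric] S_carrier G.nat_pow_mult)
  have C_D: "C \<subseteq> D" by (auto simp: C_def D_def S_carrier intro!: exI[of _ "0::nat"])
  have xD: "x \<in> D" using x(1) by (auto simp: D_def intro!: exI[of _ "1::nat"])
  have subD: "subgroup D G"
  proof (rule G.finite_subgroupI)
    show "D \<noteq> {}" using xD by blast
    show "D \<subseteq> carrier G" "finite D" using finG by (auto simp: D_def)
    fix g h assume "g \<in> D" "h \<in> D"
    then obtain i j :: nat where gh: "g \<in> carrier G" "h \<in> carrier G"
      and i: "\<And>s. s \<in> S \<Longrightarrow> conjg G g s = conjg G (x [^] i) s"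
      and j: "\<And>s. s \<in> S \<Longrightarrow> conjg G h s = conjg G (x [^] j) s" by (auto simp: D_def)
    have "conjg G (g \<otimes> h) s = conjg G (x [^] (i + j)) s" if s: "s \<in> S" for s
      using gh s i[OF conj_S[OF _ s, of "x [^] j"]] x(1) j[OF s] by (simp add: G.conj_mult_left S_carrier add)
    then show "g \<otimes> h \<in> D" using gh by (auto simp: D_def)
  qed
  interpret D: group "G\<lparr>carrier := D\<rparr>" using subgroup.subgroup_is_group[OF subD G.is_group] .
  have "subgroup C (G\<lparr>carrier := D\<rparr>)" by (rule G.subgroup_incl[OF subgroup_C subD C_D])
  from D.lagrange[OF this] obtain a where a: "card D = a * card C" by (metis order_def partial_object.select_convs(1) partial_object.surjective partial_object.update_convs(1))
  obtain b where b: "card (carrier G) = b * card D" using G.lagrange[OF subD] by (metis order_def)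
  have fin: "finite D" "finite C" using finG by (auto simp: D_def C_def)
  have "card C > 0" using subgroup.one_closed[OF subgroup_C] fin(2) card_gt_0_iff by blast
  then have iab: "i = b * a" using a b i(1) by simp
  have "a \<noteq> 1"
  proof
    assume "a = 1"
    then have "C = D" using a C_D fin by (intro card_subset_eq) auto
    then show False using xD x(2) by blast
  qed
  then have "b = 1" using i(2) iab by (auto dest: prime_product)
  then have "D = carrier G" using b finG subgroup.subset[OF subD] by (intro card_subset_eq) auto
  obtain h where h: "(x, h) \<in> \<Gamma>" using Gamma_fst[OF x(1)] by blast
  show ?thesis
    by (rule iso_of_cyclic[OF h]) (use \<open>D = carrier G\<close> in \<open>auto simp: D_def\<close>)
qed

lemma odd_sq_one:
  assumes odd: "odd (card S)" and c: "char_on G S c" and s: "s \<in> S" "c s * c s = 1"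
  shows "c s = 1"
proof -
  obtain n where "card S = 2 * n + 1" using odd by (auto elim: oddE)
  then show ?thesis using G.char_pow_card[OF finG subgroup_S c s(1)] s(2) by (simp add: power_mult power2_eq_square)
qed

lemma odd_involution:
  assumes odd: "odd (card S)" and s: "s \<in> S" "s \<otimes> s = \<one>"
  shows "s = \<one>"
proof (rule beta_nondeg'[OF s(1)])
  fix a assume a: "a \<in> S"
  show "\<beta> a s = 1"
    using char_onD(2)[OF char_beta[OF a] s(1,1)] s(2) G.char_one[OF subgroup_S char_beta[OF a]]
    by (intro odd_sq_one[OF odd char_beta[OF a] s(1)]) simp
qed

text \<open>An involution of \<open>S\<close> preserving \<open>\<beta>\<close> splits \<open>S\<close> orthogonally into a fixed and an inverted part.
  If both were nontrivial they would have order 3, and \<open>\<beta>\<close> would vanish on the cyclic fixed part.\<close>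

lemma involution_card_9:
  assumes card: "card S = 9" and \<gamma>: "\<gamma> \<in> \<Gamma>" "fst \<gamma> \<otimes> fst \<gamma> \<in> S" "fst \<gamma> \<notin> C" and s: "s \<in> S"
  shows "conjg G (fst \<gamma>) s = inv s"
proof (rule ccontr)
  assume s_ne: "conjg G (fst \<gamma>) s \<noteq> inv s"
  define \<tau> where "\<tau> = conjg G (fst \<gamma>)"
  have odd: "odd (card S)" using card by simp
  have g: "fst \<gamma> \<in> carrier G" using Gamma_carrier[OF \<gamma>(1)] by blast
  have \<tau>S: "\<tau> a \<in> S" if "a \<in> S" for a unfolding \<tau>_def by (rule conj_Gamma_S[OF \<gamma>(1) that])
  have \<tau>\<tau>: "\<tau> (\<tau> a) = a" if "a \<in> S" for a
    using that g \<gamma>(2) by (simp add: \<tau>_def S_carrier flip: G.conj_mult_left)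
  have \<tau>m: "\<tau> (a \<otimes> b) = \<tau> a \<otimes> \<tau> b" "\<tau> (inv a) = inv \<tau> a" if "a \<in> S" "b \<in> S" for a b
    using that g by (auto simp: \<tau>_def G.conj_mult G.conj_inv S_carrier)
  \<comment> \<open>\<open>u\<close> is fixed by \<open>\<tau>\<close> and nontrivial because
    \<open>s\<close> is not inverted; \<open>v\<close> below is inverted and nontrivial because
    \<open>r\<close> is not fixed.\<close>
  define u where "u = s \<otimes> \<tau> s"
  have u: "u \<in> S" "\<tau> u = u" using s \<tau>S \<tau>\<tau> \<tau>m S_comm by (auto simp: u_def)
  have u1: "u \<noteq> \<one>"
  proof
    assume "u = \<one>"
    then have "\<tau> s \<otimes> s = \<one>" using S_comm[OF s \<tau>S[OF s]] by (simp add: u_def)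
    then have "inv s = \<tau> s" using s \<tau>S by (intro G.inv_equality) (auto simp: S_carrier)
    then show False using s_ne by (simp add: \<tau>_def)
  qed
  obtain r where r: "r \<in> S" "\<tau> r \<noteq> r" using \<gamma>(3) g by (auto simp: C_def \<tau>_def)
  define v where "v = r \<otimes> inv (\<tau> r)"
  have v: "v \<in> S" using r \<tau>S by (auto simp: v_def)
  have "\<tau> v = \<tau> r \<otimes> inv r" using r \<tau>S \<tau>\<tau> \<tau>m inv_S by (simp add: v_def)
  also have "\<dots> = inv v" using r \<tau>S by (simp add: v_def G.inv_mult_group S_carrier)
  finally have \<tau>v: "\<tau> v = inv v" .
  have v1: "v \<noteq> \<one>"
  proof
    assume "v = \<one>"
    then have "v \<otimes> \<tau> r = \<tau> r" using r \<tau>S by (simp add: S_carrier)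
    then show False using r \<tau>S by (simp add: v_def S_carrier G.m_assoc)
  qed
  have fixed: "w = \<one>" if "w \<in> S" "\<tau> w = w" "\<tau> w = inv w" for w
    using that S_carrier by (intro odd_involution[OF odd that(1)]) (metis G.r_inv)
  \<comment> \<open>\<open>\<tau>\<close> preserves \<open>\<beta>\<close>, fixes \<open>u\<close>
    and inverts \<open>v\<close>, so \<open>\<beta> u v\<close> is its own inverse; odd order makes
    it 1.\<close>
  have "\<beta> u v = \<beta> (\<tau> u) (\<tau> v)" unfolding \<tau>_def by (rule beta_conj[OF \<gamma>(1) u(1) v, symmetric])
  also have "\<dots> = 1 / \<beta> u v" using u(2) \<tau>v G.char_inv[OF subgroup_S char_beta[OF u(1)] v] by simp
  finally have "\<beta> u v * \<beta> u v = 1" using char_onD(1)[OF char_beta[OF u(1)] v] by (simp add: field_simps)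
  then have uv: "\<beta> u v = 1" by (rule odd_sq_one[OF odd char_beta[OF u(1)] v])
  \<comment> \<open>The order of the kernel of \<open>\<beta> u\<close> divides 9, and four distinct
    elements lie in it, so it is all of \<open>S\<close>, against nondegeneracy.\<close>
  define K where "K = {a \<in> S. \<beta> u a = 1}"
  have K: "K \<subseteq> S" "finite K" using finite_S by (auto simp: K_def)
  have subK: "subgroup K G"
  proof (rule G.finite_subgroupI)
    show "K \<noteq> {}" using u(1) beta_same by (auto simp: K_def)
    show "x \<otimes> y \<in> K" if "x \<in> K" "y \<in> K" for x y
      using that char_onD(2)[OF char_beta[OF u(1)]] by (auto simp: K_def)
  qed (use K S_carrier in auto)
  have uu: "\<tau> (u \<otimes> u) = u \<otimes> u" "u \<otimes> u \<noteq> \<one>" "u \<otimes> u \<noteq> u"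
    using u \<tau>m odd_involution[OF odd u(1)] u1 S_carrier by (auto simp: G.r_cancel_one)
  have "v \<noteq> u" "v \<noteq> u \<otimes> u" using fixed[OF v _ \<tau>v] v1 u(2) uu(1) by auto
  then have "card {\<one>, u, u \<otimes> u, v} = 4" using u1 v1 uu by auto
  moreover have "{\<one>, u, u \<otimes> u, v} \<subseteq> K"
    using u v uv beta_same[OF u(1)] char_onD(2)[OF char_beta[OF u(1)] u(1,1)]
      G.char_one[OF subgroup_S char_beta[OF u(1)]] by (auto simp: K_def)
  ultimately have K4: "card K \<ge> 4" using card_mono[OF K(2)] by metis
  interpret S: group "G\<lparr>carrier := S\<rparr>" using subgroup.subgroup_is_group[OF subgroup_S G.is_group] .
  have "subgroup K (G\<lparr>carrier := S\<rparr>)" by (rule G.subgroup_incl[OF subK subgroup_S K(1)])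
  from S.lagrange[OF this] obtain q where q: "9 = q * card K" using card by (force simp: order_def)
  have "q = 1"
  proof (cases "q \<ge> 3")
    case True
    then have "3 * 4 \<le> q * card K" using K4 by (intro mult_mono) auto
    then show ?thesis using q by simp
  next
    case False
    then have "q = 0 \<or> q = 1 \<or> q = 2" by auto
    then show ?thesis using q by presburger
  qed
  then have "K = S" using K(1) finite_S card q by (intro card_subset_eq) auto
  then have "u = \<one>" by (intro beta_nondeg[OF u(1)]) (auto simp: K_def)
  then show False using u1 by blast
qed

text \<open>A Sylow 2-subgroup, here of order 4 or 2, provides an involution, and \<open>S\<close>
  has none because its order is odd.\<close>

lemma exists_square_root_outside:
  assumes card: "card (carrier G) = 36 \<or> card (carrier G) = 54" and S: "odd (card S)"
  obtains g where "g \<in> carrier G" "g \<otimes> g \<in> S" "g \<notin> S"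
proof -
  obtain P where P: "subgroup P G" "card P = 2 \<or> card P = 4"
  proof (cases "card (carrier G) = 36")
    case True
    then have "order G = 2 ^ 2 * 9" by (simp add: order_def)
    from sylow_thm[OF _ G.is_group this finG] show ?thesis using that by auto
  next
    case False
    then have "order G = 2 ^ 1 * 27" using card by (simp add: order_def)
    from sylow_thm[OF _ G.is_group this finG] show ?thesis using that by auto
  qed
  have Pcar: "P \<subseteq> carrier G" by (rule subgroup.subset[OF P(1)])
  have "P \<noteq> {\<one>}" using P(2) by auto
  then obtain g where g: "g \<in> P" "g \<noteq> \<one>" using subgroup.one_closed[OF P(1)] by blast
  have gc: "g \<in> carrier G" using g Pcar by blast
  interpret PP: group "G\<lparr>carrier := P\<rparr>" using subgroup.subgroup_is_group[OF P(1) G.is_group] .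
  have "g [^]\<^bsub>G\<lparr>carrier := P\<rparr>\<^esub> order (G\<lparr>carrier := P\<rparr>) = \<one>" using PP.pow_order_eq_1[of g] g by simp
  then have "g [^] card P = \<one>" by (simp add: order_def nat_pow_def)
  moreover have "g [^] (4::nat) = (g \<otimes> g) \<otimes> (g \<otimes> g)" "g [^] (2::nat) = g \<otimes> g"
    using gc by (simp_all add: numeral_eq_Suc G.m_assoc)
  ultimately have 4: "(g \<otimes> g) \<otimes> (g \<otimes> g) = \<one>" using P(2) gc by auto
  show ?thesis
  proof (cases "g \<otimes> g = \<one>")
    case True
    then show ?thesis using that[OF gc] odd_involution[OF S, of g] g(2) by auto
  next
    case False
    then show ?thesis using that[of "g \<otimes> g"] odd_involution[OF S, of "g \<otimes> g"] 4 gc by auto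
  qed
qed

text \<open>With \<open>card S = m^2\<close> the order of \<open>G\<close> is
  \<open>i * c * m^2\<close>, where \<open>i\<close> is the index of \<open>C\<close> in
  \<open>G\<close> and \<open>c\<close> that of \<open>S\<close> in \<open>C\<close>. For
  \<open>m \<ge> 4\<close>, and for \<open>m = 3\<close> with \<open>c \<ge> 2\<close>, this leaves
  \<open>i \<le> 3\<close>. For \<open>m = 3\<close> and \<open>c = 1\<close> the index is at most
  7, and only 4 and 6 are neither 1 nor prime.\<close>

theorem iso_of_order_less_64:
  assumes "card (carrier G) < 64"
  shows "H \<cong> G"
proof -
  obtain m where m: "card S = m\<^sup>2" using card_S_square by blast
  interpret C: group "G\<lparr>carrier := C\<rparr>" using subgroup.subgroup_is_group[OF subgroup_C G.is_group] .
  have "subgroup S (G\<lparr>carrier := C\<rparr>)" by (rule G.subgroup_incl[OF subgroup_S subgroup_C S_subset_C])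
  from C.lagrange[OF this] obtain c where c: "card C = c * m\<^sup>2" unfolding order_def m by simp metis
  obtain i where i: "card (carrier G) = i * card C" using G.lagrange[OF subgroup_C] by (metis order_def)
  have fin: "finite C" using finG by (auto simp: C_def)
  have pos: "card (carrier G) > 0" using finG G.one_closed card_gt_0_iff by blast
  then have pos': "i > 0" "c > 0" "m > 0" using i c by (auto intro!: Nat.gr0I)
  have small: ?thesis if "i \<le> 3"
  proof (rule iso_of_index[OF i])
    have "i = 1 \<or> i = 2 \<or> i = 3" using that pos' by auto
    then show "i = 1 \<or> prime i" by auto
  qed
  have le: "i * (c * m\<^sup>2) < 64" using assms i c by simp
  consider "m = 1" | "m = 2" | "m = 3" | "m \<ge> 4" using pos'(3) by linarith
  then show ?thesis
  proof cases
    case 1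
    then obtain s where "S = {s}" using m card_1_singletonE[of S] by auto
    then have "S = {\<one>}" using one_S by auto
    then have "C = carrier G" unfolding C_def by auto
    then have "i = 1" using i pos by simp
    then show ?thesis using small by simp
  next
    case 2
    then show ?thesis using m by (intro iso_of_card_4) simp
  next
    case 4
    have "4 * 4 \<le> m * m" using 4 by (intro mult_mono) auto
    then have "1 * 16 \<le> c * m\<^sup>2" using pos' by (intro mult_mono) (auto simp: power2_eq_square)
    then have "i * 16 \<le> i * (c * m\<^sup>2)" by (intro mult_le_mono2) simp
    also note le
    finally show ?thesis by (intro small) simp
  next
    case 3
    have c9: "card S = 9" using m 3 by simp
    have le': "i * c \<le> 7" using le 3 by simp
    show ?thesis
    proof (cases "c \<ge> 2")
      case True
      then have "i * 2 \<le> i * c" by simp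
      also note le'
      finally show ?thesis by (intro small) simp
    next
      case False
      then have c1: "c = 1" using pos' by simp
      then have i7: "i \<le> 7" using le' by simp
      have CS: "C = S" using c c1 3 c9 S_subset_C fin by (intro card_subset_eq[symmetric]) auto
      consider "i = 4 \<or> i = 6" | "i \<le> 3" | "i = 5 \<or> i = 7" using i7 by linarith
      then show ?thesis
      proof cases
        case 1
        then have "card (carrier G) = 36 \<or> card (carrier G) = 54" using i CS c9 by auto
        then obtain g where g: "g \<in> carrier G" "g \<otimes> g \<in> S" "g \<notin> S"
          using exists_square_root_outside c9 by (metis odd_numeral)
        obtain h where h: "(g, h) \<in> \<Gamma>" using Gamma_fst[OF g(1)] by blast
        show ?thesis
          by (rule iso_of_inversion[OF h]) (use involution_card_9[OF c9 h] g CS c9 in auto)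
      next
        case 2
        then show ?thesis by (rule small)
      next
        case 3
        then show ?thesis by (intro iso_of_index[OF i]) auto
      qed
    qed
  qed
qed

end

section \<open>Characters of commutative algebras\<close>

text \<open>The product is total on the ambient type with values in \<open>M\<close>, so that only
  the unit laws mention membership in \<open>M\<close>; \<open>B\<close> bounds the
  dimension.\<close>

locale complex_algebra = vector_space scale
  for scale :: "complex \<Rightarrow> 'v::ab_group_add \<Rightarrow> 'v" (infixr \<open>*s\<close> 75) +
  fixes mul :: "'v \<Rightarrow> 'v \<Rightarrow> 'v" (infixl \<open>\<star>\<close> 76) and M :: "'v set" and e :: 'v and B :: "'v set"
  assumes mul_assoc: "x \<star> y \<star> z = x \<star> (y \<star> z)"
    and mul_add_left: "(x + y) \<star> z = x \<star> z + y \<star> z"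
    and mul_add_right: "x \<star> (y + z) = x \<star> y + x \<star> z"
    and mul_scale_left: "(c *s x) \<star> y = c *s (x \<star> y)"
    and mul_scale_right: "x \<star> (c *s y) = c *s (x \<star> y)"
    and subspace_M: "subspace M"
    and mul_M [simp, intro]: "x \<star> y \<in> M"
    and e_M [simp, intro]: "e \<in> M"
    and e_nonzero: "e \<noteq> 0"
    and e_mul [simp]: "x \<in> M \<Longrightarrow> e \<star> x = x"
    and mul_e [simp]: "x \<in> M \<Longrightarrow> x \<star> e = x"
    and finite_B: "finite B"
    and span_B: "M \<subseteq> span B"
begin

lemma mul_zero [simp]: "0 \<star> x = 0" "x \<star> 0 = 0"
  using mul_scale_left[of 0 0 x] mul_scale_right[of x 0 0] by simp_all

lemma mul_minus [simp]: "(- x) \<star> y = - (x \<star> y)" "x \<star> (- y) = - (x \<star> y)"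
  using mul_scale_left[of "-1" x y] mul_scale_right[of x "-1" y] by simp_all

lemma mul_diff: "(x - y) \<star> z = x \<star> z - y \<star> z" "x \<star> (y - z) = x \<star> y - x \<star> z"
  using mul_add_left[of x "-y" z] mul_add_right[of x y "-z"] by simp_all

lemma mul_sum_left: "(\<Sum>i\<in>A. f i) \<star> z = (\<Sum>i\<in>A. f i \<star> z)"
  by (induction A rule: infinite_finite_induct) (simp_all add: mul_add_left)

lemma mul_sum_right: "z \<star> (\<Sum>i\<in>A. f i) = (\<Sum>i\<in>A. z \<star> f i)"
  by (induction A rule: infinite_finite_induct) (simp_all add: mul_add_right)

definition commutative_subalgebra :: "'v set \<Rightarrow> bool" where
  "commutative_subalgebra Z \<longleftrightarrow> subspace Z \<and> Z \<subseteq> M \<and> e \<in> Z \<and>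
     (\<forall>x\<in>Z. \<forall>y\<in>Z. x \<star> y \<in> Z \<and> x \<star> y = y \<star> x)"

definition algebra_char :: "'v set \<Rightarrow> ('v \<Rightarrow> complex) \<Rightarrow> bool" where
  "algebra_char Z p \<longleftrightarrow> p e = 1 \<and> (\<forall>x\<in>Z. \<forall>y\<in>Z. p (x + y) = p x + p y \<and> p (x \<star> y) = p x * p y) \<and>
     (\<forall>x\<in>Z. \<forall>c. p (c *s x) = c * p x)"

text \<open>Horner evaluation at \<open>z\<close>, with \<open>e\<close> in place of the constant
  1.\<close>

definition eval_poly :: "'v \<Rightarrow> complex poly \<Rightarrow> 'v" where
  "eval_poly z q = fold_coeffs (\<lambda>c v. c *s e + z \<star> v) q 0"

lemma eval_poly_0 [simp]: "eval_poly z 0 = 0"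
  by (simp add: eval_poly_def)

lemma eval_poly_pCons [simp]: "eval_poly z (pCons c q) = c *s e + z \<star> eval_poly z q"
  by (cases "q = 0 \<and> c = 0") (auto simp: eval_poly_def)

lemma eval_poly_add: "eval_poly z (p + q) = eval_poly z p + eval_poly z q"
  by (induction p q rule: poly_induct2) (simp_all add: scale_left_distrib mul_add_right)

lemma eval_poly_sum: "eval_poly z (\<Sum>i\<in>A. f i) = (\<Sum>i\<in>A. eval_poly z (f i))"
  by (induction A rule: infinite_finite_induct) (simp_all add: eval_poly_add)

lemma eval_poly_smult: "eval_poly z (smult a q) = a *s eval_poly z q"
  by (induction q) (simp_all add: scale_right_distrib mul_scale_right)

lemma eval_poly_diff: "eval_poly z (p - q) = eval_poly z p - eval_poly z q"
  using eval_poly_add[of z p "smult (- 1) q"] eval_poly_smult[of z "- 1" q] by simp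

lemma eval_poly_monom: "eval_poly z (monom c i) = c *s ((\<star>) z ^^ i) e"
  by (induction i) (simp_all add: monom_0 monom_Suc mul_scale_right)

lemma eval_poly_linear_factor:
  "z \<in> M \<Longrightarrow> eval_poly z ([:- r, 1:] * q) = (z - r *s e) \<star> eval_poly z q"
proof -
  have "eval_poly z q \<in> M" by (induction q) (auto intro!: subspace_0 subspace_add subspace_scale subspace_M)
  then show ?thesis by (simp add: eval_poly_diff eval_poly_smult mul_diff mul_scale_left)
qed

text \<open>Otherwise the powers of \<open>z\<close> with exponents from \<open>0\<close> to
  \<open>card B\<close> would be independent, one vector more than the span of \<open>B\<close>
  allows.\<close>

lemma exists_annihilating_poly:
  obtains q where "q \<noteq> 0" "eval_poly z q = 0"
proof (rule ccontr)
  assume "\<not> thesis"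
  then have none: "q = 0" if "eval_poly z q = 0" for q using that \<open>\<And>q. q \<noteq> 0 \<Longrightarrow> eval_poly z q = 0 \<Longrightarrow> thesis\<close> by blast
  define w where "w i = ((\<star>) z ^^ i) e" for i
  have wM: "w i \<in> M" for i by (cases i) (auto simp: w_def)
  have inj: "inj w"
  proof (rule injI)
    fix i j assume "w i = w j"
    then have "eval_poly z (monom 1 i - monom 1 j) = 0"
      by (simp add: eval_poly_diff eval_poly_monom w_def)
    then have "monom 1 i = (monom 1 j :: complex poly)" using none by force
    then show "i = j" by (metis degree_monom_eq zero_neq_one)
  qed
  have indep: "independent (w ` {..card B})"
  proof (rule independent_if_scalars_zero)
    fix u x assume u: "(\<Sum>x\<in>w ` {..card B}. u x *s x) = 0" and x: "x \<in> w ` {..card B}"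
    define q where "q = (\<Sum>i\<le>card B. monom (u (w i)) i)"
    have "eval_poly z q = (\<Sum>i\<le>card B. u (w i) *s w i)"
      by (simp add: q_def eval_poly_sum eval_poly_monom w_def)
    also have "\<dots> = 0" using u inj by (simp add: sum.reindex inj_on_def)
    finally have "q = 0" by (rule none)
    obtain i where i: "i \<le> card B" "x = w i" using x by auto
    have "coeff q i = u (w i)" using i by (simp add: q_def coeff_sum)
    then show "u x = 0" using \<open>q = 0\<close> i by simp
  qed simp
  moreover have "w ` {..card B} \<subseteq> span B" using wM span_B by auto
  ultimately have "card (w ` {..card B}) \<le> card B" using independent_span_bound[OF finite_B] by blast
  then show False using inj by (simp add: card_image inj_on_def)
qed

text \<open>Modulo a maximal ideal, which Zorn's lemma provides, every \<open>z\<close> is a scalar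
  multiple of \<open>e\<close> because \<open>\<complex>\<close> is algebraically closed;
  \<open>p\<close> picks this scalar.\<close>

lemma exists_algebra_char:
  assumes Z: "commutative_subalgebra Z"
  obtains p where "algebra_char Z p"
proof -
  have Zs: "subspace Z" "Z \<subseteq> M" "e \<in> Z" and Zm: "\<And>x y. \<lbrakk>x \<in> Z; y \<in> Z\<rbrakk> \<Longrightarrow> x \<star> y \<in> Z"
    and comm: "\<And>x y. \<lbrakk>x \<in> Z; y \<in> Z\<rbrakk> \<Longrightarrow> x \<star> y = y \<star> x"
    using Z by (auto simp: commutative_subalgebra_def)
  define \<I> where "\<I> = {I. subspace I \<and> I \<subseteq> Z \<and> e \<notin> I \<and> (\<forall>i\<in>I. \<forall>z\<in>Z. i \<star> z \<in> I)}"
  have "\<exists>I\<in>\<I>. \<forall>X\<in>\<I>. I \<subseteq> X \<longrightarrow> X = I"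
  proof (rule subset_Zorn_nonempty)
    have "{0} \<in> \<I>" using e_nonzero subspace_0[OF Zs(1)] by (auto simp: \<I>_def subspace_single_0)
    then show "\<I> \<noteq> {}" by blast
    fix \<C> assume ne: "\<C> \<noteq> {}" and chain: "subset.chain \<I> \<C>"
    have sub: "\<C> \<subseteq> \<I>" using chain by (simp add: subset.chain_def)
    have "subspace (\<Union>\<C>)"
    proof (rule subspaceI)
      show "0 \<in> \<Union>\<C>" using ne sub subspace_0 by (auto simp: \<I>_def)
      show "c *s x \<in> \<Union>\<C>" if x: "x \<in> \<Union>\<C>" for c x
      proof -
        obtain X where X: "X \<in> \<C>" "x \<in> X" using x by blast
        then have "subspace X" using sub by (auto simp: \<I>_def)
        then show ?thesis using X subspace_scale by blast
      qed
      show "x + y \<in> \<Union>\<C>" if xy: "x \<in> \<Union>\<C>" "y \<in> \<Union>\<C>" for x y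
      proof -
        obtain X Y where XY: "X \<in> \<C>" "Y \<in> \<C>" "x \<in> X" "y \<in> Y" using xy by blast
        have "X \<subseteq> Y \<or> Y \<subseteq> X" using chain XY by (auto simp: subset.chain_def)
        then obtain W where W: "W \<in> \<C>" "x \<in> W" "y \<in> W" using XY by blast
        then have "subspace W" using sub by (auto simp: \<I>_def)
        then show ?thesis using W subspace_add by blast
      qed
    qed
    moreover have "i \<star> z \<in> \<Union>\<C>" if "i \<in> \<Union>\<C>" "z \<in> Z" for i z
      using that sub by (auto simp: \<I>_def)
    ultimately show "\<Union>\<C> \<in> \<I>" using sub by (auto simp: \<I>_def)
  qed
  then obtain I where I: "I \<in> \<I>" and max: "\<And>X. \<lbrakk>X \<in> \<I>; I \<subseteq> X\<rbrakk> \<Longrightarrow> X = I" by blast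
  have Is: "subspace I" "I \<subseteq> Z" "e \<notin> I" and Im: "\<And>i z. \<lbrakk>i \<in> I; z \<in> Z\<rbrakk> \<Longrightarrow> i \<star> z \<in> I"
    using I by (auto simp: \<I>_def)
  have ex: "\<exists>c. z - c *s e \<in> I" if z: "z \<in> Z" for z
  proof -
    \<comment> \<open>The \<open>q\<close> chosen below is a minimal polynomial of \<open>z\<close>
      modulo \<open>I\<close>. Splitting off a root \<open>r\<close> leaves a cofactor
      \<open>q'\<close> with value outside \<open>I\<close>, so \<open>z - r *s e\<close> is a zero
      divisor modulo \<open>I\<close>.\<close>
    define P where "P q \<longleftrightarrow> q \<noteq> 0 \<and> eval_poly z q \<in> I" for q
    obtain q0 where "P q0" using exists_annihilating_poly[of z] subspace_0[OF Is(1)] by (metis P_def)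
    then obtain q where q: "P q" and qmin: "\<And>q'. P q' \<Longrightarrow> degree q \<le> degree q'"
      using ex_has_least_nat[of P q0 degree] by blast
    have "degree q \<noteq> 0"
    proof
      assume "degree q = 0"
      then obtain c where c: "q = [:c:]" by (rule degree_eq_zeroE)
      then have "c *s e \<in> I" "c \<noteq> 0" using q by (auto simp: P_def)
      then have "inverse c *s c *s e \<in> I" using subspace_scale[OF Is(1)] by blast
      then show False using Is(3) \<open>c \<noteq> 0\<close> by simp
    qed
    then obtain r where "poly q r = 0"
      using fundamental_theorem_of_algebra[of q] constant_degree[of q] by auto
    then obtain q' where q': "q = [:- r, 1:] * q'" by (auto simp: poly_eq_0_iff_dvd)
    have zM: "z \<in> M" using z Zs by blast
    have evZ: "eval_poly z q'' \<in> Z" for q''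
      by (induction q'') (use Zs z Zm in \<open>auto intro!: subspace_0 subspace_add subspace_scale\<close>)
    have "q' \<noteq> 0" using q q' by (auto simp: P_def)
    then have "degree q = Suc (degree q')" unfolding q' by (subst degree_mult_eq) auto
    then have ev': "eval_poly z q' \<notin> I" using qmin[of q'] \<open>q' \<noteq> 0\<close> by (auto simp: P_def)
    define t where "t = z - r *s e"
    have t: "t \<in> Z" using z Zs by (auto simp: t_def intro!: subspace_diff subspace_scale)
    have tev: "t \<star> eval_poly z q' \<in> I" using q eval_poly_linear_factor[OF zM, of r q'] by (simp add: P_def q' t_def del: mult_pCons_left)
    \<comment> \<open>The ideal generated by \<open>I\<close> and \<open>t\<close>. If it contained
      \<open>e\<close>, multiplying by the value of \<open>q'\<close> would put that value in
      \<open>I\<close>; so it is proper and equals \<open>I\<close> by maximality.\<close>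
    define J where "J = {i + t \<star> w | i w. i \<in> I \<and> w \<in> Z}"
    have IJ: "I \<subseteq> J"
    proof
      fix i assume "i \<in> I"
      then have "i = i + t \<star> 0" "0 \<in> Z" "i \<in> I" using subspace_0[OF Zs(1)] by auto
      then show "i \<in> J" unfolding J_def by blast
    qed
    have eJ: "e \<notin> J"
    proof
      assume "e \<in> J"
      then obtain i w where iw: "e = i + t \<star> w" "i \<in> I" "w \<in> Z" by (auto simp: J_def)
      have "eval_poly z q' = (i + t \<star> w) \<star> eval_poly z q'"
        using evZ[of q'] Zs(2) by (simp flip: iw(1) add: subset_iff)
      also have "\<dots> = i \<star> eval_poly z q' + (t \<star> eval_poly z q') \<star> w"
        using comm[OF evZ[of q'] iw(3)] by (simp add: mul_add_left mul_assoc)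
      also have "\<dots> \<in> I" using Im iw tev evZ Is(1) by (intro subspace_add) auto
      finally show False using ev' by blast
    qed
    have "subspace J"
    proof (rule subspaceI)
      show "0 \<in> J" using IJ subspace_0[OF Is(1)] by blast
      fix x assume "x \<in> J"
      then obtain i w where x: "x = i + t \<star> w" "i \<in> I" "w \<in> Z" by (auto simp: J_def)
      show "c *s x \<in> J" for c
      proof -
        have "c *s x = c *s i + t \<star> (c *s w)" by (simp add: x scale_right_distrib mul_scale_right)
        then show ?thesis using x subspace_scale[OF Is(1)] subspace_scale[OF Zs(1)] unfolding J_def by blast
      qed
      fix y assume "y \<in> J"
      then obtain j v where y: "y = j + t \<star> v" "j \<in> I" "v \<in> Z" by (auto simp: J_def)
      have "x + y = (i + j) + t \<star> (w + v)" by (simp add: x y mul_add_right)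
      then show "x + y \<in> J" using x y subspace_add[OF Is(1)] subspace_add[OF Zs(1)] unfolding J_def by blast
    qed
    moreover have "J \<subseteq> Z" using Is(2) t Zm subspace_add[OF Zs(1)] by (auto simp: J_def)
    moreover have "x \<star> u \<in> J" if xu: "x \<in> J" "u \<in> Z" for x u
    proof -
      obtain i w where x: "x = i + t \<star> w" "i \<in> I" "w \<in> Z" using xu by (auto simp: J_def)
      have "x \<star> u = i \<star> u + t \<star> (w \<star> u)" by (simp add: x mul_add_left mul_assoc)
      then show ?thesis using Im[OF x(2) xu(2)] Zm[OF x(3) xu(2)] unfolding J_def by blast
    qed
    ultimately have "J \<in> \<I>" using eJ by (auto simp: \<I>_def)
    then have "J = I" using IJ by (rule max)
    moreover have "t \<in> J"
    proof -
      have "t = 0 + t \<star> e" using t Zs(2) by auto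
      then show ?thesis using subspace_0[OF Is(1)] Zs(3) unfolding J_def by blast
    qed
    ultimately show ?thesis by (auto simp: t_def)
  qed
  have uniq: "c = d" if cd: "z - c *s e \<in> I" "z - d *s e \<in> I" for z c d
  proof (rule ccontr)
    assume "c \<noteq> d"
    have "(z - d *s e) - (z - c *s e) \<in> I" using cd subspace_diff[OF Is(1)] by blast
    then have "(c - d) *s e \<in> I" by (simp add: scale_left_diff_distrib)
    then have "inverse (c - d) *s (c - d) *s e \<in> I" using subspace_scale[OF Is(1)] by blast
    then show False using Is(3) \<open>c \<noteq> d\<close> by simp
  qed
  from ex obtain p where p: "\<And>z. z \<in> Z \<Longrightarrow> z - p z *s e \<in> I" by metis
  have eq: "p z = c" if "z \<in> Z" "z - c *s e \<in> I" for z c using uniq[OF p[OF that(1)] that(2)] .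
  have "algebra_char Z p"
    unfolding algebra_char_def
  proof (intro conjI ballI allI)
    show "p e = 1" by (rule eq) (use Zs subspace_0[OF Is(1)] in auto)
    fix x assume x: "x \<in> Z"
    show "p (c *s x) = c * p x" for c
    proof (rule eq)
      have "c *s (x - p x *s e) \<in> I" using p[OF x] subspace_scale[OF Is(1)] by blast
      then show "c *s x - (c * p x) *s e \<in> I" by (simp add: scale_right_diff_distrib)
    qed (use x subspace_scale[OF Zs(1)] in blast)
    fix y assume y: "y \<in> Z"
    show "p (x + y) = p x + p y"
    proof (rule eq)
      have "(x - p x *s e) + (y - p y *s e) \<in> I" using p x y subspace_add[OF Is(1)] by blast
      then show "x + y - (p x + p y) *s e \<in> I" by (simp add: scale_left_distrib algebra_simps)
    qed (use x y subspace_add[OF Zs(1)] in blast)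
    show "p (x \<star> y) = p x * p y"
    proof (rule eq)
      have "(y - p y *s e) \<star> x + p y *s (x - p x *s e) \<in> I"
        using p x y Im subspace_add[OF Is(1)] subspace_scale[OF Is(1)] by blast
      moreover have "(y - p y *s e) \<star> x + p y *s (x - p x *s e) = x \<star> y - (p x * p y) *s e"
        using x Zs(2) comm[OF x y] by (auto simp: mul_diff mul_scale_left scale_right_diff_distrib mult.commute)
      ultimately show "x \<star> y - (p x * p y) *s e \<in> I" by simp
    qed (use x y Zm in blast)
  qed
  then show ?thesis by (rule that)
qed

lemma algebra_charD:
  assumes "algebra_char Z p"
  shows "p e = 1" "\<lbrakk>x \<in> Z; y \<in> Z\<rbrakk> \<Longrightarrow> p (x + y) = p x + p y" "\<lbrakk>x \<in> Z; y \<in> Z\<rbrakk> \<Longrightarrow> p (x \<star> y) = p x * p y"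
    "x \<in> Z \<Longrightarrow> p (c *s x) = c * p x"
  using assms by (auto simp: algebra_char_def)

lemma algebra_char_diff:
  assumes "algebra_char Z p" "subspace Z" "x \<in> Z" "y \<in> Z"
  shows "p (x - y) = p x - p y"
proof -
  have "p (x + (-1) *s y) = p x + (-1) * p y"
    using assms subspace_scale[OF assms(2,4), of "-1"] by (simp only: algebra_charD[OF assms(1)])
  then show ?thesis by simp
qed

lemma algebra_char_sum:
  assumes "algebra_char Z p" "subspace Z" "\<And>i. i \<in> A \<Longrightarrow> f i \<in> Z"
  shows "p (\<Sum>i\<in>A. f i) = (\<Sum>i\<in>A. p (f i))"
proof -
  have p0: "p 0 = 0" using algebra_char_diff[OF assms(1,2), of 0 0] subspace_0[OF assms(2)] by simp
  show ?thesis
    using assms(3)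
    by (induction A rule: infinite_finite_induct)
      (simp_all add: p0 algebra_charD(2)[OF assms(1)] subspace_sum[OF assms(2)])
qed

text \<open>Interpolation: each \<open>\<chi>\<close> contributes a factor linear in an element
  separating it from \<open>q\<close>, scaled to be 1 at \<open>q\<close> and 0 at
  \<open>\<chi>\<close>; the product of these factors serves.\<close>

lemma separating_element:
  assumes Z: "commutative_subalgebra Z" and q: "algebra_char Z q" and "finite Q"
    and Q: "\<And>\<chi>. \<chi> \<in> Q \<Longrightarrow> algebra_char Z \<chi> \<and> (\<exists>z\<in>Z. \<chi> z \<noteq> q z)"
  shows "\<exists>w\<in>Z. q w = 1 \<and> (\<forall>\<chi>\<in>Q. \<chi> w = 0)"
  using \<open>finite Q\<close> Q
proof (induction Q rule: finite_induct)
  case empty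
  then show ?case using Z algebra_charD(1)[OF q] by (auto simp: commutative_subalgebra_def)
next
  case (insert \<chi> Q)
  have Zs: "subspace Z" "e \<in> Z" and Zm: "\<And>x y. \<lbrakk>x \<in> Z; y \<in> Z\<rbrakk> \<Longrightarrow> x \<star> y \<in> Z"
    using Z by (auto simp: commutative_subalgebra_def)
  obtain w where w: "w \<in> Z" "q w = 1" "\<And>\<xi>. \<xi> \<in> Q \<Longrightarrow> \<xi> w = 0" using insert by auto
  obtain z where z: "z \<in> Z" "\<chi> z \<noteq> q z" and \<chi>: "algebra_char Z \<chi>" using insert.prems by blast
  define y where "y = inverse (q z - \<chi> z) *s (z - \<chi> z *s e)"
  have d: "z - \<chi> z *s e \<in> Z" using z Zs by (intro subspace_diff subspace_scale)
  then have y: "y \<in> Z" using Zs by (auto simp: y_def intro: subspace_scale)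
  have ev: "\<xi> y = inverse (q z - \<chi> z) * (\<xi> z - \<chi> z)" if \<xi>: "algebra_char Z \<xi>" for \<xi>
    using d z Zs algebra_char_diff[OF \<xi> Zs(1) z(1) subspace_scale[OF Zs, of "\<chi> z"]]
    by (simp add: y_def algebra_charD[OF \<xi>])
  have "q (y \<star> w) = 1" using ev[OF q] z(2) w(2) algebra_charD(3)[OF q y w(1)] by simp
  moreover have "\<xi> (y \<star> w) = 0" if "\<xi> \<in> insert \<chi> Q" for \<xi>
    using ev[OF \<chi>] w(3) that algebra_charD(3)[OF _ y w(1), of \<xi>] insert.prems by auto
  ultimately show ?case using Zm[OF y w(1)] by blast
qed

text \<open>If \<open>q\<close> were not in the orbit of \<open>p\<close>, an element \<open>w\<close> vanishing at all points of both orbits except \<open>q\<close>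
  would have a scalar trace \<open>\<Sum>k\<in>K. \<alpha> k w\<close> with value \<open>0\<close> at \<open>p\<close> and a positive one at \<open>q\<close>.\<close>

lemma transitive_on_chars:
  assumes Z: "commutative_subalgebra Z" and K: "finite K" "\<o> \<in> K"
    and \<alpha>: "\<And>k z. \<lbrakk>k \<in> K; z \<in> Z\<rbrakk> \<Longrightarrow> \<alpha> k z \<in> Z"
    and char: "\<And>k r. \<lbrakk>k \<in> K; algebra_char Z r\<rbrakk> \<Longrightarrow> algebra_char Z (\<lambda>z. r (\<alpha> k z))"
    and one: "\<And>z. z \<in> Z \<Longrightarrow> \<alpha> \<o> z = z"
    and trace: "\<And>z. z \<in> Z \<Longrightarrow> \<exists>c. (\<Sum>k\<in>K. \<alpha> k z) = c *s e"
    and p: "algebra_char Z p" and q: "algebra_char Z q"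
  shows "\<exists>k\<in>K. \<forall>z\<in>Z. q z = p (\<alpha> k z)"
proof (rule ccontr)
  assume no: "\<not> ?thesis"
  have Zs: "subspace Z" "e \<in> Z" using Z by (auto simp: commutative_subalgebra_def)
  define Q where "Q = (\<lambda>k z. p (\<alpha> k z)) ` K \<union> (\<lambda>k z. q (\<alpha> k z)) ` {k \<in> K. \<exists>z\<in>Z. q (\<alpha> k z) \<noteq> q z}"
  have "\<exists>w\<in>Z. q w = 1 \<and> (\<forall>\<chi>\<in>Q. \<chi> w = 0)"
  proof (rule separating_element[OF Z q])
    show "finite Q" using K by (simp add: Q_def)
    show "algebra_char Z \<chi> \<and> (\<exists>z\<in>Z. \<chi> z \<noteq> q z)" if "\<chi> \<in> Q" for \<chi>
    proof -
      from that consider k where "k \<in> K" "\<chi> = (\<lambda>z. p (\<alpha> k z))"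
        | k where "k \<in> K" "\<chi> = (\<lambda>z. q (\<alpha> k z))" "\<exists>z\<in>Z. q (\<alpha> k z) \<noteq> q z"
        by (auto simp: Q_def)
      then show ?thesis
      proof cases
        case 1
        then show ?thesis using no char[OF _ p, of k] by metis
      next
        case 2
        then show ?thesis using char[OF _ q, of k] by metis
      qed
    qed
  qed
  then obtain w where w: "w \<in> Z" "q w = 1" "\<And>\<chi>. \<chi> \<in> Q \<Longrightarrow> \<chi> w = 0" by blast
  obtain c where c: "(\<Sum>k\<in>K. \<alpha> k w) = c *s e" using trace[OF w(1)] by blast
  have "c = p (\<Sum>k\<in>K. \<alpha> k w)" using algebra_charD[OF p] Zs(2) by (simp add: c)
  also have "\<dots> = (\<Sum>k\<in>K. p (\<alpha> k w))" using \<alpha> w(1) by (intro algebra_char_sum[OF p Zs(1)]) auto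
  also have "\<dots> = 0" using w(3) by (intro sum.neutral) (auto simp: Q_def)
  finally have "c = 0" .
  have "c = q (\<Sum>k\<in>K. \<alpha> k w)" using algebra_charD[OF q] Zs(2) by (simp add: c)
  also have "\<dots> = (\<Sum>k\<in>K. q (\<alpha> k w))" using \<alpha> w(1) by (intro algebra_char_sum[OF q Zs(1)]) auto
  \<comment> \<open>Translates of \<open>q\<close> different from \<open>q\<close> lie in
    \<open>Q\<close> and vanish at \<open>w\<close>; the others give 1, and \<open>\<o>\<close>
    yields one of them.\<close>
  also have "\<dots> = (\<Sum>k\<in>K. of_bool (\<forall>z\<in>Z. q (\<alpha> k z) = q z))"
  proof (rule sum.cong)
    fix k assume k: "k \<in> K"
    show "q (\<alpha> k w) = of_bool (\<forall>z\<in>Z. q (\<alpha> k z) = q z)"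
    proof (cases "\<forall>z\<in>Z. q (\<alpha> k z) = q z")
      case False
      then have "(\<lambda>z. q (\<alpha> k z)) \<in> Q" using k by (auto simp: Q_def)
      then show ?thesis using w(3) False by auto
    qed (use w in auto)
  qed simp
  also have "\<dots> = of_nat (card {k \<in> K. \<forall>z\<in>Z. q (\<alpha> k z) = q z})"
    using K by (simp add: sum.If_cases of_bool_def Int_def)
  finally have "card {k \<in> K. \<forall>z\<in>Z. q (\<alpha> k z) = q z} = 0" using \<open>c = 0\<close> by simp
  moreover have "\<o> \<in> {k \<in> K. \<forall>z\<in>Z. q (\<alpha> k z) = q z}" using K one by simp
  ultimately show False using K(1) by auto
qed

end

section \<open>Bi-Galois algebras\<close>

text \<open>The tensors \<open>\<Sum>i. l i \<otimes> r g i\<close> describe the inverse of the Galois map sending \<open>x \<otimes> y\<close> to the family of all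
  \<open>x \<star> \<sigma> k y\<close>: the tensor at \<open>g\<close> is the preimage of the unit vector at \<open>g\<close> by \<open>galois\<close>, and the expansion of
  \<open>e \<otimes> y\<close> in the images of these tensors gives \<open>galois'\<close> when \<open>z\<close> is inserted between the factors.\<close>

locale bigalois =
  complex_algebra scale mul M e B + G: group G + H: group H
  for G :: "('a, 'c) monoid_scheme" (structure) and H :: "('b, 'd) monoid_scheme"
    and scale :: "complex \<Rightarrow> 'v::ab_group_add \<Rightarrow> 'v" (infixr \<open>*s\<close> 75)
    and mul :: "'v \<Rightarrow> 'v \<Rightarrow> 'v" (infixl \<open>\<star>\<close> 76) and M :: "'v set" and e :: 'v and B :: "'v set" +
  fixes \<sigma> :: "'a \<Rightarrow> 'v \<Rightarrow> 'v" and \<tau> :: "'b \<Rightarrow> 'v \<Rightarrow> 'v"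
    and I :: "nat set" and l :: "nat \<Rightarrow> 'v" and r :: "'a \<Rightarrow> nat \<Rightarrow> 'v"
  assumes finG: "finite (carrier G)" and finH: "finite (carrier H)"
    and card_GH: "card (carrier G) \<le> card (carrier H)"
    and sg_M: "g \<in> carrier G \<Longrightarrow> x \<in> M \<Longrightarrow> \<sigma> g x \<in> M"
    and tau_M: "h \<in> carrier H \<Longrightarrow> x \<in> M \<Longrightarrow> \<tau> h x \<in> M"
    and sg_add: "g \<in> carrier G \<Longrightarrow> \<sigma> g (x + y) = \<sigma> g x + \<sigma> g y"
    and tau_add: "h \<in> carrier H \<Longrightarrow> \<tau> h (x + y) = \<tau> h x + \<tau> h y"
    and sg_scale: "g \<in> carrier G \<Longrightarrow> \<sigma> g (c *s x) = c *s \<sigma> g x"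
    and tau_scale: "h \<in> carrier H \<Longrightarrow> \<tau> h (c *s x) = c *s \<tau> h x"
    and sg_mul: "g \<in> carrier G \<Longrightarrow> x \<in> M \<Longrightarrow> y \<in> M \<Longrightarrow> \<sigma> g (x \<star> y) = \<sigma> g x \<star> \<sigma> g y"
    and tau_mul: "h \<in> carrier H \<Longrightarrow> x \<in> M \<Longrightarrow> y \<in> M \<Longrightarrow> \<tau> h (x \<star> y) = \<tau> h x \<star> \<tau> h y"
    and sg_e: "g \<in> carrier G \<Longrightarrow> \<sigma> g e = e"
    and tau_e: "h \<in> carrier H \<Longrightarrow> \<tau> h e = e"
    and sg_comp: "g \<in> carrier G \<Longrightarrow> g' \<in> carrier G \<Longrightarrow> x \<in> M \<Longrightarrow> \<sigma> (g \<otimes> g') x = \<sigma> g (\<sigma> g' x)"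
    and tau_comp: "h \<in> carrier H \<Longrightarrow> h' \<in> carrier H \<Longrightarrow> x \<in> M \<Longrightarrow> \<tau> (h \<otimes>\<^bsub>H\<^esub> h') x = \<tau> h (\<tau> h' x)"
    and sg_one: "x \<in> M \<Longrightarrow> \<sigma> \<one> x = x"
    and tau_one: "x \<in> M \<Longrightarrow> \<tau> \<one>\<^bsub>H\<^esub> x = x"
    and sg_tau: "g \<in> carrier G \<Longrightarrow> h \<in> carrier H \<Longrightarrow> x \<in> M \<Longrightarrow> \<sigma> g (\<tau> h x) = \<tau> h (\<sigma> g x)"
    and fixed_G: "x \<in> M \<Longrightarrow> (\<And>g. g \<in> carrier G \<Longrightarrow> \<sigma> g x = x) \<Longrightarrow> \<exists>c. x = c *s e"
    and fixed_H: "x \<in> M \<Longrightarrow> (\<And>h. h \<in> carrier H \<Longrightarrow> \<tau> h x = x) \<Longrightarrow> \<exists>c. x = c *s e"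
    and faithful_H: "h \<in> carrier H \<Longrightarrow> (\<And>x. x \<in> M \<Longrightarrow> \<tau> h x = x) \<Longrightarrow> h = \<one>\<^bsub>H\<^esub>"
    and r_M: "g \<in> carrier G \<Longrightarrow> i \<in> I \<Longrightarrow> r g i \<in> M"
    and galois: "g \<in> carrier G \<Longrightarrow> k \<in> carrier G \<Longrightarrow> (\<Sum>i\<in>I. l i \<star> \<sigma> k (r g i)) = (if g = k then e else 0)"
    and galois': "z \<in> M \<Longrightarrow> y \<in> M \<Longrightarrow> z \<star> y = (\<Sum>g\<in>carrier G. \<sigma> g y \<star> (\<Sum>i\<in>I. l i \<star> z \<star> r g i))"
begin

sublocale P: group "G \<times>\<times> H"
  by (rule DirProd_group) unfold_locales

lemmas M_closed = subspace_0[OF subspace_M] subspace_add[OF subspace_M] subspace_scale[OF subspace_M]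
  subspace_diff[OF subspace_M] subspace_sum[OF subspace_M]

lemma sg_zero: "g \<in> carrier G \<Longrightarrow> \<sigma> g 0 = 0"
  using sg_scale[of g 0 0] by simp

lemma sg_sum: "g \<in> carrier G \<Longrightarrow> \<sigma> g (\<Sum>i\<in>A. f i) = (\<Sum>i\<in>A. \<sigma> g (f i))"
  by (induction A rule: infinite_finite_induct) (simp_all add: sg_zero sg_add)

lemma tau_zero: "h \<in> carrier H \<Longrightarrow> \<tau> h 0 = 0"
  using tau_scale[of h 0 0] by simp

lemma sg_diff: "g \<in> carrier G \<Longrightarrow> \<sigma> g (x - y) = \<sigma> g x - \<sigma> g y"
  using sg_add[of g "x - y" y] by (simp add: algebra_simps)

lemma tau_diff: "h \<in> carrier H \<Longrightarrow> \<tau> h (x - y) = \<tau> h x - \<tau> h y"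
  using tau_add[of h "x - y" y] by (simp add: algebra_simps)

lemma sg_inv: "g \<in> carrier G \<Longrightarrow> x \<in> M \<Longrightarrow> \<sigma> g (\<sigma> (inv g) x) = x" "g \<in> carrier G \<Longrightarrow> x \<in> M \<Longrightarrow> \<sigma> (inv g) (\<sigma> g x) = x"
  by (simp_all flip: sg_comp add: sg_one)

lemma tau_inv: "h \<in> carrier H \<Longrightarrow> x \<in> M \<Longrightarrow> \<tau> h (\<tau> (inv\<^bsub>H\<^esub> h) x) = x"
  "h \<in> carrier H \<Longrightarrow> x \<in> M \<Longrightarrow> \<tau> (inv\<^bsub>H\<^esub> h) (\<tau> h x) = x"
  by (simp_all flip: tau_comp add: tau_one)

definition act :: "'a \<times> 'b \<Rightarrow> 'v \<Rightarrow> 'v" where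
  "act \<gamma> x = \<sigma> (fst \<gamma>) (\<tau> (snd \<gamma>) x)"

lemma act_M: "\<gamma> \<in> carrier (G \<times>\<times> H) \<Longrightarrow> x \<in> M \<Longrightarrow> act \<gamma> x \<in> M"
  by (auto simp: act_def sg_M tau_M)

lemma act_add: "\<gamma> \<in> carrier (G \<times>\<times> H) \<Longrightarrow> act \<gamma> (x + y) = act \<gamma> x + act \<gamma> y"
  by (auto simp: act_def sg_add tau_add)

lemma act_scale: "\<gamma> \<in> carrier (G \<times>\<times> H) \<Longrightarrow> act \<gamma> (c *s x) = c *s act \<gamma> x"
  by (auto simp: act_def sg_scale tau_scale)

lemma act_mul: "\<gamma> \<in> carrier (G \<times>\<times> H) \<Longrightarrow> x \<in> M \<Longrightarrow> y \<in> M \<Longrightarrow> act \<gamma> (x \<star> y) = act \<gamma> x \<star> act \<gamma> y"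
  by (auto simp: act_def sg_mul tau_mul tau_M)

lemma act_e: "\<gamma> \<in> carrier (G \<times>\<times> H) \<Longrightarrow> act \<gamma> e = e"
  by (auto simp: act_def sg_e tau_e)

lemma act_comp:
  "\<gamma> \<in> carrier (G \<times>\<times> H) \<Longrightarrow> \<delta> \<in> carrier (G \<times>\<times> H) \<Longrightarrow> x \<in> M \<Longrightarrow> act (\<gamma> \<otimes>\<^bsub>G \<times>\<times> H\<^esub> \<delta>) x = act \<gamma> (act \<delta> x)"
  by (auto simp: act_def sg_comp tau_comp sg_tau sg_M tau_M)

lemma act_one: "x \<in> M \<Longrightarrow> act \<one>\<^bsub>G \<times>\<times> H\<^esub> x = x"
  by (simp add: act_def sg_one tau_one tau_M)

lemma act_inv:
  assumes "\<gamma> \<in> carrier (G \<times>\<times> H)" "x \<in> M"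
  shows "act \<gamma> (act (inv\<^bsub>G \<times>\<times> H\<^esub> \<gamma>) x) = x" "act (inv\<^bsub>G \<times>\<times> H\<^esub> \<gamma>) (act \<gamma> x) = x"
  using act_comp[OF assms(1) P.inv_closed[OF assms(1)] assms(2)] act_comp[OF P.inv_closed[OF assms(1)] assms]
    act_one[OF assms(2)] P.r_inv[OF assms(1)] P.l_inv[OF assms(1)] by metis+

text \<open>The Miyashita--Ulbrich grading; its part of degree \<open>\<one>\<close> is the centre of \<open>M\<close>.\<close>

definition hom_part :: "'a \<Rightarrow> 'v set" where
  "hom_part s = {x \<in> M. \<forall>y\<in>M. x \<star> y = \<sigma> s y \<star> x}"

lemma hom_partI: "\<lbrakk>x \<in> M; \<And>y. y \<in> M \<Longrightarrow> x \<star> y = \<sigma> s y \<star> x\<rbrakk> \<Longrightarrow> x \<in> hom_part s"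
  by (auto simp: hom_part_def)

lemma hom_partD: "x \<in> hom_part s \<Longrightarrow> x \<in> M" "\<lbrakk>x \<in> hom_part s; y \<in> M\<rbrakk> \<Longrightarrow> x \<star> y = \<sigma> s y \<star> x"
  by (auto simp: hom_part_def)

lemma subspace_hom_part: "subspace (hom_part s)"
  by (rule subspaceI) (auto simp: hom_part_def M_closed mul_add_left mul_add_right mul_scale_left mul_scale_right)

lemma hom_part_mul:
  assumes "s \<in> carrier G" "t \<in> carrier G" "x \<in> hom_part s" "y \<in> hom_part t"
  shows "x \<star> y \<in> hom_part (s \<otimes> t)"
proof (rule hom_partI)
  fix z assume z: "z \<in> M"
  have "x \<star> y \<star> z = x \<star> (\<sigma> t z \<star> y)" using hom_partD(2)[OF assms(4) z] by (simp add: mul_assoc)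
  also have "\<dots> = x \<star> \<sigma> t z \<star> y" by (simp add: mul_assoc)
  also have "\<dots> = \<sigma> s (\<sigma> t z) \<star> x \<star> y" using hom_partD(2)[OF assms(3) sg_M[OF assms(2) z]] by simp
  finally show "x \<star> y \<star> z = \<sigma> (s \<otimes> t) z \<star> (x \<star> y)" using assms z by (simp add: sg_comp mul_assoc)
qed simp

lemma e_hom_part: "e \<in> hom_part \<one>"
  by (rule hom_partI) (auto simp: sg_one)

lemma hom_part_act:
  assumes \<gamma>: "\<gamma> \<in> carrier (G \<times>\<times> H)" and s: "s \<in> carrier G" and x: "x \<in> hom_part s"
  shows "act \<gamma> x \<in> hom_part (conjg G (fst \<gamma>) s)"
proof (rule hom_partI)
  show "act \<gamma> x \<in> M" using act_M[OF \<gamma> hom_partD(1)[OF x]] .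
  fix y assume y: "y \<in> M"
  have gh: "fst \<gamma> \<in> carrier G" "snd \<gamma> \<in> carrier H" using \<gamma> by auto
  \<comment> \<open>\<open>z\<close> is the preimage of \<open>y\<close> under
    \<open>\<gamma>\<close>, to which the relation defining the degree of \<open>x\<close>
    applies.\<close>
  define z where "z = \<sigma> (inv (fst \<gamma>)) (\<tau> (inv\<^bsub>H\<^esub> (snd \<gamma>)) y)"
  have z: "z \<in> M" using gh y by (auto simp: z_def sg_M tau_M)
  have az: "act \<gamma> z = y" using gh y by (simp add: act_def z_def sg_tau[symmetric] tau_M sg_inv tau_inv)
  have "act \<gamma> (\<sigma> s z) = \<sigma> (fst \<gamma>) (\<sigma> s (\<sigma> (inv (fst \<gamma>)) y))"
    using gh y s by (simp add: act_def z_def sg_tau[symmetric] sg_M tau_M tau_inv)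
  also have "\<dots> = \<sigma> (conjg G (fst \<gamma>) s) y" using gh y s by (simp add: conjg_def sg_comp sg_M)
  finally have sz: "act \<gamma> (\<sigma> s z) = \<sigma> (conjg G (fst \<gamma>) s) y" .
  have "act \<gamma> x \<star> y = act \<gamma> (x \<star> z)" using act_mul[OF \<gamma> hom_partD(1)[OF x] z] az by simp
  also have "\<dots> = act \<gamma> (\<sigma> s z \<star> x)" using hom_partD(2)[OF x z] by simp
  also have "\<dots> = act \<gamma> (\<sigma> s z) \<star> act \<gamma> x" using act_mul[OF \<gamma> sg_M[OF s z] hom_partD(1)[OF x]] .
  finally show "act \<gamma> x \<star> y = \<sigma> (conjg G (fst \<gamma>) s) y \<star> act \<gamma> x" using sz by simp
qed

lemma hom_part_sg:
  "\<lbrakk>g \<in> carrier G; s \<in> carrier G; x \<in> hom_part s\<rbrakk> \<Longrightarrow> \<sigma> g x \<in> hom_part (conjg G g s)"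
  using hom_part_act[of "(g, \<one>\<^bsub>H\<^esub>)" s x] hom_partD(1)[of x s] by (simp add: act_def tau_one)

lemma hom_part_tau:
  "\<lbrakk>h \<in> carrier H; s \<in> carrier G; x \<in> hom_part s\<rbrakk> \<Longrightarrow> \<tau> h x \<in> hom_part s"
  using hom_part_act[of "(\<one>, h)" s x] hom_partD(1)[of x s] by (simp add: act_def sg_one tau_M)

text \<open>Inserting \<open>z\<close> between the factors of the Galois tensor at \<open>g\<close>
  turns out to be the projection onto degree \<open>g\<close>.\<close>

definition \<pi> :: "'a \<Rightarrow> 'v \<Rightarrow> 'v" where
  "\<pi> g z = (\<Sum>i\<in>I. l i \<star> z \<star> r g i)"

text \<open>\<open>galois'\<close> expands \<open>z \<star> (r g i \<star> y)\<close> over all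
  \<open>k\<close>, and \<open>galois\<close> keeps only the term \<open>k = g\<close>.\<close>

lemma pi_hom_part:
  assumes g: "g \<in> carrier G" and z: "z \<in> M"
  shows "\<pi> g z \<in> hom_part g"
proof (rule hom_partI)
  show "\<pi> g z \<in> M" unfolding \<pi>_def by (intro M_closed mul_M)
  fix y assume y: "y \<in> M"
  have "\<pi> g z \<star> y = (\<Sum>i\<in>I. l i \<star> (z \<star> (r g i \<star> y)))" by (simp add: \<pi>_def mul_sum_left mul_assoc)
  also have "\<dots> = (\<Sum>i\<in>I. \<Sum>k\<in>carrier G. l i \<star> \<sigma> k (r g i) \<star> (\<sigma> k y \<star> \<pi> k z))"
  proof (rule sum.cong)
    fix i assume i: "i \<in> I"
    have "z \<star> (r g i \<star> y) = (\<Sum>k\<in>carrier G. \<sigma> k (r g i) \<star> \<sigma> k y \<star> \<pi> k z)"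
      using galois'[OF z, of "r g i \<star> y"] sg_mul r_M[OF g i] y by (simp add: \<pi>_def)
    then show "l i \<star> (z \<star> (r g i \<star> y)) = (\<Sum>k\<in>carrier G. l i \<star> \<sigma> k (r g i) \<star> (\<sigma> k y \<star> \<pi> k z))"
      by (simp add: mul_sum_right mul_assoc)
  qed simp
  also have "\<dots> = (\<Sum>k\<in>carrier G. (\<Sum>i\<in>I. l i \<star> \<sigma> k (r g i)) \<star> (\<sigma> k y \<star> \<pi> k z))"
    by (subst sum.swap) (simp add: mul_sum_left)
  also have "\<dots> = (\<Sum>k\<in>carrier G. if g = k then \<sigma> k y \<star> \<pi> k z else 0)"
    by (rule sum.cong) (auto simp: galois g)
  also have "\<dots> = \<sigma> g y \<star> \<pi> g z" using finG g by (simp add: sum.delta)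
  finally show "\<pi> g z \<star> y = \<sigma> g y \<star> \<pi> g z" .
qed

text \<open>The case \<open>y = e\<close> of \<open>galois'\<close>.\<close>

lemma sum_pi: "z \<in> M \<Longrightarrow> (\<Sum>g\<in>carrier G. \<pi> g z) = z"
proof -
  assume z: "z \<in> M"
  have "e \<star> \<pi> g z = \<pi> g z" if "g \<in> carrier G" for g using hom_partD(1)[OF pi_hom_part[OF that z]] by simp
  then show ?thesis using galois'[OF z e_M] z by (simp add: \<pi>_def sg_e)
qed

text \<open>Moving \<open>z\<close> to the right past \<open>r g i\<close> produces the sum that
  \<open>galois\<close> evaluates.\<close>

lemma pi_of_hom_part:
  assumes g: "g \<in> carrier G" and s: "s \<in> carrier G" and z: "z \<in> hom_part s"
  shows "\<pi> g z = (if g = s then z else 0)"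
proof -
  have "\<pi> g z = (\<Sum>i\<in>I. l i \<star> \<sigma> s (r g i)) \<star> z"
    using hom_partD(2)[OF z r_M[OF g]] by (simp add: \<pi>_def mul_sum_left mul_assoc)
  then show ?thesis using galois[OF g s] hom_partD(1)[OF z] by simp
qed

lemma pi_sum: "\<pi> g (\<Sum>i\<in>A. f i) = (\<Sum>i\<in>A. \<pi> g (f i))"
  unfolding \<pi>_def by (subst sum.swap) (simp add: mul_sum_left mul_sum_right)

text \<open>\<open>\<sigma> k\<close> conjugates degrees, so it maps degree \<open>\<one>\<close> to
  itself and no other degree to \<open>\<one>\<close>.\<close>

lemma pi_one_sg:
  assumes k: "k \<in> carrier G" and z: "z \<in> M"
  shows "\<pi> \<one> (\<sigma> k z) = \<sigma> k (\<pi> \<one> z)"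
proof -
  have "\<sigma> k z = (\<Sum>g\<in>carrier G. \<sigma> k (\<pi> g z))" using sum_pi[OF z] sg_sum[OF k] by metis
  then have "\<pi> \<one> (\<sigma> k z) = (\<Sum>g\<in>carrier G. \<pi> \<one> (\<sigma> k (\<pi> g z)))" by (simp add: pi_sum)
  also have "\<dots> = (\<Sum>g\<in>carrier G. if g = \<one> then \<sigma> k (\<pi> g z) else 0)"
  proof (rule sum.cong)
    fix g assume g: "g \<in> carrier G"
    have "\<sigma> k (\<pi> g z) \<in> hom_part (conjg G k g)" using hom_part_sg[OF k g pi_hom_part[OF g z]] .
    then have "\<pi> \<one> (\<sigma> k (\<pi> g z)) = (if \<one> = conjg G k g then \<sigma> k (\<pi> g z) else 0)"
      using pi_of_hom_part k g by simp
    moreover have "\<one> = conjg G k g \<longleftrightarrow> g = \<one>" using G.conj_inv_left[OF k g] k by (metis G.conj_one G.inv_closed)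
    ultimately show "\<pi> \<one> (\<sigma> k (\<pi> g z)) = (if g = \<one> then \<sigma> k (\<pi> g z) else 0)" by simp
  qed simp
  also have "\<dots> = \<sigma> k (\<pi> \<one> z)" using finG by (simp add: sum.delta)
  finally show ?thesis .
qed

section \<open>Traces, and transitivity on the characters of the centre\<close>

lemma trace_G:
  assumes "z \<in> M"
  shows "\<exists>c. (\<Sum>k\<in>carrier G. \<sigma> k z) = c *s e"
proof (rule fixed_G)
  show "(\<Sum>k\<in>carrier G. \<sigma> k z) \<in> M" using assms by (intro M_closed sg_M)
  fix g assume g: "g \<in> carrier G"
  have "\<sigma> g (\<Sum>k\<in>carrier G. \<sigma> k z) = (\<Sum>k\<in>carrier G. \<sigma> (g \<otimes> k) z)"
    using g assms by (simp add: sg_sum sg_comp)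
  also have "\<dots> = (\<Sum>k\<in>carrier G. \<sigma> k z)"
    by (rule sum.reindex_bij_betw[OF G.bij_betw_mult_subgroup[OF G.subgroup_self g]])
  finally show "\<sigma> g (\<Sum>k\<in>carrier G. \<sigma> k z) = (\<Sum>k\<in>carrier G. \<sigma> k z)" .
qed

lemma tau_sum: "h \<in> carrier H \<Longrightarrow> \<tau> h (\<Sum>i\<in>A. f i) = (\<Sum>i\<in>A. \<tau> h (f i))"
  by (induction A rule: infinite_finite_induct) (simp_all add: tau_zero tau_add)

lemma trace_H:
  assumes "z \<in> M"
  shows "\<exists>c. (\<Sum>k\<in>carrier H. \<tau> k z) = c *s e"
proof (rule fixed_H)
  show "(\<Sum>k\<in>carrier H. \<tau> k z) \<in> M" using assms by (intro M_closed tau_M)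
  fix g assume g: "g \<in> carrier H"
  have "\<tau> g (\<Sum>k\<in>carrier H. \<tau> k z) = (\<Sum>k\<in>carrier H. \<tau> (g \<otimes>\<^bsub>H\<^esub> k) z)"
    using g assms by (simp add: tau_sum tau_comp)
  also have "\<dots> = (\<Sum>k\<in>carrier H. \<tau> k z)"
    by (rule sum.reindex_bij_betw[OF H.bij_betw_mult_subgroup[OF H.subgroup_self g]])
  finally show "\<tau> g (\<Sum>k\<in>carrier H. \<tau> k z) = (\<Sum>k\<in>carrier H. \<tau> k z)" .
qed

text \<open>The trace form is nondegenerate: \<open>x\<close> is recovered as the sum of the
  products of \<open>l i\<close> with the trace of \<open>r \<one> i \<star> x\<close>, so one of
  these traces is nonzero. Being scalar, it has degree \<open>\<one>\<close>, so only the part of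
  \<open>r \<one> i\<close> of degree \<open>inv s\<close> contributes.\<close>

lemma trace_nonzero:
  assumes s: "s \<in> carrier G" and x: "x \<in> hom_part s" "x \<noteq> 0"
  obtains b c where "b \<in> hom_part (inv s)" "c \<noteq> 0" "(\<Sum>k\<in>carrier G. \<sigma> k (b \<star> x)) = c *s e"
proof -
  have xM: "x \<in> M" using hom_partD(1)[OF x(1)] .
  have "(\<Sum>i\<in>I. l i \<star> (\<Sum>k\<in>carrier G. \<sigma> k (r \<one> i \<star> x))) =
      (\<Sum>i\<in>I. \<Sum>k\<in>carrier G. l i \<star> \<sigma> k (r \<one> i) \<star> \<sigma> k x)"
    using r_M[OF G.one_closed] xM by (simp add: mul_sum_right sg_mul mul_assoc)
  also have "\<dots> = (\<Sum>k\<in>carrier G. (\<Sum>i\<in>I. l i \<star> \<sigma> k (r \<one> i)) \<star> \<sigma> k x)"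
    by (subst sum.swap) (simp add: mul_sum_left)
  also have "\<dots> = (\<Sum>k\<in>carrier G. if k = \<one> then x else 0)"
    by (rule sum.cong) (auto simp: galois xM sg_one)
  also have "\<dots> = x" using finG by (simp add: sum.delta)
  finally have "(\<Sum>i\<in>I. l i \<star> (\<Sum>k\<in>carrier G. \<sigma> k (r \<one> i \<star> x))) \<noteq> 0" using x(2) by simp
  then obtain i where i: "i \<in> I" "l i \<star> (\<Sum>k\<in>carrier G. \<sigma> k (r \<one> i \<star> x)) \<noteq> 0" by (meson sum.neutral)
  define a where "a = r \<one> i"
  have a: "a \<in> M" unfolding a_def using r_M[OF G.one_closed i(1)] .
  obtain c where c: "(\<Sum>k\<in>carrier G. \<sigma> k (a \<star> x)) = c *s e" using trace_G[OF mul_M] by blast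
  have "c \<noteq> 0" using i(2) c by (auto simp: a_def)
  define b where "b = \<pi> (inv s) a"
  have b: "b \<in> hom_part (inv s)" unfolding b_def using pi_hom_part[OF _ a] s by simp
  have "\<pi> \<one> (a \<star> x) = (\<Sum>g\<in>carrier G. \<pi> \<one> (\<pi> g a \<star> x))"
    using sum_pi[OF a] pi_sum[of \<one> "\<lambda>g. \<pi> g a \<star> x" "carrier G"] by (simp flip: mul_sum_left)
  also have "\<dots> = (\<Sum>g\<in>carrier G. if g = inv s then \<pi> g a \<star> x else 0)"
  proof (rule sum.cong)
    fix g assume g: "g \<in> carrier G"
    have "\<pi> g a \<star> x \<in> hom_part (g \<otimes> s)" using hom_part_mul[OF g s pi_hom_part[OF g a] x(1)] .
    then have "\<pi> \<one> (\<pi> g a \<star> x) = (if \<one> = g \<otimes> s then \<pi> g a \<star> x else 0)" using pi_of_hom_part g s by simp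
    moreover have "\<one> = g \<otimes> s \<longleftrightarrow> g = inv s" using g s G.inv_equality[of g s] by auto
    ultimately show "\<pi> \<one> (\<pi> g a \<star> x) = (if g = inv s then \<pi> g a \<star> x else 0)" by simp
  qed simp
  also have "\<dots> = b \<star> x" using finG s by (simp add: sum.delta b_def)
  finally have bx: "\<pi> \<one> (a \<star> x) = b \<star> x" .
  have ce: "c *s e \<in> hom_part \<one>" using e_hom_part subspace_scale[OF subspace_hom_part] by blast
  have "(\<Sum>k\<in>carrier G. \<sigma> k (b \<star> x)) = (\<Sum>k\<in>carrier G. \<pi> \<one> (\<sigma> k (a \<star> x)))"
    by (simp add: pi_one_sg bx)
  also have "\<dots> = \<pi> \<one> (c *s e)" by (simp flip: pi_sum add: c)
  also have "\<dots> = c *s e" using pi_of_hom_part[OF _ _ ce] by simp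
  finally show ?thesis using that[OF b \<open>c \<noteq> 0\<close>] by blast
qed

text \<open>For a trivial \<open>\<sigma> g\<close> the sum in \<open>galois\<close> could not tell
  \<open>g\<close> from \<open>\<one>\<close>.\<close>

lemma sg_faithful:
  assumes g: "g \<in> carrier G" and triv: "\<And>x. x \<in> M \<Longrightarrow> \<sigma> g x = x"
  shows "g = \<one>"
proof (rule ccontr)
  assume "g \<noteq> \<one>"
  then have "(\<Sum>i\<in>I. l i \<star> \<sigma> g (r \<one> i)) = 0" using galois[OF G.one_closed g] by simp
  moreover have "(\<Sum>i\<in>I. l i \<star> \<sigma> g (r \<one> i)) = (\<Sum>i\<in>I. l i \<star> \<sigma> \<one> (r \<one> i))"
    using r_M[OF G.one_closed] by (intro sum.cong) (simp_all add: triv sg_one)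
  ultimately show False using galois[OF G.one_closed G.one_closed] e_nonzero by simp
qed

lemma commutative_center: "commutative_subalgebra (hom_part \<one>)"
  unfolding commutative_subalgebra_def
proof (intro conjI ballI)
  fix x y assume xy: "x \<in> hom_part \<one>" "y \<in> hom_part \<one>"
  show "x \<star> y \<in> hom_part \<one>" using hom_part_mul[OF _ _ xy] by simp
  show "x \<star> y = y \<star> x" using hom_partD(2)[OF xy(1) hom_partD(1)[OF xy(2)]] hom_partD(1)[OF xy(2)] by (simp add: sg_one)
qed (auto simp: subspace_hom_part hom_partD(1) e_hom_part)

lemma center_act: "\<lbrakk>\<gamma> \<in> carrier (G \<times>\<times> H); x \<in> hom_part \<one>\<rbrakk> \<Longrightarrow> act \<gamma> x \<in> hom_part \<one>"
  using hom_part_act[of \<gamma> \<one> x] by auto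

lemma char_act:
  assumes \<gamma>: "\<gamma> \<in> carrier (G \<times>\<times> H)" and p: "algebra_char (hom_part \<one>) p"
  shows "algebra_char (hom_part \<one>) (\<lambda>z. p (act \<gamma> z))"
  unfolding algebra_char_def
  using center_act[OF \<gamma>] algebra_charD[OF p] act_e[OF \<gamma>] act_add[OF \<gamma>] act_scale[OF \<gamma>] act_mul[OF \<gamma>] hom_partD(1)
  by auto

lemma chars_conj_G:
  assumes "algebra_char (hom_part \<one>) p" "algebra_char (hom_part \<one>) q"
  shows "\<exists>g\<in>carrier G. \<forall>z\<in>hom_part \<one>. q z = p (\<sigma> g z)"
proof (rule transitive_on_chars[OF commutative_center finG G.one_closed])
  have eq: "\<sigma> g z = act (g, \<one>\<^bsub>H\<^esub>) z" if "z \<in> hom_part \<one>" for g z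
    using hom_partD(1)[OF that] by (simp add: act_def tau_one)
  show "algebra_char (hom_part \<one>) (\<lambda>z. r (\<sigma> k z))" if "k \<in> carrier G" "algebra_char (hom_part \<one>) r" for k r
    using char_act[OF _ that(2), of "(k, \<one>\<^bsub>H\<^esub>)"] that(1) commutative_center
    by (simp add: algebra_char_def commutative_subalgebra_def subspace_add subspace_scale flip: eq)
  show "\<sigma> k z \<in> hom_part \<one>" if "k \<in> carrier G" "z \<in> hom_part \<one>" for k z
    using hom_part_sg[OF that(1) G.one_closed that(2)] that(1) by simp
qed (use assms trace_G hom_partD(1) sg_one in auto)

lemma chars_conj_H:
  assumes "algebra_char (hom_part \<one>) p" "algebra_char (hom_part \<one>) q"
  shows "\<exists>h\<in>carrier H. \<forall>z\<in>hom_part \<one>. q z = p (\<tau> h z)"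
proof (rule transitive_on_chars[OF commutative_center finH H.one_closed])
  have eq: "\<tau> h z = act (\<one>, h) z" if "z \<in> hom_part \<one>" "h \<in> carrier H" for h z
    using hom_partD(1)[OF that(1)] that(2) by (simp add: act_def sg_one tau_M)
  show "algebra_char (hom_part \<one>) (\<lambda>z. r (\<tau> k z))" if "k \<in> carrier H" "algebra_char (hom_part \<one>) r" for k r
    using char_act[OF _ that(2), of "(\<one>, k)"] that(1) commutative_center
    by (simp add: algebra_char_def commutative_subalgebra_def subspace_add subspace_scale flip: eq)
qed (use assms trace_H hom_partD(1) hom_part_tau tau_one in auto)

end

locale pointed_bigalois =
  bigalois G H scale mul M e B \<sigma> \<tau> I l r
  for G :: "('a, 'c) monoid_scheme" (structure) and H :: "('b, 'd) monoid_scheme"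
    and scale :: "complex \<Rightarrow> 'v::ab_group_add \<Rightarrow> 'v" (infixr \<open>*s\<close> 75)
    and mul :: "'v \<Rightarrow> 'v \<Rightarrow> 'v" (infixl \<open>\<star>\<close> 76) and M :: "'v set" and e :: 'v and B :: "'v set"
    and \<sigma> :: "'a \<Rightarrow> 'v \<Rightarrow> 'v" and \<tau> :: "'b \<Rightarrow> 'v \<Rightarrow> 'v"
    and I :: "nat set" and l :: "nat \<Rightarrow> 'v" and r :: "'a \<Rightarrow> nat \<Rightarrow> 'v" +
  fixes p :: "'v \<Rightarrow> complex"
  assumes p: "algebra_char (hom_part \<one>) p"
begin

lemmas p_e = algebra_charD(1)[OF p] and p_add = algebra_charD(2)[OF p]
  and p_mul = algebra_charD(3)[OF p] and p_scale = algebra_charD(4)[OF p]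

lemma p_diff: "\<lbrakk>x \<in> hom_part \<one>; y \<in> hom_part \<one>\<rbrakk> \<Longrightarrow> p (x - y) = p x - p y"
  by (rule algebra_char_diff[OF p subspace_hom_part])

lemma p_zero: "p 0 = 0"
  using p_diff[of 0 0] subspace_0[OF subspace_hom_part] by simp

lemma conj_sg_char: "g \<in> carrier G \<Longrightarrow> \<exists>h\<in>carrier H. \<forall>z\<in>hom_part \<one>. p (\<sigma> g z) = p (\<tau> h z)"
proof -
  assume g: "g \<in> carrier G"
  have "algebra_char (hom_part \<one>) (\<lambda>z. p (act (g, \<one>\<^bsub>H\<^esub>) z))" using char_act[OF _ p] g by simp
  from chars_conj_H[OF p this] show ?thesis using hom_partD(1) by (auto simp: act_def tau_one)
qed

lemma conj_tau_char: "h \<in> carrier H \<Longrightarrow> \<exists>g\<in>carrier G. \<forall>z\<in>hom_part \<one>. p (\<tau> h z) = p (\<sigma> g z)"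
proof -
  assume h: "h \<in> carrier H"
  have "algebra_char (hom_part \<one>) (\<lambda>z. p (act (\<one>, h) z))" using char_act[OF _ p] h by simp
  from chars_conj_G[OF p this] show ?thesis using hom_partD(1) h by (auto simp: act_def sg_one tau_M)
qed

lemma prod_center:
  assumes "s \<in> carrier G" "x \<in> hom_part s" "y \<in> hom_part (inv s)"
  shows "x \<star> y \<in> hom_part \<one>" "y \<star> x \<in> hom_part \<one>"
  using hom_part_mul[of s "inv s" x y] hom_part_mul[of "inv s" s y x] assms by simp_all

lemma center_comm: "\<lbrakk>z \<in> hom_part \<one>; x \<in> M\<rbrakk> \<Longrightarrow> z \<star> x = x \<star> z"
  using hom_partD(2)[of z \<one> x] by (simp add: sg_one)

text \<open>With \<open>a = p (x \<star> y)\<close> and \<open>b = p (y \<star> x)\<close>,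
  centrality of both products gives \<open>a^2 = a b = b^2\<close>, so \<open>a = b\<close>.\<close>

lemma p_swap:
  assumes "s \<in> carrier G" "x \<in> hom_part s" "y \<in> hom_part (inv s)"
  shows "p (x \<star> y) = p (y \<star> x)"
proof -
  note c = prod_center[OF assms]
  have M: "x \<in> M" "y \<in> M" using assms hom_partD(1) by auto
  have "x \<star> y \<star> (x \<star> y) = (x \<star> (y \<star> x)) \<star> y" by (simp add: mul_assoc)
  also have "x \<star> (y \<star> x) = (y \<star> x) \<star> x" using center_comm[OF c(2) M(1)] by simp
  also have "(y \<star> x) \<star> x \<star> y = (y \<star> x) \<star> (x \<star> y)" by (simp add: mul_assoc)
  finally have 1: "p (x \<star> y) * p (x \<star> y) = p (y \<star> x) * p (x \<star> y)"
    using p_mul[OF c(1) c(1)] p_mul[OF c(2) c(1)] by metis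
  have "y \<star> x \<star> (y \<star> x) = (y \<star> (x \<star> y)) \<star> x" by (simp add: mul_assoc)
  also have "y \<star> (x \<star> y) = (x \<star> y) \<star> y" using center_comm[OF c(1) M(2)] by simp
  also have "(x \<star> y) \<star> y \<star> x = (x \<star> y) \<star> (y \<star> x)" by (simp add: mul_assoc)
  finally have 2: "p (y \<star> x) * p (y \<star> x) = p (x \<star> y) * p (y \<star> x)"
    using p_mul[OF c(2) c(2)] p_mul[OF c(1) c(2)] by metis
  from 1 2 show ?thesis by auto
qed

section \<open>The fibre at \<open>p\<close> as a twisted group algebra\<close>

definition S :: "'a set" where
  "S = {s \<in> carrier G. \<exists>x\<in>hom_part s. x \<noteq> 0}"

lemma S_carrier: "s \<in> S \<Longrightarrow> s \<in> carrier G"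
  by (simp add: S_def)

text \<open>The trace in \<open>trace_nonzero\<close> is a nonzero scalar, so applying
  \<open>p\<close> to it gives a nonvanishing sum of values of \<open>p\<close> at
  translates.\<close>

lemma nonzero_sg:
  assumes "s \<in> carrier G" "x \<in> hom_part s" "x \<noteq> 0"
  obtains b k where "b \<in> hom_part (inv s)" "k \<in> carrier G" "p (\<sigma> k (b \<star> x)) \<noteq> 0"
proof -
  obtain b c where b: "b \<in> hom_part (inv s)" "c \<noteq> 0" "(\<Sum>k\<in>carrier G. \<sigma> k (b \<star> x)) = c *s e"
    using trace_nonzero[OF assms] .
  have bx: "b \<star> x \<in> hom_part \<one>" using prod_center(2)[OF assms(1,2) b(1)] .
  have "\<sigma> k (b \<star> x) \<in> hom_part \<one>" if "k \<in> carrier G" for k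
    using hom_part_sg[OF that G.one_closed bx] that by simp
  then have "(\<Sum>k\<in>carrier G. p (\<sigma> k (b \<star> x))) = p (c *s e)"
    unfolding b(3)[symmetric] by (intro algebra_char_sum[OF p subspace_hom_part, symmetric]) auto
  also have "\<dots> = c" using p_scale[OF e_hom_part] p_e by simp
  finally have "(\<Sum>k\<in>carrier G. p (\<sigma> k (b \<star> x))) \<noteq> 0" using b(2) by simp
  then obtain k where "k \<in> carrier G" "p (\<sigma> k (b \<star> x)) \<noteq> 0" by (meson sum.neutral)
  then show ?thesis using that[OF b(1)] by blast
qed

text \<open>Since \<open>H\<close> reaches the same characters from \<open>p\<close> as
  \<open>G\<close>, the translate can be taken by \<open>H\<close>, which unlike \<open>G\<close>
  preserves degrees.\<close>

lemma nonzero_tau: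
  assumes "s \<in> carrier G" "x \<in> hom_part s" "x \<noteq> 0"
  obtains b h where "b \<in> hom_part (inv s)" "h \<in> carrier H" "p (\<tau> h (b \<star> x)) \<noteq> 0"
proof -
  obtain b k where b: "b \<in> hom_part (inv s)" "k \<in> carrier G" "p (\<sigma> k (b \<star> x)) \<noteq> 0"
    using nonzero_sg[OF assms] .
  have bx: "b \<star> x \<in> hom_part \<one>" using prod_center(2)[OF assms(1,2) b(1)] .
  then show ?thesis using conj_sg_char[OF b(2)] b that by metis
qed

text \<open>The point \<open>p\<close> may kill a given \<open>x\<close>. Translating by the
  \<open>h\<close> of \<open>nonzero_tau\<close> keeps the degree and yields a pair that is inverse
  at \<open>p\<close> after scaling.\<close>

lemma exists_units:
  assumes s: "s \<in> S"
  shows "\<exists>v v'. v \<in> hom_part s \<and> v' \<in> hom_part (inv s) \<and> p (v \<star> v') = 1"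
proof -
  have sG: "s \<in> carrier G" using s S_carrier by blast
  obtain x where x: "x \<in> hom_part s" "x \<noteq> 0" using s by (auto simp: S_def)
  obtain b h where b: "b \<in> hom_part (inv s)" "h \<in> carrier H" "p (\<tau> h (b \<star> x)) \<noteq> 0"
    using nonzero_tau[OF sG x] .
  have t: "\<tau> h x \<in> hom_part s" "\<tau> h b \<in> hom_part (inv s)"
    using hom_part_tau[OF b(2)] x b(1) sG by auto
  define a where "a = p (\<tau> h x \<star> \<tau> h b)"
  have "p (\<tau> h (b \<star> x)) = p (\<tau> h b \<star> \<tau> h x)"
    using tau_mul[OF b(2)] hom_partD(1) x(1) b(1) by simp
  then have a: "a \<noteq> 0" using b(3) p_swap[OF sG t] by (simp add: a_def)
  have "p (\<tau> h x \<star> (inverse a *s \<tau> h b)) = 1"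
    using p_scale[OF prod_center(1)[OF sG t], of "inverse a"] a by (simp add: mul_scale_right a_def)
  then show ?thesis using t subspace_scale[OF subspace_hom_part] by blast
qed

text \<open>In degree \<open>\<one>\<close> the pair is fixed as \<open>(e, e)\<close>, so that the
  coordinate there is \<open>p\<close> itself; elsewhere any pair inverse to each other at
  \<open>p\<close> will do.\<close>

definition unit_pair :: "'a \<Rightarrow> 'v \<times> 'v" where
  "unit_pair s = (if s = \<one> then (e, e)
     else SOME w. fst w \<in> hom_part s \<and> snd w \<in> hom_part (inv s) \<and> p (fst w \<star> snd w) = 1)"

definition v :: "'a \<Rightarrow> 'v" where "v s = fst (unit_pair s)"
definition v' :: "'a \<Rightarrow> 'v" where "v' s = snd (unit_pair s)"

lemma v:
  assumes "s \<in> S"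
  shows "v s \<in> hom_part s" "v' s \<in> hom_part (inv s)" "p (v s \<star> v' s) = 1"
proof -
  have "v s \<in> hom_part s \<and> v' s \<in> hom_part (inv s) \<and> p (v s \<star> v' s) = 1"
  proof (cases "s = \<one>")
    case True
    then show ?thesis by (simp add: v_def v'_def unit_pair_def e_hom_part p_e)
  next
    case False
    have "\<exists>w. fst w \<in> hom_part s \<and> snd w \<in> hom_part (inv s) \<and> p (fst w \<star> snd w) = 1"
      using exists_units[OF assms] by auto
    from someI_ex[OF this] show ?thesis using False by (simp add: v_def v'_def unit_pair_def)
  qed
  then show "v s \<in> hom_part s" "v' s \<in> hom_part (inv s)" "p (v s \<star> v' s) = 1" by auto
qed

lemma v_one: "v \<one> = e" "v' \<one> = e"
  by (simp_all add: v_def v'_def unit_pair_def)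

text \<open>At the point \<open>p\<close> the component of degree \<open>s\<close> is a line spanned
  by \<open>v s\<close>; this is the coordinate on that line, read off with the inverse
  \<open>v' s\<close>.\<close>

definition coord :: "'a \<Rightarrow> 'v \<Rightarrow> complex" where
  "coord s x = p (x \<star> v' s)"

lemma coord_v: "s \<in> S \<Longrightarrow> coord s (v s) = 1"
  by (simp add: coord_def v(3))

lemma coord_one: "x \<in> M \<Longrightarrow> coord \<one> x = p x"
  by (simp add: coord_def v_one)

lemma coord_diff:
  assumes "s \<in> S" "x \<in> hom_part s" "y \<in> hom_part s"
  shows "coord s (x - y) = coord s x - coord s y"
  using prod_center(1)[OF S_carrier[OF assms(1)] _ v(2)[OF assms(1)]] assms
  by (simp add: coord_def mul_diff p_diff)

text \<open>\<open>v' s \<star> v s\<close> is central with value 1 at \<open>p\<close>, so it can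
  be inserted between \<open>x\<close> and \<open>w\<close>. Hence \<open>p\<close> sees
  \<open>x\<close> only through its coordinate, which is what makes the fibre in degree
  \<open>s\<close> a line.\<close>

lemma p_coord:
  assumes s: "s \<in> S" and x: "x \<in> hom_part s" and w: "w \<in> hom_part (inv s)"
  shows "p (x \<star> w) = coord s x * p (v s \<star> w)"
proof -
  note sG = S_carrier[OF s] and vs = v[OF s]
  note c = prod_center[OF sG vs(1,2)] prod_center[OF sG x w] prod_center[OF sG x vs(2)] prod_center[OF sG vs(1) w]
  have M: "x \<in> M" "w \<in> M" "v s \<in> M" "v' s \<in> M" using hom_partD(1) x w vs by auto
  have "(x \<star> v' s) \<star> (v s \<star> w) = x \<star> (v' s \<star> v s) \<star> w" by (simp add: mul_assoc)
  also have "x \<star> (v' s \<star> v s) = (v' s \<star> v s) \<star> x" using center_comm[OF c(2) M(1)] by simp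
  also have "(v' s \<star> v s) \<star> x \<star> w = (v' s \<star> v s) \<star> (x \<star> w)" by (simp add: mul_assoc)
  finally have "p (x \<star> v' s) * p (v s \<star> w) = p (v' s \<star> v s) * p (x \<star> w)"
    using p_mul[OF c(5,7)] p_mul[OF c(2,3)] by simp
  then show ?thesis using p_swap[OF sG vs(1,2)] vs(3) by (simp add: coord_def)
qed

text \<open>\<open>v t \<star> v' t\<close> is central and can be pulled out of the middle, leaving
  two factors with value 1 at \<open>p\<close>.\<close>

lemma product_nonzero:
  assumes s: "s \<in> S" and t: "t \<in> S"
  shows "p ((v s \<star> v t) \<star> (v' t \<star> v' s)) = 1" "s \<otimes> t \<in> S"
proof -
  note sG = S_carrier[OF s] S_carrier[OF t] and vs = v[OF s] v[OF t]
  note c = prod_center(1)[OF sG(1) vs(1,2)] prod_center(1)[OF sG(2) vs(4,5)]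
  have M: "v s \<in> M" using hom_partD(1) vs by blast
  have "(v s \<star> v t) \<star> (v' t \<star> v' s) = (v s \<star> (v t \<star> v' t)) \<star> v' s" by (simp add: mul_assoc)
  also have "v s \<star> (v t \<star> v' t) = (v t \<star> v' t) \<star> v s" using center_comm[OF c(2) M] by simp
  also have "(v t \<star> v' t) \<star> v s \<star> v' s = (v t \<star> v' t) \<star> (v s \<star> v' s)" by (simp add: mul_assoc)
  finally show 1: "p ((v s \<star> v t) \<star> (v' t \<star> v' s)) = 1" using p_mul[OF c(2,1)] vs by simp
  then have "v s \<star> v t \<noteq> 0" using p_zero by auto
  then show "s \<otimes> t \<in> S" using hom_part_mul[OF sG vs(1,4)] sG by (auto simp: S_def)
qed

lemma one_S: "\<one> \<in> S"
  using e_hom_part e_nonzero by (auto simp: S_def)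

lemma subgroup_S: "subgroup S G"
proof (rule G.finite_subgroupI)
  show "finite S" using finG by (simp add: S_def)
qed (use one_S S_carrier product_nonzero(2) in auto)

lemma conj_S:
  assumes "g \<in> carrier G" "s \<in> S"
  shows "conjg G g s \<in> S"
proof -
  obtain x where x: "x \<in> hom_part s" "x \<noteq> 0" using assms(2) by (auto simp: S_def)
  have "\<sigma> g x \<noteq> 0"
    using sg_inv(2)[OF assms(1) hom_partD(1)[OF x(1)]] sg_zero[of "inv g"] assms(1) x(2) by auto
  moreover have "conjg G g s \<in> carrier G" using assms(1) S_carrier[OF assms(2)] by simp
  ultimately show ?thesis
    unfolding S_def using hom_part_sg[OF assms(1) S_carrier[OF assms(2)] x(1)] by blast
qed

definition f :: "'a \<Rightarrow> 'a \<Rightarrow> complex" where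
  "f s t = coord (s \<otimes> t) (v s \<star> v t)"

lemma f_nz:
  assumes "s \<in> S" "t \<in> S"
  shows "f s t \<noteq> 0"
proof -
  have G: "s \<in> carrier G" "t \<in> carrier G" using assms S_carrier by auto
  have x: "v s \<star> v t \<in> hom_part (s \<otimes> t)" using hom_part_mul[OF G v(1)[OF assms(1)] v(1)[OF assms(2)]] .
  have w: "v' t \<star> v' s \<in> hom_part (inv (s \<otimes> t))"
    using hom_part_mul[OF _ _ v(2)[OF assms(2)] v(2)[OF assms(1)]] G by (simp add: G.inv_mult_group)
  show ?thesis
    using p_coord[OF product_nonzero(2)[OF assms] x w] product_nonzero(1)[OF assms] by (auto simp: f_def)
qed

text \<open>\<open>p_coord\<close> replaces \<open>x\<close> by \<open>v s\<close>; rotating the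
  product cyclically with \<open>p_swap\<close> brings \<open>y\<close> to the front, where
  \<open>p_coord\<close> replaces it by \<open>v t\<close>.\<close>

lemma coord_mul:
  assumes s: "s \<in> S" and t: "t \<in> S" and x: "x \<in> hom_part s" and y: "y \<in> hom_part t"
  shows "coord (s \<otimes> t) (x \<star> y) = f s t * coord s x * coord t y"
proof -
  note G = S_carrier[OF s] S_carrier[OF t] and st = product_nonzero(2)[OF s t]
  have u: "v' (s \<otimes> t) \<in> hom_part (inv t \<otimes> inv s)" using v(2)[OF st] G by (simp add: G.inv_mult_group)
  have yu: "y \<star> v' (s \<otimes> t) \<in> hom_part (inv s)"
    using hom_part_mul[OF G(2) _ y u] G by (simp flip: G.m_assoc)
  have vu: "v t \<star> v' (s \<otimes> t) \<in> hom_part (inv s)"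
    using hom_part_mul[OF G(2) _ v(1)[OF t] u] G by (simp flip: G.m_assoc)
  have uv: "v' (s \<otimes> t) \<star> v s \<in> hom_part (inv t)"
    using hom_part_mul[OF _ G(1) u v(1)[OF s]] G by (simp add: G.m_assoc)
  have "coord (s \<otimes> t) (x \<star> y) = p (x \<star> (y \<star> v' (s \<otimes> t)))" by (simp add: coord_def mul_assoc)
  also have "\<dots> = coord s x * p (v s \<star> (y \<star> v' (s \<otimes> t)))" using p_coord[OF s x yu] .
  also have "p (v s \<star> (y \<star> v' (s \<otimes> t))) = p (y \<star> (v' (s \<otimes> t) \<star> v s))"
    using p_swap[OF G(1) v(1)[OF s] yu] by (simp add: mul_assoc)
  also have "\<dots> = coord t y * p (v t \<star> (v' (s \<otimes> t) \<star> v s))" using p_coord[OF t y uv] .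
  also have "p (v t \<star> (v' (s \<otimes> t) \<star> v s)) = p (v s \<star> (v t \<star> v' (s \<otimes> t)))"
    using p_swap[OF G(1) v(1)[OF s] vu] by (simp add: mul_assoc)
  also have "\<dots> = f s t" by (simp add: f_def coord_def mul_assoc)
  finally show ?thesis by simp
qed

text \<open>The stabiliser of the point \<open>p\<close> of the spectrum of the centre.\<close>

definition \<Gamma> :: "('a \<times> 'b) set" where
  "\<Gamma> = {\<gamma> \<in> carrier (G \<times>\<times> H). \<forall>z\<in>hom_part \<one>. p (act \<gamma> z) = p z}"

lemma Gamma_carrier: "\<gamma> \<in> \<Gamma> \<Longrightarrow> \<gamma> \<in> carrier (G \<times>\<times> H)" "\<gamma> \<in> \<Gamma> \<Longrightarrow> fst \<gamma> \<in> carrier G"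
  by (auto simp: \<Gamma>_def)

lemma p_act: "\<gamma> \<in> \<Gamma> \<Longrightarrow> z \<in> hom_part \<one> \<Longrightarrow> p (act \<gamma> z) = p z"
  by (simp add: \<Gamma>_def)

lemma subgroup_Gamma: "subgroup \<Gamma> (G \<times>\<times> H)"
proof (rule P.finite_subgroupI)
  show "finite \<Gamma>" using finG finH by (simp add: \<Gamma>_def)
  have "\<one>\<^bsub>G \<times>\<times> H\<^esub> \<in> \<Gamma>" using act_one hom_partD(1) P.one_closed unfolding \<Gamma>_def by auto
  then show "\<Gamma> \<noteq> {}" by blast
  show "\<gamma> \<otimes>\<^bsub>G \<times>\<times> H\<^esub> \<delta> \<in> \<Gamma>" if "\<gamma> \<in> \<Gamma>" "\<delta> \<in> \<Gamma>" for \<gamma> \<delta>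
    unfolding \<Gamma>_def
  proof (intro CollectI conjI ballI)
    show "\<gamma> \<otimes>\<^bsub>G \<times>\<times> H\<^esub> \<delta> \<in> carrier (G \<times>\<times> H)" using Gamma_carrier(1) that P.m_closed by blast
    fix z assume z: "z \<in> hom_part \<one>"
    have "act (\<gamma> \<otimes>\<^bsub>G \<times>\<times> H\<^esub> \<delta>) z = act \<gamma> (act \<delta> z)"
      using act_comp[OF Gamma_carrier(1)[OF that(1)] Gamma_carrier(1)[OF that(2)] hom_partD(1)[OF z]] .
    then show "p (act (\<gamma> \<otimes>\<^bsub>G \<times>\<times> H\<^esub> \<delta>) z) = p z"
      using p_act[OF that(1) center_act[OF Gamma_carrier(1)[OF that(2)] z]] p_act[OF that(2) z] by simp
  qed
qed (auto simp: \<Gamma>_def)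

definition \<epsilon> :: "'a \<times> 'b \<Rightarrow> 'a \<Rightarrow> complex" where
  "\<epsilon> \<gamma> s = coord (conjg G (fst \<gamma>) s) (act \<gamma> (v s))"

text \<open>\<open>p\<close> is invariant under \<open>\<gamma>\<close>, so the coordinate of
  \<open>act \<gamma> x\<close> is the value of \<open>p\<close> at \<open>x \<star> w\<close>,
  where \<open>\<gamma>\<close> carries \<open>w\<close> to the inverse element chosen in the new
  degree; then \<open>p_coord\<close> applies.\<close>

lemma coord_act:
  assumes \<gamma>: "\<gamma> \<in> \<Gamma>" and s: "s \<in> S" and x: "x \<in> hom_part s"
  shows "coord (conjg G (fst \<gamma>) s) (act \<gamma> x) = \<epsilon> \<gamma> s * coord s x"
proof -
  note c = Gamma_carrier[OF \<gamma>] and sG = S_carrier[OF s]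
  let ?s = "conjg G (fst \<gamma>) s"
  have sS: "?s \<in> S" using conj_S[OF c(2) s] .
  define w where "w = act (inv\<^bsub>G \<times>\<times> H\<^esub> \<gamma>) (v' ?s)"
  have ci: "inv\<^bsub>G \<times>\<times> H\<^esub> \<gamma> \<in> carrier (G \<times>\<times> H)" using P.inv_closed[OF c(1)] .
  have fi: "fst (inv\<^bsub>G \<times>\<times> H\<^esub> \<gamma>) = inv (fst \<gamma>)" using c(1) G.is_group H.is_group by (cases \<gamma>) auto
  have "w \<in> hom_part (conjg G (inv (fst \<gamma>)) (inv ?s))"
    unfolding w_def fi[symmetric] using hom_part_act[OF ci _ v(2)[OF sS]] S_carrier[OF sS] by simp
  then have w: "w \<in> hom_part (inv s)" using c(2) sG by (simp flip: G.conj_inv add: G.conj_inv_left)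
  have aw: "act \<gamma> w = v' ?s" unfolding w_def using act_inv(1)[OF c(1)] v(2)[OF sS] hom_partD(1) by blast
  have key: "coord ?s (act \<gamma> y) = p (y \<star> w)" if y: "y \<in> hom_part s" for y
  proof -
    have "coord ?s (act \<gamma> y) = p (act \<gamma> (y \<star> w))"
      using act_mul[OF c(1) hom_partD(1)[OF y] hom_partD(1)[OF w]] aw by (simp add: coord_def)
    then show ?thesis using p_act[OF \<gamma> prod_center(1)[OF sG y w]] by simp
  qed
  show ?thesis using key[OF x] key[OF v(1)[OF s]] p_coord[OF s x w] by (simp add: \<epsilon>_def)
qed

lemma eps_mult:
  assumes \<gamma>: "\<gamma> \<in> \<Gamma>" and \<delta>: "\<delta> \<in> \<Gamma>" and s: "s \<in> S"
  shows "\<epsilon> (\<gamma> \<otimes>\<^bsub>G \<times>\<times> H\<^esub> \<delta>) s = \<epsilon> \<gamma> (conjg G (fst \<delta>) s) * \<epsilon> \<delta> s"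
proof -
  note c = Gamma_carrier[OF \<gamma>] Gamma_carrier[OF \<delta>] and sG = S_carrier[OF s]
  have "conjg G (fst (\<gamma> \<otimes>\<^bsub>G \<times>\<times> H\<^esub> \<delta>)) s = conjg G (fst \<gamma>) (conjg G (fst \<delta>) s)"
    using c sG by (simp add: mult_DirProd' G.conj_mult_left)
  moreover have "act (\<gamma> \<otimes>\<^bsub>G \<times>\<times> H\<^esub> \<delta>) (v s) = act \<gamma> (act \<delta> (v s))"
    using act_comp[OF c(1,3) hom_partD(1)[OF v(1)[OF s]]] .
  moreover have "act \<delta> (v s) \<in> hom_part (conjg G (fst \<delta>) s)" using hom_part_act[OF c(3) sG v(1)[OF s]] .
  ultimately show ?thesis
    using coord_act[OF \<gamma> conj_S[OF c(4) s]] by (simp add: \<epsilon>_def)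
qed

lemma eps_one: "s \<in> S \<Longrightarrow> \<epsilon> \<one>\<^bsub>G \<times>\<times> H\<^esub> s = 1"
  using act_one[of "v s"] v(1)[of s] hom_partD(1) S_carrier coord_v by (simp add: \<epsilon>_def)

lemma eps_nz:
  assumes \<gamma>: "\<gamma> \<in> \<Gamma>" and s: "s \<in> S"
  shows "\<epsilon> \<gamma> s \<noteq> 0"
proof -
  have "inv\<^bsub>G \<times>\<times> H\<^esub> \<gamma> \<in> \<Gamma>" using subgroup.m_inv_closed[OF subgroup_Gamma \<gamma>] .
  from eps_mult[OF this \<gamma> s] show ?thesis
    using eps_one[OF s] P.l_inv[OF Gamma_carrier(1)[OF \<gamma>]] by auto
qed

lemma eps_f:
  assumes \<gamma>: "\<gamma> \<in> \<Gamma>" and s: "s \<in> S" and t: "t \<in> S"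
  shows "f s t * \<epsilon> \<gamma> (s \<otimes> t) = \<epsilon> \<gamma> s * \<epsilon> \<gamma> t * f (conjg G (fst \<gamma>) s) (conjg G (fst \<gamma>) t)"
proof -
  note c = Gamma_carrier[OF \<gamma>] and G = S_carrier[OF s] S_carrier[OF t]
  have h: "act \<gamma> (v s) \<in> hom_part (conjg G (fst \<gamma>) s)" "act \<gamma> (v t) \<in> hom_part (conjg G (fst \<gamma>) t)"
    using hom_part_act[OF c(1)] G v(1) s t by auto
  have "coord (conjg G (fst \<gamma>) (s \<otimes> t)) (act \<gamma> (v s \<star> v t)) = \<epsilon> \<gamma> (s \<otimes> t) * f s t"
    using coord_act[OF \<gamma> product_nonzero(2)[OF s t] hom_part_mul[OF G v(1)[OF s] v(1)[OF t]]] by (simp add: f_def)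
  moreover have "act \<gamma> (v s \<star> v t) = act \<gamma> (v s) \<star> act \<gamma> (v t)"
    using act_mul[OF c(1)] hom_partD(1) v(1) s t by blast
  moreover have "conjg G (fst \<gamma>) (s \<otimes> t) = conjg G (fst \<gamma>) s \<otimes> conjg G (fst \<gamma>) t"
    using G.conj_mult[OF c(2) G] .
  ultimately show ?thesis
    using coord_mul[OF conj_S[OF c(2) s] conj_S[OF c(2) t] h] by (simp add: \<epsilon>_def mult_ac)
qed

text \<open>\<open>z \<star> v s = \<sigma> s z \<star> v s\<close> for central \<open>z\<close>,
  and \<open>v s\<close> is invertible at \<open>p\<close>, so \<open>p\<close> takes the same value
  at \<open>z\<close> and at \<open>\<sigma> s z\<close>.\<close>

lemma S_Gamma:
  assumes s: "s \<in> S"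
  shows "(s, \<one>\<^bsub>H\<^esub>) \<in> \<Gamma>"
proof -
  note sG = S_carrier[OF s]
  have "p (\<sigma> s z) = p z" if z: "z \<in> hom_part \<one>" for z
  proof -
    note M = hom_partD(1)[OF z] and vM = hom_partD(1)[OF v(1)[OF s]] and c = prod_center(1)[OF sG v(1,2)[OF s]]
    have sz: "\<sigma> s z \<in> hom_part \<one>" using hom_part_sg[OF sG G.one_closed z] sG by simp
    have "z \<star> v s = \<sigma> s z \<star> v s" using center_comm[OF z vM] hom_partD(2)[OF v(1)[OF s] M] by simp
    then have "z \<star> (v s \<star> v' s) = \<sigma> s z \<star> (v s \<star> v' s)" by (simp flip: mul_assoc)
    then show ?thesis using p_mul[OF z c] p_mul[OF sz c] v(3)[OF s] by simp
  qed
  then show ?thesis using sG hom_partD(1) by (auto simp: \<Gamma>_def act_def tau_one)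
qed

lemma act_S: "x \<in> M \<Longrightarrow> act (s, \<one>\<^bsub>H\<^esub>) x = \<sigma> s x"
  by (simp add: act_def tau_one)

text \<open>The coordinate form of
  \<open>v s \<star> v t = \<sigma> s (v t) \<star> v s\<close>.\<close>

lemma f_comm:
  assumes s: "s \<in> S" and t: "t \<in> S"
  shows "f s t = \<epsilon> (s, \<one>\<^bsub>H\<^esub>) t * f (conjg G s t) s"
proof -
  note G = S_carrier[OF s] S_carrier[OF t] and M = hom_partD(1)[OF v(1)[OF t]]
  have "conjg G s t \<otimes> s = s \<otimes> t" using G by (simp add: conjg_def G.m_assoc)
  moreover have "v s \<star> v t = \<sigma> s (v t) \<star> v s" using hom_partD(2)[OF v(1)[OF s] M] .
  moreover have "coord (conjg G s t \<otimes> s) (\<sigma> s (v t) \<star> v s) =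
      f (conjg G s t) s * coord (conjg G s t) (\<sigma> s (v t)) * coord s (v s)"
    using coord_mul[OF conj_S[OF G(1) t] s hom_part_sg[OF G v(1)[OF t]] v(1)[OF s]] .
  ultimately show ?thesis using coord_v[OF s] act_S[OF M] by (simp add: f_def \<epsilon>_def)
qed

text \<open>In every degree the difference \<open>\<sigma> s x - x\<close> has coordinate zero at
  \<open>p\<close>, and so have its translates by \<open>H\<close>, which commutes with
  \<open>\<sigma> s\<close>. But \<open>nonzero_tau\<close> detects a nonzero element on some
  translate, so \<open>\<sigma> s\<close> is the identity.\<close>

lemma faithful_fst:
  assumes s: "s \<in> S" and comm: "\<And>t. t \<in> S \<Longrightarrow> s \<otimes> t = t \<otimes> s"
    and triv: "\<And>t. t \<in> S \<Longrightarrow> \<epsilon> (s, \<one>\<^bsub>H\<^esub>) t = 1"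
  shows "s = \<one>"
proof (rule sg_faithful)
  note sG = S_carrier[OF s]
  show "s \<in> carrier G" by (rule sG)
  have conj: "conjg G s t = t" if "t \<in> S" for t
    using comm[OF that] sG S_carrier[OF that] by (simp add: conjg_def G.m_assoc)
  have part: "\<sigma> s x = x" if t: "t \<in> carrier G" and x: "x \<in> hom_part t" for t x
  proof (rule ccontr)
    assume ne: "\<sigma> s x \<noteq> x"
    then have "x \<noteq> 0" using sg_zero[OF sG] by auto
    then have tS: "t \<in> S" using t x by (auto simp: S_def)
    have sx: "\<sigma> s y \<in> hom_part t" if "y \<in> hom_part t" for y
      using hom_part_sg[OF sG t that] conj[OF tS] by simp
    have d: "\<sigma> s x - x \<in> hom_part t" using sx[OF x] x subspace_diff[OF subspace_hom_part] by blast
    obtain b h where b: "b \<in> hom_part (inv t)" "h \<in> carrier H" "p (\<tau> h (b \<star> (\<sigma> s x - x))) \<noteq> 0"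
      using nonzero_tau[OF t d] ne by auto
    define y where "y = \<tau> h x"
    have y: "y \<in> hom_part t" unfolding y_def using hom_part_tau[OF b(2) t x] .
    have hb: "\<tau> h b \<in> hom_part (inv t)" using hom_part_tau[OF b(2) _ b(1)] t by simp
    have hd: "\<tau> h (\<sigma> s x - x) = \<sigma> s y - y"
      using tau_diff[OF b(2)] sg_tau[OF sG b(2) hom_partD(1)[OF x]] by (simp add: y_def)
    have dy: "\<sigma> s y - y \<in> hom_part t" using sx[OF y] y subspace_diff[OF subspace_hom_part] by blast
    have "coord t (\<sigma> s y) = coord t y"
      using coord_act[OF S_Gamma[OF s] tS y] act_S[OF hom_partD(1)[OF y]] triv[OF tS] conj[OF tS] by simp
    then have "coord t (\<sigma> s y - y) = 0" using coord_diff[OF tS sx[OF y] y] by simp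
    then have "p ((\<sigma> s y - y) \<star> \<tau> h b) = 0" using p_coord[OF tS dy hb] by simp
    then have "p (\<tau> h b \<star> (\<sigma> s y - y)) = 0" using p_swap[OF t dy hb] by simp
    then show False
      using b(3) tau_mul[OF b(2) hom_partD(1)[OF b(1)] hom_partD(1)[OF d]] hd by simp
  qed
  fix x assume x: "x \<in> M"
  have "\<sigma> s x = (\<Sum>g\<in>carrier G. \<sigma> s (\<pi> g x))" using sum_pi[OF x] sg_sum[OF sG] by metis
  also have "\<dots> = (\<Sum>g\<in>carrier G. \<pi> g x)" using part pi_hom_part[OF _ x] by (intro sum.cong) auto
  finally show "\<sigma> s x = x" using sum_pi[OF x] by simp
qed

text \<open>The argument of \<open>faithful_fst\<close> with translates by \<open>G\<close>. These
  change the degree from \<open>t\<close> to a conjugate \<open>u\<close>, which is harmless because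
  \<open>triv\<close> covers all of \<open>S\<close>.\<close>

lemma faithful_snd:
  assumes h: "(\<one>, h) \<in> \<Gamma>" and triv: "\<And>t. t \<in> S \<Longrightarrow> \<epsilon> (\<one>, h) t = 1"
  shows "h = \<one>\<^bsub>H\<^esub>"
proof (rule faithful_H)
  show hH: "h \<in> carrier H" using Gamma_carrier(1)[OF h] by simp
  have act: "act (\<one>, h) x = \<tau> h x" if "x \<in> M" for x
    using tau_M[OF hH that] by (simp add: act_def sg_one)
  have part: "\<tau> h x = x" if t: "t \<in> carrier G" and x: "x \<in> hom_part t" for t x
  proof (rule ccontr)
    assume ne: "\<tau> h x \<noteq> x"
    then have "x \<noteq> 0" using tau_zero[OF hH] by auto
    then have tS: "t \<in> S" using t x by (auto simp: S_def)
    have d: "\<tau> h x - x \<in> hom_part t"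
      using hom_part_tau[OF hH t x] x subspace_diff[OF subspace_hom_part] by blast
    obtain b k where b: "b \<in> hom_part (inv t)" "k \<in> carrier G" "p (\<sigma> k (b \<star> (\<tau> h x - x))) \<noteq> 0"
      using nonzero_sg[OF t d] ne by auto
    define u where "u = conjg G k t"
    define y where "y = \<sigma> k x"
    have u: "u \<in> S" "u \<in> carrier G" unfolding u_def using conj_S[OF b(2) tS] b(2) t by auto
    have y: "y \<in> hom_part u" unfolding y_def u_def using hom_part_sg[OF b(2) t x] .
    have hy: "\<tau> h y \<in> hom_part u" using hom_part_tau[OF hH u(2) y] .
    have kb: "\<sigma> k b \<in> hom_part (inv u)"
      using hom_part_sg[OF b(2) _ b(1)] t b(2) by (simp add: u_def G.conj_inv)
    have kd: "\<sigma> k (\<tau> h x - x) = \<tau> h y - y"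
      using sg_diff[OF b(2)] sg_tau[OF b(2) hH hom_partD(1)[OF x]] by (simp add: y_def)
    have dy: "\<tau> h y - y \<in> hom_part u" using hy y subspace_diff[OF subspace_hom_part] by blast
    have "coord u (\<tau> h y) = coord u y"
      using coord_act[OF h u(1) y] act[OF hom_partD(1)[OF y]] triv[OF u(1)] u(2) by simp
    then have "coord u (\<tau> h y - y) = 0" using coord_diff[OF u(1) hy y] by simp
    then have "p ((\<tau> h y - y) \<star> \<sigma> k b) = 0" using p_coord[OF u(1) dy kb] by simp
    then have "p (\<sigma> k b \<star> (\<tau> h y - y)) = 0" using p_swap[OF u(2) dy kb] by simp
    then show False
      using b(3) sg_mul[OF b(2) hom_partD(1)[OF b(1)] hom_partD(1)[OF d]] kd by simp
  qed
  fix x assume x: "x \<in> M"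
  have "\<tau> h x = (\<Sum>g\<in>carrier G. \<tau> h (\<pi> g x))" using sum_pi[OF x] tau_sum[OF hH] by metis
  also have "\<dots> = (\<Sum>g\<in>carrier G. \<pi> g x)" using part pi_hom_part[OF _ x] by (intro sum.cong) auto
  finally show "\<tau> h x = x" using sum_pi[OF x] by simp
qed

text \<open>The counterpart in \<open>M\<close> of \<open>norm_prod\<close>, with the factors in the
  same order so that degrees match.\<close>

primrec orbit_prod :: "'a \<times> 'b \<Rightarrow> nat \<Rightarrow> 'v \<Rightarrow> 'v" where
  "orbit_prod \<gamma> 0 x = e"
| "orbit_prod \<gamma> (Suc k) x = orbit_prod \<gamma> k (act \<gamma> x) \<star> x"

lemma orbit_prod_M: "orbit_prod \<gamma> k x \<in> M"
  by (cases k) auto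

lemma norm_prod_S: "\<lbrakk>g \<in> carrier G; s \<in> S\<rbrakk> \<Longrightarrow> norm_prod G g k s \<in> S"
  by (induction k arbitrary: s) (use one_S conj_S product_nonzero(2) in auto)

lemma orbit_prod_hom_part:
  assumes "\<gamma> \<in> \<Gamma>" "s \<in> S" "x \<in> hom_part s"
  shows "orbit_prod \<gamma> k x \<in> hom_part (norm_prod G (fst \<gamma>) k s)"
  using assms(2,3)
proof (induction k arbitrary: s x)
  case (Suc k)
  note c = Gamma_carrier[OF assms(1)]
  have "conjg G (fst \<gamma>) s \<in> S" using conj_S[OF c(2) Suc.prems(1)] .
  then show ?case
    using Suc.IH[OF _ hom_part_act[OF c(1) S_carrier Suc.prems(2)]] Suc.prems norm_prod_S[OF c(2)]
    by (auto intro!: hom_part_mul S_carrier)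
qed (simp add: e_hom_part)

lemma orbit_prod_coord:
  assumes "\<gamma> \<in> \<Gamma>" "s \<in> S" "x \<in> hom_part s" "coord s x \<noteq> 0"
  shows "coord (norm_prod G (fst \<gamma>) k s) (orbit_prod \<gamma> k x) \<noteq> 0"
  using assms(2-4)
proof (induction k arbitrary: s x)
  case 0
  then show ?case by (simp add: coord_one p_e)
next
  case (Suc k)
  note c = Gamma_carrier[OF assms(1)]
  have sS: "conjg G (fst \<gamma>) s \<in> S" using conj_S[OF c(2) Suc.prems(1)] .
  have ax: "act \<gamma> x \<in> hom_part (conjg G (fst \<gamma>) s)"
    using hom_part_act[OF c(1) S_carrier[OF Suc.prems(1)] Suc.prems(2)] .
  have "coord (conjg G (fst \<gamma>) s) (act \<gamma> x) \<noteq> 0"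
    using coord_act[OF assms(1) Suc.prems(1,2)] eps_nz[OF assms(1) Suc.prems(1)] Suc.prems(3) by simp
  then have "coord (norm_prod G (fst \<gamma>) k (conjg G (fst \<gamma>) s)) (orbit_prod \<gamma> k (act \<gamma> x)) \<noteq> 0"
    using Suc.IH[OF sS ax] by simp
  then show ?case
    using coord_mul[OF norm_prod_S[OF c(2) sS] Suc.prems(1) orbit_prod_hom_part[OF assms(1) sS ax] Suc.prems(2)]
      f_nz[OF norm_prod_S[OF c(2) sS] Suc.prems(1)] Suc.prems(3) by simp
qed

lemma act_pow_Suc:
  assumes "\<gamma> \<in> \<Gamma>" "x \<in> M"
  shows "act (\<gamma> [^]\<^bsub>G \<times>\<times> H\<^esub> Suc k) x = act (\<gamma> [^]\<^bsub>G \<times>\<times> H\<^esub> (k::nat)) (act \<gamma> x)"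
  using act_comp[OF P.nat_pow_closed[OF Gamma_carrier(1)[OF assms(1)], of k] Gamma_carrier(1)[OF assms(1)] assms(2)]
  by simp

text \<open>The recursion from the other end, splitting off the leftmost factor.\<close>

lemma orbit_prod_Suc:
  assumes "\<gamma> \<in> \<Gamma>" "x \<in> M"
  shows "orbit_prod \<gamma> (Suc k) x = act (\<gamma> [^]\<^bsub>G \<times>\<times> H\<^esub> k) x \<star> orbit_prod \<gamma> k x"
  using assms(2)
proof (induction k arbitrary: x)
  case 0
  then show ?case using act_one[OF 0] by simp
next
  case (Suc k)
  have "orbit_prod \<gamma> (Suc (Suc k)) x = orbit_prod \<gamma> (Suc k) (act \<gamma> x) \<star> x" by simp
  also have "orbit_prod \<gamma> (Suc k) (act \<gamma> x) = act (\<gamma> [^]\<^bsub>G \<times>\<times> H\<^esub> k) (act \<gamma> x) \<star> orbit_prod \<gamma> k (act \<gamma> x)"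
    by (rule Suc.IH[OF act_M[OF Gamma_carrier(1)[OF assms(1)] Suc.prems]])
  finally show ?case using act_pow_Suc[OF assms(1) Suc.prems] by (simp add: mul_assoc)
qed

lemma act_orbit_prod:
  assumes "\<gamma> \<in> \<Gamma>" "x \<in> M"
  shows "act \<gamma> (orbit_prod \<gamma> k x) = orbit_prod \<gamma> k (act \<gamma> x)"
  using assms(2)
proof (induction k arbitrary: x)
  case 0
  then show ?case using act_e[OF Gamma_carrier(1)[OF assms(1)]] by simp
next
  case (Suc k)
  then show ?case
    using act_mul[OF Gamma_carrier(1)[OF assms(1)] orbit_prod_M Suc.prems]
      act_M[OF Gamma_carrier(1)[OF assms(1)] Suc.prems] by simp
qed

text \<open>Applying \<open>\<gamma>\<close> to the central element \<open>\<gamma>\<^sup>k\<^sup>-\<^sup>1 v \<cdots> \<gamma> v \<cdot> v\<close> permutes its factors cyclically, except that the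
  last one, \<open>v\<close>, comes back as \<open>\<gamma>\<^sup>k v\<close>.\<close>

lemma eps_norm:
  assumes \<gamma>: "\<gamma> \<in> \<Gamma>" and s: "s \<in> S" and k: "k > 0" and fixes_s: "conjg G (fst \<gamma> [^] k) s = s"
    and norm: "norm_prod G (fst \<gamma>) k s = \<one>"
  shows "\<epsilon> (\<gamma> [^]\<^bsub>G \<times>\<times> H\<^esub> k) s = 1"
proof -
  note c = Gamma_carrier[OF \<gamma>] and sG = S_carrier[OF s] and x = v(1)[OF s]
  note xM = hom_partD(1)[OF x]
  obtain j where j: "k = Suc j" using k by (cases k) auto
  have pow1: "\<gamma> [^]\<^bsub>G \<times>\<times> H\<^esub> i \<in> \<Gamma>" for i :: nat
  proof (induction i)
    case 0
    then show ?case using subgroup.one_closed[OF subgroup_Gamma] by simp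
  next
    case (Suc i)
    then show ?case using subgroup.m_closed[OF subgroup_Gamma Suc \<gamma>] by simp
  qed
  have pow2: "fst (\<gamma> [^]\<^bsub>G \<times>\<times> H\<^esub> i) = fst \<gamma> [^] i" for i :: nat
    by (induction i) (simp_all add: mult_DirProd')
  note pow = pow1 pow2
  \<comment> \<open>The product without its rightmost factor \<open>v s\<close>; its degree is
    \<open>inv s\<close> because the whole product has degree \<open>\<one>\<close>.\<close>
  define Q where "Q = orbit_prod \<gamma> j (act \<gamma> (v s))"
  have sS: "conjg G (fst \<gamma>) s \<in> S" using conj_S[OF c(2) s] .
  have "norm_prod G (fst \<gamma>) j (conjg G (fst \<gamma>) s) \<otimes> s = \<one>" using norm by (simp add: j)
  then have "norm_prod G (fst \<gamma>) j (conjg G (fst \<gamma>) s) = inv s"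
    using G.inv_equality[of _ s] sG norm_prod_S[OF c(2) sS] S_carrier by auto
  then have Q: "Q \<in> hom_part (inv s)"
    using orbit_prod_hom_part[OF \<gamma> sS hom_part_act[OF c(1) sG x], of j] by (simp add: Q_def)
  have W: "orbit_prod \<gamma> k (v s) = Q \<star> v s" by (simp add: j Q_def)
  have aW: "act \<gamma> (Q \<star> v s) = act (\<gamma> [^]\<^bsub>G \<times>\<times> H\<^esub> k) (v s) \<star> Q"
    using act_orbit_prod[OF \<gamma> xM, of k] orbit_prod_Suc[OF \<gamma> act_M[OF c(1) xM], of j] act_pow_Suc[OF \<gamma> xM, of j]
    unfolding W by (simp add: j Q_def del: orbit_prod.simps)
  have nz: "p (Q \<star> v s) \<noteq> 0"
    using orbit_prod_coord[OF \<gamma> s x, of k] coord_v[OF s] norm W by (simp add: coord_one)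
  have ax: "act (\<gamma> [^]\<^bsub>G \<times>\<times> H\<^esub> k) (v s) \<in> hom_part s"
    using hom_part_act[OF Gamma_carrier(1)[OF pow(1)] sG x, of k] pow(2)[of k] fixes_s by simp
  have "p (Q \<star> v s) = p (act (\<gamma> [^]\<^bsub>G \<times>\<times> H\<^esub> k) (v s) \<star> Q)"
    using p_act[OF \<gamma> prod_center(2)[OF sG x Q]] aW by simp
  also have "\<dots> = \<epsilon> (\<gamma> [^]\<^bsub>G \<times>\<times> H\<^esub> k) s * p (v s \<star> Q)"
    using p_coord[OF s ax Q] pow(2)[of k] fixes_s by (simp add: \<epsilon>_def)
  also have "p (v s \<star> Q) = p (Q \<star> v s)" by (rule p_swap[OF sG x Q])
  finally show ?thesis using nz by simp
qed

sublocale mono: monomial_data G H \<Gamma> S \<epsilon> f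
proof (intro monomial_data.intro monomial_data_axioms.intro)
  \<comment> \<open>Some \<open>h\<close> moves \<open>p\<close> to the same character as
    \<open>g\<close> does, so \<open>g\<close> paired with the inverse of \<open>h\<close> fixes
    \<open>p\<close>.\<close>
  show "\<exists>h. (g, h) \<in> \<Gamma>" if g: "g \<in> carrier G" for g
  proof -
    obtain h where h: "h \<in> carrier H" "\<And>z. z \<in> hom_part \<one> \<Longrightarrow> p (\<sigma> g z) = p (\<tau> h z)"
      using conj_sg_char[OF g] by blast
    have "p (act (g, inv\<^bsub>H\<^esub> h) z) = p z" if z: "z \<in> hom_part \<one>" for z
    proof -
      have "\<tau> (inv\<^bsub>H\<^esub> h) z \<in> hom_part \<one>" using hom_part_tau[OF _ _ z] h(1) by simp
      then show ?thesis using h tau_inv(1)[OF h(1) hom_partD(1)[OF z]] by (simp add: act_def)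
    qed
    then have "(g, inv\<^bsub>H\<^esub> h) \<in> \<Gamma>" using g h(1) by (simp add: \<Gamma>_def)
    then show ?thesis by blast
  qed
  show "\<exists>g. (g, h) \<in> \<Gamma>" if h: "h \<in> carrier H" for h
  proof -
    obtain g where g: "g \<in> carrier G" "\<And>z. z \<in> hom_part \<one> \<Longrightarrow> p (\<tau> h z) = p (\<sigma> g z)"
      using conj_tau_char[OF h] by blast
    have "p (act (inv g, h) z) = p z" if z: "z \<in> hom_part \<one>" for z
    proof -
      have gz: "\<sigma> (inv g) z \<in> hom_part \<one>" using hom_part_sg[OF _ G.one_closed z, of "inv g"] g(1) by simp
      have "act (inv g, h) z = \<tau> h (\<sigma> (inv g) z)" using sg_tau[OF _ h hom_partD(1)[OF z]] g(1) by (simp add: act_def)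
      then show ?thesis using g(2)[OF gz] sg_inv(1)[OF g(1) hom_partD(1)[OF z]] by simp
    qed
    then have "(inv g, h) \<in> \<Gamma>" using g(1) h by (simp add: \<Gamma>_def)
    then show ?thesis by blast
  qed
qed (fact G.is_group H.is_group finG finH card_GH subgroup_Gamma subgroup_S conj_S S_Gamma eps_nz f_nz eps_mult eps_f f_comm
  faithful_fst faithful_snd eps_norm)+

end

theorem (in bigalois) iso_of_order_less_64:
  assumes "card (carrier G) < 64"
  shows "H \<cong> G"
proof -
  obtain p where "algebra_char (hom_part \<one>) p" using exists_algebra_char[OF commutative_center] .
  then interpret pointed_bigalois G H scale mul M e B \<sigma> \<tau> I l r p by unfold_locales
  show ?thesis using assms by (rule mono.iso_of_order_less_64)
qed

section \<open>Galois algebras given by matrices\<close>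

lemma index_mult_mat_sum:
  fixes A B :: "complex mat"
  assumes "A \<in> carrier_mat m k" "B \<in> carrier_mat k n" "i < m" "j < n"
  shows "(A * B) $$ (i, j) = (\<Sum>l<k. A $$ (i, l) * B $$ (l, j))"
  using assms by (auto simp: scalar_prod_def lessThan_atLeast0)

text \<open>The dimensions are arguments so that an empty sum is the zero matrix of the right
  size.\<close>

definition msum :: "nat \<Rightarrow> nat \<Rightarrow> 'i set \<Rightarrow> ('i \<Rightarrow> complex mat) \<Rightarrow> complex mat" where
  "msum r c A f = mat r c (\<lambda>ij. \<Sum>a\<in>A. f a $$ ij)"

lemma msum_carrier [simp]: "msum r c A f \<in> carrier_mat r c"
  by (simp add: msum_def)

lemma msum_index: "i < r \<Longrightarrow> j < c \<Longrightarrow> msum r c A f $$ (i, j) = (\<Sum>a\<in>A. f a $$ (i, j))"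
  by (simp add: msum_def)

lemma msum_empty: "msum r c {} f = 0\<^sub>m r c"
  by (rule eq_matI) (auto simp: msum_def)

lemma msum_insert:
  assumes "finite A" "a \<notin> A" "f a \<in> carrier_mat r c"
  shows "msum r c (insert a A) f = f a + msum r c A f"
  by (rule eq_matI) (use assms in \<open>auto simp: msum_def\<close>)

lemma msum_cong:
  "(\<And>a. a \<in> A \<Longrightarrow> f a = g a) \<Longrightarrow> msum r c A f = msum r c A g"
  by (simp add: msum_def)

lemma mult_msum:
  assumes "B \<in> carrier_mat m r" "\<And>a. a \<in> A \<Longrightarrow> f a \<in> carrier_mat r c"
  shows "B * msum r c A f = msum m c A (\<lambda>a. B * f a)"
proof (rule eq_matI)
  fix i j assume "i < dim_row (msum m c A (\<lambda>a. B * f a))" "j < dim_col (msum m c A (\<lambda>a. B * f a))"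
  then have ij: "i < m" "j < c" by (auto simp: msum_def)
  have "(B * msum r c A f) $$ (i, j) = (\<Sum>l<r. \<Sum>a\<in>A. B $$ (i, l) * f a $$ (l, j))"
    using ij by (simp add: index_mult_mat_sum[OF assms(1) msum_carrier] msum_index sum_distrib_left)
  also have "\<dots> = (\<Sum>a\<in>A. \<Sum>l<r. B $$ (i, l) * f a $$ (l, j))" by (rule sum.swap)
  also have "\<dots> = (\<Sum>a\<in>A. (B * f a) $$ (i, j))"
    using ij index_mult_mat_sum[OF assms(1) assms(2)] by (intro sum.cong) auto
  finally show "(B * msum r c A f) $$ (i, j) = msum m c A (\<lambda>a. B * f a) $$ (i, j)"
    using ij by (simp add: msum_index)
qed (use assms in \<open>auto simp: msum_def\<close>)

lemma msum_mult:
  assumes "B \<in> carrier_mat c n" "\<And>a. a \<in> A \<Longrightarrow> f a \<in> carrier_mat r c"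
  shows "msum r c A f * B = msum r n A (\<lambda>a. f a * B)"
proof (rule eq_matI)
  fix i j assume "i < dim_row (msum r n A (\<lambda>a. f a * B))" "j < dim_col (msum r n A (\<lambda>a. f a * B))"
  then have ij: "i < r" "j < n" by (auto simp: msum_def)
  have "(msum r c A f * B) $$ (i, j) = (\<Sum>l<c. \<Sum>a\<in>A. f a $$ (i, l) * B $$ (l, j))"
    using ij by (simp add: index_mult_mat_sum[OF msum_carrier assms(1)] msum_index sum_distrib_right)
  also have "\<dots> = (\<Sum>a\<in>A. \<Sum>l<c. f a $$ (i, l) * B $$ (l, j))" by (rule sum.swap)
  also have "\<dots> = (\<Sum>a\<in>A. (f a * B) $$ (i, j))"
    using ij index_mult_mat_sum[OF assms(2) assms(1)] by (intro sum.cong) auto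
  finally show "(msum r c A f * B) $$ (i, j) = msum r n A (\<lambda>a. f a * B) $$ (i, j)"
    using ij by (simp add: msum_index)
qed (use assms in \<open>auto simp: msum_def\<close>)

lemma msum_delta:
  assumes "finite A" "a \<in> A" "f a \<in> carrier_mat r c"
  shows "msum r c A (\<lambda>b. if a = b then f b else 0\<^sub>m r c) = f a"
proof (rule eq_matI)
  fix i j assume "i < dim_row (f a)" "j < dim_col (f a)"
  then have ij: "i < r" "j < c" using assms by auto
  have "msum r c A (\<lambda>b. if a = b then f b else 0\<^sub>m r c) $$ (i, j) = (\<Sum>b\<in>A. if a = b then f b $$ (i, j) else 0)"
    using ij by (auto simp: msum_index intro!: sum.cong)
  then show "msum r c A (\<lambda>b. if a = b then f b else 0\<^sub>m r c) $$ (i, j) = f a $$ (i, j)"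
    using assms by (simp add: sum.delta)
qed (use assms in \<open>auto simp: msum_def\<close>)

definition mtrace :: "complex mat \<Rightarrow> complex" where
  "mtrace A = (\<Sum>i<dim_row A. A $$ (i, i))"

lemma mtrace_comm:
  assumes "A \<in> carrier_mat m n" "B \<in> carrier_mat n m"
  shows "mtrace (A * B) = mtrace (B * A)"
proof -
  have "mtrace (A * B) = (\<Sum>i<m. \<Sum>l<n. A $$ (i, l) * B $$ (l, i))"
    using assms by (auto simp: mtrace_def simp del: index_mult_mat(1) intro!: sum.cong index_mult_mat_sum[OF assms])
  also have "\<dots> = (\<Sum>l<n. \<Sum>i<m. B $$ (l, i) * A $$ (i, l))" by (subst sum.swap) (simp add: mult.commute)
  also have "\<dots> = mtrace (B * A)"
    using assms
    by (auto simp: mtrace_def simp del: index_mult_mat(1) intro!: sum.cong index_mult_mat_sum[OF assms(2,1), symmetric])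
  finally show ?thesis .
qed

lemma mtrace_one: "mtrace (1\<^sub>m n) = of_nat n"
  by (simp add: mtrace_def)

lemma mtrace_msum:
  assumes "\<And>a. a \<in> A \<Longrightarrow> f a \<in> carrier_mat n n"
  shows "mtrace (msum n n A f) = (\<Sum>a\<in>A. mtrace (f a))"
proof -
  have "mtrace (msum n n A f) = (\<Sum>i<n. \<Sum>a\<in>A. f a $$ (i, i))"
    by (simp add: mtrace_def msum_index carrier_matD[OF msum_carrier])
  also have "\<dots> = (\<Sum>a\<in>A. \<Sum>i<n. f a $$ (i, i))" by (rule sum.swap)
  also have "\<dots> = (\<Sum>a\<in>A. mtrace (f a))" using assms by (intro sum.cong) (auto simp: mtrace_def)
  finally show ?thesis .
qed

lemma mtrace_kronecker:
  assumes "A \<in> carrier_mat m m" "B \<in> carrier_mat n n"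
  shows "mtrace (kronecker A B) = mtrace A * mtrace B"
proof -
  have "mtrace (kronecker A B) = (\<Sum>k=0..<m * n. A $$ (k div n, k div n) * B $$ (k mod n, k mod n))"
    using assms by (auto simp: mtrace_def kronecker_index[OF assms] lessThan_atLeast0 intro!: sum.cong)
  also have "\<dots> = (\<Sum>a=0..<m. \<Sum>b=0..<n. A $$ (a, a) * B $$ (b, b))" by (rule sum_div_mod)
  also have "\<dots> = mtrace A * mtrace B" using assms by (simp add: mtrace_def sum_product lessThan_atLeast0)
  finally show ?thesis .
qed

section \<open>Column matrices as functions, and simple tensors\<close>

definition cvec :: "nat \<Rightarrow> (nat \<Rightarrow> complex) \<Rightarrow> complex mat" where
  "cvec N x = mat N 1 (\<lambda>(i, j). x i)"

definition fvec :: "nat \<Rightarrow> complex mat \<Rightarrow> nat \<Rightarrow> complex" where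
  "fvec N A = (\<lambda>i. if i < N then A $$ (i, 0) else 0)"

definition fscale :: "complex \<Rightarrow> (nat \<Rightarrow> complex) \<Rightarrow> nat \<Rightarrow> complex" where
  "fscale c x = (\<lambda>i. c * x i)"

lemma cvec_carrier [simp]: "cvec N x \<in> carrier_mat N 1"
  by (simp add: cvec_def)

lemma cvec_carrier_Suc [simp]: "cvec N x \<in> carrier_mat N (Suc 0)"
  by (simp add: cvec_def)

lemma cvec_fvec: "A \<in> carrier_mat N 1 \<Longrightarrow> cvec N (fvec N A) = A"
  by (rule eq_matI) (auto simp: cvec_def fvec_def)

lemma fvec_cvec: "(\<And>i. i \<ge> N \<Longrightarrow> x i = 0) \<Longrightarrow> fvec N (cvec N x) = x"
  by (auto simp: cvec_def fvec_def fun_eq_iff)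

lemma cvec_add: "cvec N (x + y) = cvec N x + cvec N y"
  by (rule eq_matI) (auto simp: cvec_def)

lemma cvec_fscale: "cvec N (fscale c x) = c \<cdot>\<^sub>m cvec N x"
  by (rule eq_matI) (auto simp: cvec_def fscale_def)

lemma fvec_add: "\<lbrakk>A \<in> carrier_mat N 1; B \<in> carrier_mat N 1\<rbrakk> \<Longrightarrow> fvec N (A + B) = fvec N A + fvec N B"
  by (auto simp: fvec_def fun_eq_iff)

lemma fvec_smult: "A \<in> carrier_mat N 1 \<Longrightarrow> fvec N (c \<cdot>\<^sub>m A) = fscale c (fvec N A)"
  by (auto simp: fvec_def fun_eq_iff fscale_def)

lemma sum_fun_apply: "(\<Sum>a\<in>A. f a) i = (\<Sum>a\<in>A. f a (i :: 'i) :: complex)"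
  by (induction A rule: infinite_finite_induct) simp_all

lemma fvec_msum:
  "fvec N (msum N 1 A f) = (\<Sum>a\<in>A. fvec N (f a))"
  by (auto simp: fvec_def fun_eq_iff msum_index sum_fun_apply)

lemma vector_space_fscale: "vector_space fscale"
  by unfold_locales (auto simp: fscale_def fun_eq_iff algebra_simps)

definition unit_fun :: "nat \<Rightarrow> nat \<Rightarrow> complex" where
  "unit_fun i = (\<lambda>j. of_bool (i = j))"

lemma mult_unit_fun:
  assumes "E \<in> carrier_mat K N" "i < K" "j < N"
  shows "(E * cvec N (unit_fun j)) $$ (i, 0) = E $$ (i, j)"
proof -
  have "(E * cvec N (unit_fun j)) $$ (i, 0) = (\<Sum>l<N. E $$ (i, l) * cvec N (unit_fun j) $$ (l, 0))"
    by (rule index_mult_mat_sum[OF assms(1) cvec_carrier assms(2)]) simp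
  also have "\<dots> = (\<Sum>l<N. if j = l then E $$ (i, l) else 0)"
    by (rule sum.cong) (auto simp: cvec_def unit_fun_def)
  finally show ?thesis using assms(3) by (simp add: sum.delta)
qed

text \<open>\<open>block N D i\<close> is the factor \<open>r\<^sub>i\<close> in the expansion of a tensor \<open>D\<close> as \<open>\<Sum>i. e\<^sub>i \<otimes> r\<^sub>i\<close>.\<close>

definition block :: "nat \<Rightarrow> complex mat \<Rightarrow> nat \<Rightarrow> nat \<Rightarrow> complex" where
  "block N D i = (\<lambda>j. if j < N then D $$ (i * N + j, 0) else 0)"

text \<open>An index \<open>l\<close> of the tensor square stands for the pair
  \<open>l div N\<close>, \<open>l mod N\<close>. A linear map on the tensor square is thereby
  evaluated on simple tensors, where products in the algebra can be read off.\<close>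

lemma fvec_tensor_expand:
  assumes A: "A \<in> carrier_mat K (N * N)" and D: "D \<in> carrier_mat (N * N) 1"
  shows "fvec K (A * D) = (\<Sum>i<N. fvec K (A * kronecker (cvec N (unit_fun i)) (cvec N (block N D i))))"
proof
  fix a
  show "fvec K (A * D) a = (\<Sum>i<N. fvec K (A * kronecker (cvec N (unit_fun i)) (cvec N (block N D i)))) a"
  proof (cases "a < K")
    case a: True
    let ?k = "\<lambda>i. kronecker (cvec N (unit_fun i)) (cvec N (block N D i))"
    have k: "?k i \<in> carrier_mat (N * N) 1" for i
      using kronecker_carrier[OF cvec_carrier cvec_carrier, of N "unit_fun i" N "block N D i"] by simp
    have "(A * D) $$ (a, 0) = (\<Sum>l<N * N. A $$ (a, l) * D $$ (l, 0))"
      using a by (simp add: index_mult_mat_sum[OF A D])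
    also have "\<dots> = (\<Sum>l=0..<N * N. A $$ (a, l div N * N + l mod N) * D $$ (l div N * N + l mod N, 0))"
      by (simp add: lessThan_atLeast0)
    also have "\<dots> = (\<Sum>i=0..<N. \<Sum>j=0..<N. A $$ (a, i * N + j) * D $$ (i * N + j, 0))"
      by (rule sum_div_mod)
    also have "\<dots> = (\<Sum>i<N. (A * ?k i) $$ (a, 0))"
      unfolding lessThan_atLeast0
    proof (rule sum.cong)
      fix i assume i: "i \<in> {0..<N}"
      have "(A * ?k i) $$ (a, 0) = (\<Sum>l<N * N. A $$ (a, l) * ?k i $$ (l, 0))"
        using a by (simp add: index_mult_mat_sum[OF A k])
      also have "\<dots> = (\<Sum>l=0..<N * N. A $$ (a, l div N * N + l mod N) *
          (of_bool (i = l div N) * D $$ (i * N + l mod N, 0)))"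
        unfolding lessThan_atLeast0
      proof (rule sum.cong)
        fix l assume "l \<in> {0..<N * N}"
        then have l: "l < N * N" "l div N < N" "l mod N < N" using div_mod_less[of l N N] by auto
        have "?k i $$ (l, 0) = of_bool (i = l div N) * D $$ (i * N + l mod N, 0)"
          using l kronecker_index[OF cvec_carrier cvec_carrier, of l N N 0 "unit_fun i" "block N D i"]
          by (simp add: cvec_def unit_fun_def block_def)
        then show "A $$ (a, l) * ?k i $$ (l, 0) =
            A $$ (a, l div N * N + l mod N) * (of_bool (i = l div N) * D $$ (i * N + l mod N, 0))" by simp
      qed simp
      also have "\<dots> = (\<Sum>i'=0..<N. \<Sum>j=0..<N. A $$ (a, i' * N + j) * (of_bool (i = i') * D $$ (i * N + j, 0)))"
        by (rule sum_div_mod)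
      also have "\<dots> = (\<Sum>i'=0..<N. if i = i' then \<Sum>j=0..<N. A $$ (a, i' * N + j) * D $$ (i * N + j, 0) else 0)"
        by (rule sum.cong) auto
      also have "\<dots> = (\<Sum>j=0..<N. A $$ (a, i * N + j) * D $$ (i * N + j, 0))"
        using i by (simp add: sum.delta)
      finally show "(\<Sum>j=0..<N. A $$ (a, i * N + j) * D $$ (i * N + j, 0)) = (A * ?k i) $$ (a, 0)" by simp
    qed simp
    finally show ?thesis using a by (simp add: fvec_def sum_fun_apply)
  qed (simp add: fvec_def sum_fun_apply)
qed

text \<open>\<open>d g\<close> is the component at \<open>g\<close> of the inverse of the Galois map \<open>M \<otimes> M \<rightarrow> M\<^sup>G\<close>. Elements of \<open>M\<close> are column
  matrices here; they become functions \<open>nat \<Rightarrow> complex\<close> (via \<open>fvec\<close>) below, since matrices of fixed size do not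
  form a type of class \<open>ab_group_add\<close>.\<close>

locale galois_matrices =
  G: group G + H: group H
  for G :: "('a, 'c) monoid_scheme" (structure) and H :: "('b, 'd) monoid_scheme" +
  fixes N :: nat and \<mu> :: "complex mat" and \<eta> :: "complex mat"
    and \<sigma> :: "'a \<Rightarrow> complex mat" and \<tau> :: "'b \<Rightarrow> complex mat" and d :: "'a \<Rightarrow> complex mat"
  assumes finG: "finite (carrier G)" and finH: "finite (carrier H)" and N_pos: "N > 0"
    and mu_carrier: "\<mu> \<in> carrier_mat N (N * N)" and eta_carrier: "\<eta> \<in> carrier_mat N 1"
    and sg_carrier: "g \<in> carrier G \<Longrightarrow> \<sigma> g \<in> carrier_mat N N"
    and tau_carrier: "h \<in> carrier H \<Longrightarrow> \<tau> h \<in> carrier_mat N N"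
    and d_carrier: "g \<in> carrier G \<Longrightarrow> d g \<in> carrier_mat (N * N) N"
    and assoc: "\<mu> * kronecker \<mu> (1\<^sub>m N) = \<mu> * kronecker (1\<^sub>m N) \<mu>"
    and unit_left: "\<mu> * kronecker \<eta> (1\<^sub>m N) = 1\<^sub>m N"
    and unit_right: "\<mu> * kronecker (1\<^sub>m N) \<eta> = 1\<^sub>m N"
    and sg_mult: "g \<in> carrier G \<Longrightarrow> g' \<in> carrier G \<Longrightarrow> \<sigma> (g \<otimes> g') = \<sigma> g * \<sigma> g'"
    and sg_one: "\<sigma> \<one> = 1\<^sub>m N"
    and tau_mult: "h \<in> carrier H \<Longrightarrow> h' \<in> carrier H \<Longrightarrow> \<tau> (h \<otimes>\<^bsub>H\<^esub> h') = \<tau> h * \<tau> h'"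
    and tau_one: "\<tau> \<one>\<^bsub>H\<^esub> = 1\<^sub>m N"
    and sg_tau: "g \<in> carrier G \<Longrightarrow> h \<in> carrier H \<Longrightarrow> \<sigma> g * \<tau> h = \<tau> h * \<sigma> g"
    and sg_mu: "g \<in> carrier G \<Longrightarrow> \<sigma> g * \<mu> = \<mu> * kronecker (\<sigma> g) (\<sigma> g)"
    and tau_mu: "h \<in> carrier H \<Longrightarrow> \<tau> h * \<mu> = \<mu> * kronecker (\<tau> h) (\<tau> h)"
    and sg_eta: "g \<in> carrier G \<Longrightarrow> \<sigma> g * \<eta> = \<eta>"
    and tau_eta: "h \<in> carrier H \<Longrightarrow> \<tau> h * \<eta> = \<eta>"
    and can_d: "g \<in> carrier G \<Longrightarrow> k \<in> carrier G \<Longrightarrow>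
      \<mu> * kronecker (1\<^sub>m N) (\<sigma> k) * d g = (if g = k then 1\<^sub>m N else 0\<^sub>m N N)"
    and d_can: "msum (N * N) (N * N) (carrier G) (\<lambda>g. d g * (\<mu> * kronecker (1\<^sub>m N) (\<sigma> g))) = 1\<^sub>m (N * N)"
    and fixed_tau: "x \<in> carrier_mat N 1 \<Longrightarrow> (\<And>h. h \<in> carrier H \<Longrightarrow> \<tau> h * x = x) \<Longrightarrow> \<exists>c. x = c \<cdot>\<^sub>m \<eta>"
    and faithful_tau: "h \<in> carrier H \<Longrightarrow> \<tau> h = 1\<^sub>m N \<Longrightarrow> h = \<one>\<^bsub>H\<^esub>"
begin

section \<open>The product and the Galois map in matrix form\<close>

lemma kron_carrier1: "x \<in> carrier_mat N 1 \<Longrightarrow> y \<in> carrier_mat N 1 \<Longrightarrow> kronecker x y \<in> carrier_mat (N * N) 1"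
  using kronecker_carrier[of x N 1 y N 1] by simp

definition prod :: "complex mat \<Rightarrow> complex mat \<Rightarrow> complex mat" (infixl \<open>\<star>\<close> 76) where
  "x \<star> y = \<mu> * kronecker x y"

lemma prod_carrier: "x \<in> carrier_mat N 1 \<Longrightarrow> y \<in> carrier_mat N 1 \<Longrightarrow> x \<star> y \<in> carrier_mat N 1"
  unfolding prod_def using kron_carrier1 mu_carrier by (metis mult_carrier_mat)

lemma prod_assoc:
  assumes "x \<in> carrier_mat N 1" "y \<in> carrier_mat N 1" "z \<in> carrier_mat N 1"
  shows "x \<star> y \<star> z = x \<star> (y \<star> z)"
proof -
  note xy = kron_carrier1[OF assms(1,2)] and yz = kron_carrier1[OF assms(2,3)]
  have xyz: "kronecker (kronecker x y) z \<in> carrier_mat (N * N * N) 1"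
    using kronecker_carrier[OF xy assms(3)] by simp
  have k: "kronecker \<mu> (1\<^sub>m N) \<in> carrier_mat (N * N) (N * N * N)" "kronecker (1\<^sub>m N) \<mu> \<in> carrier_mat (N * N) (N * N * N)"
    using kronecker_carrier[OF mu_carrier one_carrier_mat] kronecker_carrier[OF one_carrier_mat mu_carrier]
    by (simp_all add: mult.assoc)
  have "x \<star> y \<star> z = \<mu> * kronecker (\<mu> * kronecker x y) (1\<^sub>m N * z)" using assms by (simp add: prod_def)
  also have "\<dots> = \<mu> * (kronecker \<mu> (1\<^sub>m N) * kronecker (kronecker x y) z)"
    by (subst kronecker_mult[OF mu_carrier xy one_carrier_mat assms(3)]) simp
  also have "\<dots> = (\<mu> * kronecker \<mu> (1\<^sub>m N)) * kronecker (kronecker x y) z"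
    by (rule assoc_mult_mat[OF mu_carrier k(1) xyz, symmetric])
  also have "\<dots> = (\<mu> * kronecker (1\<^sub>m N) \<mu>) * kronecker x (kronecker y z)"
    by (simp add: assoc kronecker_assoc)
  also have "\<dots> = \<mu> * (kronecker (1\<^sub>m N) \<mu> * kronecker x (kronecker y z))"
    by (rule assoc_mult_mat[OF mu_carrier k(2)]) (use xyz in \<open>simp add: kronecker_assoc\<close>)
  also have "\<dots> = \<mu> * kronecker (1\<^sub>m N * x) (\<mu> * kronecker y z)"
    by (subst kronecker_mult[OF one_carrier_mat assms(1) mu_carrier yz]) simp
  also have "\<dots> = x \<star> (y \<star> z)" using assms by (simp add: prod_def)
  finally show ?thesis .
qed

lemma prod_eta:
  assumes x: "x \<in> carrier_mat N 1"
  shows "\<eta> \<star> x = x" "x \<star> \<eta> = x"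
proof -
  have k: "kronecker \<eta> (1\<^sub>m N) \<in> carrier_mat (N * N) N" "kronecker (1\<^sub>m N) \<eta> \<in> carrier_mat (N * N) N"
    using kronecker_carrier[OF eta_carrier one_carrier_mat] kronecker_carrier[OF one_carrier_mat eta_carrier] by simp_all
  have "\<eta> \<star> x = \<mu> * kronecker (\<eta> * 1\<^sub>m 1) (1\<^sub>m N * x)" using x eta_carrier by (simp add: prod_def)
  also have "\<dots> = \<mu> * (kronecker \<eta> (1\<^sub>m N) * x)"
    by (subst kronecker_mult[OF eta_carrier one_carrier_mat one_carrier_mat x]) (simp add: kronecker_one_left[simplified])
  also have "\<dots> = (\<mu> * kronecker \<eta> (1\<^sub>m N)) * x" by (rule assoc_mult_mat[OF mu_carrier k(1) x, symmetric])
  finally show "\<eta> \<star> x = x" using x by (simp add: unit_left)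
  have "x \<star> \<eta> = \<mu> * kronecker (1\<^sub>m N * x) (\<eta> * 1\<^sub>m 1)" using x eta_carrier by (simp add: prod_def)
  also have "\<dots> = \<mu> * (kronecker (1\<^sub>m N) \<eta> * x)"
    by (subst kronecker_mult[OF one_carrier_mat x eta_carrier one_carrier_mat]) (simp add: kronecker_one_right[simplified])
  also have "\<dots> = (\<mu> * kronecker (1\<^sub>m N) \<eta>) * x" by (rule assoc_mult_mat[OF mu_carrier k(2) x, symmetric])
  finally show "x \<star> \<eta> = x" using x by (simp add: unit_right)
qed

lemma aut_prod:
  assumes A: "A \<in> carrier_mat N N" "A * \<mu> = \<mu> * kronecker A A" and x: "x \<in> carrier_mat N 1" and y: "y \<in> carrier_mat N 1"
  shows "A * (x \<star> y) = (A * x) \<star> (A * y)"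
proof -
  have "A * (x \<star> y) = (A * \<mu>) * kronecker x y"
    unfolding prod_def by (rule assoc_mult_mat[OF A(1) mu_carrier kron_carrier1[OF x y], symmetric])
  also have "\<dots> = \<mu> * (kronecker A A * kronecker x y)"
    unfolding A(2) by (rule assoc_mult_mat[OF mu_carrier kronecker_carrier[OF A(1,1)] kron_carrier1[OF x y]])
  also have "\<dots> = (A * x) \<star> (A * y)"
    unfolding prod_def by (simp add: kronecker_mult[OF A(1) x A(1) y])
  finally show ?thesis .
qed

text \<open>The component at \<open>g\<close> of the Galois map; \<open>can_tensor\<close> gives it
  on simple tensors.\<close>

definition can :: "'a \<Rightarrow> complex mat" where
  "can g = \<mu> * kronecker (1\<^sub>m N) (\<sigma> g)"

lemma kron_one_sg: "g \<in> carrier G \<Longrightarrow> kronecker (1\<^sub>m N) (\<sigma> g) \<in> carrier_mat (N * N) (N * N)"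
  by (intro kronecker_carrier one_carrier_mat sg_carrier)

lemma can_carrier: "g \<in> carrier G \<Longrightarrow> can g \<in> carrier_mat N (N * N)"
  unfolding can_def by (rule mult_carrier_mat[OF mu_carrier kron_one_sg])

lemma d_can_carrier: "g \<in> carrier G \<Longrightarrow> d g * can g \<in> carrier_mat (N * N) (N * N)"
  by (rule mult_carrier_mat[OF d_carrier can_carrier])

lemma can_tensor:
  assumes g: "g \<in> carrier G" and x: "x \<in> carrier_mat N 1" and y: "y \<in> carrier_mat N 1"
  shows "can g * kronecker x y = x \<star> (\<sigma> g * y)"
proof -
  have "can g * kronecker x y = \<mu> * (kronecker (1\<^sub>m N) (\<sigma> g) * kronecker x y)"
    unfolding can_def by (rule assoc_mult_mat[OF mu_carrier kron_one_sg[OF g] kron_carrier1[OF x y]])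
  then show ?thesis
    using x by (simp add: prod_def kronecker_mult[OF one_carrier_mat x sg_carrier[OF g] y, symmetric])
qed

lemma tensor_expand:
  assumes t: "t \<in> carrier_mat (N * N) 1"
  shows "t = msum (N * N) 1 (carrier G) (\<lambda>g. d g * (can g * t))"
proof -
  have "t = msum (N * N) (N * N) (carrier G) (\<lambda>g. d g * can g) * t"
    using left_mult_one_mat[OF t] d_can by (simp add: can_def)
  also have "\<dots> = msum (N * N) 1 (carrier G) (\<lambda>g. d g * can g * t)"
    by (rule msum_mult[OF t d_can_carrier])
  also have "\<dots> = msum (N * N) 1 (carrier G) (\<lambda>g. d g * (can g * t))"
    by (rule msum_cong) (use d_carrier can_carrier t in \<open>auto intro: assoc_mult_mat\<close>)
  finally show ?thesis .
qed

definition lmult :: "complex mat \<Rightarrow> complex mat" where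
  "lmult w = \<mu> * kronecker w (1\<^sub>m N)"

definition rmult :: "complex mat \<Rightarrow> complex mat" where
  "rmult z = \<mu> * kronecker (1\<^sub>m N) z"

lemma lmult_carrier: "w \<in> carrier_mat N 1 \<Longrightarrow> lmult w \<in> carrier_mat N N"
  unfolding lmult_def using mu_carrier kronecker_carrier[of w N 1 "1\<^sub>m N" N N] by auto

lemma rmult_carrier: "z \<in> carrier_mat N 1 \<Longrightarrow> rmult z \<in> carrier_mat N N"
  unfolding rmult_def using mu_carrier kronecker_carrier[of "1\<^sub>m N" N N z N 1] by auto

lemma lmult_mult:
  assumes w: "w \<in> carrier_mat N 1" and x: "x \<in> carrier_mat N n"
  shows "lmult w * x = \<mu> * kronecker w x"
proof -
  have k: "kronecker w (1\<^sub>m N) \<in> carrier_mat (N * N) N"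
    using kronecker_carrier[OF w one_carrier_mat] by simp
  have "lmult w * x = \<mu> * (kronecker w (1\<^sub>m N) * kronecker (1\<^sub>m 1) x)"
    unfolding lmult_def using assoc_mult_mat[OF mu_carrier k x] by (simp add: kronecker_one_left[simplified])
  then show ?thesis
    using kronecker_mult[OF w one_carrier_mat one_carrier_mat x] w x by simp
qed

lemma rmult_mult:
  assumes z: "z \<in> carrier_mat N 1" and x: "x \<in> carrier_mat N n"
  shows "rmult z * x = \<mu> * kronecker x z"
proof -
  have k: "kronecker (1\<^sub>m N) z \<in> carrier_mat (N * N) N"
    using kronecker_carrier[OF one_carrier_mat z] by simp
  have "rmult z * x = \<mu> * (kronecker (1\<^sub>m N) z * kronecker x (1\<^sub>m 1))"
    unfolding rmult_def using assoc_mult_mat[OF mu_carrier k x] by (simp add: kronecker_one_right[simplified])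
  then show ?thesis
    using kronecker_mult[OF one_carrier_mat x z one_carrier_mat] z x by simp
qed

lemma mu_lmult:
  assumes w: "w \<in> carrier_mat N 1"
  shows "\<mu> * kronecker (lmult w) (1\<^sub>m N) = lmult w * \<mu>"
proof -
  have kw: "kronecker w (1\<^sub>m N) \<in> carrier_mat (N * N) N"
    using kronecker_carrier[OF w one_carrier_mat] by simp
  have kk: "kronecker w (1\<^sub>m (N * N)) \<in> carrier_mat (N * N * N) (N * N)"
    using kronecker_carrier[OF w one_carrier_mat[of "N * N"]] by (simp add: mult.assoc)
  have k: "kronecker \<mu> (1\<^sub>m N) \<in> carrier_mat (N * N) (N * N * N)" "kronecker (1\<^sub>m N) \<mu> \<in> carrier_mat (N * N) (N * N * N)"
    using kronecker_carrier[OF mu_carrier one_carrier_mat] kronecker_carrier[OF one_carrier_mat mu_carrier]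
    by (simp_all add: mult.assoc)
  have "kronecker (lmult w) (1\<^sub>m N) = kronecker \<mu> (1\<^sub>m N) * kronecker (kronecker w (1\<^sub>m N)) (1\<^sub>m N)"
    unfolding lmult_def using kronecker_mult[OF mu_carrier kw one_carrier_mat[of N] one_carrier_mat] by simp
  also have "kronecker (kronecker w (1\<^sub>m N)) (1\<^sub>m N) = kronecker w (1\<^sub>m (N * N))"
    by (simp add: kronecker_assoc kronecker_one)
  finally have "\<mu> * kronecker (lmult w) (1\<^sub>m N) = \<mu> * kronecker (1\<^sub>m N) \<mu> * kronecker w (1\<^sub>m (N * N))"
    using assoc_mult_mat[OF mu_carrier k(1) kk] assoc by simp
  also have "\<dots> = \<mu> * (kronecker (1\<^sub>m N) \<mu> * kronecker w (1\<^sub>m (N * N)))"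
    by (rule assoc_mult_mat[OF mu_carrier k(2) kk])
  also have "kronecker (1\<^sub>m N) \<mu> * kronecker w (1\<^sub>m (N * N)) = kronecker w \<mu>"
    using kronecker_mult[OF one_carrier_mat w mu_carrier one_carrier_mat] w mu_carrier by simp
  finally show ?thesis using lmult_mult[OF w mu_carrier] by simp
qed

text \<open>Left multiplication acts on the first tensor factor and \<open>\<sigma> g\<close> on the
  second, so by associativity the Galois map is left linear.\<close>

lemma can_lmult:
  assumes g: "g \<in> carrier G" and w: "w \<in> carrier_mat N 1"
  shows "can g * kronecker (lmult w) (1\<^sub>m N) = lmult w * can g"
proof -
  note L = lmult_carrier[OF w]
  have kL: "kronecker (lmult w) (1\<^sub>m N) \<in> carrier_mat (N * N) (N * N)" by (rule kronecker_carrier[OF L one_carrier_mat])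
  have "can g * kronecker (lmult w) (1\<^sub>m N) = \<mu> * (kronecker (1\<^sub>m N) (\<sigma> g) * kronecker (lmult w) (1\<^sub>m N))"
    unfolding can_def by (rule assoc_mult_mat[OF mu_carrier kron_one_sg[OF g] kL])
  also have "kronecker (1\<^sub>m N) (\<sigma> g) * kronecker (lmult w) (1\<^sub>m N) = kronecker (lmult w) (1\<^sub>m N) * kronecker (1\<^sub>m N) (\<sigma> g)"
    using kronecker_mult[OF one_carrier_mat L sg_carrier[OF g] one_carrier_mat]
      kronecker_mult[OF L one_carrier_mat one_carrier_mat sg_carrier[OF g]] L sg_carrier[OF g] by simp
  also have "\<mu> * (kronecker (lmult w) (1\<^sub>m N) * kronecker (1\<^sub>m N) (\<sigma> g)) = lmult w * \<mu> * kronecker (1\<^sub>m N) (\<sigma> g)"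
    using assoc_mult_mat[OF mu_carrier kL kron_one_sg[OF g]] mu_lmult[OF w] by simp
  also have "\<dots> = lmult w * can g"
    unfolding can_def by (rule assoc_mult_mat[OF L mu_carrier kron_one_sg[OF g]])
  finally show ?thesis .
qed

text \<open>The preimage under the Galois map of the family that is \<open>\<eta>\<close> at
  \<open>g\<close> and zero elsewhere; \<open>block\<close> cuts it into the tensors of
  \<open>bigalois\<close>.\<close>

definition D :: "'a \<Rightarrow> complex mat" where
  "D g = d g * \<eta>"

lemma D_carrier: "g \<in> carrier G \<Longrightarrow> D g \<in> carrier_mat (N * N) 1"
  unfolding D_def by (rule mult_carrier_mat[OF d_carrier eta_carrier])

lemma can_D: "g \<in> carrier G \<Longrightarrow> k \<in> carrier G \<Longrightarrow> can k * D g = (if g = k then \<eta> else 0\<^sub>m N 1)"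
  using assoc_mult_mat[OF can_carrier d_carrier eta_carrier, of k g] can_d[of g k] eta_carrier
  by (auto simp: D_def can_def)

text \<open>The inverse of a left linear map is left linear: both sides have the same image under
  every \<open>can k\<close>, and \<open>tensor_expand\<close> recovers a tensor from these
  images.\<close>

lemma d_left_linear:
  assumes g: "g \<in> carrier G" and w: "w \<in> carrier_mat N 1"
  shows "kronecker (lmult w) (1\<^sub>m N) * D g = d g * w"
proof -
  note L = lmult_carrier[OF w]
  have kL: "kronecker (lmult w) (1\<^sub>m N) \<in> carrier_mat (N * N) (N * N)" by (rule kronecker_carrier[OF L one_carrier_mat])
  define t where "t = kronecker (lmult w) (1\<^sub>m N) * D g"
  have t: "t \<in> carrier_mat (N * N) 1" unfolding t_def by (rule mult_carrier_mat[OF kL D_carrier[OF g]])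
  have can_t: "can k * t = (if g = k then w else 0\<^sub>m N 1)" if k: "k \<in> carrier G" for k
  proof -
    have "can k * t = lmult w * can k * D g"
      unfolding t_def using assoc_mult_mat[OF can_carrier[OF k] kL D_carrier[OF g]] can_lmult[OF k w] by simp
    also have "\<dots> = lmult w * (can k * D g)" by (rule assoc_mult_mat[OF L can_carrier[OF k] D_carrier[OF g]])
    also have "\<dots> = (if g = k then lmult w * \<eta> else 0\<^sub>m N 1)" using can_D[OF g k] L by auto
    finally show ?thesis using lmult_mult[OF w eta_carrier] prod_eta(2)[OF w] by (simp add: prod_def)
  qed
  have "t = msum (N * N) 1 (carrier G) (\<lambda>k. d k * (can k * t))" by (rule tensor_expand[OF t])
  also have "\<dots> = msum (N * N) 1 (carrier G) (\<lambda>k. if g = k then d k * w else 0\<^sub>m (N * N) 1)"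
    by (rule msum_cong) (simp add: can_t right_mult_zero_mat[OF d_carrier])
  also have "\<dots> = d g * w" by (rule msum_delta[where f = "\<lambda>k. d k * w", OF finG g mult_carrier_mat[OF d_carrier[OF g] w]])
  finally show ?thesis by (simp add: t_def)
qed

lemma eta_tensor:
  assumes y: "y \<in> carrier_mat N 1"
  shows "kronecker \<eta> y = msum (N * N) 1 (carrier G) (\<lambda>g. d g * (\<sigma> g * y))"
proof -
  have "kronecker \<eta> y = msum (N * N) 1 (carrier G) (\<lambda>g. d g * (can g * kronecker \<eta> y))"
    by (rule tensor_expand[OF kron_carrier1[OF eta_carrier y]])
  also have "\<dots> = msum (N * N) 1 (carrier G) (\<lambda>g. d g * (\<sigma> g * y))"
    using prod_eta(1) mult_carrier_mat[OF sg_carrier y] by (intro msum_cong) (simp add: can_tensor[OF _ eta_carrier y])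
  finally show ?thesis .
qed

lemma eta_nonzero: "\<exists>i<N. \<eta> $$ (i, 0) \<noteq> 0"
proof (rule ccontr)
  assume "\<not> ?thesis"
  then have "\<eta> = 0\<^sub>m N 1" using eta_carrier by (intro eq_matI) auto
  then have "kronecker \<eta> (1\<^sub>m N) = 0\<^sub>m (N * N) N" by (intro eq_matI) (auto simp: kronecker_def div_mod_less less_mult_imp_div_less)
  then have "1\<^sub>m N = (0\<^sub>m N N :: complex mat)" using unit_left mu_carrier by simp
  then have "(1\<^sub>m N :: complex mat) $$ (0, 0) = 0\<^sub>m N N $$ (0, 0)" by simp
  then show False using N_pos by simp
qed

text \<open>For a fixed \<open>x\<close> the tensors \<open>\<eta> \<otimes> x\<close> and
  \<open>x \<otimes> \<eta>\<close> have the same Galois image, hence are equal. Comparing entries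
  at an index where \<open>\<eta>\<close> is nonzero makes \<open>x\<close> proportional to
  \<open>\<eta>\<close>.\<close>

lemma fixed_sg:
  assumes x: "x \<in> carrier_mat N 1" and fixed: "\<And>g. g \<in> carrier G \<Longrightarrow> \<sigma> g * x = x"
  shows "\<exists>c. x = c \<cdot>\<^sub>m \<eta>"
proof -
  have "kronecker \<eta> x = msum (N * N) 1 (carrier G) (\<lambda>g. d g * x)"
    unfolding eta_tensor[OF x] by (rule msum_cong) (simp add: fixed)
  moreover have "kronecker x \<eta> = msum (N * N) 1 (carrier G) (\<lambda>g. d g * (can g * kronecker x \<eta>))"
    by (rule tensor_expand[OF kron_carrier1[OF x eta_carrier]])
  moreover have "\<dots> = msum (N * N) 1 (carrier G) (\<lambda>g. d g * x)"
    by (rule msum_cong) (simp add: can_tensor[OF _ x eta_carrier] sg_eta prod_eta(2)[OF x])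
  ultimately have eq: "kronecker \<eta> x = kronecker x \<eta>" by simp
  obtain a where a: "a < N" "\<eta> $$ (a, 0) \<noteq> 0" using eta_nonzero by blast
  have "x = (x $$ (a, 0) / \<eta> $$ (a, 0)) \<cdot>\<^sub>m \<eta>"
  proof (rule eq_matI)
    fix i j assume "i < dim_row ((x $$ (a, 0) / \<eta> $$ (a, 0)) \<cdot>\<^sub>m \<eta>)" "j < dim_col ((x $$ (a, 0) / \<eta> $$ (a, 0)) \<cdot>\<^sub>m \<eta>)"
    then have ij: "i < N" "j = 0" using eta_carrier by auto
    have l: "a * N + i < N * N" using mult_add_less[OF a(1) ij(1)] .
    have "kronecker \<eta> x $$ (a * N + i, 0) = \<eta> $$ (a, 0) * x $$ (i, 0)"
      using kronecker_index[OF eta_carrier x l, of 0] a ij N_pos by simp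
    moreover have "kronecker x \<eta> $$ (a * N + i, 0) = x $$ (a, 0) * \<eta> $$ (i, 0)"
      using kronecker_index[OF x eta_carrier l, of 0] a ij N_pos by simp
    ultimately show "x $$ (i, j) = ((x $$ (a, 0) / \<eta> $$ (a, 0)) \<cdot>\<^sub>m \<eta>) $$ (i, j)"
      using eq a ij eta_carrier by (simp add: field_simps)
  qed (use x eta_carrier in auto)
  then show ?thesis by blast
qed

text \<open>The identity of the tensor square has trace \<open>N * N\<close>. Swapping the factors
  in the trace of \<open>d g * can g\<close>, each \<open>g\<close> contributes the trace
  \<open>N\<close> of an identity matrix.\<close>

lemma card_G: "card (carrier G) = N"
proof -
  have "of_nat (N * N) = mtrace (1\<^sub>m (N * N))" by (rule mtrace_one[symmetric])
  also have "\<dots> = (\<Sum>g\<in>carrier G. mtrace (d g * can g))"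
    unfolding d_can[symmetric] can_def[symmetric] by (rule mtrace_msum[OF d_can_carrier])
  also have "\<dots> = (\<Sum>g\<in>carrier G. mtrace (can g * d g))"
    by (rule sum.cong) (use mtrace_comm[OF d_carrier can_carrier] in auto)
  also have "\<dots> = (\<Sum>g\<in>carrier G. of_nat N)" by (rule sum.cong) (simp_all add: can_def can_d mtrace_one)
  finally have "of_nat (N * N) = (of_nat (card (carrier G) * N) :: complex)" by simp
  then have "N * N = card (carrier G) * N" using of_nat_eq_iff by blast
  then show ?thesis using N_pos by simp
qed

text \<open>\<open>\<tau> h\<close> acting on both tensor factors is carried by the Galois map to
  \<open>\<tau> h\<close> on each of the \<open>N\<close> components, so the trace \<open>x\<close>
  of \<open>\<tau> h\<close> satisfies \<open>x * x = N * x\<close>.\<close>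

lemma mtrace_tau:
  assumes h: "h \<in> carrier H"
  shows "mtrace (\<tau> h) = 0 \<or> mtrace (\<tau> h) = of_nat N"
proof -
  let ?t = "\<tau> h"
  note t = tau_carrier[OF h]
  have kt: "kronecker ?t ?t \<in> carrier_mat (N * N) (N * N)" by (rule kronecker_carrier[OF t t])
  have can_t: "can g * kronecker ?t ?t = ?t * can g" if g: "g \<in> carrier G" for g
  proof -
    have "can g * kronecker ?t ?t = \<mu> * (kronecker (1\<^sub>m N) (\<sigma> g) * kronecker ?t ?t)"
      unfolding can_def by (rule assoc_mult_mat[OF mu_carrier kron_one_sg[OF g] kt])
    also have "kronecker (1\<^sub>m N) (\<sigma> g) * kronecker ?t ?t = kronecker ?t ?t * kronecker (1\<^sub>m N) (\<sigma> g)"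
      using kronecker_mult[OF one_carrier_mat t sg_carrier[OF g] t] kronecker_mult[OF t one_carrier_mat t sg_carrier[OF g]]
        t sg_tau[OF g h] by simp
    also have "\<mu> * (kronecker ?t ?t * kronecker (1\<^sub>m N) (\<sigma> g)) = \<mu> * kronecker ?t ?t * kronecker (1\<^sub>m N) (\<sigma> g)"
      by (rule assoc_mult_mat[OF mu_carrier kt kron_one_sg[OF g], symmetric])
    also have "\<dots> = ?t * \<mu> * kronecker (1\<^sub>m N) (\<sigma> g)" by (simp add: tau_mu[OF h])
    also have "\<dots> = ?t * can g" unfolding can_def by (rule assoc_mult_mat[OF t mu_carrier kron_one_sg[OF g]])
    finally show ?thesis .
  qed
  have "kronecker ?t ?t = msum (N * N) (N * N) (carrier G) (\<lambda>g. d g * can g) * kronecker ?t ?t"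
    using left_mult_one_mat[OF kt] d_can by (simp add: can_def)
  also have "\<dots> = msum (N * N) (N * N) (carrier G) (\<lambda>g. d g * can g * kronecker ?t ?t)"
    by (rule msum_mult[OF kt d_can_carrier])
  also have "\<dots> = msum (N * N) (N * N) (carrier G) (\<lambda>g. d g * (?t * can g))"
    by (rule msum_cong) (use assoc_mult_mat[OF d_carrier can_carrier kt] can_t in auto)
  finally have "mtrace (kronecker ?t ?t) = (\<Sum>g\<in>carrier G. mtrace (d g * (?t * can g)))"
    using mtrace_msum[of "carrier G" "\<lambda>g. d g * (?t * can g)" "N * N"]
      mult_carrier_mat[OF d_carrier mult_carrier_mat[OF t can_carrier]] by simp
  also have "\<dots> = (\<Sum>g\<in>carrier G. mtrace ?t)"
  proof (rule sum.cong)
    fix g assume g: "g \<in> carrier G"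
    have "mtrace (d g * (?t * can g)) = mtrace (?t * can g * d g)"
      by (rule mtrace_comm[OF d_carrier[OF g] mult_carrier_mat[OF t can_carrier[OF g]]])
    also have "?t * can g * d g = ?t * (can g * d g)"
      by (rule assoc_mult_mat[OF t can_carrier[OF g] d_carrier[OF g]])
    also have "\<dots> = ?t" using can_d[OF g g] t by (simp add: can_def)
    finally show "mtrace (d g * (?t * can g)) = mtrace ?t" .
  qed simp
  finally have "mtrace ?t * mtrace ?t = of_nat N * mtrace ?t"
    using mtrace_kronecker[OF t t] card_G by simp
  then show ?thesis by auto
qed

text \<open>The sum \<open>E\<close> of all \<open>\<tau> h\<close> has image in the multiples of
  \<open>\<eta>\<close> and multiplies \<open>\<eta>\<close> by \<open>card (carrier H)\<close>; the
  trace of such a matrix of rank one is this eigenvalue.\<close>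

lemma sum_mtrace_tau: "(\<Sum>h\<in>carrier H. mtrace (\<tau> h)) = of_nat (card (carrier H))"
proof -
  define E where "E = msum N N (carrier H) \<tau>"
  have E: "E \<in> carrier_mat N N" by (simp add: E_def)
  have tE: "\<tau> h * E = E" if h: "h \<in> carrier H" for h
  proof -
    have "\<tau> h * E = msum N N (carrier H) (\<lambda>k. \<tau> h * \<tau> k)"
      unfolding E_def by (rule mult_msum[OF tau_carrier[OF h] tau_carrier])
    also have "\<dots> = msum N N (carrier H) (\<lambda>k. \<tau> (h \<otimes>\<^bsub>H\<^esub> k))"
      by (rule msum_cong) (simp add: tau_mult h)
    also have "\<dots> = E"
    proof (rule eq_matI)
      fix i j assume "i < dim_row E" "j < dim_col E"
      then have ij: "i < N" "j < N" using E by auto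
      have "(\<Sum>k\<in>carrier H. \<tau> (h \<otimes>\<^bsub>H\<^esub> k) $$ (i, j)) = (\<Sum>k\<in>carrier H. \<tau> k $$ (i, j))"
        by (rule sum.reindex_bij_betw[OF H.bij_betw_mult_subgroup[OF H.subgroup_self h]])
      then show "msum N N (carrier H) (\<lambda>k. \<tau> (h \<otimes>\<^bsub>H\<^esub> k)) $$ (i, j) = E $$ (i, j)"
        using ij by (simp add: E_def msum_index)
    qed (use E in \<open>auto simp: msum_def\<close>)
    finally show ?thesis .
  qed
  have "\<exists>c. \<forall>i<N. E $$ (i, j) = c * \<eta> $$ (i, 0)" if j: "j < N" for j
  proof -
    define x where "x = E * cvec N (unit_fun j)"
    have x: "x \<in> carrier_mat N 1" unfolding x_def by (rule mult_carrier_mat[OF E cvec_carrier])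
    have "\<tau> h * x = x" if h: "h \<in> carrier H" for h
      unfolding x_def using assoc_mult_mat[OF tau_carrier[OF h] E cvec_carrier] tE[OF h] by simp
    then obtain c where c: "x = c \<cdot>\<^sub>m \<eta>" using fixed_tau[OF x] by blast
    have "E $$ (i, j) = c * \<eta> $$ (i, 0)" if i: "i < N" for i
    proof -
      have "x $$ (i, 0) = E $$ (i, j)" unfolding x_def by (rule mult_unit_fun[OF E i j])
      then show ?thesis using c i eta_carrier by simp
    qed
    then show ?thesis by blast
  qed
  then obtain c where c: "\<And>i j. \<lbrakk>i < N; j < N\<rbrakk> \<Longrightarrow> E $$ (i, j) = c j * \<eta> $$ (i, 0)" by metis
  obtain a where a: "a < N" "\<eta> $$ (a, 0) \<noteq> 0" using eta_nonzero by blast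
  have "E * \<eta> = msum N 1 (carrier H) (\<lambda>h. \<tau> h * \<eta>)"
    unfolding E_def by (rule msum_mult[OF eta_carrier tau_carrier])
  also have "\<dots> = msum N 1 (carrier H) (\<lambda>h. \<eta>)" by (rule msum_cong) (simp add: tau_eta)
  finally have "(E * \<eta>) $$ (a, 0) = of_nat (card (carrier H)) * \<eta> $$ (a, 0)"
    using a by (simp add: msum_index)
  moreover have "(E * \<eta>) $$ (a, 0) = (\<Sum>l<N. E $$ (a, l) * \<eta> $$ (l, 0))"
    using a by (intro index_mult_mat_sum[OF E eta_carrier]) auto
  moreover have "\<dots> = (\<Sum>l<N. c l * \<eta> $$ (l, 0) * \<eta> $$ (a, 0))"
    by (rule sum.cong) (use a c in auto)
  moreover have "\<dots> = (\<Sum>l<N. c l * \<eta> $$ (l, 0)) * \<eta> $$ (a, 0)" by (rule sum_distrib_right[symmetric])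
  moreover have "mtrace E = (\<Sum>l<N. c l * \<eta> $$ (l, 0))" using E by (simp add: mtrace_def c)
  ultimately have "mtrace E = of_nat (card (carrier H))" using a(2) by simp
  then show ?thesis unfolding E_def using mtrace_msum[of "carrier H" \<tau> N] tau_carrier by simp
qed

text \<open>By \<open>mtrace_tau\<close> each trace is \<open>0\<close> or \<open>N\<close>, and the
  traces add up to \<open>card (carrier H)\<close>. So this is a multiple of \<open>N\<close>,
  positive because \<open>\<tau>\<close> at the unit contributes.\<close>

lemma card_G_le: "card (carrier G) \<le> card (carrier H)"
proof -
  let ?K = "{h \<in> carrier H. mtrace (\<tau> h) = of_nat N}"
  have "of_nat (card (carrier H)) = (\<Sum>h\<in>carrier H. mtrace (\<tau> h))" by (rule sum_mtrace_tau[symmetric])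
  also have "\<dots> = (\<Sum>h\<in>carrier H. if mtrace (\<tau> h) = of_nat N then of_nat N else 0)"
    using mtrace_tau by (intro sum.cong) auto
  also have "\<dots> = of_nat (card ?K * N)" using finH by (simp add: sum.If_cases Int_def)
  finally have "card (carrier H) = card ?K * N" using of_nat_eq_iff by blast
  moreover have "\<one>\<^bsub>H\<^esub> \<in> ?K" by (simp add: tau_one mtrace_one)
  then have "card ?K \<noteq> 0" using finH by auto
  ultimately show ?thesis using card_G by simp
qed

section \<open>Passage to an algebra of functions\<close>

definition M :: "(nat \<Rightarrow> complex) set" where
  "M = {x. \<forall>i\<ge>N. x i = 0}"

definition mul :: "(nat \<Rightarrow> complex) \<Rightarrow> (nat \<Rightarrow> complex) \<Rightarrow> nat \<Rightarrow> complex" where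
  "mul x y = fvec N (cvec N x \<star> cvec N y)"

lemma fvec_M: "fvec N A \<in> M"
  by (simp add: M_def fvec_def)

lemma fvec_cvec_M: "x \<in> M \<Longrightarrow> fvec N (cvec N x) = x"
  by (rule fvec_cvec) (simp add: M_def)

lemma cvec_mul: "cvec N (mul x y) = cvec N x \<star> cvec N y"
  unfolding mul_def by (rule cvec_fvec[OF prod_carrier]) auto

lemma complex_algebra: "complex_algebra fscale mul M (fvec N \<eta>) (unit_fun ` {..<N})"
proof -
  interpret vs: vector_space fscale by (rule vector_space_fscale)
  note k = kron_carrier1[OF cvec_carrier cvec_carrier] and kc = kronecker_carrier[OF cvec_carrier cvec_carrier]
  show ?thesis
  proof
    fix x y z :: "nat \<Rightarrow> complex" and c
    show "mul (mul x y) z = mul x (mul y z)"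
      unfolding mul_def[of "mul x y"] mul_def[of x "mul y z"] cvec_mul by (simp add: prod_assoc)
    show "mul (x + y) z = mul x z + mul y z"
      using mult_add_distrib_mat[OF mu_carrier k k] fvec_add[OF prod_carrier prod_carrier]
      by (simp add: mul_def prod_def cvec_add kronecker_add_left[OF cvec_carrier cvec_carrier])
    show "mul x (y + z) = mul x y + mul x z"
      using mult_add_distrib_mat[OF mu_carrier k k] fvec_add[OF prod_carrier prod_carrier]
      by (simp add: mul_def prod_def cvec_add kronecker_add_right[OF cvec_carrier cvec_carrier])
    show "mul (fscale c x) y = fscale c (mul x y)"
      using mult_smult_distrib[OF mu_carrier k] fvec_smult[OF prod_carrier]
      by (simp add: mul_def prod_def cvec_fscale kronecker_smult_left)
    show "mul x (fscale c y) = fscale c (mul x y)"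
      using mult_smult_distrib[OF mu_carrier k] fvec_smult[OF prod_carrier]
      by (simp add: mul_def prod_def cvec_fscale kronecker_smult_right)
    show "vs.subspace M" by (rule vs.subspaceI) (auto simp: M_def fscale_def)
    show "mul x y \<in> M" unfolding mul_def by (rule fvec_M)
    show "fvec N \<eta> \<in> M" by (rule fvec_M)
    show "fvec N \<eta> \<noteq> 0" using eta_nonzero by (auto simp: fvec_def fun_eq_iff)
    show "mul (fvec N \<eta>) x = x" "mul x (fvec N \<eta>) = x" if "x \<in> M"
      using that prod_eta[OF cvec_carrier] by (simp_all add: mul_def cvec_fvec[OF eta_carrier] fvec_cvec_M)
    show "finite (unit_fun ` {..<N})" by simp
    show "M \<subseteq> vs.span (unit_fun ` {..<N})"
    proof
      fix x assume x: "x \<in> M"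
      have "x = (\<Sum>i<N. fscale (x i) (unit_fun i))"
      proof
        fix j
        have "(\<Sum>i<N. fscale (x i) (unit_fun i)) j = (\<Sum>i<N. if j = i then x i else 0)"
          by (auto simp: sum_fun_apply fscale_def unit_fun_def intro!: sum.cong)
        then show "x j = (\<Sum>i<N. fscale (x i) (unit_fun i)) j" using x by (auto simp: sum.delta M_def not_less)
      qed
      also have "\<dots> \<in> vs.span (unit_fun ` {..<N})" by (intro vs.span_sum vs.span_scale vs.span_base) auto
      finally show "x \<in> vs.span (unit_fun ` {..<N})" .
    qed
  qed
qed

definition sg :: "'a \<Rightarrow> (nat \<Rightarrow> complex) \<Rightarrow> nat \<Rightarrow> complex" where
  "sg g x = fvec N (\<sigma> g * cvec N x)"

definition tau :: "'b \<Rightarrow> (nat \<Rightarrow> complex) \<Rightarrow> nat \<Rightarrow> complex" where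
  "tau h x = fvec N (\<tau> h * cvec N x)"

lemma cvec_sg: "g \<in> carrier G \<Longrightarrow> cvec N (sg g x) = \<sigma> g * cvec N x"
  unfolding sg_def by (rule cvec_fvec[OF mult_carrier_mat[OF sg_carrier cvec_carrier]])

lemma cvec_tau: "h \<in> carrier H \<Longrightarrow> cvec N (tau h x) = \<tau> h * cvec N x"
  unfolding tau_def by (rule cvec_fvec[OF mult_carrier_mat[OF tau_carrier cvec_carrier]])

lemma cvec_eq_smult: "cvec N x = c \<cdot>\<^sub>m \<eta> \<Longrightarrow> x \<in> M \<Longrightarrow> x = fscale c (fvec N \<eta>)"
  by (metis eta_carrier fvec_cvec_M fvec_smult)

lemma tau_faithful:
  assumes h: "h \<in> carrier H" and triv: "\<And>x. x \<in> M \<Longrightarrow> tau h x = x"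
  shows "h = \<one>\<^bsub>H\<^esub>"
proof (rule faithful_tau[OF h])
  note t = tau_carrier[OF h]
  show "\<tau> h = 1\<^sub>m N"
  proof (rule eq_matI)
    fix i j assume "i < dim_row (1\<^sub>m N :: complex mat)" "j < dim_col (1\<^sub>m N :: complex mat)"
    then have ij: "i < N" "j < N" by auto
    have "unit_fun j \<in> M" using ij by (auto simp: M_def unit_fun_def)
    then have "tau h (unit_fun j) i = unit_fun j i" by (simp add: triv)
    moreover have "tau h (unit_fun j) i = \<tau> h $$ (i, j)"
      unfolding tau_def fvec_def using mult_unit_fun[OF t ij] ij by simp
    ultimately show "\<tau> h $$ (i, j) = (1\<^sub>m N :: complex mat) $$ (i, j)"
      using ij by (auto simp: sum.delta unit_fun_def)
  qed (use t in auto)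
qed

lemma galois_sum:
  assumes "g \<in> carrier G" "k \<in> carrier G"
  shows "(\<Sum>i<N. mul (unit_fun i) (sg k (block N (D g) i))) = (if g = k then fvec N \<eta> else 0)"
proof -
  have "(\<Sum>i<N. mul (unit_fun i) (sg k (block N (D g) i))) =
      (\<Sum>i<N. fvec N (can k * kronecker (cvec N (unit_fun i)) (cvec N (block N (D g) i))))"
    by (simp add: mul_def cvec_sg assms can_tensor)
  also have "\<dots> = fvec N (can k * D g)"
    by (rule fvec_tensor_expand[OF can_carrier[OF assms(2)] D_carrier[OF assms(1)], symmetric])
  finally show ?thesis using can_D[OF assms] by (auto simp: fvec_def fun_eq_iff)
qed

text \<open>The map \<open>\<Theta>\<close> sends \<open>a \<otimes> b\<close> to
  \<open>a \<star> z \<star> b\<close>. It is applied to the expansion \<open>eta_tensor\<close> of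
  \<open>\<eta> \<otimes> y\<close>; \<open>d_left_linear\<close> then moves
  \<open>\<sigma> g y\<close> out to the left of each term.\<close>

lemma galois_sum':
  assumes z: "z \<in> M" and y: "y \<in> M"
  shows "mul z y = (\<Sum>g\<in>carrier G. mul (sg g y) (\<Sum>i<N. mul (mul (unit_fun i) z) (block N (D g) i)))"
proof -
  interpret complex_algebra fscale mul M "fvec N \<eta>" "unit_fun ` {..<N}" by (rule complex_algebra)
  let ?z = "cvec N z" and ?y = "cvec N y"
  note R = rmult_carrier[OF cvec_carrier[of N z]]
  define \<Theta> where "\<Theta> = \<mu> * kronecker (rmult ?z) (1\<^sub>m N)"
  have kR: "kronecker (rmult ?z) (1\<^sub>m N) \<in> carrier_mat (N * N) (N * N)" by (rule kronecker_carrier[OF R one_carrier_mat])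
  have \<Theta>: "\<Theta> \<in> carrier_mat N (N * N)" unfolding \<Theta>_def by (rule mult_carrier_mat[OF mu_carrier kR])
  have \<Theta>_tensor: "\<Theta> * kronecker a b = (a \<star> ?z) \<star> b" if a: "a \<in> carrier_mat N 1" and b: "b \<in> carrier_mat N 1" for a b
  proof -
    have "\<Theta> * kronecker a b = \<mu> * (kronecker (rmult ?z) (1\<^sub>m N) * kronecker a b)"
      unfolding \<Theta>_def by (rule assoc_mult_mat[OF mu_carrier kR kron_carrier1[OF a b]])
    also have "kronecker (rmult ?z) (1\<^sub>m N) * kronecker a b = kronecker (rmult ?z * a) b"
      using kronecker_mult[OF R a one_carrier_mat b] b by simp
    also have "rmult ?z * a = a \<star> ?z" unfolding prod_def by (rule rmult_mult[OF cvec_carrier a])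
    finally show ?thesis by (simp add: prod_def)
  qed
  have inner: "mul (sg g y) (\<Sum>i<N. mul (mul (unit_fun i) z) (block N (D g) i)) = fvec N (\<Theta> * (d g * (\<sigma> g * ?y)))"
    if g: "g \<in> carrier G" for g
  proof -
    let ?w = "\<sigma> g * ?y"
    have w: "?w \<in> carrier_mat N 1" by (rule mult_carrier_mat[OF sg_carrier[OF g] cvec_carrier])
    note L = lmult_carrier[OF w]
    have kL: "kronecker (lmult ?w) (1\<^sub>m N) \<in> carrier_mat (N * N) (N * N)" by (rule kronecker_carrier[OF L one_carrier_mat])
    have A: "\<Theta> * kronecker (lmult ?w) (1\<^sub>m N) \<in> carrier_mat N (N * N)" by (rule mult_carrier_mat[OF \<Theta> kL])
    have "mul (sg g y) (\<Sum>i<N. mul (mul (unit_fun i) z) (block N (D g) i)) =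
        (\<Sum>i<N. mul (mul (mul (sg g y) (unit_fun i)) z) (block N (D g) i))"
      by (simp add: mul_sum_right mul_assoc)
    also have "\<dots> = (\<Sum>i<N. fvec N (\<Theta> * kronecker (lmult ?w) (1\<^sub>m N) * kronecker (cvec N (unit_fun i)) (cvec N (block N (D g) i))))"
    proof (rule sum.cong)
      fix i
      let ?u = "cvec N (unit_fun i)" and ?r = "cvec N (block N (D g) i)"
      have "\<Theta> * kronecker (lmult ?w) (1\<^sub>m N) * kronecker ?u ?r = \<Theta> * (kronecker (lmult ?w) (1\<^sub>m N) * kronecker ?u ?r)"
        by (rule assoc_mult_mat[OF \<Theta> kL kron_carrier1]) auto
      also have "kronecker (lmult ?w) (1\<^sub>m N) * kronecker ?u ?r = kronecker (?w \<star> ?u) ?r"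
        using kronecker_mult[OF L cvec_carrier[of N "unit_fun i"] one_carrier_mat[of N] cvec_carrier[of N "block N (D g) i"]]
          lmult_mult[OF w cvec_carrier[of N "unit_fun i"]]
        by (simp add: prod_def carrier_matD[OF cvec_carrier])
      also have "\<Theta> * kronecker (?w \<star> ?u) ?r = ((?w \<star> ?u) \<star> ?z) \<star> ?r"
        by (rule \<Theta>_tensor[OF prod_carrier[OF w cvec_carrier] cvec_carrier])
      finally show "mul (mul (mul (sg g y) (unit_fun i)) z) (block N (D g) i) =
          fvec N (\<Theta> * kronecker (lmult ?w) (1\<^sub>m N) * kronecker ?u ?r)"
        by (simp add: mul_def[of "mul (mul (sg g y) (unit_fun i)) z"] cvec_mul cvec_sg[OF g])
    qed simp
    also have "\<dots> = fvec N (\<Theta> * kronecker (lmult ?w) (1\<^sub>m N) * D g)"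
      by (rule fvec_tensor_expand[OF A D_carrier[OF g], symmetric])
    also have "\<Theta> * kronecker (lmult ?w) (1\<^sub>m N) * D g = \<Theta> * (kronecker (lmult ?w) (1\<^sub>m N) * D g)"
      by (rule assoc_mult_mat[OF \<Theta> kL D_carrier[OF g]])
    also have "kronecker (lmult ?w) (1\<^sub>m N) * D g = d g * ?w" by (rule d_left_linear[OF g w])
    finally show ?thesis .
  qed
  have "mul z y = fvec N (\<Theta> * kronecker \<eta> ?y)"
    by (simp add: \<Theta>_tensor[OF eta_carrier cvec_carrier] prod_eta mul_def)
  also have "\<Theta> * kronecker \<eta> ?y = msum N 1 (carrier G) (\<lambda>g. \<Theta> * (d g * (\<sigma> g * ?y)))"
    unfolding eta_tensor[OF cvec_carrier]
    by (rule mult_msum[OF \<Theta> mult_carrier_mat[OF d_carrier mult_carrier_mat[OF sg_carrier cvec_carrier]]])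
  also have "fvec N \<dots> = (\<Sum>g\<in>carrier G. fvec N (\<Theta> * (d g * (\<sigma> g * ?y))))" by (rule fvec_msum)
  also have "\<dots> = (\<Sum>g\<in>carrier G. mul (sg g y) (\<Sum>i<N. mul (mul (unit_fun i) z) (block N (D g) i)))"
    by (rule sum.cong) (simp_all add: inner)
  finally show ?thesis .
qed

lemma bigalois: "bigalois G H fscale mul M (fvec N \<eta>) (unit_fun ` {..<N}) sg tau {..<N} unit_fun (\<lambda>g. block N (D g))"
proof (intro bigalois.intro bigalois_axioms.intro complex_algebra G.is_group H.is_group finG finH card_G_le)
  note c = cvec_carrier and add = mult_add_distrib_mat[OF _ cvec_carrier cvec_carrier]
  fix g g' x y c h h'
  {
    assume g: "g \<in> carrier G"
    note s = sg_carrier[OF g] and sc = mult_carrier_mat[OF sg_carrier[OF g] cvec_carrier]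
    show "sg g x \<in> M" unfolding sg_def by (rule fvec_M)
    show "sg g (x + y) = sg g x + sg g y" unfolding sg_def cvec_add add[OF s] by (rule fvec_add[OF sc sc])
    show "sg g (fscale c x) = fscale c (sg g x)"
      unfolding sg_def cvec_fscale mult_smult_distrib[OF s cvec_carrier] by (rule fvec_smult[OF sc])
    show "sg g (mul x y) = mul (sg g x) (sg g y)"
      unfolding sg_def[of g "mul x y"] mul_def[of "sg g x"] cvec_mul cvec_sg[OF g]
      by (simp add: aut_prod[OF s sg_mu[OF g]])
    show "sg g (fvec N \<eta>) = fvec N \<eta>" by (simp add: sg_def cvec_fvec[OF eta_carrier] sg_eta[OF g])
    show "sg (g \<otimes> g') x = sg g (sg g' x)" if g': "g' \<in> carrier G"
      unfolding sg_def[of g "sg g' x"] cvec_sg[OF g'] sg_def[of "g \<otimes> g'"] sg_mult[OF g g']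
      by (simp add: assoc_mult_mat[OF s sg_carrier[OF g'] cvec_carrier])
    show "sg g (tau h x) = tau h (sg g x)" if h: "h \<in> carrier H"
      unfolding sg_def[of g "tau h x"] tau_def[of h "sg g x"] cvec_sg[OF g] cvec_tau[OF h]
      by (simp add: assoc_mult_mat[OF s tau_carrier[OF h] cvec_carrier, symmetric] sg_tau[OF g h]
          assoc_mult_mat[OF tau_carrier[OF h] s cvec_carrier])
    show "block N (D g) i \<in> M" for i by (simp add: block_def M_def)
    show "(\<Sum>i<N. mul (unit_fun i) (sg k (block N (D g) i))) = (if g = k then fvec N \<eta> else 0)"
      if "k \<in> carrier G" for k using galois_sum[OF g that] .
  }
  {
    assume h: "h \<in> carrier H"
    note s = tau_carrier[OF h] and sc = mult_carrier_mat[OF tau_carrier[OF h] cvec_carrier]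
    show "tau h x \<in> M" unfolding tau_def by (rule fvec_M)
    show "tau h (x + y) = tau h x + tau h y" unfolding tau_def cvec_add add[OF s] by (rule fvec_add[OF sc sc])
    show "tau h (fscale c x) = fscale c (tau h x)"
      unfolding tau_def cvec_fscale mult_smult_distrib[OF s cvec_carrier] by (rule fvec_smult[OF sc])
    show "tau h (mul x y) = mul (tau h x) (tau h y)"
      unfolding tau_def[of h "mul x y"] mul_def[of "tau h x"] cvec_mul cvec_tau[OF h]
      by (simp add: aut_prod[OF s tau_mu[OF h]])
    show "tau h (fvec N \<eta>) = fvec N \<eta>" by (simp add: tau_def cvec_fvec[OF eta_carrier] tau_eta[OF h])
    show "tau (h \<otimes>\<^bsub>H\<^esub> h') x = tau h (tau h' x)" if h': "h' \<in> carrier H"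
      unfolding tau_def[of h "tau h' x"] cvec_tau[OF h'] tau_def[of "h \<otimes>\<^bsub>H\<^esub> h'"] tau_mult[OF h h']
      by (simp add: assoc_mult_mat[OF s tau_carrier[OF h'] cvec_carrier])
    show "h = \<one>\<^bsub>H\<^esub>" if "\<And>x. x \<in> M \<Longrightarrow> tau h x = x" by (rule tau_faithful[OF h that])
  }
  assume x: "x \<in> M"
  show "sg \<one> x = x" by (simp add: sg_def sg_one fvec_cvec_M[OF x] carrier_matD[OF cvec_carrier])
  show "tau \<one>\<^bsub>H\<^esub> x = x" by (simp add: tau_def tau_one fvec_cvec_M[OF x] carrier_matD[OF cvec_carrier])
  show "\<exists>c. x = fscale c (fvec N \<eta>)" if "\<And>g. g \<in> carrier G \<Longrightarrow> sg g x = x"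
    using fixed_sg[OF cvec_carrier, of x] cvec_sg that cvec_eq_smult[OF _ x] by metis
  show "\<exists>c. x = fscale c (fvec N \<eta>)" if "\<And>h. h \<in> carrier H \<Longrightarrow> tau h x = x"
    using fixed_tau[OF cvec_carrier, of x] cvec_tau that cvec_eq_smult[OF _ x] by metis
  show "mul x y = (\<Sum>g\<in>carrier G. mul (sg g y) (\<Sum>i<N. mul (mul (unit_fun i) x) (block N (D g) i)))" if "y \<in> M"
    by (rule galois_sum'[OF x that])
qed

end

section \<open>The regular representation\<close>

text \<open>The matrix of \<open>e\<^sub>j \<mapsto> c j \<cdot> e\<^bsub>a j\<^esub>\<close>, where basis vectors with \<open>a j \<ge> m\<close> are sent to \<open>0\<close>.\<close>

definition fmat :: "nat \<Rightarrow> nat \<Rightarrow> (nat \<Rightarrow> nat) \<Rightarrow> (nat \<Rightarrow> complex) \<Rightarrow> complex mat" where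
  "fmat m n a c = mat m n (\<lambda>(i, j). if i = a j then c j else 0)"

lemma fmat_carrier [simp]: "fmat m n a c \<in> carrier_mat m n"
  by (simp add: fmat_def)

lemma fmat_index: "i < m \<Longrightarrow> j < n \<Longrightarrow> fmat m n a c $$ (i, j) = (if i = a j then c j else 0)"
  by (simp add: fmat_def)

lemma fmat_eqI:
  assumes "\<And>j. j < n \<Longrightarrow> c j = c' j" "\<And>j. \<lbrakk>j < n; c j \<noteq> 0\<rbrakk> \<Longrightarrow> a j = a' j"
  shows "fmat m n a c = fmat m n a' c'"
proof (rule eq_matI)
  fix i j assume "i < dim_row (fmat m n a' c')" "j < dim_col (fmat m n a' c')"
  then have ij: "i < m" "j < n" by (auto simp: fmat_def)
  show "fmat m n a c $$ (i, j) = fmat m n a' c' $$ (i, j)"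
    using assms(1)[OF ij(2)] assms(2)[OF ij(2)] ij by (cases "c j = 0") (auto simp: fmat_index)
qed (auto simp: fmat_def)

lemma fmat_one: "fmat n n (\<lambda>j. j) (\<lambda>_. 1) = 1\<^sub>m n"
  by (rule eq_matI) (auto simp: fmat_def)

lemma fmat_mult_index:
  assumes A: "A \<in> carrier_mat m n" and ij: "i < m" "j < p" and b: "b j < n"
  shows "(A * fmat n p b d) $$ (i, j) = A $$ (i, b j) * d j"
proof -
  have "(A * fmat n p b d) $$ (i, j) = (\<Sum>l<n. A $$ (i, l) * fmat n p b d $$ (l, j))"
    by (rule index_mult_mat_sum[OF A fmat_carrier ij])
  also have "\<dots> = (\<Sum>l<n. if l = b j then A $$ (i, l) * d j else 0)"
    by (rule sum.cong) (use ij in \<open>auto simp: fmat_index\<close>)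
  finally show ?thesis using b by (simp add: sum.delta)
qed

lemma fmat_mult:
  assumes "\<And>j. j < p \<Longrightarrow> b j < n"
  shows "fmat m n a c * fmat n p b d = fmat m p (\<lambda>j. a (b j)) (\<lambda>j. c (b j) * d j)"
proof (rule eq_matI)
  fix i j assume "i < dim_row (fmat m p (\<lambda>j. a (b j)) (\<lambda>j. c (b j) * d j))"
    "j < dim_col (fmat m p (\<lambda>j. a (b j)) (\<lambda>j. c (b j) * d j))"
  then have ij: "i < m" "j < p" by (auto simp: fmat_def)
  show "(fmat m n a c * fmat n p b d) $$ (i, j) = fmat m p (\<lambda>j. a (b j)) (\<lambda>j. c (b j) * d j) $$ (i, j)"
    unfolding fmat_mult_index[where b = b and d = d, OF fmat_carrier ij assms[OF ij(2)]] using ij assms[OF ij(2)] by (simp add: fmat_index)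
qed (auto simp: fmat_def)

lemma fmat_kronecker:
  assumes "\<And>j. j < n' \<Longrightarrow> a' j < m'"
  shows "kronecker (fmat m n a c) (fmat m' n' a' c') =
    fmat (m * m') (n * n') (\<lambda>j. a (j div n') * m' + a' (j mod n')) (\<lambda>j. c (j div n') * c' (j mod n'))"
proof (rule eq_matI)
  fix i j assume "i < dim_row (fmat (m * m') (n * n') (\<lambda>j. a (j div n') * m' + a' (j mod n')) (\<lambda>j. c (j div n') * c' (j mod n')))"
    "j < dim_col (fmat (m * m') (n * n') (\<lambda>j. a (j div n') * m' + a' (j mod n')) (\<lambda>j. c (j div n') * c' (j mod n')))"
  then have ij: "i < m * m'" "j < n * n'" by (auto simp: fmat_def)
  note d = div_mod_less[OF ij(1)] div_mod_less[OF ij(2)]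
  have lt: "a' (j mod n') < m'" using assms d by auto
  have "i = a (j div n') * m' + a' (j mod n') \<longleftrightarrow> i div m' = a (j div n') \<and> i mod m' = a' (j mod n')"
  proof
    assume "i = a (j div n') * m' + a' (j mod n')"
    then show "i div m' = a (j div n') \<and> i mod m' = a' (j mod n')" using lt by simp
  next
    assume "i div m' = a (j div n') \<and> i mod m' = a' (j mod n')"
    then show "i = a (j div n') * m' + a' (j mod n')" by (metis div_mult_mod_eq)
  qed
  then show "kronecker (fmat m n a c) (fmat m' n' a' c') $$ (i, j) =
      fmat (m * m') (n * n') (\<lambda>j. a (j div n') * m' + a' (j mod n')) (\<lambda>j. c (j div n') * c' (j mod n')) $$ (i, j)"
    unfolding kronecker_index[OF fmat_carrier fmat_carrier ij] using ij d by (simp add: fmat_index)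
qed (auto simp: fmat_def)

text \<open>A folded form of the tensor product in \<open>Rep G\<close>, which the simplification
  rules for \<open>Rep\<close> would expand into a pair.\<close>

definition ten :: "('a, 'c) monoid_scheme \<Rightarrow> 'a matrix_rep \<Rightarrow> 'a matrix_rep \<Rightarrow> 'a matrix_rep" where
  "ten G V W = (fst V * fst W, \<lambda>g \<in> carrier G. kronecker (snd V g) (snd W g))"

definition unit_rep :: "('a, 'c) monoid_scheme \<Rightarrow> 'a matrix_rep" where
  "unit_rep G = (1, \<lambda>g \<in> carrier G. 1\<^sub>m 1)"

lemma fst_ten [simp]: "fst (ten G V W) = fst V * fst W"
  by (simp add: ten_def)

lemma snd_ten: "g \<in> carrier G \<Longrightarrow> snd (ten G V W) g = kronecker (snd V g) (snd W g)"
  by (simp add: ten_def)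

text \<open>Kronecker products associate strictly, so both bracketings are the same object and the
  associators act as identities.\<close>

lemma ten_assoc: "ten G (ten G U V) W = ten G U (ten G V W)"
  by (auto simp: ten_def kronecker_assoc restrict_def fun_eq_iff)

lemma ten_rep: "\<lbrakk>group G; V \<in> representations G; W \<in> representations G\<rbrakk> \<Longrightarrow> ten G V W \<in> representations G"
  using tensor_representation[of G V W] by (simp add: ten_def)

lemma unit_rep: "group G \<Longrightarrow> unit_rep G \<in> representations G"
  using unit_representation[of G] by (simp add: unit_rep_def)

lemma fst_unit_rep [simp]: "fst (unit_rep G) = 1"
  by (simp add: unit_rep_def)

lemma snd_unit_rep: "g \<in> carrier G \<Longrightarrow> snd (unit_rep G) g = 1\<^sub>m 1"
  by (simp add: unit_rep_def)

lemma intertwinersI: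
  "\<lbrakk>T \<in> carrier_mat (fst W) (fst V); \<And>g. g \<in> carrier G \<Longrightarrow> T * snd V g = snd W g * T\<rbrakk> \<Longrightarrow> T \<in> intertwiners G V W"
  by (simp add: intertwiners_def)

lemma intertwiners_mult:
  assumes "group G" "V \<in> representations G" "W \<in> representations G" "X \<in> representations G"
    "T \<in> intertwiners G V W" "S \<in> intertwiners G W X"
  shows "S * T \<in> intertwiners G V X"
proof -
  interpret linear_monoidal_category "Rep G" by (rule linear_monoidal_category_Rep[OF assms(1)])
  show ?thesis using comp_hom[of V W X T S] assms by simp
qed

lemma kronecker_intertwiner:
  assumes "S \<in> intertwiners G V V'" "T \<in> intertwiners G W W'" "V \<in> representations G" "V' \<in> representations G"
    "W \<in> representations G" "W' \<in> representations G"
  shows "kronecker S T \<in> intertwiners G (ten G V W) (ten G V' W')"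
  using tensor_intertwiner[OF assms] by (simp add: ten_def)

lemma rep_one:
  assumes "group G" "V \<in> representations G"
  shows "snd V \<one>\<^bsub>G\<^esub> = 1\<^sub>m (fst V)"
proof -
  interpret group G by fact
  let ?A = "snd V \<one>\<^bsub>G\<^esub>"
  have A: "?A \<in> carrier_mat (fst V) (fst V)" by (rule representationsD(2)[OF assms(2) one_closed])
  obtain B where B: "B \<in> carrier_mat (fst V) (fst V)" "B * ?A = 1\<^sub>m (fst V)"
    using representationsD(1)[OF assms(2) one_closed] by (auto simp: GL_iff)
  have "?A * ?A = ?A" using representations_mult[OF assms(2) one_closed one_closed] by simp
  then have "B * ?A * ?A = B * ?A" using assoc_mult_mat[OF B(1) A A] by simp
  then show ?thesis using B(2) A by simp
qed

locale finite_group = group G for G :: "('a, 'c) monoid_scheme" (structure) +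
  assumes fin: "finite (carrier G)"
begin

section \<open>Permutation matrices on the elements of the group\<close>

definition n :: nat where "n = card (carrier G)"

definition en :: "nat \<Rightarrow> 'a" where "en = (SOME f. bij_betw f {0..<n} (carrier G))"

definition idx :: "'a \<Rightarrow> nat" where "idx = inv_into {0..<n} en"

lemma bij_en: "bij_betw en {0..<n} (carrier G)"
  unfolding en_def n_def by (rule someI_ex[OF ex_bij_betw_nat_finite[OF fin]])

lemma en_carrier [simp]: "i < n \<Longrightarrow> en i \<in> carrier G"
  using bij_en by (auto simp: bij_betw_def)

lemma idx_less [simp]: "x \<in> carrier G \<Longrightarrow> idx x < n"
  using bij_en inv_into_into[of x en "{0..<n}"] by (auto simp: idx_def bij_betw_def)

lemma en_idx [simp]: "x \<in> carrier G \<Longrightarrow> en (idx x) = x"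
  using bij_en f_inv_into_f[of x en "{0..<n}"] by (auto simp: idx_def bij_betw_def)

lemma idx_en [simp]: "i < n \<Longrightarrow> idx (en i) = i"
  using bij_en inv_into_f_f[of en "{0..<n}" i] by (auto simp: idx_def bij_betw_def)

lemma idx_eq_iff: "x \<in> carrier G \<Longrightarrow> i < n \<Longrightarrow> idx x = i \<longleftrightarrow> x = en i"
  by (metis en_idx idx_en)

lemma idx_inj: "x \<in> carrier G \<Longrightarrow> y \<in> carrier G \<Longrightarrow> idx x = idx y \<longleftrightarrow> x = y"
  by (metis en_idx)

lemma n_pos: "n > 0"
  using fin one_closed card_gt_0_iff unfolding n_def by blast

definition perm :: "('a \<Rightarrow> 'a) \<Rightarrow> complex mat" where
  "perm \<phi> = fmat n n (\<lambda>j. idx (\<phi> (en j))) (\<lambda>_. 1)"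

lemma perm_carrier [simp]: "perm \<phi> \<in> carrier_mat n n"
  by (simp add: perm_def)

lemma perm_mult:
  assumes "\<And>x. x \<in> carrier G \<Longrightarrow> \<psi> x \<in> carrier G"
  shows "perm \<phi> * perm \<psi> = perm (\<lambda>x. \<phi> (\<psi> x))"
  unfolding perm_def by (subst fmat_mult) (auto simp: assms intro!: fmat_eqI)

lemma perm_one: "(\<And>x. x \<in> carrier G \<Longrightarrow> \<phi> x = x) \<Longrightarrow> perm \<phi> = 1\<^sub>m n"
  unfolding perm_def fmat_one[symmetric] by (rule fmat_eqI) auto

lemma perm_cong: "(\<And>x. x \<in> carrier G \<Longrightarrow> \<phi> x = \<psi> x) \<Longrightarrow> perm \<phi> = perm \<psi>"
  unfolding perm_def by (rule fmat_eqI) auto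

definition reg :: "'a matrix_rep" where
  "reg = (n, \<lambda>g\<in>carrier G. perm (\<lambda>x. g \<otimes> x))"

lemma fst_reg [simp]: "fst reg = n"
  by (simp add: reg_def)

lemma snd_reg: "g \<in> carrier G \<Longrightarrow> snd reg g = perm (\<lambda>x. g \<otimes> x)"
  by (simp add: reg_def)

lemma reg_rep: "reg \<in> representations G"
proof -
  have "perm (\<lambda>x. g \<otimes> x) \<in> carrier (GL n)" if g: "g \<in> carrier G" for g
    unfolding GL_iff
  proof (intro conjI bexI[of _ "perm (\<lambda>x. inv g \<otimes> x)"])
    show "perm ((\<otimes>) (inv g)) * perm ((\<otimes>) g) = 1\<^sub>m n" "perm ((\<otimes>) g) * perm ((\<otimes>) (inv g)) = 1\<^sub>m n"
      using g by (simp_all add: perm_mult m_assoc[symmetric] perm_one)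
  qed auto
  moreover have "perm ((\<otimes>) (g \<otimes> h)) = perm ((\<otimes>) g) * perm ((\<otimes>) h)" if "g \<in> carrier G" "h \<in> carrier G" for g h
    using that by (simp add: perm_mult m_assoc cong: perm_cong)
  ultimately show ?thesis by (auto simp: representations_def reg_def GL_simps intro!: homI)
qed

text \<open>Translation on the other side, with the inverse so that it is a left action; it commutes
  with the translations in \<open>reg\<close>.\<close>

definition outer :: "'a \<Rightarrow> complex mat" where
  "outer g = perm (\<lambda>x. x \<otimes> inv g)"

lemma outer_intertwiner: "g \<in> carrier G \<Longrightarrow> outer g \<in> intertwiners G reg reg"
  by (rule intertwinersI) (auto simp: snd_reg outer_def perm_mult m_assoc cong: perm_cong)

lemma outer_mult: "g \<in> carrier G \<Longrightarrow> h \<in> carrier G \<Longrightarrow> outer (g \<otimes> h) = outer g * outer h"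
  by (simp add: outer_def perm_mult inv_mult_group m_assoc cong: perm_cong)

lemma outer_one: "outer \<one> = 1\<^sub>m n"
  by (simp add: outer_def perm_one)

text \<open>The regular representation is an algebra under pointwise multiplication of functions on \<open>G\<close>, and \<open>diag g\<close>
  embeds it into its square as the functions supported on the pairs \<open>(x, x \<otimes> g)\<close>.\<close>

definition mult_reg :: "complex mat" where
  "mult_reg = fmat n (n * n) (\<lambda>k. k div n) (\<lambda>k. of_bool (k div n = k mod n))"

definition unit_reg :: "complex mat" where
  "unit_reg = mat n 1 (\<lambda>_. 1)"

definition diag :: "'a \<Rightarrow> complex mat" where
  "diag g = fmat (n * n) n (\<lambda>i. i * n + idx (en i \<otimes> g)) (\<lambda>_. 1)"

lemma mult_reg_carrier [simp]: "mult_reg \<in> carrier_mat n (n * n)"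
  by (simp add: mult_reg_def)

lemma unit_reg_carrier [simp]: "unit_reg \<in> carrier_mat n 1"
  by (simp add: unit_reg_def)

lemma unit_reg_carrier_Suc [simp]: "unit_reg \<in> carrier_mat n (Suc 0)"
  by (simp add: unit_reg_def)

lemma dim_reg [simp]: "dim_row unit_reg = n" "dim_col unit_reg = Suc 0" "dim_row mult_reg = n" "dim_col mult_reg = n * n"
  "dim_row (perm \<phi>) = n" "dim_col (perm \<phi>) = n"
  by (simp_all add: unit_reg_def mult_reg_def perm_def fmat_def)

lemma diag_carrier [simp]: "diag g \<in> carrier_mat (n * n) n"
  by (simp add: diag_def)

lemma perm_mult_reg:
  assumes \<phi>: "\<And>x. x \<in> carrier G \<Longrightarrow> \<phi> x \<in> carrier G" and inj: "inj_on \<phi> (carrier G)"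
  shows "perm \<phi> * mult_reg = mult_reg * kronecker (perm \<phi>) (perm \<phi>)"
proof -
  have "kronecker (perm \<phi>) (perm \<phi>) = fmat (n * n) (n * n) (\<lambda>j. idx (\<phi> (en (j div n))) * n + idx (\<phi> (en (j mod n)))) (\<lambda>_. 1)"
    unfolding perm_def by (subst fmat_kronecker) (auto simp: \<phi>)
  moreover have "idx (\<phi> (en (j div n))) * n + idx (\<phi> (en (j mod n))) < n * n" if "j < n * n" for j
    using div_mod_less[OF that] by (intro mult_add_less) (auto simp: \<phi>)
  ultimately have "mult_reg * kronecker (perm \<phi>) (perm \<phi>) = fmat n (n * n)
      (\<lambda>j. (idx (\<phi> (en (j div n))) * n + idx (\<phi> (en (j mod n)))) div n)
      (\<lambda>j. of_bool ((idx (\<phi> (en (j div n))) * n + idx (\<phi> (en (j mod n)))) div n =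
        (idx (\<phi> (en (j div n))) * n + idx (\<phi> (en (j mod n)))) mod n))"
    unfolding mult_reg_def by (simp add: fmat_mult)
  also have "\<dots> = perm \<phi> * mult_reg"
  proof -
    have "perm \<phi> * mult_reg = fmat n (n * n) (\<lambda>j. idx (\<phi> (en (j div n)))) (\<lambda>k. of_bool (k div n = k mod n))"
      unfolding perm_def mult_reg_def by (subst fmat_mult) (auto dest: div_mod_less)
    also have "\<dots> = fmat n (n * n)
      (\<lambda>j. (idx (\<phi> (en (j div n))) * n + idx (\<phi> (en (j mod n)))) div n)
      (\<lambda>j. of_bool ((idx (\<phi> (en (j div n))) * n + idx (\<phi> (en (j mod n)))) div n =
        (idx (\<phi> (en (j div n))) * n + idx (\<phi> (en (j mod n)))) mod n))"
    proof (rule fmat_eqI)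
      fix j assume "j < n * n"
      then have d: "j div n < n" "j mod n < n" using div_mod_less by auto
      have lt: "idx (\<phi> (en (j mod n))) < n" using d \<phi> by simp
      have "idx (\<phi> (en (j div n))) = idx (\<phi> (en (j mod n))) \<longleftrightarrow> j div n = j mod n"
        using d \<phi> inj by (metis en_carrier idx_en idx_inj inj_onD)
      then show "of_bool (j div n = j mod n) = (of_bool ((idx (\<phi> (en (j div n))) * n + idx (\<phi> (en (j mod n)))) div n =
          (idx (\<phi> (en (j div n))) * n + idx (\<phi> (en (j mod n)))) mod n) :: complex)"
        using lt by simp
      show "idx (\<phi> (en (j div n))) = (idx (\<phi> (en (j div n))) * n + idx (\<phi> (en (j mod n)))) div n"
        using lt by simp
    qed
    finally show ?thesis by simp
  qed
  finally show ?thesis by simp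
qed

lemma perm_unit_reg:
  assumes \<phi>: "\<And>x. x \<in> carrier G \<Longrightarrow> \<phi> x \<in> carrier G" "\<And>x. x \<in> carrier G \<Longrightarrow> \<psi> x \<in> carrier G"
    "\<And>x. x \<in> carrier G \<Longrightarrow> \<phi> (\<psi> x) = x" "\<And>x. x \<in> carrier G \<Longrightarrow> \<psi> (\<phi> x) = x"
  shows "perm \<phi> * unit_reg = unit_reg"
proof (rule eq_matI)
  fix i j assume "i < dim_row unit_reg" "j < dim_col unit_reg"
  then have ij: "i < n" "j = 0" by (auto simp: unit_reg_def)
  have "(perm \<phi> * unit_reg) $$ (i, 0) = (\<Sum>l<n. perm \<phi> $$ (i, l) * unit_reg $$ (l, 0))"
    by (rule index_mult_mat_sum[OF perm_carrier unit_reg_carrier ij(1)]) simp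
  also have "\<dots> = (\<Sum>l<n. if l = idx (\<psi> (en i)) then 1 else 0)"
  proof (rule sum.cong)
    fix l assume l: "l \<in> {..<n}"
    have "i = idx (\<phi> (en l)) \<longleftrightarrow> l = idx (\<psi> (en i))"
      using l ij \<phi> by (metis en_carrier en_idx idx_en lessThan_iff)
    then show "perm \<phi> $$ (i, l) * unit_reg $$ (l, 0) = (if l = idx (\<psi> (en i)) then 1 else 0)"
      using l ij by (simp add: perm_def fmat_index unit_reg_def)
  qed simp
  also have "\<dots> = 1" using ij \<phi> by (simp add: sum.delta)
  finally show "(perm \<phi> * unit_reg) $$ (i, j) = unit_reg $$ (i, j)" using ij by (simp add: unit_reg_def)
qed (auto simp: unit_reg_def perm_def fmat_def)

lemma outer_mult_reg: "g \<in> carrier G \<Longrightarrow> outer g * mult_reg = mult_reg * kronecker (outer g) (outer g)"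
  unfolding outer_def by (rule perm_mult_reg) (auto simp: inj_on_def)

lemma outer_unit_reg: "g \<in> carrier G \<Longrightarrow> outer g * unit_reg = unit_reg"
  unfolding outer_def by (rule perm_unit_reg[where \<psi> = "\<lambda>x. x \<otimes> g"]) (auto simp: m_assoc)

lemma mult_reg_intertwiner: "mult_reg \<in> intertwiners G (ten G reg reg) reg"
proof (rule intertwinersI)
  fix g assume g: "g \<in> carrier G"
  have "perm (\<lambda>x. g \<otimes> x) * mult_reg = mult_reg * kronecker (perm (\<lambda>x. g \<otimes> x)) (perm (\<lambda>x. g \<otimes> x))"
    by (rule perm_mult_reg) (use g in \<open>auto simp: inj_on_def\<close>)
  then show "mult_reg * snd (ten G reg reg) g = snd reg g * mult_reg" using g by (simp add: snd_ten snd_reg)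
qed simp

lemma unit_reg_intertwiner: "unit_reg \<in> intertwiners G (unit_rep G) reg"
proof (rule intertwinersI)
  fix g assume g: "g \<in> carrier G"
  have "perm (\<lambda>x. g \<otimes> x) * unit_reg = unit_reg"
    by (rule perm_unit_reg[where \<psi> = "\<lambda>x. inv g \<otimes> x"]) (use g in \<open>auto simp: m_assoc[symmetric]\<close>)
  then show "unit_reg * snd (unit_rep G) g = snd reg g * unit_reg"
    using g right_mult_one_mat[OF unit_reg_carrier] by (simp add: snd_unit_rep snd_reg)
qed simp

lemma diag_intertwiner:
  assumes k: "k \<in> carrier G"
  shows "diag k \<in> intertwiners G reg (ten G reg reg)"
proof (rule intertwinersI)
  fix g assume g: "g \<in> carrier G"
  let ?p = "\<lambda>j. idx (g \<otimes> en j)"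
  have K: "kronecker (perm (\<lambda>x. g \<otimes> x)) (perm (\<lambda>x. g \<otimes> x)) = fmat (n * n) (n * n) (\<lambda>j. ?p (j div n) * n + ?p (j mod n)) (\<lambda>_. 1)"
    unfolding perm_def by (subst fmat_kronecker) (auto simp: g)
  have "kronecker (perm (\<lambda>x. g \<otimes> x)) (perm (\<lambda>x. g \<otimes> x)) * diag k = diag k * perm (\<lambda>x. g \<otimes> x)"
    unfolding K unfolding diag_def perm_def using g k
    by (simp add: fmat_mult mult_add_less) (auto intro!: fmat_eqI simp: m_assoc)
  then show "diag k * snd reg g = snd (ten G reg reg) g * diag k" using g by (simp add: snd_ten snd_reg)
qed simp

lemma reg_assoc: "mult_reg * kronecker mult_reg (1\<^sub>m n) = mult_reg * kronecker (1\<^sub>m n) mult_reg"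
proof -
  have e: "x mod (n * n) div n = x div n mod n" "x mod (n * n) mod n = x mod n" "x div n div n = x div (n * n)" for x
    using mod_mult2_eq[of x n n] div_mult2_eq[of x n n] n_pos by simp_all
  have A: "kronecker mult_reg (1\<^sub>m n) = fmat (n * n) (n * n * n) (\<lambda>j. j div n div n * n + j mod n)
      (\<lambda>j. of_bool (j div n div n = j div n mod n))"
    unfolding mult_reg_def fmat_one[symmetric] by (subst fmat_kronecker) auto
  have B: "kronecker (1\<^sub>m n) mult_reg = fmat (n * n) (n * (n * n)) (\<lambda>j. j div (n * n) * n + j mod (n * n) div n)
      (\<lambda>j. of_bool (j mod (n * n) div n = j mod (n * n) mod n))"
    unfolding mult_reg_def fmat_one[symmetric] by (subst fmat_kronecker) (auto dest: div_mod_less)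
  have hd: "(a * n + b) div n = a" "(a * n + b) mod n = b" if "b < n" for a b using that by simp_all
  have l: "j div n div n < n" "j div n mod n < n" "j mod n < n" "j div n < n * n" if "j < n * (n * n)" for j
    using that div_mod_less[of j "n * n" n] div_mod_less[of j "n * n" n] div_mod_less[of "j div n" n n] by (simp_all add: mult_ac)
  have "mult_reg * kronecker mult_reg (1\<^sub>m n) = fmat n (n * (n * n)) (\<lambda>j. j div n div n)
      (\<lambda>j. of_bool (j div n div n = j mod n) * of_bool (j div n div n = j div n mod n))"
    unfolding A unfolding mult_reg_def mult.assoc[of n n n]
    by (subst fmat_mult) (auto simp: l hd mult_add_less intro!: fmat_eqI)
  also have "\<dots> = mult_reg * kronecker (1\<^sub>m n) mult_reg"
    unfolding B unfolding mult_reg_def e(3)[symmetric] e(1,2)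
    by (subst fmat_mult) (auto simp: l hd mult_add_less intro!: fmat_eqI)
  finally show ?thesis .
qed

lemma mult_reg_index:
  "i < n \<Longrightarrow> k < n * n \<Longrightarrow> mult_reg $$ (i, k) = of_bool (i = k div n \<and> i = k mod n)"
  by (auto simp: mult_reg_def fmat_index)

lemma reg_unit_left: "mult_reg * kronecker unit_reg (1\<^sub>m n) = 1\<^sub>m n"
proof (rule eq_matI)
  fix i j assume "i < dim_row (1\<^sub>m n :: complex mat)" "j < dim_col (1\<^sub>m n :: complex mat)"
  then have ij: "i < n" "j < n" by auto
  have K: "kronecker unit_reg (1\<^sub>m n) \<in> carrier_mat (n * n) n"
    using kronecker_carrier[OF unit_reg_carrier one_carrier_mat] by simp
  have "(mult_reg * kronecker unit_reg (1\<^sub>m n)) $$ (i, j) =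
      (\<Sum>k=0..<n * n. of_bool (i = k div n \<and> i = k mod n) * of_bool (k mod n = j))"
    unfolding index_mult_mat_sum[OF mult_reg_carrier K ij] lessThan_atLeast0
  proof (rule sum.cong)
    fix k assume "k \<in> {0..<n * n}"
    then have k: "k < n * n" "k div n < n" "k mod n < n" using div_mod_less[of k n n] by auto
    then have "kronecker unit_reg (1\<^sub>m n) $$ (k, j) = of_bool (k mod n = j)"
      using kronecker_index[OF unit_reg_carrier one_carrier_mat, of k n j] ij by (simp add: unit_reg_def)
    then show "mult_reg $$ (i, k) * kronecker unit_reg (1\<^sub>m n) $$ (k, j) =
        of_bool (i = k div n \<and> i = k mod n) * of_bool (k mod n = j)" using k ij by (simp add: mult_reg_index)
  qed simp
  also have "\<dots> = (\<Sum>a=0..<n. \<Sum>b=0..<n. of_bool (i = a \<and> i = b) * of_bool (b = j))" by (rule sum_div_mod)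
  also have "\<dots> = (\<Sum>a=0..<n. if a = i then \<Sum>b=0..<n. if b = i then of_bool (b = j) else 0 else 0)"
    by (intro sum.cong) (auto intro!: sum.cong sum.neutral)
  also have "\<dots> = of_bool (i = j)" using ij by (simp add: sum.delta)
  finally show "(mult_reg * kronecker unit_reg (1\<^sub>m n)) $$ (i, j) = 1\<^sub>m n $$ (i, j)" using ij by simp
qed (auto simp: mult_reg_def fmat_def)

lemma reg_unit_right: "mult_reg * kronecker (1\<^sub>m n) unit_reg = 1\<^sub>m n"
proof (rule eq_matI)
  fix i j assume "i < dim_row (1\<^sub>m n :: complex mat)" "j < dim_col (1\<^sub>m n :: complex mat)"
  then have ij: "i < n" "j < n" by auto
  have K: "kronecker (1\<^sub>m n) unit_reg \<in> carrier_mat (n * n) n"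
    using kronecker_carrier[OF one_carrier_mat unit_reg_carrier] by simp
  have "(mult_reg * kronecker (1\<^sub>m n) unit_reg) $$ (i, j) =
      (\<Sum>k=0..<n * n. of_bool (i = k div n \<and> i = k mod n) * of_bool (k div n = j))"
    unfolding index_mult_mat_sum[OF mult_reg_carrier K ij] lessThan_atLeast0
  proof (rule sum.cong)
    fix k assume "k \<in> {0..<n * n}"
    then have k: "k < n * n" "k div n < n" "k mod n < n" using div_mod_less[of k n n] by auto
    then have "kronecker (1\<^sub>m n) unit_reg $$ (k, j) = of_bool (k div n = j)"
      using kronecker_index[OF one_carrier_mat unit_reg_carrier, of k n j] ij by (simp add: unit_reg_def)
    then show "mult_reg $$ (i, k) * kronecker (1\<^sub>m n) unit_reg $$ (k, j) =
        of_bool (i = k div n \<and> i = k mod n) * of_bool (k div n = j)" using k ij by (simp add: mult_reg_index)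
  qed simp
  also have "\<dots> = (\<Sum>a=0..<n. \<Sum>b=0..<n. of_bool (i = a \<and> i = b) * of_bool (a = j))" by (rule sum_div_mod)
  also have "\<dots> = (\<Sum>a=0..<n. if a = i then \<Sum>b=0..<n. if b = i then of_bool (a = j) else 0 else 0)"
    by (intro sum.cong) (auto intro!: sum.cong sum.neutral)
  also have "\<dots> = of_bool (i = j)" using ij by (simp add: sum.delta)
  finally show "(mult_reg * kronecker (1\<^sub>m n) unit_reg) $$ (i, j) = 1\<^sub>m n $$ (i, j)" using ij by simp
qed (auto simp: mult_reg_def fmat_def)

text \<open>Restriction of a function on pairs to the pairs \<open>(x, x \<otimes> g)\<close>, which
  is the component at \<open>g\<close> of the Galois map for \<open>reg\<close>.\<close>

definition can_reg :: "'a \<Rightarrow> complex mat" where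
  "can_reg g = mult_reg * kronecker (1\<^sub>m n) (outer g)"

lemma can_reg_fmat:
  assumes g: "g \<in> carrier G"
  shows "can_reg g = fmat n (n * n) (\<lambda>j. j div n) (\<lambda>j. of_bool (en (j mod n) = en (j div n) \<otimes> g))"
proof -
  have K: "kronecker (1\<^sub>m n) (outer g) = fmat (n * n) (n * n) (\<lambda>j. j div n * n + idx (en (j mod n) \<otimes> inv g)) (\<lambda>_. 1)"
    unfolding outer_def perm_def fmat_one[symmetric] by (subst fmat_kronecker) (auto simp: g)
  have eq: "(j div n = idx (en (j mod n) \<otimes> inv g)) = (en (j mod n) = en (j div n) \<otimes> g)" if "j < n * n" for j
  proof -
    have d: "j div n < n" "j mod n < n" using div_mod_less[OF that] by auto
    have "(j div n = idx (en (j mod n) \<otimes> inv g)) = (en (j div n) = en (j mod n) \<otimes> inv g)"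
      using idx_eq_iff[OF _ d(1), of "en (j mod n) \<otimes> inv g"] d g by (metis en_carrier inv_closed m_closed)
    also have "\<dots> = (en (j mod n) = en (j div n) \<otimes> g)"
      using d g inv_solve_right[of "en (j div n)" "en (j mod n)" g] by auto
    finally show ?thesis .
  qed
  have hd: "(j div n * n + idx (en (j mod n) \<otimes> inv g)) div n = j div n"
    "(j div n * n + idx (en (j mod n) \<otimes> inv g)) mod n = idx (en (j mod n) \<otimes> inv g)" if "j < n * n" for j
  proof -
    have "idx (en (j mod n) \<otimes> inv g) < n" using div_mod_less[OF that] g by simp
    then show "(j div n * n + idx (en (j mod n) \<otimes> inv g)) div n = j div n"
      "(j div n * n + idx (en (j mod n) \<otimes> inv g)) mod n = idx (en (j mod n) \<otimes> inv g)" by simp_all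
  qed
  have lt: "j div n * n + idx (en (j mod n) \<otimes> inv g) < n * n" if "j < n * n" for j
    using div_mod_less[OF that] g by (intro mult_add_less) auto
  have "can_reg g = fmat n (n * n) (\<lambda>j. (j div n * n + idx (en (j mod n) \<otimes> inv g)) div n)
      (\<lambda>j. of_bool ((j div n * n + idx (en (j mod n) \<otimes> inv g)) div n =
        (j div n * n + idx (en (j mod n) \<otimes> inv g)) mod n) * 1)"
    unfolding can_reg_def K unfolding mult_reg_def by (rule fmat_mult) (rule lt)
  also have "\<dots> = fmat n (n * n) (\<lambda>j. j div n) (\<lambda>j. of_bool (en (j mod n) = en (j div n) \<otimes> g))"
    by (rule fmat_eqI) (simp_all only: hd eq mult_1_right)
  finally show ?thesis .
qed

lemma can_diag:
  assumes "g \<in> carrier G" "k \<in> carrier G"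
  shows "can_reg k * diag g = (if g = k then 1\<^sub>m n else 0\<^sub>m n n)"
proof -
  have "can_reg k * diag g = fmat n n (\<lambda>i. i) (\<lambda>i. of_bool (g = k))"
    unfolding can_reg_fmat[OF assms(2)] diag_def
    using assms by (subst fmat_mult) (auto simp: mult_add_less intro!: fmat_eqI)
  then show ?thesis by (auto simp: fmat_one) (auto simp: fmat_def intro!: eq_matI)
qed

text \<open>Each pair of group elements has the form \<open>(x, x \<otimes> g)\<close> for exactly
  one \<open>g\<close>, namely the \<open>g0\<close> of the proof.\<close>

lemma sum_diag_can: "msum (n * n) (n * n) (carrier G) (\<lambda>g. diag g * can_reg g) = 1\<^sub>m (n * n)"
proof (rule eq_matI)
  fix i j assume "i < dim_row (1\<^sub>m (n * n) :: complex mat)" "j < dim_col (1\<^sub>m (n * n) :: complex mat)"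
  then have ij: "i < n * n" "j < n * n" by auto
  have d: "j div n < n" "j mod n < n" using div_mod_less[OF ij(2)] by auto
  have F: "diag g * can_reg g = fmat (n * n) (n * n) (\<lambda>j. j div n * n + idx (en (j div n) \<otimes> g))
      (\<lambda>j. of_bool (en (j mod n) = en (j div n) \<otimes> g))" if g: "g \<in> carrier G" for g
    unfolding can_reg_fmat[OF g] diag_def by (subst fmat_mult) (auto dest: div_mod_less)
  define g0 where "g0 = inv (en (j div n)) \<otimes> en (j mod n)"
  have g0: "g0 \<in> carrier G" "en (j div n) \<otimes> g0 = en (j mod n)" using d by (auto simp: g0_def m_assoc[symmetric])
  have "msum (n * n) (n * n) (carrier G) (\<lambda>g. diag g * can_reg g) $$ (i, j) =
      (\<Sum>g\<in>carrier G. if g = g0 then of_bool (i = j) else 0)"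
    unfolding msum_index[OF ij]
  proof (rule sum.cong)
    fix g assume g: "g \<in> carrier G"
    have "en (j mod n) = en (j div n) \<otimes> g \<longleftrightarrow> g = g0" using inv_solve_left[of g "en (j div n)" "en (j mod n)"] g d by (auto simp: g0_def)
    then show "(diag g * can_reg g) $$ (i, j) = (if g = g0 then of_bool (i = j) else 0)"
      using ij g0 d by (auto simp: F[OF g] fmat_index)
  qed simp
  also have "\<dots> = of_bool (i = j)" using g0 fin by (simp add: sum.delta)
  finally show "msum (n * n) (n * n) (carrier G) (\<lambda>g. diag g * can_reg g) $$ (i, j) = 1\<^sub>m (n * n) $$ (i, j)"
    using ij by simp
qed (auto simp: msum_def)

text \<open>A function invariant under translations is constant, here equal to its value at
  \<open>\<one>\<close>.\<close>

lemma fixed_reg: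
  assumes T: "T \<in> intertwiners G (unit_rep G) reg"
  shows "\<exists>c. T = c \<cdot>\<^sub>m unit_reg"
proof -
  have Tc: "T \<in> carrier_mat n 1" using intertwiners_carrier[OF T] by simp
  have const: "T $$ (i, 0) = T $$ (idx \<one>, 0)" if i: "i < n" for i
  proof -
    have g: "en i \<in> carrier G" using i by simp
    have "T = T * 1\<^sub>m 1" using Tc by simp
    also have "\<dots> = perm (\<lambda>x. en i \<otimes> x) * T" using intertwiners_eq[OF T g] g by (simp add: snd_unit_rep snd_reg)
    finally have "T $$ (i, 0) = (perm (\<lambda>x. en i \<otimes> x) * T) $$ (i, 0)" by simp
    also have "\<dots> = (\<Sum>l<n. perm (\<lambda>x. en i \<otimes> x) $$ (i, l) * T $$ (l, 0))"
      by (rule index_mult_mat_sum[OF perm_carrier Tc i]) simp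
    also have "\<dots> = (\<Sum>l<n. if l = idx \<one> then T $$ (l, 0) else 0)"
    proof (rule sum.cong)
      fix l assume l: "l \<in> {..<n}"
      have "i = idx (en i \<otimes> en l) \<longleftrightarrow> en i \<otimes> en l = en i" using idx_eq_iff[of "en i \<otimes> en l" i] i l by auto
      also have "\<dots> \<longleftrightarrow> en l = \<one>" using g l by (simp add: r_cancel_one)
      also have "\<dots> \<longleftrightarrow> l = idx \<one>" using idx_eq_iff[of \<one> l] l by auto
      finally show "perm (\<lambda>x. en i \<otimes> x) $$ (i, l) * T $$ (l, 0) = (if l = idx \<one> then T $$ (l, 0) else 0)"
        using i l by (simp add: perm_def fmat_index)
    qed simp
    finally show ?thesis by (simp add: sum.delta)
  qed
  have "T = T $$ (idx \<one>, 0) \<cdot>\<^sub>m unit_reg"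
  proof (intro eq_matI)
    fix i k assume "i < dim_row (T $$ (idx \<one>, 0) \<cdot>\<^sub>m unit_reg)" "k < dim_col (T $$ (idx \<one>, 0) \<cdot>\<^sub>m unit_reg)"
    then have ik: "i < n" "k = 0" by auto
    show "T $$ (i, k) = (T $$ (idx \<one>, 0) \<cdot>\<^sub>m unit_reg) $$ (i, k)"
      using const[OF ik(1)] ik by (simp add: unit_reg_def)
  qed (use Tc in auto)
  then show ?thesis by blast
qed

text \<open>Matrix coefficients: a vector goes to the function whose value at \<open>x\<close> is
  the \<open>i\<close>-th coordinate of the vector moved by \<open>inv x\<close>.\<close>

definition to_reg :: "'a matrix_rep \<Rightarrow> nat \<Rightarrow> complex mat" where
  "to_reg X i = mat n (fst X) (\<lambda>(p, c). snd X (inv (en p)) $$ (i, c))"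

text \<open>The basis vector of \<open>reg\<close> at \<open>x\<close> goes to the
  \<open>i\<close>-th basis vector of \<open>X\<close> moved by \<open>x\<close>.\<close>

definition from_reg :: "'a matrix_rep \<Rightarrow> nat \<Rightarrow> complex mat" where
  "from_reg X i = mat (fst X) n (\<lambda>(c, p). snd X (en p) $$ (c, i))"

lemma to_reg_carrier [simp]: "to_reg X i \<in> carrier_mat n (fst X)"
  by (simp add: to_reg_def)

lemma from_reg_carrier [simp]: "from_reg X i \<in> carrier_mat (fst X) n"
  by (simp add: from_reg_def)

lemma to_reg_intertwiner:
  assumes X: "X \<in> representations G" and i: "i < fst X"
  shows "to_reg X i \<in> intertwiners G X reg"
proof (rule intertwinersI)
  fix g assume g: "g \<in> carrier G"
  note \<rho> = representationsD(2)[OF X]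
  show "to_reg X i * snd X g = snd reg g * to_reg X i"
  proof (rule eq_matI)
    fix p c assume "p < dim_row (snd reg g * to_reg X i)" "c < dim_col (snd reg g * to_reg X i)"
    then have pc: "p < n" "c < fst X" using g by (auto simp: snd_reg to_reg_def perm_def fmat_def)
    have "(to_reg X i * snd X g) $$ (p, c) = (\<Sum>k<fst X. snd X (inv (en p)) $$ (i, k) * snd X g $$ (k, c))"
      unfolding index_mult_mat_sum[OF to_reg_carrier \<rho>[OF g] pc] by (rule sum.cong) (use pc in \<open>auto simp: to_reg_def\<close>)
    also have "\<dots> = (snd X (inv (en p)) * snd X g) $$ (i, c)"
      by (rule index_mult_mat_sum[OF \<rho> \<rho>[OF g] i pc(2), symmetric]) (use pc in simp)
    also have "\<dots> = snd X (inv (en p) \<otimes> g) $$ (i, c)" using representations_mult[OF X _ g] pc by simp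
    finally have L: "(to_reg X i * snd X g) $$ (p, c) = snd X (inv (en p) \<otimes> g) $$ (i, c)" .
    define q where "q = idx (inv g \<otimes> en p)"
    have q: "q < n" "inv (en q) = inv (en p) \<otimes> g" using g pc by (auto simp: q_def inv_mult_group)
    have "(snd reg g * to_reg X i) $$ (p, c) = (\<Sum>l<n. perm (\<lambda>x. g \<otimes> x) $$ (p, l) * to_reg X i $$ (l, c))"
      unfolding snd_reg[OF g] by (rule index_mult_mat_sum[OF perm_carrier to_reg_carrier pc])
    also have "\<dots> = (\<Sum>l<n. if l = q then to_reg X i $$ (l, c) else 0)"
    proof (rule sum.cong)
      fix l assume l: "l \<in> {..<n}"
      have "p = idx (g \<otimes> en l) \<longleftrightarrow> en p = g \<otimes> en l" using idx_eq_iff[of "g \<otimes> en l" p] g l pc by auto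
      also have "\<dots> \<longleftrightarrow> en l = inv g \<otimes> en p" using g l pc inv_solve_left[of "en l" g "en p"] by auto
      also have "\<dots> \<longleftrightarrow> l = q" unfolding q_def using idx_eq_iff[of "inv g \<otimes> en p" l] g l pc by auto
      finally show "perm (\<lambda>x. g \<otimes> x) $$ (p, l) * to_reg X i $$ (l, c) = (if l = q then to_reg X i $$ (l, c) else 0)"
        using l pc by (simp add: perm_def fmat_index)
    qed simp
    also have "\<dots> = snd X (inv (en p) \<otimes> g) $$ (i, c)" using q pc by (simp add: sum.delta to_reg_def)
    finally show "(to_reg X i * snd X g) $$ (p, c) = (snd reg g * to_reg X i) $$ (p, c)" using L by simp
  qed (use g \<rho>[OF g] in \<open>auto simp: snd_reg to_reg_def perm_def fmat_def\<close>)
qed simp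

lemma from_reg_intertwiner:
  assumes X: "X \<in> representations G" and i: "i < fst X"
  shows "from_reg X i \<in> intertwiners G reg X"
proof (rule intertwinersI)
  fix g assume g: "g \<in> carrier G"
  note \<rho> = representationsD(2)[OF X]
  show "from_reg X i * snd reg g = snd X g * from_reg X i"
  proof (rule eq_matI)
    fix c p assume "c < dim_row (snd X g * from_reg X i)" "p < dim_col (snd X g * from_reg X i)"
    then have cp: "c < fst X" "p < n" using \<rho>[OF g] by (auto simp: from_reg_def)
    have "(from_reg X i * snd reg g) $$ (c, p) = snd X (g \<otimes> en p) $$ (c, i)"
      unfolding snd_reg[OF g] perm_def using cp g
      by (subst fmat_mult_index[OF from_reg_carrier]) (auto simp: from_reg_def)
    also have "\<dots> = (snd X g * snd X (en p)) $$ (c, i)" using representations_mult[OF X g] cp by simp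
    also have "\<dots> = (\<Sum>k<fst X. snd X g $$ (c, k) * snd X (en p) $$ (k, i))"
      by (rule index_mult_mat_sum[OF \<rho>[OF g] \<rho> cp(1) i]) (use cp in simp)
    also have "\<dots> = (snd X g * from_reg X i) $$ (c, p)"
      unfolding index_mult_mat_sum[OF \<rho>[OF g] from_reg_carrier cp] by (rule sum.cong) (use cp in \<open>auto simp: from_reg_def\<close>)
    finally show "(from_reg X i * snd reg g) $$ (c, p) = (snd X g * from_reg X i) $$ (c, p)" .
  qed (use g \<rho>[OF g] in \<open>auto simp: snd_reg from_reg_def perm_def fmat_def\<close>)
qed simp

text \<open>Summing over \<open>i\<close> multiplies the matrices of \<open>x\<close> and
  \<open>inv x\<close>, so each of the \<open>n\<close> group elements contributes an identity. This
  exhibits \<open>X\<close> as a direct summand of a power of \<open>reg\<close>.\<close>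

lemma sum_from_to_reg:
  assumes X: "X \<in> representations G"
  shows "msum (fst X) (fst X) {..<fst X} (\<lambda>i. from_reg X i * to_reg X i) = of_nat n \<cdot>\<^sub>m 1\<^sub>m (fst X)"
proof (rule eq_matI)
  note \<rho> = representationsD(2)[OF X]
  fix a b assume "a < dim_row (of_nat n \<cdot>\<^sub>m 1\<^sub>m (fst X) :: complex mat)" "b < dim_col (of_nat n \<cdot>\<^sub>m 1\<^sub>m (fst X) :: complex mat)"
  then have ab: "a < fst X" "b < fst X" by auto
  have "msum (fst X) (fst X) {..<fst X} (\<lambda>i. from_reg X i * to_reg X i) $$ (a, b) =
      (\<Sum>i<fst X. \<Sum>p<n. from_reg X i $$ (a, p) * to_reg X i $$ (p, b))"
    unfolding msum_index[OF ab] by (rule sum.cong) (simp_all add: index_mult_mat_sum[OF from_reg_carrier to_reg_carrier ab])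
  also have "\<dots> = (\<Sum>p<n. \<Sum>i<fst X. snd X (en p) $$ (a, i) * snd X (inv (en p)) $$ (i, b))"
    by (subst sum.swap) (intro sum.cong refl, use ab in \<open>auto simp: from_reg_def to_reg_def\<close>)
  also have "\<dots> = (\<Sum>p<n. of_bool (a = b))"
  proof (rule sum.cong)
    fix p assume p: "p \<in> {..<n}"
    have "(\<Sum>i<fst X. snd X (en p) $$ (a, i) * snd X (inv (en p)) $$ (i, b)) = (snd X (en p) * snd X (inv (en p))) $$ (a, b)"
      by (rule index_mult_mat_sum[OF \<rho> \<rho> ab, symmetric]) (use p in auto)
    also have "\<dots> = snd X (en p \<otimes> inv (en p)) $$ (a, b)" using p representations_mult[OF X, of "en p" "inv (en p)"] by simp
    also have "\<dots> = of_bool (a = b)" using p ab rep_one[OF is_group X] by simp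
    finally show "(\<Sum>i<fst X. snd X (en p) $$ (a, i) * snd X (inv (en p)) $$ (i, b)) = of_bool (a = b)" .
  qed simp
  finally show "msum (fst X) (fst X) {..<fst X} (\<lambda>i. from_reg X i * to_reg X i) $$ (a, b) =
      (of_nat n \<cdot>\<^sub>m 1\<^sub>m (fst X)) $$ (a, b)" using ab by simp
qed (auto simp: msum_def)

lemma reg_faithful:
  assumes g: "g \<in> carrier G" and "snd reg g = 1\<^sub>m n"
  shows "g = \<one>"
proof -
  let ?i = "idx (g \<otimes> \<one>)" and ?j = "idx \<one>"
  have "perm (\<lambda>x. g \<otimes> x) $$ (?i, ?j) = 1" using g by (simp add: perm_def fmat_index)
  then have "(1\<^sub>m n :: complex mat) $$ (?i, ?j) = 1" using assms by (simp add: snd_reg)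
  then have "?i = ?j" using g by (simp split: if_splits)
  then show ?thesis using idx_inj[of "g \<otimes> \<one>" \<one>] g by simp
qed

end

section \<open>Transport along an equivalence\<close>

lemma equivalence_functor_faithful:
  assumes C: "linear_monoidal_category C" and eq: "equivalence_functor C D F Fm"
    and ob: "X \<in> Ob C" "Y \<in> Ob C" and f: "f \<in> Hom C X Y" "f' \<in> Hom C X Y" and ff: "Fm X Y f = Fm X Y f'"
  shows "f = f'"
proof -
  interpret C: linear_monoidal_category C by fact
  obtain K Km \<eta> where cf: "cat_functor C D F Fm" and K: "cat_functor D C K Km"
    and nat: "natural_iso C C (\<lambda>X. X) (\<lambda>X Y f. f) (\<lambda>X. K (F X)) (\<lambda>X Y f. Km (F X) (F Y) (Fm X Y f)) \<eta>"
    using eq unfolding equivalence_functor_def by blast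
  have KFY: "K (F Y) \<in> Ob C" using cf K ob(2) unfolding cat_functor_def by blast
  obtain \<theta> where \<theta>: "\<eta> Y \<in> Hom C Y (K (F Y))" "\<theta> \<in> Hom C (K (F Y)) Y" "\<theta> \<cdot>\<^bsub>C\<^esub> \<eta> Y = Ide C Y"
    using nat ob(2) unfolding natural_iso_def cat_iso_def by blast
  have "\<eta> Y \<cdot>\<^bsub>C\<^esub> f = \<eta> Y \<cdot>\<^bsub>C\<^esub> f'"
    using nat ob f ff unfolding natural_iso_def by metis
  then have "\<theta> \<cdot>\<^bsub>C\<^esub> \<eta> Y \<cdot>\<^bsub>C\<^esub> f = \<theta> \<cdot>\<^bsub>C\<^esub> \<eta> Y \<cdot>\<^bsub>C\<^esub> f'" by simp
  then have "(\<theta> \<cdot>\<^bsub>C\<^esub> \<eta> Y) \<cdot>\<^bsub>C\<^esub> f = (\<theta> \<cdot>\<^bsub>C\<^esub> \<eta> Y) \<cdot>\<^bsub>C\<^esub> f'"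
    using C.comp_assoc[OF ob(1,2) KFY ob(2) f(1) \<theta>(1,2)] C.comp_assoc[OF ob(1,2) KFY ob(2) f(2) \<theta>(1,2)] by simp
  then show ?thesis using C.ide_comp[OF ob f(1)] C.ide_comp[OF ob f(2)] \<theta>(3) by simp
qed

text \<open>\<open>f\<close> is obtained from the image of \<open>g\<close> under the quasi-inverse
  \<open>K\<close> by means of \<open>\<eta>\<close>, so \<open>K\<close> sends the image of
  \<open>f\<close> and \<open>g\<close> to the same morphism; naturality of
  \<open>\<epsilon>\<close> recovers a morphism from its image under \<open>K\<close>.\<close>

lemma equivalence_functor_full:
  assumes C: "linear_monoidal_category C" and D: "linear_monoidal_category D" and eq: "equivalence_functor C D F Fm"
    and ob: "X \<in> Ob C" "Y \<in> Ob C" and g: "g \<in> Hom D (F X) (F Y)"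
  shows "\<exists>f\<in>Hom C X Y. Fm X Y f = g"
proof -
  interpret C: linear_monoidal_category C by fact
  interpret D: linear_monoidal_category D by fact
  obtain K Km \<eta> \<epsilon> where cf: "cat_functor C D F Fm" and K: "cat_functor D C K Km"
    and nat: "natural_iso C C (\<lambda>X. X) (\<lambda>X Y f. f) (\<lambda>X. K (F X)) (\<lambda>X Y f. Km (F X) (F Y) (Fm X Y f)) \<eta>"
    and nat': "natural_iso D D (\<lambda>X. F (K X)) (\<lambda>X Y f. Fm (K X) (K Y) (Km X Y f)) (\<lambda>X. X) (\<lambda>X Y f. f) \<epsilon>"
    using eq unfolding equivalence_functor_def by blast
  have F: "F X \<in> Ob D" "F Y \<in> Ob D" using cf ob unfolding cat_functor_def by blast+
  have KF: "K (F X) \<in> Ob C" "K (F Y) \<in> Ob C" using K F unfolding cat_functor_def by blast+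
  have FKF: "F (K (F X)) \<in> Ob D" "F (K (F Y)) \<in> Ob D" using cf KF unfolding cat_functor_def by blast+
  obtain \<theta> where \<theta>: "\<eta> Y \<in> Hom C Y (K (F Y))" "\<theta> \<in> Hom C (K (F Y)) Y" "\<eta> Y \<cdot>\<^bsub>C\<^esub> \<theta> = Ide C (K (F Y))"
    using nat ob(2) unfolding natural_iso_def cat_iso_def by blast
  obtain \<xi> where \<xi>: "\<eta> X \<in> Hom C X (K (F X))" "\<xi> \<in> Hom C (K (F X)) X" "\<eta> X \<cdot>\<^bsub>C\<^esub> \<xi> = Ide C (K (F X))"
    using nat ob(1) unfolding natural_iso_def cat_iso_def by blast
  obtain \<delta> where \<delta>: "\<epsilon> (F X) \<in> Hom D (F (K (F X))) (F X)" "\<delta> \<in> Hom D (F X) (F (K (F X)))" "\<epsilon> (F X) \<cdot>\<^bsub>D\<^esub> \<delta> = Ide D (F X)"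
    using nat' F(1) unfolding natural_iso_def cat_iso_def by blast
  have Kg: "Km (F X) (F Y) g \<in> Hom C (K (F X)) (K (F Y))" using K F g unfolding cat_functor_def by blast
  define a where "a = Km (F X) (F Y) g \<cdot>\<^bsub>C\<^esub> \<eta> X"
  have a: "a \<in> Hom C X (K (F Y))" unfolding a_def by (rule C.comp_hom[OF ob(1) KF \<xi>(1) Kg])
  define f where "f = \<theta> \<cdot>\<^bsub>C\<^esub> a"
  have f: "f \<in> Hom C X Y" unfolding f_def by (rule C.comp_hom[OF ob(1) KF(2) ob(2) a \<theta>(2)])
  have Ff: "Fm X Y f \<in> Hom D (F X) (F Y)" using cf ob f unfolding cat_functor_def by blast
  have KFf: "Km (F X) (F Y) (Fm X Y f) \<in> Hom C (K (F X)) (K (F Y))" using K F Ff unfolding cat_functor_def by blast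
  have "\<eta> Y \<cdot>\<^bsub>C\<^esub> f = (\<eta> Y \<cdot>\<^bsub>C\<^esub> \<theta>) \<cdot>\<^bsub>C\<^esub> a"
    unfolding f_def by (rule C.comp_assoc[OF ob(1) KF(2) ob(2) KF(2) a \<theta>(2,1), symmetric])
  also have "\<dots> = a" using \<theta>(3) C.ide_comp[OF ob(1) KF(2) a] by simp
  finally have "Km (F X) (F Y) (Fm X Y f) \<cdot>\<^bsub>C\<^esub> \<eta> X = Km (F X) (F Y) g \<cdot>\<^bsub>C\<^esub> \<eta> X"
    using nat ob f unfolding natural_iso_def a_def by metis
  then have "(Km (F X) (F Y) (Fm X Y f) \<cdot>\<^bsub>C\<^esub> \<eta> X) \<cdot>\<^bsub>C\<^esub> \<xi> = (Km (F X) (F Y) g \<cdot>\<^bsub>C\<^esub> \<eta> X) \<cdot>\<^bsub>C\<^esub> \<xi>" by simp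
  then have KK: "Km (F X) (F Y) (Fm X Y f) = Km (F X) (F Y) g"
    using C.comp_assoc[OF KF(1) ob(1) KF \<xi>(2,1) KFf] C.comp_assoc[OF KF(1) ob(1) KF \<xi>(2,1) Kg] \<xi>(3)
      C.comp_ide[OF KF KFf] C.comp_ide[OF KF Kg] by simp
  have "Fm X Y f \<cdot>\<^bsub>D\<^esub> \<epsilon> (F X) = g \<cdot>\<^bsub>D\<^esub> \<epsilon> (F X)"
    using nat' F Ff g KK unfolding natural_iso_def by metis
  then have "(Fm X Y f \<cdot>\<^bsub>D\<^esub> \<epsilon> (F X)) \<cdot>\<^bsub>D\<^esub> \<delta> = (g \<cdot>\<^bsub>D\<^esub> \<epsilon> (F X)) \<cdot>\<^bsub>D\<^esub> \<delta>" by simp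
  then have "Fm X Y f = g"
    using D.comp_assoc[OF F(1) FKF(1) F \<delta>(2,1) Ff] D.comp_assoc[OF F(1) FKF(1) F \<delta>(2,1) g] \<delta>(3)
      D.comp_ide[OF F Ff] D.comp_ide[OF F g] by simp
  then show ?thesis using f by blast
qed

lemma equivalence_functor_surj:
  assumes "equivalence_functor C D F Fm" "Y \<in> Ob D"
  shows "\<exists>X\<in>Ob C. \<exists>f. cat_iso D (F X) Y f"
proof -
  obtain K Km \<epsilon> where K: "cat_functor D C K Km"
    and nat': "natural_iso D D (\<lambda>X. F (K X)) (\<lambda>X Y f. Fm (K X) (K Y) (Km X Y f)) (\<lambda>X. X) (\<lambda>X Y f. f) \<epsilon>"
    using assms(1) unfolding equivalence_functor_def by blast
  have "K Y \<in> Ob C" using K assms(2) unfolding cat_functor_def by blast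
  moreover have "cat_iso D (F (K Y)) Y (\<epsilon> Y)" using nat' assms(2) unfolding natural_iso_def by blast
  ultimately show ?thesis by blast
qed

locale rep_equivalence =
  G: finite_group G + H: finite_group H
  for G :: "('a, 'c) monoid_scheme" (structure) and H :: "('b, 'd) monoid_scheme" +
  fixes F :: "'a matrix_rep \<Rightarrow> 'b matrix_rep"
    and Fm :: "'a matrix_rep \<Rightarrow> 'a matrix_rep \<Rightarrow> complex mat \<Rightarrow> complex mat"
    and J :: "'a matrix_rep \<Rightarrow> 'a matrix_rep \<Rightarrow> complex mat" and u :: "complex mat"
  assumes linear: "linear_functor (Rep G) (Rep H) F Fm"
    and equiv: "equivalence_functor (Rep G) (Rep H) F Fm"
    and monoidal: "monoidal_structure (Rep G) (Rep H) F Fm J u"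
begin

section \<open>Functoriality and coherence in matrix form\<close>

lemma F_rep: "X \<in> representations G \<Longrightarrow> F X \<in> representations H"
  using linear by (simp add: linear_functor_def cat_functor_def)

lemma F_hom:
  "\<lbrakk>X \<in> representations G; Y \<in> representations G; T \<in> intertwiners G X Y\<rbrakk> \<Longrightarrow> Fm X Y T \<in> intertwiners H (F X) (F Y)"
  using linear by (simp add: linear_functor_def cat_functor_def)

lemma F_carrier:
  "\<lbrakk>X \<in> representations G; Y \<in> representations G; T \<in> intertwiners G X Y\<rbrakk> \<Longrightarrow> Fm X Y T \<in> carrier_mat (fst (F Y)) (fst (F X))"
  using F_hom intertwiners_carrier by blast

lemma F_id: "X \<in> representations G \<Longrightarrow> Fm X X (1\<^sub>m (fst X)) = 1\<^sub>m (fst (F X))"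
  using linear by (simp add: linear_functor_def cat_functor_def)

lemma F_comp:
  "\<lbrakk>X \<in> representations G; Y \<in> representations G; Z \<in> representations G; T \<in> intertwiners G X Y; S \<in> intertwiners G Y Z\<rbrakk>
    \<Longrightarrow> Fm X Z (S * T) = Fm Y Z S * Fm X Y T"
  using linear by (simp add: linear_functor_def cat_functor_def)

lemma F_add:
  "\<lbrakk>X \<in> representations G; Y \<in> representations G; S \<in> intertwiners G X Y; T \<in> intertwiners G X Y\<rbrakk>
    \<Longrightarrow> Fm X Y (S + T) = Fm X Y S + Fm X Y T"
  using linear by (simp add: linear_functor_def)

lemma F_smult:
  "\<lbrakk>X \<in> representations G; Y \<in> representations G; T \<in> intertwiners G X Y\<rbrakk> \<Longrightarrow> Fm X Y (a \<cdot>\<^sub>m T) = a \<cdot>\<^sub>m Fm X Y T"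
  using linear by (simp add: linear_functor_def)

lemma zero_intertwiner: "\<lbrakk>X \<in> representations G; Y \<in> representations G\<rbrakk> \<Longrightarrow> 0\<^sub>m (fst Y) (fst X) \<in> intertwiners G X Y"
  using linear_monoidal_category.zero_hom[OF linear_monoidal_category_Rep[OF G.is_group], of X Y] by simp

lemma add_intertwiner:
  "\<lbrakk>X \<in> representations G; Y \<in> representations G; S \<in> intertwiners G X Y; T \<in> intertwiners G X Y\<rbrakk> \<Longrightarrow> S + T \<in> intertwiners G X Y"
  using linear_monoidal_category.add_hom[OF linear_monoidal_category_Rep[OF G.is_group], of X Y S T] by simp

lemma F_zero:
  assumes "X \<in> representations G" "Y \<in> representations G"
  shows "Fm X Y (0\<^sub>m (fst Y) (fst X)) = 0\<^sub>m (fst (F Y)) (fst (F X))"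
proof -
  note z = zero_intertwiner[OF assms]
  have "Fm X Y (0 \<cdot>\<^sub>m 0\<^sub>m (fst Y) (fst X)) = 0 \<cdot>\<^sub>m Fm X Y (0\<^sub>m (fst Y) (fst X))"
    by (rule F_smult[OF assms z])
  moreover have "0 \<cdot>\<^sub>m 0\<^sub>m (fst Y) (fst X) = (0\<^sub>m (fst Y) (fst X) :: complex mat)" by (rule eq_matI) auto
  moreover have "0 \<cdot>\<^sub>m Fm X Y (0\<^sub>m (fst Y) (fst X)) = 0\<^sub>m (fst (F Y)) (fst (F X))"
    using F_carrier[OF assms z] by (intro eq_matI) auto
  ultimately show ?thesis by simp
qed

lemma msum_F:
  assumes "X \<in> representations G" "Y \<in> representations G" "finite A" "\<And>a. a \<in> A \<Longrightarrow> T a \<in> intertwiners G X Y"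
  shows "msum (fst Y) (fst X) A T \<in> intertwiners G X Y"
    "Fm X Y (msum (fst Y) (fst X) A T) = msum (fst (F Y)) (fst (F X)) A (\<lambda>a. Fm X Y (T a))"
proof -
  have "msum (fst Y) (fst X) A T \<in> intertwiners G X Y \<and>
    Fm X Y (msum (fst Y) (fst X) A T) = msum (fst (F Y)) (fst (F X)) A (\<lambda>a. Fm X Y (T a))"
    using assms(3,4)
  proof (induction A rule: finite_induct)
    case empty
    then show ?case using zero_intertwiner F_zero assms(1,2) by (simp add: msum_empty)
  next
    case (insert a A)
    then have a: "T a \<in> intertwiners G X Y" and A: "msum (fst Y) (fst X) A T \<in> intertwiners G X Y" by auto
    have "msum (fst Y) (fst X) (Set.insert a A) T = T a + msum (fst Y) (fst X) A T"
      by (rule msum_insert[where f = T, OF insert.hyps intertwiners_carrier[OF a]])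
    moreover have "msum (fst (F Y)) (fst (F X)) (Set.insert a A) (\<lambda>a. Fm X Y (T a)) =
        Fm X Y (T a) + msum (fst (F Y)) (fst (F X)) A (\<lambda>a. Fm X Y (T a))"
      by (rule msum_insert[where f = "\<lambda>a. Fm X Y (T a)", OF insert.hyps F_carrier[OF assms(1,2) a]])
    ultimately show ?case
      using insert add_intertwiner[OF assms(1,2) a A] F_add[OF assms(1,2) a A] by simp
  qed
  then show "msum (fst Y) (fst X) A T \<in> intertwiners G X Y"
    "Fm X Y (msum (fst Y) (fst X) A T) = msum (fst (F Y)) (fst (F X)) A (\<lambda>a. Fm X Y (T a))" by auto
qed

lemma J_iso:
  assumes "X \<in> representations G" "Y \<in> representations G"
  shows "J X Y \<in> intertwiners H (ten H (F X) (F Y)) (F (ten G X Y))"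
    "\<exists>K\<in>carrier_mat (fst (F X) * fst (F Y)) (fst (F (ten G X Y))).
      K * J X Y = 1\<^sub>m (fst (F X) * fst (F Y)) \<and> J X Y * K = 1\<^sub>m (fst (F (ten G X Y)))"
proof -
  have "cat_iso (Rep H) (ten H (F X) (F Y)) (F (ten G X Y)) (J X Y)"
    using monoidal assms by (simp add: monoidal_structure_def ten_def)
  then show "J X Y \<in> intertwiners H (ten H (F X) (F Y)) (F (ten G X Y))"
    "\<exists>K\<in>carrier_mat (fst (F X) * fst (F Y)) (fst (F (ten G X Y))).
      K * J X Y = 1\<^sub>m (fst (F X) * fst (F Y)) \<and> J X Y * K = 1\<^sub>m (fst (F (ten G X Y)))"
    using intertwiners_carrier[of _ H "F (ten G X Y)" "ten H (F X) (F Y)"] by (auto simp: cat_iso_def)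
qed

lemma J_carrier:
  "\<lbrakk>X \<in> representations G; Y \<in> representations G\<rbrakk> \<Longrightarrow> J X Y \<in> carrier_mat (fst (F (ten G X Y))) (fst (F X) * fst (F Y))"
  using intertwiners_carrier[OF J_iso(1)] by simp

lemma J_natural:
  assumes "X \<in> representations G" "X' \<in> representations G" "Y \<in> representations G" "Y' \<in> representations G"
    "f \<in> intertwiners G X X'" "g \<in> intertwiners G Y Y'"
  shows "J X' Y' * kronecker (Fm X X' f) (Fm Y Y' g) = Fm (ten G X Y) (ten G X' Y') (kronecker f g) * J X Y"
  using monoidal assms by (simp add: monoidal_structure_def ten_def)

lemma u_iso:
  "u \<in> intertwiners H (unit_rep H) (F (unit_rep G))"
  "\<exists>w\<in>intertwiners H (F (unit_rep G)) (unit_rep H). w * u = 1\<^sub>m 1 \<and> u * w = 1\<^sub>m (fst (F (unit_rep G)))"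
proof -
  have "cat_iso (Rep H) (unit_rep H) (F (unit_rep G)) u"
    using monoidal by (simp add: monoidal_structure_def unit_rep_def)
  then show "u \<in> intertwiners H (unit_rep H) (F (unit_rep G))"
    "\<exists>w\<in>intertwiners H (F (unit_rep G)) (unit_rep H). w * u = 1\<^sub>m 1 \<and> u * w = 1\<^sub>m (fst (F (unit_rep G)))"
    by (auto simp: cat_iso_def)
qed

text \<open>The associators in the coherence condition are identity matrices and disappear.\<close>

lemma J_assoc:
  assumes X: "X \<in> representations G" and Y: "Y \<in> representations G" and Z: "Z \<in> representations G"
  shows "J (ten G X Y) Z * kronecker (J X Y) (1\<^sub>m (fst (F Z))) = J X (ten G Y Z) * kronecker (1\<^sub>m (fst (F X))) (J Y Z)"
proof -
  have ten: "ten G X Y \<in> representations G" "ten G Y Z \<in> representations G" by (rule ten_rep[OF G.is_group X Y], rule ten_rep[OF G.is_group Y Z])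
  have ten3: "ten G X (ten G Y Z) \<in> representations G" using ten_rep[OF G.is_group X ten(2)] .
  let ?N = "fst (F (ten G X (ten G Y Z)))"
  have "Fm (ten G (ten G X Y) Z) (ten G X (ten G Y Z)) (1\<^sub>m (fst X * fst Y * fst Z)) *
      (J (ten G X Y) Z * kronecker (J X Y) (1\<^sub>m (fst (F Z)))) =
      J X (ten G Y Z) * (kronecker (1\<^sub>m (fst (F X))) (J Y Z) * 1\<^sub>m (fst (F X) * fst (F Y) * fst (F Z)))"
    using monoidal assms by (simp add: monoidal_structure_def ten_def)
  moreover have "Fm (ten G (ten G X Y) Z) (ten G X (ten G Y Z)) (1\<^sub>m (fst X * fst Y * fst Z)) = 1\<^sub>m ?N"
    unfolding ten_assoc using F_id[OF ten3] by (simp add: mult.assoc)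
  moreover have "J (ten G X Y) Z * kronecker (J X Y) (1\<^sub>m (fst (F Z))) \<in> carrier_mat ?N (fst (F X) * fst (F Y) * fst (F Z))"
    using J_carrier[OF ten(1) Z] kronecker_carrier[OF J_carrier[OF X Y] one_carrier_mat[of "fst (F Z)"]]
    unfolding ten_assoc by (rule mult_carrier_mat)
  moreover have "kronecker (1\<^sub>m (fst (F X))) (J Y Z) \<in> carrier_mat (fst (F X) * fst (F (ten G Y Z))) (fst (F X) * fst (F Y) * fst (F Z))"
    using kronecker_carrier[OF one_carrier_mat[of "fst (F X)"] J_carrier[OF Y Z]] by (simp add: mult.assoc)
  ultimately show ?thesis by (simp add: right_mult_one_mat left_mult_one_mat)
qed

lemma J_unit_left:
  assumes X: "X \<in> representations G"
  shows "Fm (ten G (unit_rep G) X) X (1\<^sub>m (fst X)) * (J (unit_rep G) X * kronecker u (1\<^sub>m (fst (F X)))) = 1\<^sub>m (fst (F X))"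
  using monoidal X by (simp add: monoidal_structure_def ten_def unit_rep_def)

lemma J_unit_right:
  assumes X: "X \<in> representations G"
  shows "Fm (ten G X (unit_rep G)) X (1\<^sub>m (fst X)) * (J X (unit_rep G) * kronecker (1\<^sub>m (fst (F X))) u) = 1\<^sub>m (fst (F X))"
  using monoidal X by (simp add: monoidal_structure_def ten_def unit_rep_def)

section \<open>The image of the regular algebra\<close>

abbreviation "R \<equiv> G.reg"
abbreviation "RR \<equiv> ten G R R"

lemmas R = G.reg_rep
lemmas RR = ten_rep[OF G.is_group R R]
lemmas U = unit_rep[OF G.is_group]

lemma one_R: "1\<^sub>m G.n \<in> intertwiners G R R"
  using one_intertwiner[OF R] by simp

lemma F_one_R: "Fm R R (1\<^sub>m G.n) = 1\<^sub>m (fst (F R))"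
  using F_id[OF R] by simp

definition N :: nat where "N = fst (F R)"

definition j :: "complex mat" where "j = J R R"

definition \<mu> :: "complex mat" where "\<mu> = Fm RR R G.mult_reg * j"

definition \<eta> :: "complex mat" where "\<eta> = Fm (unit_rep G) R G.unit_reg * u"

definition \<sigma> :: "'a \<Rightarrow> complex mat" where "\<sigma> g = Fm R R (G.outer g)"

definition j' :: "complex mat" where
  "j' = (SOME K. K \<in> carrier_mat (N * N) (fst (F RR)) \<and> K * j = 1\<^sub>m (N * N) \<and> j * K = 1\<^sub>m (fst (F RR)))"

definition d :: "'a \<Rightarrow> complex mat" where "d g = j' * Fm R RR (G.diag g)"

lemma j': "j' \<in> carrier_mat (N * N) (fst (F RR))" "j' * j = 1\<^sub>m (N * N)" "j * j' = 1\<^sub>m (fst (F RR))"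
proof -
  have "\<exists>K. K \<in> carrier_mat (N * N) (fst (F RR)) \<and> K * j = 1\<^sub>m (N * N) \<and> j * K = 1\<^sub>m (fst (F RR))"
    using J_iso(2)[OF R R] by (auto simp: N_def j_def)
  from someI_ex[OF this]
  show "j' \<in> carrier_mat (N * N) (fst (F RR))" "j' * j = 1\<^sub>m (N * N)" "j * j' = 1\<^sub>m (fst (F RR))"
    by (auto simp: j'_def)
qed

lemma j_carrier: "j \<in> carrier_mat (fst (F RR)) (N * N)"
  using J_carrier[OF R R] by (simp add: j_def N_def)

lemma Fmult_carrier: "Fm RR R G.mult_reg \<in> carrier_mat N (fst (F RR))"
  using F_carrier[OF RR R G.mult_reg_intertwiner] by (simp add: N_def)

lemma mu_carrier: "\<mu> \<in> carrier_mat N (N * N)"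
  unfolding \<mu>_def by (rule mult_carrier_mat[OF Fmult_carrier j_carrier])

lemma Funit_carrier: "Fm (unit_rep G) R G.unit_reg \<in> carrier_mat N (fst (F (unit_rep G)))"
  using F_carrier[OF U R G.unit_reg_intertwiner] by (simp add: N_def)

lemma u_carrier: "u \<in> carrier_mat (fst (F (unit_rep G))) 1"
  using intertwiners_carrier[OF u_iso(1)] by simp

lemma eta_carrier: "\<eta> \<in> carrier_mat N 1"
  unfolding \<eta>_def by (rule mult_carrier_mat[OF Funit_carrier u_carrier])

lemma sg_carrier: "g \<in> carrier G \<Longrightarrow> \<sigma> g \<in> carrier_mat N N"
  using F_carrier[OF R R G.outer_intertwiner] by (simp add: \<sigma>_def N_def)

lemma d_carrier: "g \<in> carrier G \<Longrightarrow> d g \<in> carrier_mat (N * N) N"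
  unfolding d_def using F_carrier[OF R RR G.diag_intertwiner] by (intro mult_carrier_mat[OF j'(1)]) (simp add: N_def)

text \<open>Naturality of \<open>J\<close> lets the product absorb both morphisms, so that
  identities between maps into \<open>reg\<close> turn into identities for
  \<open>\<mu>\<close>.\<close>

lemma mult_through_J:
  assumes X: "X \<in> representations G" and Y: "Y \<in> representations G"
    and f: "f \<in> intertwiners G X R" and g: "g \<in> intertwiners G Y R"
  shows "\<mu> * kronecker (Fm X R f) (Fm Y R g) = Fm (ten G X Y) R (G.mult_reg * kronecker f g) * J X Y"
proof -
  note XY = ten_rep[OF G.is_group X Y] and fg = kronecker_intertwiner[OF f g X R Y R]
  have "kronecker (Fm X R f) (Fm Y R g) \<in> carrier_mat (N * N) (fst (F X) * fst (F Y))"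
    using kronecker_carrier[OF F_carrier[OF X R f] F_carrier[OF Y R g]] by (simp add: N_def)
  then have "\<mu> * kronecker (Fm X R f) (Fm Y R g) = Fm RR R G.mult_reg * (j * kronecker (Fm X R f) (Fm Y R g))"
    unfolding \<mu>_def by (rule assoc_mult_mat[OF Fmult_carrier j_carrier])
  also have "j * kronecker (Fm X R f) (Fm Y R g) = Fm (ten G X Y) RR (kronecker f g) * J X Y"
    unfolding j_def by (rule J_natural[OF X R Y R f g])
  also have "Fm RR R G.mult_reg * (Fm (ten G X Y) RR (kronecker f g) * J X Y) =
      Fm RR R G.mult_reg * Fm (ten G X Y) RR (kronecker f g) * J X Y"
    by (rule assoc_mult_mat[OF Fmult_carrier F_carrier[OF XY RR fg] J_carrier[OF X Y], symmetric])
  also have "Fm RR R G.mult_reg * Fm (ten G X Y) RR (kronecker f g) = Fm (ten G X Y) R (G.mult_reg * kronecker f g)"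
    by (rule F_comp[OF XY RR R fg G.mult_reg_intertwiner, symmetric])
  finally show ?thesis .
qed

lemma mult_kronecker_intertwiner:
  assumes X: "X \<in> representations G" and Y: "Y \<in> representations G"
    and f: "f \<in> intertwiners G X R" and g: "g \<in> intertwiners G Y R"
  shows "G.mult_reg * kronecker f g \<in> intertwiners G (ten G X Y) R"
  by (rule intertwiners_mult[OF G.is_group ten_rep[OF G.is_group X Y] RR R kronecker_intertwiner[OF f g X R Y R] G.mult_reg_intertwiner])

lemma assoc: "\<mu> * kronecker \<mu> (1\<^sub>m N) = \<mu> * kronecker (1\<^sub>m N) \<mu>"
proof -
  note k1 = kronecker_carrier[OF j_carrier one_carrier_mat[of N]] and k2 = kronecker_carrier[OF one_carrier_mat[of N] j_carrier]
  note A1 = kronecker_carrier[OF Fmult_carrier one_carrier_mat[of N]] and A2 = kronecker_carrier[OF one_carrier_mat[of N] Fmult_carrier]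
  have T1: "G.mult_reg * kronecker G.mult_reg (1\<^sub>m G.n) \<in> intertwiners G (ten G RR R) R"
    by (rule mult_kronecker_intertwiner[OF RR R G.mult_reg_intertwiner one_R])
  have T2: "G.mult_reg * kronecker (1\<^sub>m G.n) G.mult_reg \<in> intertwiners G (ten G R RR) R"
    by (rule mult_kronecker_intertwiner[OF R RR one_R G.mult_reg_intertwiner])
  have "kronecker \<mu> (1\<^sub>m N) = kronecker (Fm RR R G.mult_reg) (1\<^sub>m N) * kronecker j (1\<^sub>m N)"
    unfolding \<mu>_def using kronecker_mult[OF Fmult_carrier j_carrier one_carrier_mat[of N] one_carrier_mat] by simp
  then have "\<mu> * kronecker \<mu> (1\<^sub>m N) = \<mu> * kronecker (Fm RR R G.mult_reg) (1\<^sub>m N) * kronecker j (1\<^sub>m N)"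
    using assoc_mult_mat[OF mu_carrier A1 k1] by simp
  also have "\<mu> * kronecker (Fm RR R G.mult_reg) (1\<^sub>m N) =
      Fm (ten G RR R) R (G.mult_reg * kronecker G.mult_reg (1\<^sub>m G.n)) * J RR R"
    using mult_through_J[OF RR R G.mult_reg_intertwiner one_R] by (simp add: F_one_R N_def)
  also have "Fm (ten G RR R) R (G.mult_reg * kronecker G.mult_reg (1\<^sub>m G.n)) * J RR R * kronecker j (1\<^sub>m N) =
      Fm (ten G RR R) R (G.mult_reg * kronecker G.mult_reg (1\<^sub>m G.n)) * (J RR R * kronecker j (1\<^sub>m N))"
    by (rule assoc_mult_mat[OF F_carrier[OF ten_rep[OF G.is_group RR R] R T1] J_carrier[OF RR R]])
      (use k1 in \<open>simp add: N_def\<close>)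
  also have "J RR R * kronecker j (1\<^sub>m N) = J R RR * kronecker (1\<^sub>m N) j"
    using J_assoc[OF R R R] by (simp add: j_def N_def)
  also have "Fm (ten G RR R) R (G.mult_reg * kronecker G.mult_reg (1\<^sub>m G.n)) =
      Fm (ten G R RR) R (G.mult_reg * kronecker (1\<^sub>m G.n) G.mult_reg)"
    by (simp add: ten_assoc G.reg_assoc)
  also have "\<dots> * (J R RR * kronecker (1\<^sub>m N) j) = \<dots> * J R RR * kronecker (1\<^sub>m N) j"
    by (rule assoc_mult_mat[OF F_carrier[OF ten_rep[OF G.is_group R RR] R T2] J_carrier[OF R RR], symmetric])
      (use k2 in \<open>simp add: N_def\<close>)
  also have "Fm (ten G R RR) R (G.mult_reg * kronecker (1\<^sub>m G.n) G.mult_reg) * J R RR =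
      \<mu> * kronecker (1\<^sub>m N) (Fm RR R G.mult_reg)"
    using mult_through_J[OF R RR one_R G.mult_reg_intertwiner] by (simp add: F_one_R N_def)
  also have "\<mu> * kronecker (1\<^sub>m N) (Fm RR R G.mult_reg) * kronecker (1\<^sub>m N) j = \<mu> * kronecker (1\<^sub>m N) \<mu>"
    unfolding assoc_mult_mat[OF mu_carrier A2 k2]
    using kronecker_mult[OF one_carrier_mat[of N] one_carrier_mat Fmult_carrier j_carrier] by (simp add: \<mu>_def)
  finally show ?thesis .
qed

lemma unit_left: "\<mu> * kronecker \<eta> (1\<^sub>m N) = 1\<^sub>m N"
proof -
  note k = kronecker_carrier[OF u_carrier one_carrier_mat[of N]] and A = kronecker_carrier[OF Funit_carrier one_carrier_mat[of N]]
  have T: "G.mult_reg * kronecker G.unit_reg (1\<^sub>m G.n) \<in> intertwiners G (ten G (unit_rep G) R) R"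
    by (rule mult_kronecker_intertwiner[OF U R G.unit_reg_intertwiner one_R])
  have "kronecker \<eta> (1\<^sub>m N) = kronecker (Fm (unit_rep G) R G.unit_reg) (1\<^sub>m N) * kronecker u (1\<^sub>m N)"
    unfolding \<eta>_def using kronecker_mult[OF Funit_carrier u_carrier one_carrier_mat[of N] one_carrier_mat] by simp
  then have "\<mu> * kronecker \<eta> (1\<^sub>m N) = \<mu> * kronecker (Fm (unit_rep G) R G.unit_reg) (1\<^sub>m N) * kronecker u (1\<^sub>m N)"
    using assoc_mult_mat[OF mu_carrier A k] by simp
  also have "\<mu> * kronecker (Fm (unit_rep G) R G.unit_reg) (1\<^sub>m N) =
      Fm (ten G (unit_rep G) R) R (G.mult_reg * kronecker G.unit_reg (1\<^sub>m G.n)) * J (unit_rep G) R"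
    using mult_through_J[OF U R G.unit_reg_intertwiner one_R] by (simp add: F_one_R N_def)
  also have "Fm (ten G (unit_rep G) R) R (G.mult_reg * kronecker G.unit_reg (1\<^sub>m G.n)) * J (unit_rep G) R * kronecker u (1\<^sub>m N) =
      Fm (ten G (unit_rep G) R) R (G.mult_reg * kronecker G.unit_reg (1\<^sub>m G.n)) * (J (unit_rep G) R * kronecker u (1\<^sub>m N))"
    by (rule assoc_mult_mat[OF F_carrier[OF ten_rep[OF G.is_group U R] R T] J_carrier[OF U R]]) (use k in \<open>simp add: N_def\<close>)
  also have "\<dots> = 1\<^sub>m N" using J_unit_left[OF R] by (simp add: G.reg_unit_left N_def)
  finally show ?thesis .
qed

lemma unit_right: "\<mu> * kronecker (1\<^sub>m N) \<eta> = 1\<^sub>m N"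
proof -
  note k = kronecker_carrier[OF one_carrier_mat[of N] u_carrier] and A = kronecker_carrier[OF one_carrier_mat[of N] Funit_carrier]
  have T: "G.mult_reg * kronecker (1\<^sub>m G.n) G.unit_reg \<in> intertwiners G (ten G R (unit_rep G)) R"
    by (rule mult_kronecker_intertwiner[OF R U one_R G.unit_reg_intertwiner])
  have "kronecker (1\<^sub>m N) \<eta> = kronecker (1\<^sub>m N) (Fm (unit_rep G) R G.unit_reg) * kronecker (1\<^sub>m N) u"
    unfolding \<eta>_def using kronecker_mult[OF one_carrier_mat[of N] one_carrier_mat Funit_carrier u_carrier] by simp
  then have "\<mu> * kronecker (1\<^sub>m N) \<eta> = \<mu> * kronecker (1\<^sub>m N) (Fm (unit_rep G) R G.unit_reg) * kronecker (1\<^sub>m N) u"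
    using assoc_mult_mat[OF mu_carrier A k] by simp
  also have "\<mu> * kronecker (1\<^sub>m N) (Fm (unit_rep G) R G.unit_reg) =
      Fm (ten G R (unit_rep G)) R (G.mult_reg * kronecker (1\<^sub>m G.n) G.unit_reg) * J R (unit_rep G)"
    using mult_through_J[OF R U one_R G.unit_reg_intertwiner] by (simp add: F_one_R N_def)
  also have "Fm (ten G R (unit_rep G)) R (G.mult_reg * kronecker (1\<^sub>m G.n) G.unit_reg) * J R (unit_rep G) * kronecker (1\<^sub>m N) u =
      Fm (ten G R (unit_rep G)) R (G.mult_reg * kronecker (1\<^sub>m G.n) G.unit_reg) * (J R (unit_rep G) * kronecker (1\<^sub>m N) u)"
    by (rule assoc_mult_mat[OF F_carrier[OF ten_rep[OF G.is_group R U] R T] J_carrier[OF R U]]) (use k in \<open>simp add: N_def\<close>)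
  also have "\<dots> = 1\<^sub>m N" using J_unit_right[OF R] by (simp add: G.reg_unit_right N_def)
  finally show ?thesis .
qed

lemma sg_mu:
  assumes g: "g \<in> carrier G"
  shows "\<sigma> g * \<mu> = \<mu> * kronecker (\<sigma> g) (\<sigma> g)"
proof -
  note o = G.outer_intertwiner[OF g]
  have "\<sigma> g * \<mu> = \<sigma> g * Fm RR R G.mult_reg * j"
    unfolding \<mu>_def by (rule assoc_mult_mat[OF sg_carrier[OF g] Fmult_carrier j_carrier, symmetric])
  also have "\<sigma> g * Fm RR R G.mult_reg = Fm RR R (G.outer g * G.mult_reg)"
    unfolding \<sigma>_def by (rule F_comp[OF RR R R G.mult_reg_intertwiner o, symmetric])
  also have "\<dots> * j = \<mu> * kronecker (\<sigma> g) (\<sigma> g)"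
    using mult_through_J[OF R R o o] by (simp add: G.outer_mult_reg[OF g] \<sigma>_def j_def)
  finally show ?thesis .
qed

lemma sg_eta:
  assumes g: "g \<in> carrier G"
  shows "\<sigma> g * \<eta> = \<eta>"
proof -
  have "\<sigma> g * \<eta> = \<sigma> g * Fm (unit_rep G) R G.unit_reg * u"
    unfolding \<eta>_def by (rule assoc_mult_mat[OF sg_carrier[OF g] Funit_carrier u_carrier, symmetric])
  also have "\<sigma> g * Fm (unit_rep G) R G.unit_reg = Fm (unit_rep G) R (G.outer g * G.unit_reg)"
    unfolding \<sigma>_def by (rule F_comp[OF U R R G.unit_reg_intertwiner G.outer_intertwiner[OF g], symmetric])
  finally show ?thesis by (simp add: G.outer_unit_reg[OF g] \<eta>_def)
qed

lemma can_eq: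
  assumes g: "g \<in> carrier G"
  shows "\<mu> * kronecker (1\<^sub>m N) (\<sigma> g) = Fm RR R (G.can_reg g) * j" "G.can_reg g \<in> intertwiners G RR R"
  using mult_through_J[OF R R one_R G.outer_intertwiner[OF g]]
    mult_kronecker_intertwiner[OF R R one_R G.outer_intertwiner[OF g]]
  by (simp_all add: G.can_reg_def F_one_R N_def \<sigma>_def j_def)

lemma can_d:
  assumes g: "g \<in> carrier G" and k: "k \<in> carrier G"
  shows "\<mu> * kronecker (1\<^sub>m N) (\<sigma> k) * d g = (if g = k then 1\<^sub>m N else 0\<^sub>m N N)"
proof -
  note c = F_carrier[OF RR R can_eq(2)[OF k]] and D = F_carrier[OF R RR G.diag_intertwiner[OF g]]
  have "\<mu> * kronecker (1\<^sub>m N) (\<sigma> k) * d g = Fm RR R (G.can_reg k) * (j * d g)"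
    unfolding can_eq(1)[OF k] by (rule assoc_mult_mat[OF c j_carrier d_carrier[OF g]])
  also have "j * d g = (j * j') * Fm R RR (G.diag g)"
    unfolding d_def by (rule assoc_mult_mat[OF j_carrier j'(1) D, symmetric])
  also have "\<dots> = Fm R RR (G.diag g)" using D j'(3) by simp
  also have "Fm RR R (G.can_reg k) * Fm R RR (G.diag g) = Fm R R (G.can_reg k * G.diag g)"
    by (rule F_comp[OF R RR R G.diag_intertwiner[OF g] can_eq(2)[OF k], symmetric])
  finally show ?thesis using G.can_diag[OF g k] F_one_R F_zero[OF R R] by (simp add: N_def)
qed

lemma d_can: "msum (N * N) (N * N) (carrier G) (\<lambda>g. d g * (\<mu> * kronecker (1\<^sub>m N) (\<sigma> g))) = 1\<^sub>m (N * N)"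
proof -
  let ?L = "fst (F RR)"
  define T where "T g = G.diag g * G.can_reg g" for g
  have T: "T g \<in> intertwiners G RR RR" if "g \<in> carrier G" for g
    unfolding T_def by (rule intertwiners_mult[OF G.is_group RR R RR can_eq(2)[OF that] G.diag_intertwiner[OF that]])
  note FT = F_carrier[OF RR RR T]
  have eq: "d g * (\<mu> * kronecker (1\<^sub>m N) (\<sigma> g)) = j' * (Fm RR RR (T g) * j)" if g: "g \<in> carrier G" for g
  proof -
    note c = F_carrier[OF RR R can_eq(2)[OF g]] and D = F_carrier[OF R RR G.diag_intertwiner[OF g]]
    have "d g * (\<mu> * kronecker (1\<^sub>m N) (\<sigma> g)) = j' * (Fm R RR (G.diag g) * (Fm RR R (G.can_reg g) * j))"
      unfolding can_eq(1)[OF g] d_def by (rule assoc_mult_mat[OF j'(1) D mult_carrier_mat[OF c j_carrier]])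
    also have "Fm R RR (G.diag g) * (Fm RR R (G.can_reg g) * j) = Fm R RR (G.diag g) * Fm RR R (G.can_reg g) * j"
      by (rule assoc_mult_mat[OF D c j_carrier, symmetric])
    also have "Fm R RR (G.diag g) * Fm RR R (G.can_reg g) = Fm RR RR (T g)"
      unfolding T_def by (rule F_comp[OF RR R RR can_eq(2)[OF g] G.diag_intertwiner[OF g], symmetric])
    finally show ?thesis .
  qed
  have "msum (N * N) (N * N) (carrier G) (\<lambda>g. d g * (\<mu> * kronecker (1\<^sub>m N) (\<sigma> g))) =
      msum (N * N) (N * N) (carrier G) (\<lambda>g. j' * (Fm RR RR (T g) * j))"
    by (rule msum_cong) (rule eq)
  also have "\<dots> = j' * msum ?L (N * N) (carrier G) (\<lambda>g. Fm RR RR (T g) * j)"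
    by (rule mult_msum[OF j'(1) mult_carrier_mat[OF FT j_carrier], symmetric])
  also have "msum ?L (N * N) (carrier G) (\<lambda>g. Fm RR RR (T g) * j) = msum ?L ?L (carrier G) (\<lambda>g. Fm RR RR (T g)) * j"
    by (rule msum_mult[OF j_carrier FT, symmetric])
  also have "msum ?L ?L (carrier G) (\<lambda>g. Fm RR RR (T g)) = Fm RR RR (msum (fst RR) (fst RR) (carrier G) T)"
    by (rule msum_F(2)[OF RR RR G.fin T, symmetric])
  also have "msum (fst RR) (fst RR) (carrier G) T = 1\<^sub>m (fst RR)"
    using G.sum_diag_can by (simp add: T_def[abs_def])
  also have "Fm RR RR (1\<^sub>m (fst RR)) = 1\<^sub>m ?L" by (rule F_id[OF RR])
  also have "j' * (1\<^sub>m ?L * j) = 1\<^sub>m (N * N)" using left_mult_one_mat[OF j_carrier] j'(2) by simp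
  finally show ?thesis .
qed

text \<open>If \<open>F R\<close> had dimension zero, \<open>F\<close> would identify the identity
  and the zero map of \<open>reg\<close>, against faithfulness.\<close>

lemma N_pos: "N > 0"
proof (rule ccontr)
  assume "\<not> N > 0"
  then have N0: "fst (F R) = 0" by (simp add: N_def)
  have "Fm R R (1\<^sub>m (fst R)) = Fm R R (0\<^sub>m (fst R) (fst R))"
    unfolding F_id[OF R] F_zero[OF R R] N0 by (rule eq_matI) auto
  then have "1\<^sub>m (fst R) = (0\<^sub>m (fst R) (fst R) :: complex mat)"
    using equivalence_functor_faithful[OF linear_monoidal_category_Rep[OF G.is_group] equiv, of R R "1\<^sub>m (fst R)" "0\<^sub>m (fst R) (fst R)"]
      R one_intertwiner[OF R] zero_intertwiner[OF R R] by simp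
  then have "(1\<^sub>m (fst R) :: complex mat) $$ (0, 0) = 0\<^sub>m (fst R) (fst R) $$ (0, 0)" by simp
  then show False using G.n_pos by simp
qed

lemma mu_intertwiner: "\<mu> \<in> intertwiners H (ten H (F R) (F R)) (F R)"
  unfolding \<mu>_def j_def
  by (rule intertwiners_mult[OF H.is_group ten_rep[OF H.is_group F_rep[OF R] F_rep[OF R]] F_rep[OF RR] F_rep[OF R]
        J_iso(1)[OF R R] F_hom[OF RR R G.mult_reg_intertwiner]])

lemma eta_intertwiner: "\<eta> \<in> intertwiners H (unit_rep H) (F R)"
  unfolding \<eta>_def
  by (rule intertwiners_mult[OF H.is_group unit_rep[OF H.is_group] F_rep[OF U] F_rep[OF R] u_iso(1)
        F_hom[OF U R G.unit_reg_intertwiner]])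

text \<open>A fixed vector is a morphism from the unit object; by fullness it comes from an
  invariant function on \<open>G\<close>, and those are constant.\<close>

lemma fixed_vector:
  assumes x: "x \<in> carrier_mat N 1" and fixed: "\<And>h. h \<in> carrier H \<Longrightarrow> snd (F R) h * x = x"
  shows "\<exists>c. x = c \<cdot>\<^sub>m \<eta>"
proof -
  have xi: "x \<in> intertwiners H (unit_rep H) (F R)"
  proof (rule intertwinersI)
    show "x \<in> carrier_mat (fst (F R)) (fst (unit_rep H))" using x by (simp add: N_def)
    show "x * snd (unit_rep H) h = snd (F R) h * x" if "h \<in> carrier H" for h
      using right_mult_one_mat[OF x] fixed[OF that] that by (simp add: snd_unit_rep)
  qed
  obtain w where w: "w \<in> intertwiners H (F (unit_rep G)) (unit_rep H)" "w * u = 1\<^sub>m 1" using u_iso(2) by blast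
  have wc: "w \<in> carrier_mat 1 (fst (F (unit_rep G)))" using intertwiners_carrier[OF w(1)] by simp
  have "x * w \<in> intertwiners H (F (unit_rep G)) (F R)"
    by (rule intertwiners_mult[OF H.is_group F_rep[OF U] unit_rep[OF H.is_group] F_rep[OF R] w(1) xi])
  then obtain s where s: "s \<in> intertwiners G (unit_rep G) R" "Fm (unit_rep G) R s = x * w"
    using equivalence_functor_full[OF linear_monoidal_category_Rep[OF G.is_group] linear_monoidal_category_Rep[OF H.is_group]
        equiv, of "unit_rep G" R "x * w"] U R by auto
  obtain c where c: "s = c \<cdot>\<^sub>m G.unit_reg" using G.fixed_reg[OF s(1)] by blast
  have "x = x * (w * u)" using w(2) right_mult_one_mat[OF x] by simp
  also have "\<dots> = (x * w) * u" by (rule assoc_mult_mat[OF x wc u_carrier, symmetric])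
  also have "x * w = c \<cdot>\<^sub>m Fm (unit_rep G) R G.unit_reg"
    using s(2) F_smult[OF U R G.unit_reg_intertwiner] c by simp
  also have "\<dots> * u = c \<cdot>\<^sub>m \<eta>" unfolding \<eta>_def by (rule mult_smult_assoc_mat[OF Funit_carrier u_carrier])
  finally show ?thesis by blast
qed

text \<open>Every representation is a direct summand of a power of the regular one, so an element acting trivially on
  \<open>F R\<close> acts trivially on every \<open>F X\<close>, in particular on a copy of the regular representation of \<open>H\<close>.\<close>

lemma faithful:
  assumes h: "h \<in> carrier H" and triv: "snd (F R) h = 1\<^sub>m N"
  shows "h = \<one>\<^bsub>H\<^esub>"
proof -
  obtain X f where X: "X \<in> representations G" and f: "cat_iso (Rep H) (F X) H.reg f"
    using equivalence_functor_surj[OF equiv, of H.reg] H.reg_rep by auto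
  let ?n = "fst X" and ?k = "fst (F X)"
  note FX = F_rep[OF X]
  define A where "A i = Fm X R (G.to_reg X i)" for i
  define B where "B i = Fm R X (G.from_reg X i)" for i
  have A: "A i \<in> intertwiners H (F X) (F R)" if "i < ?n" for i
    unfolding A_def by (rule F_hom[OF X R G.to_reg_intertwiner[OF X that]])
  have B: "B i \<in> intertwiners H (F R) (F X)" if "i < ?n" for i
    unfolding B_def by (rule F_hom[OF R X G.from_reg_intertwiner[OF X that]])
  have Ac: "A i \<in> carrier_mat N ?k" and Bc: "B i \<in> carrier_mat ?k N" if "i < ?n" for i
    using intertwiners_carrier[OF A[OF that]] intertwiners_carrier[OF B[OF that]] by (auto simp: N_def)
  note \<rho> = representationsD(2)[OF FX h]
  have "msum ?k ?k {..<?n} (\<lambda>i. B i * A i) = Fm X X (msum ?n ?n {..<?n} (\<lambda>i. G.from_reg X i * G.to_reg X i))"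
  proof -
    have "Fm X X (msum ?n ?n {..<?n} (\<lambda>i. G.from_reg X i * G.to_reg X i)) =
        msum ?k ?k {..<?n} (\<lambda>i. Fm X X (G.from_reg X i * G.to_reg X i))"
      by (rule msum_F(2)[OF X X]) (auto intro!: intertwiners_mult[OF G.is_group X R X] G.to_reg_intertwiner[OF X] G.from_reg_intertwiner[OF X])
    also have "\<dots> = msum ?k ?k {..<?n} (\<lambda>i. B i * A i)"
      unfolding A_def B_def
      by (rule msum_cong) (simp add: F_comp[OF X R X G.to_reg_intertwiner[OF X] G.from_reg_intertwiner[OF X]])
    finally show ?thesis by simp
  qed
  also have "\<dots> = of_nat G.n \<cdot>\<^sub>m 1\<^sub>m ?k"
    by (simp add: G.sum_from_to_reg[OF X] F_smult[OF X X one_intertwiner[OF X]] F_id[OF X])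
  finally have sum: "msum ?k ?k {..<?n} (\<lambda>i. B i * A i) = of_nat G.n \<cdot>\<^sub>m 1\<^sub>m ?k" .
  have "of_nat G.n \<cdot>\<^sub>m snd (F X) h = msum ?k ?k {..<?n} (\<lambda>i. B i * A i) * snd (F X) h"
    using mult_smult_assoc_mat[OF one_carrier_mat \<rho>, of "of_nat G.n"] \<rho> by (simp add: sum)
  also have "\<dots> = msum ?k ?k {..<?n} (\<lambda>i. B i * A i * snd (F X) h)"
    by (rule msum_mult[OF \<rho>]) (auto intro: mult_carrier_mat[OF Bc Ac])
  also have "\<dots> = msum ?k ?k {..<?n} (\<lambda>i. B i * A i)"
  proof (rule msum_cong)
    fix i assume "i \<in> {..<?n}"
    then have i: "i < ?n" by simp
    have "B i * A i * snd (F X) h = B i * (A i * snd (F X) h)" by (rule assoc_mult_mat[OF Bc[OF i] Ac[OF i] \<rho>])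
    also have "A i * snd (F X) h = A i" using intertwiners_eq[OF A[OF i] h] triv Ac[OF i] by simp
    finally show "B i * A i * snd (F X) h = B i * A i" .
  qed
  finally have eq: "of_nat G.n \<cdot>\<^sub>m snd (F X) h = of_nat G.n \<cdot>\<^sub>m 1\<^sub>m ?k" by (simp add: sum)
  have FXh: "snd (F X) h = 1\<^sub>m ?k"
  proof (rule eq_matI)
    fix a b assume "a < dim_row (1\<^sub>m ?k :: complex mat)" "b < dim_col (1\<^sub>m ?k :: complex mat)"
    then have ab: "a < ?k" "b < ?k" by auto
    have "(of_nat G.n \<cdot>\<^sub>m snd (F X) h) $$ (a, b) = (of_nat G.n \<cdot>\<^sub>m 1\<^sub>m ?k) $$ (a, b)" by (simp add: eq)
    then show "snd (F X) h $$ (a, b) = (1\<^sub>m ?k :: complex mat) $$ (a, b)" using ab \<rho> G.n_pos by simp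
  qed (use \<rho> in auto)
  obtain f' where ff: "f \<in> intertwiners H (F X) H.reg" "f' \<in> intertwiners H H.reg (F X)" "f * f' = 1\<^sub>m H.n"
    using f by (auto simp: cat_iso_def)
  have fc: "f \<in> carrier_mat H.n ?k" "f' \<in> carrier_mat ?k H.n"
    using intertwiners_carrier[OF ff(1)] intertwiners_carrier[OF ff(2)] by auto
  have r: "snd H.reg h \<in> carrier_mat H.n H.n" using representationsD(2)[OF H.reg_rep h] by simp
  have "snd H.reg h = snd H.reg h * (f * f')" using ff(3) r by simp
  also have "\<dots> = snd H.reg h * f * f'" by (rule assoc_mult_mat[OF r fc, symmetric])
  also have "snd H.reg h * f = f" using intertwiners_eq[OF ff(1) h] FXh fc by simp
  finally have "snd H.reg h = 1\<^sub>m H.n" using ff(3) by simp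
  then show ?thesis by (rule H.reg_faithful[OF h])
qed

text \<open>\<open>H\<close> acts by the representation \<open>F R\<close> itself, \<open>G\<close>
  by the images of the translations \<open>outer g\<close>.\<close>

sublocale galois_matrices G H N \<mu> \<eta> \<sigma> "snd (F R)" d
proof
  note FR = F_rep[OF R]
  show "finite (carrier G)" "finite (carrier H)" by (rule G.fin H.fin)+
  show "\<sigma> (g \<otimes> g') = \<sigma> g * \<sigma> g'" if "g \<in> carrier G" "g' \<in> carrier G" for g g'
    unfolding \<sigma>_def G.outer_mult[OF that] by (rule F_comp[OF R R R]) (use that G.outer_intertwiner in auto)
  show "\<sigma> \<one> = 1\<^sub>m N" unfolding \<sigma>_def G.outer_one F_one_R N_def by (rule refl)
  show "snd (F R) h \<in> carrier_mat N N" if "h \<in> carrier H" for h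
    unfolding N_def by (rule representationsD(2)[OF FR that])
  show "snd (F R) (h \<otimes>\<^bsub>H\<^esub> h') = snd (F R) h * snd (F R) h'" if "h \<in> carrier H" "h' \<in> carrier H" for h h'
    by (rule representations_mult[OF FR that])
  show "snd (F R) \<one>\<^bsub>H\<^esub> = 1\<^sub>m N" unfolding N_def by (rule rep_one[OF H.is_group FR])
  show "\<sigma> g * snd (F R) h = snd (F R) h * \<sigma> g" if "g \<in> carrier G" "h \<in> carrier H" for g h
    unfolding \<sigma>_def by (rule intertwiners_eq[OF F_hom[OF R R G.outer_intertwiner[OF that(1)]] that(2)])
  show "snd (F R) h * \<mu> = \<mu> * kronecker (snd (F R) h) (snd (F R) h)" if "h \<in> carrier H" for h
    using intertwiners_eq[OF mu_intertwiner that] that by (simp add: snd_ten)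
  show "snd (F R) h * \<eta> = \<eta>" if "h \<in> carrier H" for h
    using intertwiners_eq[OF eta_intertwiner that] right_mult_one_mat[OF eta_carrier] that by (simp add: snd_unit_rep)
qed (fact N_pos mu_carrier eta_carrier sg_carrier d_carrier assoc unit_left unit_right sg_mu sg_eta can_d d_can
  fixed_vector faithful)+

end

theorem proposition6p2:
  fixes G :: "('a, 'c) monoid_scheme"
  assumes "group G" and "finite (carrier G)" and "order G < 64"
  shows "categorically_rigid TYPE(('b, 'd) monoid_scheme) G"
  unfolding categorically_rigid_def
proof (intro allI impI)
  fix H :: "('b, 'd) monoid_scheme"
  assume H: "group H \<and> finite (carrier H) \<and> isocategorical G H"
  then obtain F Fm J u where "linear_functor (Rep G) (Rep H) F Fm" "equivalence_functor (Rep G) (Rep H) F Fm"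
    "monoidal_structure (Rep G) (Rep H) F Fm J u"
    by (auto simp: isocategorical_def linear_monoidal_equivalent_def)
  then interpret rep_equivalence G H F Fm J u
    using assms H by (auto intro!: rep_equivalence.intro rep_equivalence_axioms.intro finite_group.intro finite_group_axioms.intro)
  show "H \<cong> G"
    using bigalois.iso_of_order_less_64[OF bigalois] assms(3) by (simp add: order_def)
qed

end
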